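(* A curve $q\in\Omega$ is a modified cubic polynomial if and only if it is a $Q$-local minimizer of $J$. Moreover, in this case $q$ is the locally unique minimizer: for every $\tau\in[0,T]$ there exists an interval $[a,b]\subset[0,T]$, $a<b$, containing $\tau$ such that $q|_{[a,b]}$ is the unique minimizer of $J$ on $\Omega_{\xi,\eta}^{a,b}$, where $\xi=(q(a),\dot q(a))$ and $\eta=(q(b),\dot q(b))$.
   Context: $Q$ is a complete connected Riemannian manifold with Levi-Civita connection $\nabla$ and curvature endomorphism $R(X,Y)Z = \nabla_X\nabla_Y Z - \nabla_Y\nabla_X Z - \nabla_{[X,Y]}Z$; $\frac{D}{dt}$ is the covariant derivative along a curve. $V:Q\to\mathbb{R}$ is smooth and non-negative, with gradient $\operatorname{grad}V$. For $a<b$ and $\xi=(q_a,v_a),\eta=(q_b,v_b)\in TQ$, $\Omega_{\xi,\eta}^{a,b}$ is the set of piecewise smooth $C^1$ curves $\gamma:[a,b]\to Q$ with $\gamma(a)=q_a$, $\dot\gamma(a)=v_a$, $\gamma(b)=q_b$, $\dot\gamma(b)=v_b$; on it $J(\gamma)=\int_a^b\big(\tfrac12\|\tfrac{D}{dt}\dot\gamma(t)\|^2+V(\gamma(t))\big)dt$ (the limits of integration always match the interval of the admissible set). A minimizer of $J$ on $\Omega_{\xi,\eta}^{a,b}$ is a curve $\gamma$ in it with $J(\gamma)\le J(\tilde\gamma)$ for all $\tilde\gamma\in\Omega_{\xi,\eta}^{a,b}$. Fix $T>0$ and $\xi_0,\eta_0\in TQ$, and write $\Omega=\Omega_{\xi_0,\eta_0}^{0,T}$.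 A modified cubic polynomial is a smooth curve $q$ satisfying $\frac{D^3\dot q}{dt^3}+R\big(\frac{D\dot q}{dt},\dot q\big)\dot q+\operatorname{grad}V(q(t))=0$. A curve $q\in\Omega$ is a $Q$-local minimizer of $J$ if for any $\tau\in[0,T]$ there exists an interval $[a,b]\subset[0,T]$ ($a<b$) containing $\tau$ such that $q|_{[a,b]}$ is a minimizer of $J$ on $\Omega_{\xi,\eta}^{a,b}$, where $\xi=(q(a),\dot q(a))$, $\eta=(q(b),\dot q(b))$.
   Formalization: The interval [a,b] containing τ is required to contain τ in its interior relative to [0,T]; if τ could be an endpoint inside (0,T), a C^1 join of two cubics with a jump in the second derivative (Q=R, V=0) would be a Q-local minimizer that is not smooth. Dim Q ≥ 1 is assumed. *)

theory Defs
  imports "HOL-Analysis.Analysis"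
begin

section \<open>Smoothness\<close>

text \<open>
  All derivatives are taken within the set \<open>S\<close>, which is used with \<open>S\<close> open and with \<open>S\<close> a relatively
  open subset of a nondegenerate real interval (one-sided derivatives at the end points). In both
  cases derivatives within \<open>S\<close> are unique.
\<close>

primrec C_k_on :: "nat \<Rightarrow> 'a::real_normed_vector set \<Rightarrow> ('a \<Rightarrow> 'b::real_normed_vector) \<Rightarrow> bool"
  where
    "C_k_on 0 S f \<longleftrightarrow> continuous_on S f"
  | "C_k_on (Suc k) S f \<longleftrightarrow>
       f differentiable_on S \<and> (\<forall>v. C_k_on k S (\<lambda>x. frechet_derivative f (at x within S) v))"

definition smooth_on :: "'a::real_normed_vector set \<Rightarrow> ('a \<Rightarrow> 'b::real_normed_vector) \<Rightarrow> bool"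
  where "smooth_on S f \<longleftrightarrow> (\<forall>k. C_k_on k S f)"


section \<open>Smooth manifolds and tangent vectors\<close>

text \<open>
  The manifold is a whole type \<open>'q\<close> and \<open>'e\<close> is the model space. A chart is a pair \<open>(U, \<phi>)\<close>;
  the values of \<open>\<phi>\<close> outside \<open>U\<close> are never used.
\<close>

type_synonym ('q, 'e) chart = "'q set \<times> ('q \<Rightarrow> 'e)"

abbreviation dom_chart :: "('q, 'e) chart \<Rightarrow> 'q set"
  where "dom_chart c \<equiv> fst c"

abbreviation coord :: "('q, 'e) chart \<Rightarrow> 'q \<Rightarrow> 'e"
  where "coord c \<equiv> snd c"

definition ran_chart :: "('q, 'e) chart \<Rightarrow> 'e set"
  where "ran_chart c = coord c ` dom_chart c"

definition inv_coord :: "('q, 'e) chart \<Rightarrow> 'e \<Rightarrow> 'q"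
  where "inv_coord c = inv_into (dom_chart c) (coord c)"

definition charts_at :: "('q, 'e) chart set \<Rightarrow> 'q \<Rightarrow> ('q, 'e) chart set"
  where "charts_at A p = {c \<in> A. p \<in> dom_chart c}"

definition smooth_atlas ::
    "('q::{t2_space,second_countable_topology}, 'e::euclidean_space) chart set \<Rightarrow> bool"
  where "smooth_atlas A \<longleftrightarrow>
    (\<Union>c\<in>A. dom_chart c) = UNIV \<and>
    (\<forall>c\<in>A. open (dom_chart c) \<and> open (ran_chart c) \<and>
       homeomorphism (dom_chart c) (ran_chart c) (coord c) (inv_coord c)) \<and>
    (\<forall>c\<in>A. \<forall>c'\<in>A.
       smooth_on (coord c ` (dom_chart c \<inter> dom_chart c')) (coord c' \<circ> inv_coord c))"

text \<open>
  A tangent vector at \<open>p\<close> is the family of its components in all charts around \<open>p\<close>, transforming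
  by the derivative of the change of coordinates (and \<open>0\<close> by convention at all other indices).
\<close>

type_synonym ('q, 'e) tvec = "('q, 'e) chart \<Rightarrow> 'e"

definition transition_deriv ::
    "('q, 'e::euclidean_space) chart \<Rightarrow> ('q, 'e) chart \<Rightarrow> 'q \<Rightarrow> 'e \<Rightarrow> 'e"
  where "transition_deriv c c' p =
    frechet_derivative (coord c' \<circ> inv_coord c) (at (coord c p))"

definition tangent_space ::
    "('q, 'e::euclidean_space) chart set \<Rightarrow> 'q \<Rightarrow> ('q, 'e) tvec set"
  where "tangent_space A p = {v.
    (\<forall>c. c \<notin> charts_at A p \<longrightarrow> v c = 0) \<and>
    (\<forall>c\<in>charts_at A p. \<forall>c'\<in>charts_at A p. v c' = transition_deriv c c' p (v c))}"

definition tangent_bundle ::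
    "('q, 'e::euclidean_space) chart set \<Rightarrow> ('q \<times> ('q, 'e) tvec) set"
  where "tangent_bundle A = {(p, v). v \<in> tangent_space A p}"

text \<open>The tangent vector at \<open>p\<close> whose component in the chart \<open>c\<close> around \<open>p\<close> is \<open>u\<close>.\<close>

definition tvec_of ::
    "('q, 'e::euclidean_space) chart set \<Rightarrow> ('q, 'e) chart \<Rightarrow> 'q \<Rightarrow> 'e \<Rightarrow> ('q, 'e) tvec"
  where "tvec_of A c p u = (\<lambda>c'. if c' \<in> charts_at A p then transition_deriv c c' p u else 0)"

definition smooth_scalar ::
    "('q, 'e::euclidean_space) chart set \<Rightarrow> ('q \<Rightarrow> real) \<Rightarrow> bool"
  where "smooth_scalar A f \<longleftrightarrow> (\<forall>c\<in>A. smooth_on (ran_chart c) (f \<circ> inv_coord c))"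


section \<open>Riemannian metrics, Levi-Civita connection, curvature, gradient\<close>

type_synonym ('q, 'e) metric = "'q \<Rightarrow> ('q, 'e) tvec \<Rightarrow> ('q, 'e) tvec \<Rightarrow> real"

definition metric_in_chart ::
    "('q, 'e::euclidean_space) chart set \<Rightarrow> ('q, 'e) metric \<Rightarrow> ('q, 'e) chart
      \<Rightarrow> 'e \<Rightarrow> 'e \<Rightarrow> 'e \<Rightarrow> real"
  where "metric_in_chart A g c x u v =
    g (inv_coord c x) (tvec_of A c (inv_coord c x) u) (tvec_of A c (inv_coord c x) v)"

definition riemannian_metric ::
    "('q, 'e::euclidean_space) chart set \<Rightarrow> ('q, 'e) metric \<Rightarrow> bool"
  where "riemannian_metric A g \<longleftrightarrow>
    (\<forall>p. \<forall>u\<in>tangent_space A p. \<forall>v\<in>tangent_space A p. \<forall>w\<in>tangent_space A p. \<forall>r.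
       g p u v = g p v u \<and>
       g p (\<lambda>c. u c + r *\<^sub>R v c) w = g p u w + r * g p v w \<and>
       (u \<noteq> (\<lambda>c. 0) \<longrightarrow> g p u u > 0)) \<and>
    (\<forall>c\<in>A. \<forall>u v. smooth_on (ran_chart c) (\<lambda>x. metric_in_chart A g c x u v))"

text \<open>
  Christoffel symbols of the Levi-Civita connection in the chart \<open>c\<close>, i.e. the component in \<open>c\<close> of
  the covariant derivative of the coordinate field \<open>v\<close> in direction \<open>u\<close>, by Koszul's formula.
\<close>

definition christoffel ::
    "('q, 'e::euclidean_space) chart set \<Rightarrow> ('q, 'e) metric \<Rightarrow> ('q, 'e) chart
      \<Rightarrow> 'e \<Rightarrow> 'e \<Rightarrow> 'e \<Rightarrow> 'e"
  where "christoffel A g c x u v = (THE z. \<forall>w.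
    metric_in_chart A g c x z w =
      (frechet_derivative (\<lambda>y. metric_in_chart A g c y v w) (at x) u
       + frechet_derivative (\<lambda>y. metric_in_chart A g c y u w) (at x) v
       - frechet_derivative (\<lambda>y. metric_in_chart A g c y u v) (at x) w) / 2)"

text \<open>
  Vector fields on the domain of \<open>c\<close> are given here by their components \<open>'e \<Rightarrow> 'e\<close> in \<open>c\<close>.
\<close>

definition nabla ::
    "('q, 'e::euclidean_space) chart set \<Rightarrow> ('q, 'e) metric \<Rightarrow> ('q, 'e) chart
      \<Rightarrow> ('e \<Rightarrow> 'e) \<Rightarrow> ('e \<Rightarrow> 'e) \<Rightarrow> ('e \<Rightarrow> 'e)"
  where "nabla A g c X Y =
    (\<lambda>x. frechet_derivative Y (at x) (X x) + christoffel A g c x (X x) (Y x))"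

definition lie_bracket :: "('e::euclidean_space \<Rightarrow> 'e) \<Rightarrow> ('e \<Rightarrow> 'e) \<Rightarrow> ('e \<Rightarrow> 'e)"
  where "lie_bracket X Y =
    (\<lambda>x. frechet_derivative Y (at x) (X x) - frechet_derivative X (at x) (Y x))"

definition curvature_field ::
    "('q, 'e::euclidean_space) chart set \<Rightarrow> ('q, 'e) metric \<Rightarrow> ('q, 'e) chart
      \<Rightarrow> ('e \<Rightarrow> 'e) \<Rightarrow> ('e \<Rightarrow> 'e) \<Rightarrow> ('e \<Rightarrow> 'e) \<Rightarrow> ('e \<Rightarrow> 'e)"
  where "curvature_field A g c X Y Z = (\<lambda>x.
    nabla A g c X (nabla A g c Y Z) x - nabla A g c Y (nabla A g c X Z) x
    - nabla A g c (lie_bracket X Y) Z x)"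

text \<open>
  \<open>R(X, Y)Z\<close> at \<open>p\<close> depends only on the values of the fields at \<open>p\<close>, so the vectors are extended to
  fields with constant components in the chart.
\<close>

definition curvature ::
    "('q, 'e::euclidean_space) chart set \<Rightarrow> ('q, 'e) metric \<Rightarrow> 'q
      \<Rightarrow> ('q, 'e) tvec \<Rightarrow> ('q, 'e) tvec \<Rightarrow> ('q, 'e) tvec \<Rightarrow> ('q, 'e) tvec"
  where "curvature A g p u v w = (\<lambda>c. if c \<in> charts_at A p
    then curvature_field A g c (\<lambda>_. u c) (\<lambda>_. v c) (\<lambda>_. w c) (coord c p) else 0)"

definition grad ::
    "('q, 'e::euclidean_space) chart set \<Rightarrow> ('q, 'e) metric \<Rightarrow> ('q \<Rightarrow> real) \<Rightarrow> 'q
      \<Rightarrow> ('q, 'e) tvec"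
  where "grad A g V p = (THE z. z \<in> tangent_space A p \<and>
    (\<forall>w\<in>tangent_space A p. \<forall>c\<in>charts_at A p.
       g p z w = frechet_derivative (V \<circ> inv_coord c) (at (coord c p)) (w c)))"


section \<open>Curves\<close>

text \<open>
  A curve \<open>I \<rightarrow> Q\<close> on an interval \<open>I\<close> is a function on the reals of which only the values on \<open>I\<close>
  are used.
\<close>

definition C_k_curve ::
    "('q::topological_space, 'e::euclidean_space) chart set \<Rightarrow> nat \<Rightarrow> real set
      \<Rightarrow> (real \<Rightarrow> 'q) \<Rightarrow> bool"
  where "C_k_curve A k I \<gamma> \<longleftrightarrow> continuous_on I \<gamma> \<and>
    (\<forall>c\<in>A. C_k_on k {t \<in> I. \<gamma> t \<in> dom_chart c} (coord c \<circ> \<gamma>))"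

definition smooth_curve ::
    "('q::topological_space, 'e::euclidean_space) chart set \<Rightarrow> real set
      \<Rightarrow> (real \<Rightarrow> 'q) \<Rightarrow> bool"
  where "smooth_curve A I \<gamma> \<longleftrightarrow> (\<forall>k. C_k_curve A k I \<gamma>)"

definition piecewise_smooth_curve ::
    "('q::topological_space, 'e::euclidean_space) chart set \<Rightarrow> real \<Rightarrow> real
      \<Rightarrow> (real \<Rightarrow> 'q) \<Rightarrow> bool"
  where "piecewise_smooth_curve A a b \<gamma> \<longleftrightarrow>
    (\<exists>n s. s 0 = a \<and> s n = b \<and>
       (\<forall>i<n::nat. s i < s (Suc i) \<and> smooth_curve A {s i..s (Suc i)} \<gamma>))"

definition velocity ::
    "('q, 'e::euclidean_space) chart set \<Rightarrow> real set \<Rightarrow> (real \<Rightarrow> 'q) \<Rightarrow> real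
      \<Rightarrow> ('q, 'e) tvec"
  where "velocity A I \<gamma> t = (\<lambda>c. if c \<in> charts_at A (\<gamma> t)
    then vector_derivative (coord c \<circ> \<gamma>) (at t within I) else 0)"

text \<open>The covariant derivative at time \<open>t\<close> of a vector field \<open>X\<close> along \<open>\<gamma>\<close>.\<close>

definition cov_deriv ::
    "('q, 'e::euclidean_space) chart set \<Rightarrow> ('q, 'e) metric \<Rightarrow> real set \<Rightarrow> (real \<Rightarrow> 'q)
      \<Rightarrow> (real \<Rightarrow> ('q, 'e) tvec) \<Rightarrow> real \<Rightarrow> ('q, 'e) tvec"
  where "cov_deriv A g I \<gamma> X t = (\<lambda>c. if c \<in> charts_at A (\<gamma> t)
    then vector_derivative (\<lambda>s. X s c) (at t within I)
         + christoffel A g c (coord c (\<gamma> t)) (velocity A I \<gamma> t c) (X t c)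
    else 0)"

text \<open>Every maximal geodesic is defined on all of the real line.\<close>

definition geodesically_complete ::
    "('q::topological_space, 'e::euclidean_space) chart set \<Rightarrow> ('q, 'e) metric \<Rightarrow> bool"
  where "geodesically_complete A g \<longleftrightarrow>
    (\<forall>(p, v)\<in>tangent_bundle A. \<exists>\<gamma>. smooth_curve A UNIV \<gamma> \<and>
       \<gamma> 0 = p \<and> velocity A UNIV \<gamma> 0 = v \<and>
       (\<forall>t. cov_deriv A g UNIV \<gamma> (velocity A UNIV \<gamma>) t = (\<lambda>c. 0)))"

definition complete_connected_riemannian_manifold ::
    "('q::{t2_space,second_countable_topology}, 'e::euclidean_space) chart set
      \<Rightarrow> ('q, 'e) metric \<Rightarrow> bool"
  where "complete_connected_riemannian_manifold A g \<longleftrightarrow>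
    smooth_atlas A \<and> riemannian_metric A g \<and>
    connected (UNIV :: 'q set) \<and> geodesically_complete A g"


section \<open>The variational problem\<close>

definition admissible ::
    "('q::topological_space, 'e::euclidean_space) chart set \<Rightarrow> real \<Rightarrow> real
      \<Rightarrow> 'q \<times> ('q, 'e) tvec \<Rightarrow> 'q \<times> ('q, 'e) tvec \<Rightarrow> (real \<Rightarrow> 'q) set"
  where "admissible A a b \<xi> \<eta> = {\<gamma>.
    C_k_curve A 1 {a..b} \<gamma> \<and> piecewise_smooth_curve A a b \<gamma> \<and>
    (\<gamma> a, velocity A {a..b} \<gamma> a) = \<xi> \<and> (\<gamma> b, velocity A {a..b} \<gamma> b) = \<eta>}"

text \<open>
  At the finitely many times where the acceleration of an admissible curve does not exist, the
  value of the integrand is irrelevant.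
\<close>

definition J_functional ::
    "('q, 'e::euclidean_space) chart set \<Rightarrow> ('q, 'e) metric \<Rightarrow> ('q \<Rightarrow> real) \<Rightarrow> real \<Rightarrow> real
      \<Rightarrow> (real \<Rightarrow> 'q) \<Rightarrow> real"
  where "J_functional A g V a b \<gamma> = integral {a..b} (\<lambda>t.
    (let acc = cov_deriv A g {a..b} \<gamma> (velocity A {a..b} \<gamma>) t
     in g (\<gamma> t) acc acc / 2 + V (\<gamma> t)))"

definition minimizer ::
    "('q::topological_space, 'e::euclidean_space) chart set \<Rightarrow> ('q, 'e) metric
      \<Rightarrow> ('q \<Rightarrow> real) \<Rightarrow> real \<Rightarrow> real \<Rightarrow> 'q \<times> ('q, 'e) tvec \<Rightarrow> 'q \<times> ('q, 'e) tvec
      \<Rightarrow> (real \<Rightarrow> 'q) \<Rightarrow> bool"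
  where "minimizer A g V a b \<xi> \<eta> \<gamma> \<longleftrightarrow>
    \<gamma> \<in> admissible A a b \<xi> \<eta> \<and>
    (\<forall>\<gamma>'\<in>admissible A a b \<xi> \<eta>. J_functional A g V a b \<gamma> \<le> J_functional A g V a b \<gamma>')"

definition unique_minimizer ::
    "('q::topological_space, 'e::euclidean_space) chart set \<Rightarrow> ('q, 'e) metric
      \<Rightarrow> ('q \<Rightarrow> real) \<Rightarrow> real \<Rightarrow> real \<Rightarrow> 'q \<times> ('q, 'e) tvec \<Rightarrow> 'q \<times> ('q, 'e) tvec
      \<Rightarrow> (real \<Rightarrow> 'q) \<Rightarrow> bool"
  where "unique_minimizer A g V a b \<xi> \<eta> \<gamma> \<longleftrightarrow>
    minimizer A g V a b \<xi> \<eta> \<gamma> \<and>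
    (\<forall>\<gamma>'. minimizer A g V a b \<xi> \<eta> \<gamma>' \<longrightarrow> (\<forall>t\<in>{a..b}. \<gamma>' t = \<gamma> t))"

definition modified_cubic_polynomial ::
    "('q::topological_space, 'e::euclidean_space) chart set \<Rightarrow> ('q, 'e) metric
      \<Rightarrow> ('q \<Rightarrow> real) \<Rightarrow> real \<Rightarrow> real \<Rightarrow> (real \<Rightarrow> 'q) \<Rightarrow> bool"
  where "modified_cubic_polynomial A g V a b q \<longleftrightarrow>
    smooth_curve A {a..b} q \<and>
    (let D = cov_deriv A g {a..b} q; q' = velocity A {a..b} q in
     \<forall>t\<in>{a..b}. \<forall>c\<in>charts_at A (q t).
       D (D (D q')) t c + curvature A g (q t) (D q' t) (q' t) (q' t) c + grad A g V (q t) c = 0)"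

text \<open>
  An interval \<open>[a, b] \<subseteq> [0, T]\<close> around \<open>\<tau>\<close>: \<open>\<tau>\<close> has to lie in the interior of \<open>[a, b]\<close> relative to
  \<open>[0, T]\<close>. If \<open>\<tau>\<close> were allowed to be an end point of \<open>[a, b]\<close> inside \<open>(0, T)\<close>, a cubic spline with
  a jump in its second derivative would be a local minimizer.
\<close>

definition interval_around :: "real \<Rightarrow> real \<Rightarrow> real \<Rightarrow> real \<Rightarrow> bool"
  where "interval_around T \<tau> a b \<longleftrightarrow>
    a < b \<and> {a..b} \<subseteq> {0..T} \<and> \<tau> \<in> (top_of_set {0..T}) interior_of {a..b}"

definition Q_local_minimizer ::
    "('q::topological_space, 'e::euclidean_space) chart set \<Rightarrow> ('q, 'e) metric
      \<Rightarrow> ('q \<Rightarrow> real) \<Rightarrow> real \<Rightarrow> (real \<Rightarrow> 'q) \<Rightarrow> bool"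
  where "Q_local_minimizer A g V T q \<longleftrightarrow>
    (\<forall>\<tau>\<in>{0..T}. \<exists>a b. interval_around T \<tau> a b \<and>
       minimizer A g V a b (q a, velocity A {0..T} q a) (q b, velocity A {0..T} q b) q)"

end

theory Submission
  imports Defs
begin

text \<open>
  Both directions are local, and both rest on the expansion of the action in a single chart. In a
  chart, let \<open>x\<close> be a curve with velocity \<open>v\<close> and covariant acceleration \<open>a\<close>, and let \<open>y = x + h\<close> be
  another curve. The integrand of \<open>J\<close> at \<open>y\<close> exceeds the one at \<open>x\<close> by a linear part in
  \<open>(h, h', h'')\<close> and a remainder (\<open>remainder_estimate\<close>). Two integrations by parts turn the integral
  of the linear part into boundary terms plus the pairing of \<open>h\<close> with
  \<open>E = D\<^sup>2a/dt\<^sup>2 + R(a, v)v + grad V\<close> (\<open>first_variation\<close>); the curvature term arises because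
  covariant derivatives along the curve and along the variation do not commute, and the symmetries of
  the curvature tensor move it from \<open>h\<close> to \<open>a\<close>. The curve is a modified cubic polynomial exactly
  if \<open>E = 0\<close>.

  If \<open>E = 0\<close> and \<open>h\<close> and \<open>h'\<close> vanish at both ends, the linear part integrates to zero. The remainder
  is at least \<open>c \<bar>h''\<bar>\<^sup>2 - C (\<bar>h\<bar>\<^sup>2 + \<bar>h'\<bar>\<^sup>2)\<close>, because the integrand is a positive definite quadratic
  function of the acceleration. On an interval of length \<open>\<rho>\<close> the integrals of \<open>\<bar>h\<bar>\<^sup>2\<close> and \<open>\<bar>h'\<bar>\<^sup>2\<close> are
  at most a multiple of \<open>\<rho>\<^sup>2\<close> times the integral of \<open>\<bar>h''\<bar>\<^sup>2\<close> (\<open>poincare\<close>), so that for small \<open>\<rho>\<close> the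
  action of \<open>y\<close> is larger unless \<open>h = 0\<close> (\<open>local_minimality_in_ball\<close>). It remains to see that a
  competitor on a short interval cannot leave the chart. Since \<open>V \<ge> 0\<close>, a competitor that is not
  worse than \<open>x\<close> has bounded acceleration energy; the speed grows at most by the integral of the norm
  of the acceleration, hence stays bounded, and a short interval leaves no time to escape
  (\<open>speed_bound\<close>, \<open>confinement\<close>).

  Conversely, let the curve be a minimizer on intervals around every time. Varying it inside a chart by
  piecewise polynomial \<open>C\<^sup>1\<close> bumps gives \<open>E = 0\<close> on the open pieces on which it is smooth
  (\<open>euler_lagrange_interior\<close>), and bumps that do not vanish at a break point show that \<open>a\<close> and \<open>Da/dt\<close>
  have no jump there (\<open>corner_conditions\<close>). The equation \<open>E = 0\<close> is a smooth first-order system for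
  \<open>x\<close>, \<open>v\<close>, \<open>a\<close>, \<open>Da/dt\<close>, so a continuous solution of it is smooth across the break points
  (\<open>motion_glue\<close>, \<open>motion_C_k\<close>).

  The metric is only constrained on tangent vectors, so the integrand of \<open>J\<close> can be computed in a chart
  only after the components of the acceleration in different charts are known to fit together
  (\<open>acc_tangent\<close>).
\<close>

section \<open>Calculus of C^k maps\<close>

text \<open>
  Derivatives within a set are unique at a point at which it accumulates along every coordinate
  direction. This condition covers open sets as well as relatively open
  subsets of nondegenerate intervals.
\<close>

definition fat :: "'a::euclidean_space set \<Rightarrow> bool"
  where "fat S \<longleftrightarrow> (\<forall>x\<in>S. \<forall>i\<in>Basis. \<forall>e>0. \<exists>d. 0 < \<bar>d\<bar> \<and> \<bar>d\<bar> < e \<and> x + d *\<^sub>R i \<in> S)"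

lemma fat_open_Int:
  fixes S T :: "'a::euclidean_space set"
  assumes "fat S" "open T" shows "fat (S \<inter> T)"
  unfolding fat_def
proof safe
  fix x i :: 'a and e :: real assume x: "x \<in> S" "x \<in> T" and i: "i \<in> Basis" and e: "e > 0"
  obtain r where r: "r > 0" "ball x r \<subseteq> T" using \<open>open T\<close> x openE by blast
  obtain d where d: "0 < \<bar>d\<bar>" "\<bar>d\<bar> < min e r" "x + d *\<^sub>R i \<in> S"
    using \<open>fat S\<close> x i e r unfolding fat_def by (metis min_less_iff_conj)
  have "x + d *\<^sub>R i \<in> ball x r" using d i by (simp add: dist_norm)
  then show "\<exists>d. 0 < \<bar>d\<bar> \<and> \<bar>d\<bar> < e \<and> x + d *\<^sub>R i \<in> S \<inter> T" using d r by auto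
qed

lemma fat_UNIV: "fat (UNIV :: 'a::euclidean_space set)"
proof -
  have "\<exists>d. 0 < \<bar>d\<bar> \<and> \<bar>d\<bar> < e" if "e > 0" for e :: real
    using that by (intro exI[of _ "e / 2"]) simp
  then show ?thesis unfolding fat_def by simp
qed

lemma fat_open: "open S \<Longrightarrow> fat S"
  using fat_open_Int[OF fat_UNIV] by simp

lemma fat_Icc: "a < b \<Longrightarrow> fat {a..b::real}"
  unfolding fat_def
proof (intro ballI allI impI)
  fix x i e :: real assume *: "a < b" "x \<in> {a..b}" "i \<in> Basis" "e > 0"
  show "\<exists>d. 0 < \<bar>d\<bar> \<and> \<bar>d\<bar> < e \<and> x + d *\<^sub>R i \<in> {a..b}"
  proof (cases "x < b")
    case True
    then show ?thesis using * by (intro exI[of _ "min (e/2) (b - x)"]) auto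
  next
    case False
    then show ?thesis using * by (intro exI[of _ "- min (e/2) (b - a)"]) auto
  qed
qed

lemma fat_unique:
  assumes "fat S" "x \<in> S" "(f has_derivative f') (at x within S)" "(f has_derivative f'') (at x within S)"
  shows "f' = f''"
  using frechet_derivative_unique_within[OF assms(3,4)] assms(1,2) unfolding fat_def by blast

lemma fat_frechet:
  assumes "fat S" "x \<in> S" "(f has_derivative f') (at x within S)"
  shows "frechet_derivative f (at x within S) = f'"
  using fat_unique[OF assms(1,2) _ assms(3)] assms(3)
  by (metis differentiableI frechet_derivative_works)

lemma fat_not_bot: "fat S \<Longrightarrow> (t::real) \<in> S \<Longrightarrow> at t within S \<noteq> bot"
proof -
  assume f: "fat S" "t \<in> S"
  have "t islimpt S" unfolding islimpt_approachable
  proof (intro allI impI)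
    fix e :: real assume "e > 0"
    then obtain d where "0 < \<bar>d\<bar>" "\<bar>d\<bar> < e" "t + d \<in> S" using f unfolding fat_def by force
    then show "\<exists>x'\<in>S. x' \<noteq> t \<and> dist x' t < e" by (intro bexI[of _ "t + d"]) (auto simp: dist_real_def)
  qed
  then show ?thesis by (simp add: trivial_limit_within)
qed

lemma frechet_derivative_cong_on:
  assumes "x \<in> S" "\<And>y. y \<in> S \<Longrightarrow> f y = g y"
  shows "frechet_derivative f (at x within S) = frechet_derivative g (at x within S)"
    and "f differentiable (at x within S) \<longleftrightarrow> g differentiable (at x within S)"
proof -
  have "(f has_derivative D) (at x within S) \<longleftrightarrow> (g has_derivative D) (at x within S)" for D
    using has_derivative_transform[OF assms(1)] assms(2) by metis
  then show "frechet_derivative f (at x within S) = frechet_derivative g (at x within S)"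
    and "f differentiable (at x within S) \<longleftrightarrow> g differentiable (at x within S)"
    unfolding frechet_derivative_def differentiable_def by auto
qed

lemma C_k_on_cong:
  assumes "\<And>y. y \<in> S \<Longrightarrow> f y = g y"
  shows "C_k_on k S f \<longleftrightarrow> C_k_on k S g"
  using assms
proof (induction k arbitrary: f g)
  case 0 then show ?case by (simp cong: continuous_on_cong)
next
  case (Suc k)
  have "f differentiable_on S \<longleftrightarrow> g differentiable_on S"
    unfolding differentiable_on_def using frechet_derivative_cong_on(2)[of _ S f g] Suc.prems by auto
  moreover have "C_k_on k S (\<lambda>x. frechet_derivative f (at x within S) v)
      \<longleftrightarrow> C_k_on k S (\<lambda>x. frechet_derivative g (at x within S) v)" for v
    by (rule Suc.IH) (simp add: frechet_derivative_cong_on(1)[of _ S f g] Suc.prems)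
  ultimately show ?case by simp
qed

text \<open>
  The definition of \<open>C_k_on\<close> refers to one chosen derivative; on a fat set every derivative is that one.
\<close>

lemma C_k_on_SucI:
  assumes S: "fat S" and f: "\<And>x. x \<in> S \<Longrightarrow> (f has_derivative f' x) (at x within S)"
    and C: "\<And>v. C_k_on k S (\<lambda>x. f' x v)"
  shows "C_k_on (Suc k) S f"
proof -
  have "C_k_on k S (\<lambda>x. frechet_derivative f (at x within S) v)" for v
    using C[of v] fat_frechet[OF S _ f] by (subst C_k_on_cong[of S _ "\<lambda>x. f' x v"]) auto
  then show ?thesis using f by (auto simp: differentiable_on_def differentiable_def)
qed

lemma C_k_on_SucE:
  assumes "C_k_on (Suc k) S f"
  obtains f' where "\<And>x. x \<in> S \<Longrightarrow> (f has_derivative f' x) (at x within S)"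
    and "\<And>v. C_k_on k S (\<lambda>x. f' x v)"
  using assms that[of "\<lambda>x. frechet_derivative f (at x within S)"]
  by (auto simp: differentiable_on_def frechet_derivative_works)

lemma C_k_on_continuous: "C_k_on k S f \<Longrightarrow> continuous_on S f"
  by (cases k) (auto simp: differentiable_imp_continuous_on)

lemma C_k_on_Suc_imp: "C_k_on (Suc k) S f \<Longrightarrow> C_k_on k S f"
proof (induction k arbitrary: f)
  case 0 then show ?case by (auto intro: differentiable_imp_continuous_on)
next
  case (Suc k) then show ?case by (metis C_k_on.simps(2))
qed

lemma C_k_on_subset:
  assumes "C_k_on k S f" "S' \<subseteq> S" "fat S'"
  shows "C_k_on k S' f"
  using assms
proof (induction k arbitrary: f)
  case 0 then show ?case using continuous_on_subset by auto
next
  case (Suc k)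
  from Suc.prems(1) obtain f' where f': "\<And>x. x \<in> S \<Longrightarrow> (f has_derivative f' x) (at x within S)"
    and C: "\<And>v. C_k_on k S (\<lambda>x. f' x v)" by (rule C_k_on_SucE) blast
  show ?case
    by (rule C_k_on_SucI[of _ _ f'])
      (use Suc f' C in \<open>auto intro: has_derivative_subset\<close>)
qed

lemma C_k_on_const: "fat S \<Longrightarrow> C_k_on k S (\<lambda>_. c)"
proof (induction k arbitrary: c)
  case (Suc k)
  show ?case by (rule C_k_on_SucI[of _ _ "\<lambda>_ _. 0"]) (use Suc in auto)
qed simp

lemma C_k_on_linear:
  assumes "bounded_linear L" "fat S" shows "C_k_on k S L"
proof (cases k)
  case 0 then show ?thesis
    using assms by (simp add: linear_continuous_on)
next
  case (Suc m) show ?thesis unfolding Suc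
    by (rule C_k_on_SucI[of _ _ "\<lambda>_. L"])
      (use assms C_k_on_const in \<open>auto simp: bounded_linear_imp_has_derivative\<close>)
qed

lemma C_k_on_linear_comp:
  assumes "bounded_linear L" "fat S" "C_k_on k S f" shows "C_k_on k S (\<lambda>x. L (f x))"
  using assms(3)
proof (induction k arbitrary: f)
  case 0 then show ?case using assms(1) by (auto intro: bounded_linear.continuous_on)
next
  case (Suc k)
  from Suc.prems obtain f' where f': "\<And>x. x \<in> S \<Longrightarrow> (f has_derivative f' x) (at x within S)"
    and C: "\<And>v. C_k_on k S (\<lambda>x. f' x v)" by (rule C_k_on_SucE) blast
  show ?case
    by (rule C_k_on_SucI[of _ _ "\<lambda>x v. L (f' x v)"])
      (use assms f' C Suc.IH in \<open>auto intro: bounded_linear.has_derivative\<close>)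
qed

lemma C_k_on_add:
  assumes "fat S" "C_k_on k S f" "C_k_on k S g" shows "C_k_on k S (\<lambda>x. f x + g x)"
  using assms(2,3)
proof (induction k arbitrary: f g)
  case 0 then show ?case by (auto intro: continuous_on_add)
next
  case (Suc k)
  from Suc.prems(1) obtain f' where f': "\<And>x. x \<in> S \<Longrightarrow> (f has_derivative f' x) (at x within S)"
    and C: "\<And>v. C_k_on k S (\<lambda>x. f' x v)" by (rule C_k_on_SucE) blast
  from Suc.prems(2) obtain g' where g': "\<And>x. x \<in> S \<Longrightarrow> (g has_derivative g' x) (at x within S)"
    and D: "\<And>v. C_k_on k S (\<lambda>x. g' x v)" by (rule C_k_on_SucE) blast
  show ?case
    by (rule C_k_on_SucI[of _ _ "\<lambda>x v. f' x v + g' x v"])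
      (use assms f' C g' D Suc.IH in \<open>auto intro: has_derivative_add\<close>)
qed

lemma C_k_on_minus:
  assumes "fat S" "C_k_on k S f" shows "C_k_on k S (\<lambda>x. - f x)"
  using C_k_on_linear_comp[OF bounded_linear_minus[OF bounded_linear_ident] assms] by simp

lemma C_k_on_diff:
  assumes "fat S" "C_k_on k S f" "C_k_on k S g" shows "C_k_on k S (\<lambda>x. f x - g x)"
  using C_k_on_add[OF assms(1,2) C_k_on_minus[OF assms(1,3)]] by simp

lemma C_k_on_sum:
  assumes "fat S" "finite I" "\<And>i. i \<in> I \<Longrightarrow> C_k_on k S (f i)" shows "C_k_on k S (\<lambda>x. \<Sum>i\<in>I. f i x)"
  using assms(2,3) by (induction rule: finite_induct) (auto intro: C_k_on_const C_k_on_add assms(1))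

lemma C_k_on_bilinear:
  assumes B: "bounded_bilinear B" and "fat S" "C_k_on k S f" "C_k_on k S g"
  shows "C_k_on k S (\<lambda>x. B (f x) (g x))"
  using assms(3,4)
proof (induction k arbitrary: f g)
  case 0 then show ?case using B by (auto intro: bounded_bilinear.continuous_on)
next
  case (Suc k)
  from Suc.prems(1) obtain f' where f': "\<And>x. x \<in> S \<Longrightarrow> (f has_derivative f' x) (at x within S)"
    and C: "\<And>v. C_k_on k S (\<lambda>x. f' x v)" by (rule C_k_on_SucE) blast
  from Suc.prems(2) obtain g' where g': "\<And>x. x \<in> S \<Longrightarrow> (g has_derivative g' x) (at x within S)"
    and D: "\<And>v. C_k_on k S (\<lambda>x. g' x v)" by (rule C_k_on_SucE) blast
  note fg = Suc.prems[THEN C_k_on_Suc_imp]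
  show ?case
    by (rule C_k_on_SucI[of _ _ "\<lambda>x v. B (f x) (g' x v) + B (f' x v) (g x)"])
      (use assms(2) f' C g' D Suc.IH fg B in \<open>auto intro!: bounded_bilinear.FDERIV C_k_on_add\<close>)
qed

lemmas C_k_on_scaleR = C_k_on_bilinear[OF bounded_bilinear_scaleR]
lemmas C_k_on_mult = C_k_on_bilinear[OF bounded_bilinear_mult]
lemmas C_k_on_inner_left = C_k_on_linear_comp[OF bounded_linear_inner_left]

text \<open>
  By the chain rule the derivative of the composition is a sum of products of components of \<open>g'\<close> with
  partial derivatives of \<open>f\<close> composed with \<open>g\<close>, and the induction hypothesis covers each factor.
\<close>

lemma C_k_on_compose:
  fixes g :: "'a::euclidean_space \<Rightarrow> 'b::euclidean_space"
  assumes S: "fat S" and U: "open U" and "C_k_on k U f" "C_k_on k S g" "g ` S \<subseteq> U"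
  shows "C_k_on k S (\<lambda>x. f (g x))"
  using assms(3,4,5)
proof (induction k arbitrary: f)
  case 0 then show ?case by (auto intro: continuous_on_compose2)
next
  case (Suc k)
  from Suc.prems(1) obtain f' where f': "\<And>x. x \<in> U \<Longrightarrow> (f has_derivative f' x) (at x within U)"
    and C: "\<And>v. C_k_on k U (\<lambda>x. f' x v)" by (rule C_k_on_SucE) blast
  from Suc.prems(2) obtain g' where g': "\<And>x. x \<in> S \<Longrightarrow> (g has_derivative g' x) (at x within S)"
    and D: "\<And>v. C_k_on k S (\<lambda>x. g' x v)" by (rule C_k_on_SucE) blast
  note g = Suc.prems(2)[THEN C_k_on_Suc_imp]
  have lin: "f' (g x) (g' x v) = (\<Sum>i\<in>Basis. (g' x v \<bullet> i) *\<^sub>R f' (g x) i)" if "x \<in> S" for x v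
  proof -
    have "linear (f' (g x))" using f' that Suc.prems(3) by (meson has_derivative_linear imageI subsetD)
    then have "f' (g x) (\<Sum>i\<in>Basis. (g' x v \<bullet> i) *\<^sub>R i) = (\<Sum>i\<in>Basis. (g' x v \<bullet> i) *\<^sub>R f' (g x) i)"
      by (simp add: linear_sum linear_scale)
    then show ?thesis by (simp add: euclidean_representation)
  qed
  show ?case
  proof (rule C_k_on_SucI[OF S, of _ "\<lambda>x v. f' (g x) (g' x v)"])
    fix x assume x: "x \<in> S"
    have "(f has_derivative f' (g x)) (at (g x))"
      using f'[of "g x"] x Suc.prems(3) U by (auto simp: at_within_open[OF _ U])
    then show "((\<lambda>x. f (g x)) has_derivative (\<lambda>v. f' (g x) (g' x v))) (at x within S)"
      using g'[OF x] has_derivative_compose by blast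
  next
    fix v
    have "C_k_on k S (\<lambda>x. \<Sum>i\<in>Basis. (g' x v \<bullet> i) *\<^sub>R f' (g x) i)"
      by (intro C_k_on_sum C_k_on_scaleR C_k_on_inner_left S D Suc.IH C g Suc.prems(3) finite_Basis)
    then show "C_k_on k S (\<lambda>x. f' (g x) (g' x v))"
      by (subst C_k_on_cong[OF lin]) auto
  qed
qed

lemma at_within_Int_nhd: "open W \<Longrightarrow> x \<in> W \<Longrightarrow> at x within (S \<inter> W) = at x within S"
  by (metis at_within_nhd Int_assoc Int_absorb)

text \<open>
  Curves will be smooth near different times for different reasons: because they agree with a given curve,
  or because of their formula in one particular chart.
\<close>

lemma C_k_on_local:
  assumes S: "fat S" and loc: "\<And>x. x \<in> S \<Longrightarrow> \<exists>W. open W \<and> x \<in> W \<and> C_k_on k (S \<inter> W) f"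
  shows "C_k_on k S f"
  using loc
proof (induction k arbitrary: f)
  case 0
  show ?case unfolding C_k_on.simps continuous_on_eq_continuous_within
  proof
    fix x assume x: "x \<in> S"
    obtain W where W: "open W" "x \<in> W" "continuous_on (S \<inter> W) f" using 0[OF x] by auto
    then have "continuous (at x within S \<inter> W) f" using x by (simp add: continuous_on_eq_continuous_within)
    then show "continuous (at x within S) f" using W x
      by (simp add: at_within_Int_nhd)
  qed
next
  case (Suc k)
  have at: "at x within (S \<inter> W) = at x within S" if "open W" "x \<in> W" for x W
    using that by (rule at_within_Int_nhd)
  have dif: "f differentiable (at x within S)" if x: "x \<in> S" for x
  proof -
    obtain W where W: "open W" "x \<in> W" "C_k_on (Suc k) (S \<inter> W) f" using Suc.prems[OF x] by auto
    then have "f differentiable (at x within S \<inter> W)" using x by (simp add: differentiable_on_def)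
    then show ?thesis unfolding at[OF W(1,2)] .
  qed
  show ?case
  proof (rule C_k_on_SucI[OF S, of _ "\<lambda>x. frechet_derivative f (at x within S)"])
    show "(f has_derivative frechet_derivative f (at x within S)) (at x within S)" if "x \<in> S" for x
      using dif[OF that] by (simp add: frechet_derivative_works)
    show "C_k_on k S (\<lambda>x. frechet_derivative f (at x within S) v)" for v
    proof (rule Suc.IH)
      fix x assume x: "x \<in> S"
      obtain W where W: "open W" "x \<in> W" "C_k_on (Suc k) (S \<inter> W) f" using Suc.prems[OF x] by auto
      then have "C_k_on k (S \<inter> W) (\<lambda>x. frechet_derivative f (at x within S \<inter> W) v)" by simp
      then have "C_k_on k (S \<inter> W) (\<lambda>x. frechet_derivative f (at x within S) v)"
        by (subst C_k_on_cong[where g = "\<lambda>x. frechet_derivative f (at x within S \<inter> W) v"])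
          (auto simp: at W)
      then show "\<exists>W. open W \<and> x \<in> W \<and> C_k_on k (S \<inter> W) (\<lambda>x. frechet_derivative f (at x within S) v)"
        using W by blast
    qed
  qed
qed

subsection \<open>Curves\<close>

lemma C_k_on_Suc_vectorI:
  assumes "fat S" "\<And>t. t \<in> S \<Longrightarrow> (x has_vector_derivative x' t) (at t within S)" "C_k_on k S x'"
  shows "C_k_on (Suc k) S x"
  by (rule C_k_on_SucI[of _ _ "\<lambda>t d. d *\<^sub>R x' t"])
    (use assms in \<open>auto simp: has_vector_derivative_def intro!: C_k_on_scaleR C_k_on_const\<close>)

lemma C_k_on_Suc_vectorD:
  assumes S: "fat S" and C: "C_k_on (Suc k) S (x :: real \<Rightarrow> 'a::real_normed_vector)"
  shows "\<And>t. t \<in> S \<Longrightarrow> (x has_vector_derivative vector_derivative x (at t within S)) (at t within S)"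
    and "C_k_on k S (\<lambda>t. vector_derivative x (at t within S))"
proof -
  have d: "x differentiable (at t within S)" if "t \<in> S" for t
    using C that by (auto simp: differentiable_on_def)
  then show *: "(x has_vector_derivative vector_derivative x (at t within S)) (at t within S)" if "t \<in> S" for t
    using that vector_derivative_works by blast
  have "C_k_on k S (\<lambda>t. frechet_derivative x (at t within S) 1)" using C by simp
  then show "C_k_on k S (\<lambda>t. vector_derivative x (at t within S))"
    by (subst C_k_on_cong[where g = "\<lambda>t. frechet_derivative x (at t within S) 1"])
      (use fat_frechet[OF S _ *[unfolded has_vector_derivative_def]] in auto)
qed

lemma fat_vector_derivative:
  assumes "fat S" "t \<in> S" "(x has_vector_derivative x') (at t within S)"
  shows "vector_derivative x (at t within S) = x'"
  using vector_derivative_within[OF fat_not_bot[OF assms(1,2)] assms(3)] .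

lemma smooth_onD: "smooth_on S f \<Longrightarrow> C_k_on k S f"
  by (simp add: smooth_on_def)

subsection \<open>Symmetry of second derivatives\<close>

text \<open>
  Two applications of the mean value theorem, first along \<open>u\<close> and then along \<open>v\<close>, express the second
  difference over a parallelogram by a second derivative at some point of it.
\<close>

lemma symmetric_second_derivative_aux:
  fixes f :: "'a::euclidean_space \<Rightarrow> real"
  assumes U: "open U" "x \<in> U"
    and f': "\<And>y. y \<in> U \<Longrightarrow> (f has_derivative f' y) (at y)"
    and fu: "\<And>y. y \<in> U \<Longrightarrow> ((\<lambda>y. f' y u) has_derivative fu y) (at y)"
    and r: "\<And>\<rho> \<sigma>. \<bar>\<rho>\<bar> \<le> s \<Longrightarrow> \<bar>\<sigma>\<bar> \<le> s \<Longrightarrow> x + \<rho> *\<^sub>R u + \<sigma> *\<^sub>R v \<in> U" and s: "s > 0"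
  shows "\<exists>\<rho> \<sigma>. 0 < \<rho> \<and> \<rho> < s \<and> 0 < \<sigma> \<and> \<sigma> < s \<and>
    f (x + s *\<^sub>R u + s *\<^sub>R v) - f (x + s *\<^sub>R u) - f (x + s *\<^sub>R v) + f x = s * (s * fu (x + \<rho> *\<^sub>R u + \<sigma> *\<^sub>R v) v)"
proof -
  have lin: "linear (f' y)" "linear (fu y)" if "y \<in> U" for y
    using f'[OF that] fu[OF that] has_derivative_linear by blast+
  define p where "p = (\<lambda>\<rho>. f (x + \<rho> *\<^sub>R u + s *\<^sub>R v) - f (x + \<rho> *\<^sub>R u))"
  have p: "(p has_real_derivative (f' (x + \<rho> *\<^sub>R u + s *\<^sub>R v) u - f' (x + \<rho> *\<^sub>R u) u)) (at \<rho>)"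
    if "0 \<le> \<rho>" "\<rho> \<le> s" for \<rho>
  proof -
    have in1: "x + \<rho> *\<^sub>R u + s *\<^sub>R v \<in> U" and in2: "x + \<rho> *\<^sub>R u \<in> U"
      using r[of \<rho> s] r[of \<rho> 0] that s by auto
    have "((\<lambda>\<rho>. x + \<rho> *\<^sub>R u + s *\<^sub>R v) has_derivative (\<lambda>d. d *\<^sub>R u)) (at \<rho>)"
         "((\<lambda>\<rho>. x + \<rho> *\<^sub>R u) has_derivative (\<lambda>d. d *\<^sub>R u)) (at \<rho>)"
      by (auto intro!: derivative_eq_intros)
    from this[THEN has_derivative_compose] f'[OF in1] f'[OF in2]
    have "(p has_derivative (\<lambda>d. f' (x + \<rho> *\<^sub>R u + s *\<^sub>R v) (d *\<^sub>R u) - f' (x + \<rho> *\<^sub>R u) (d *\<^sub>R u))) (at \<rho>)"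
      unfolding p_def by (intro has_derivative_diff) auto
    then show ?thesis unfolding has_field_derivative_def
      by (rule has_derivative_eq_rhs) (use lin in1 in2 in \<open>auto simp: linear_scale fun_eq_iff algebra_simps\<close>)
  qed
  obtain \<rho> where \<rho>: "0 < \<rho>" "\<rho> < s"
    "p s - p 0 = (s - 0) * (f' (x + \<rho> *\<^sub>R u + s *\<^sub>R v) u - f' (x + \<rho> *\<^sub>R u) u)"
    using MVT2[OF s p] by blast
  define q where "q = (\<lambda>\<sigma>. f' (x + \<rho> *\<^sub>R u + \<sigma> *\<^sub>R v) u)"
  have q: "(q has_real_derivative (fu (x + \<rho> *\<^sub>R u + \<sigma> *\<^sub>R v) v)) (at \<sigma>)"
    if "0 \<le> \<sigma>" "\<sigma> \<le> s" for \<sigma>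
  proof -
    have in1: "x + \<rho> *\<^sub>R u + \<sigma> *\<^sub>R v \<in> U"
      using r[of \<rho> \<sigma>] that \<rho> by auto
    have "((\<lambda>\<sigma>. x + \<rho> *\<^sub>R u + \<sigma> *\<^sub>R v) has_derivative (\<lambda>d. d *\<^sub>R v)) (at \<sigma>)"
      by (auto intro!: derivative_eq_intros)
    from has_derivative_compose[OF this fu[OF in1]]
    show ?thesis unfolding has_field_derivative_def q_def
      by (rule has_derivative_eq_rhs) (use lin in1 in \<open>auto simp: linear_scale fun_eq_iff algebra_simps\<close>)
  qed
  obtain \<sigma> where \<sigma>: "0 < \<sigma>" "\<sigma> < s" "q s - q 0 = (s - 0) * fu (x + \<rho> *\<^sub>R u + \<sigma> *\<^sub>R v) v"
    using MVT2[OF s q] by blast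
  show ?thesis
    by (rule exI[of _ \<rho>], rule exI[of _ \<sigma>]) (use \<rho> \<sigma> in \<open>auto simp: p_def q_def algebra_simps\<close>)
qed

text \<open>
  The second difference is symmetric in \<open>u\<close> and \<open>v\<close>, so the two orders of differentiation agree at
  nearby points of a shrinking parallelogram, and continuity gives the claim in the limit.
\<close>

lemma symmetric_second_derivative:
  fixes f :: "'a::euclidean_space \<Rightarrow> real"
  assumes U: "open U" "x \<in> U"
    and f': "\<And>y. y \<in> U \<Longrightarrow> (f has_derivative f' y) (at y)"
    and f2: "\<And>y u. y \<in> U \<Longrightarrow> ((\<lambda>y. f' y u) has_derivative f2 u y) (at y)"
    and cont: "\<And>u v. continuous_on U (\<lambda>y. f2 u y v)"
  shows "f2 u x v = f2 v x u"
proof -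
  obtain r where r: "r > 0" "ball x r \<subseteq> U" using U openE by blast
  \<comment> \<open>The added 1 keeps the denominator positive when both vectors vanish.\<close>
  define d where "d n = r / (norm u + norm v + 1) * (1 / real (n + 2))" for n
  have d0: "d n > 0" for n using r(1) unfolding d_def
    by (intro mult_pos_pos divide_pos_pos) (auto intro: add_nonneg_pos)
  have dlim: "d \<longlonglongrightarrow> 0" unfolding d_def
    by (rule tendsto_mult_right_zero) (use LIMSEQ_inverse_real_of_nat[THEN LIMSEQ_Suc] in \<open>simp add: inverse_eq_divide\<close>)
  have inU: "x + \<rho> *\<^sub>R u + \<sigma> *\<^sub>R v \<in> U" if "\<bar>\<rho>\<bar> \<le> d n" "\<bar>\<sigma>\<bar> \<le> d n" for \<rho> \<sigma> n
  proof -
    have "norm (\<rho> *\<^sub>R u + \<sigma> *\<^sub>R v) \<le> \<bar>\<rho>\<bar> * norm u + \<bar>\<sigma>\<bar> * norm v"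
      by (metis norm_scaleR norm_triangle_ineq)
    also have "\<dots> \<le> d n * norm u + d n * norm v"
      using that by (intro add_mono mult_right_mono) auto
    also have "\<dots> < d n * (norm u + norm v + 1)" using d0[of n] by (simp add: algebra_simps)
    also have "\<dots> = r * (1 / real (n + 2))"
    proof -
      have "norm u + norm v + 1 \<noteq> 0" using norm_ge_zero[of u] norm_ge_zero[of v] by linarith
      then show ?thesis unfolding d_def by (simp only: times_divide_eq_left times_divide_eq_right mult_1_right nonzero_mult_div_cancel_right divide_divide_eq_left) simp
    qed
    also have "\<dots> \<le> r" using r(1) by (simp add: field_simps)
    finally show ?thesis using r(2) by (auto simp: dist_norm norm_minus_commute algebra_simps)
  qed
  show ?thesis
  proof -
    have 1: "\<exists>\<rho> \<sigma>. 0 < \<rho> \<and> \<rho> < d n \<and> 0 < \<sigma> \<and> \<sigma> < d n \<and>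
      f (x + d n *\<^sub>R u + d n *\<^sub>R v) - f (x + d n *\<^sub>R u) - f (x + d n *\<^sub>R v) + f x = d n * (d n * f2 u (x + \<rho> *\<^sub>R u + \<sigma> *\<^sub>R v) v)" for n
      by (rule symmetric_second_derivative_aux[OF U f' f2 inU d0]) auto
    have inU': "x + \<rho> *\<^sub>R v + \<sigma> *\<^sub>R u \<in> U" if "\<bar>\<rho>\<bar> \<le> d n" "\<bar>\<sigma>\<bar> \<le> d n" for \<rho> \<sigma> n
      using inU[OF that(2,1)] by (simp add: algebra_simps)
    have 2: "\<exists>\<rho> \<sigma>. 0 < \<rho> \<and> \<rho> < d n \<and> 0 < \<sigma> \<and> \<sigma> < d n \<and>
      f (x + d n *\<^sub>R v + d n *\<^sub>R u) - f (x + d n *\<^sub>R v) - f (x + d n *\<^sub>R u) + f x = d n * (d n * f2 v (x + \<rho> *\<^sub>R v + \<sigma> *\<^sub>R u) u)" for n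
      by (rule symmetric_second_derivative_aux[OF U f' f2 inU' d0]) auto
    obtain a b where ab: "\<And>n. 0 < a n \<and> a n < d n \<and> 0 < b n \<and> b n < d n \<and>
      f (x + d n *\<^sub>R u + d n *\<^sub>R v) - f (x + d n *\<^sub>R u) - f (x + d n *\<^sub>R v) + f x = d n * (d n * f2 u (x + a n *\<^sub>R u + b n *\<^sub>R v) v)"
      using 1 by metis
    obtain a' b' where ab': "\<And>n. 0 < a' n \<and> a' n < d n \<and> 0 < b' n \<and> b' n < d n \<and>
      f (x + d n *\<^sub>R v + d n *\<^sub>R u) - f (x + d n *\<^sub>R v) - f (x + d n *\<^sub>R u) + f x = d n * (d n * f2 v (x + a' n *\<^sub>R v + b' n *\<^sub>R u) u)"
      using 2 by metis
    have "d n * (d n * f2 u (x + a n *\<^sub>R u + b n *\<^sub>R v) v) = d n * (d n * f2 v (x + a' n *\<^sub>R v + b' n *\<^sub>R u) u)" for n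
      using ab[of n] ab'[of n] by (simp add: algebra_simps)
    then have eq: "f2 u (x + a n *\<^sub>R u + b n *\<^sub>R v) v = f2 v (x + a' n *\<^sub>R v + b' n *\<^sub>R u) u" for n
      using d0[of n] by (metis mult_cancel_left less_irrefl)
    have z: "c \<longlonglongrightarrow> 0" if "\<And>n. 0 < c n \<and> c n < d n" for c
      by (rule tendsto_sandwich[OF _ _ tendsto_const dlim])
        (use that in \<open>auto intro!: always_eventually less_imp_le\<close>)
    have z1: "a \<longlonglongrightarrow> 0" "b \<longlonglongrightarrow> 0" "a' \<longlonglongrightarrow> 0" "b' \<longlonglongrightarrow> 0" using z ab ab' by blast+
    have "(\<lambda>n. x + a n *\<^sub>R u + b n *\<^sub>R v) \<longlonglongrightarrow> x + 0 *\<^sub>R u + 0 *\<^sub>R v"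
         "(\<lambda>n. x + a' n *\<^sub>R v + b' n *\<^sub>R u) \<longlonglongrightarrow> x + 0 *\<^sub>R v + 0 *\<^sub>R u"
      by (intro tendsto_intros z1)+
    then have l: "(\<lambda>n. x + a n *\<^sub>R u + b n *\<^sub>R v) \<longlonglongrightarrow> x" "(\<lambda>n. x + a' n *\<^sub>R v + b' n *\<^sub>R u) \<longlonglongrightarrow> x" by auto
    have c: "isCont (\<lambda>y. f2 u y v) x" for u v using cont U continuous_on_eq_continuous_at by blast
    from isCont_tendsto_compose[OF c l(1), of u v] isCont_tendsto_compose[OF c l(2), of v u] eq
    show ?thesis using LIMSEQ_unique by auto
  qed
qed

lemma C_k_on_transfer: "C_k_on k S f \<Longrightarrow> (\<And>y. y \<in> S \<Longrightarrow> f y = g y) \<Longrightarrow> C_k_on k S g"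
  using C_k_on_cong by blast

lemma C_k_on_Suc_differentiable: "C_k_on (Suc k) S f \<Longrightarrow> x \<in> S \<Longrightarrow> f differentiable (at x within S)"
  by (simp add: differentiable_on_def)

section \<open>Fields of bilinear maps\<close>

definition Dfield :: "('e::real_normed_vector \<Rightarrow> 'e \<Rightarrow> 'e \<Rightarrow> 'f::real_normed_vector) \<Rightarrow> 'e \<Rightarrow> 'e \<Rightarrow> 'e \<Rightarrow> 'e \<Rightarrow> 'f"
  where "Dfield B x h u v = frechet_derivative (\<lambda>y. B y u v) (at x) h"

lemma smooth_on_has_derivative:
  fixes f :: "'e::euclidean_space \<Rightarrow> 'f::real_normed_vector"
  assumes "smooth_on U f" "open U" "x \<in> U"
  shows "(f has_derivative frechet_derivative f (at x)) (at x)"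
proof -
  have "C_k_on (Suc 0) U f" using assms(1) smooth_onD by blast
  then have "f differentiable (at x within U)" using assms(3) by (auto simp: differentiable_on_def)
  then show ?thesis unfolding at_within_open[OF assms(3,2)] frechet_derivative_works .
qed

lemma smooth_on_frechet_derivative:
  fixes f :: "'e::euclidean_space \<Rightarrow> 'f::real_normed_vector"
  assumes "smooth_on U f" "open U"
  shows "smooth_on U (\<lambda>x. frechet_derivative f (at x) h)"
  unfolding smooth_on_def
proof
  fix k
  have "C_k_on (Suc k) U f" using assms(1) smooth_onD by blast
  then have "C_k_on k U (\<lambda>x. frechet_derivative f (at x within U) h)" by simp
  then show "C_k_on k U (\<lambda>x. frechet_derivative f (at x) h)"
    by (rule C_k_on_transfer) (simp add: at_within_open[OF _ assms(2)])
qed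

lemma smooth_on_continuous: "smooth_on U f \<Longrightarrow> continuous_on U f"
  using C_k_on_continuous smooth_onD by blast

text \<open>
  Metric tensor, Christoffel symbols and their derivatives are all bilinear maps depending on a point. That
  each coefficient depends smoothly on the point is all that has to be known about them: by bilinearity
  the rules for moving arguments follow from those for finite sums of products (\<open>expand\<close>).
\<close>

locale bilin_field =
  fixes U :: "'e::euclidean_space set" and B :: "'e \<Rightarrow> 'e \<Rightarrow> 'e \<Rightarrow> 'f::euclidean_space"
  assumes open_U: "open U"
    and bil: "x \<in> U \<Longrightarrow> bilinear (B x)"
    and smooth: "smooth_on U (\<lambda>x. B x u v)"
begin

lemma bil_simps:
  assumes "x \<in> U"
  shows "B x (u + u') v = B x u v + B x u' v" "B x u (v + v') = B x u v + B x u v'"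
    "B x (u - u') v = B x u v - B x u' v" "B x u (v - v') = B x u v - B x u v'"
    "B x (c *\<^sub>R u) v = c *\<^sub>R B x u v" "B x u (c *\<^sub>R v) = c *\<^sub>R B x u v"
    "B x (- u) v = - B x u v" "B x u (- v) = - B x u v"
    "B x 0 v = 0" "B x u 0 = 0"
  using bil[OF assms]
  by (auto simp: bilinear_ladd bilinear_radd bilinear_lsub bilinear_rsub bilinear_lmul bilinear_rmul
      bilinear_lneg bilinear_rneg bilinear_lzero bilinear_rzero)

lemma expand:
  assumes "x \<in> U"
  shows "B x u v = (\<Sum>i\<in>Basis. \<Sum>j\<in>Basis. ((u \<bullet> i) * (v \<bullet> j)) *\<^sub>R B x i j)"
proof -
  have l: "linear (\<lambda>u. B x u v)" "linear (B x u)" for u v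
    using bil[OF assms] by (auto simp: bilinear_def)
  have "B x u v = B x (\<Sum>i\<in>Basis. (u \<bullet> i) *\<^sub>R i) v" by (simp add: euclidean_representation)
  also have "\<dots> = (\<Sum>i\<in>Basis. (u \<bullet> i) *\<^sub>R B x i v)"
    by (simp add: linear_sum[OF l(1)] linear_scale[OF l(1)])
  also have "\<dots> = (\<Sum>i\<in>Basis. (u \<bullet> i) *\<^sub>R B x i (\<Sum>j\<in>Basis. (v \<bullet> j) *\<^sub>R j))"
    by (simp add: euclidean_representation)
  also have "\<dots> = (\<Sum>i\<in>Basis. \<Sum>j\<in>Basis. ((u \<bullet> i) * (v \<bullet> j)) *\<^sub>R B x i j)"
    by (simp add: linear_sum[OF l(2)] linear_scale[OF l(2)] scaleR_sum_right)
  finally show ?thesis .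
qed

lemma Dfield_deriv: "x \<in> U \<Longrightarrow> ((\<lambda>y. B y u v) has_derivative (\<lambda>h. Dfield B x h u v)) (at x)"
  unfolding Dfield_def using smooth_on_has_derivative[OF smooth open_U] .

lemma linear_Dfield: "x \<in> U \<Longrightarrow> linear (\<lambda>h. Dfield B x h u v)"
  using Dfield_deriv has_derivative_linear by blast

lemma Dfield_simps:
  assumes "x \<in> U"
  shows "Dfield B x (h + h') u v = Dfield B x h u v + Dfield B x h' u v"
    "Dfield B x (h - h') u v = Dfield B x h u v - Dfield B x h' u v"
    "Dfield B x (c *\<^sub>R h) u v = c *\<^sub>R Dfield B x h u v"
    "Dfield B x (- h) u v = - Dfield B x h u v"
    "Dfield B x 0 u v = 0"
  using linear_add[OF linear_Dfield[OF assms]] linear_diff[OF linear_Dfield[OF assms]]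
    linear_scale[OF linear_Dfield[OF assms]] linear_neg[OF linear_Dfield[OF assms]]
    linear_0[OF linear_Dfield[OF assms]] by auto

lemma Dfield_eqI:
  assumes "x \<in> U" "(f has_derivative D) (at x)" "\<And>y. y \<in> U \<Longrightarrow> B y u v = f y"
  shows "Dfield B x h u v = D h"
proof -
  have "((\<lambda>y. B y u v) has_derivative D) (at x)"
    by (rule has_derivative_transform_within_open[OF assms(2) open_U assms(1)]) (simp add: assms(3))
  then show ?thesis using has_derivative_unique[OF Dfield_deriv[OF assms(1)]] by metis
qed

lemma bilin_field_Dfield: "bilin_field U (\<lambda>x. Dfield B x h)"
proof
  show "open U" by (rule open_U)
  show "smooth_on U (\<lambda>x. Dfield B x h u v)" for u v
    unfolding Dfield_def by (rule smooth_on_frechet_derivative[OF smooth open_U])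
  show "bilinear (Dfield B x h)" if x: "x \<in> U" for x
    unfolding bilinear_def
  proof (intro conjI allI linearI)
    fix u u' v and c :: real
    show "Dfield B x h (u + u') v = Dfield B x h u v + Dfield B x h u' v"
      by (rule Dfield_eqI[OF x has_derivative_add[OF Dfield_deriv[OF x] Dfield_deriv[OF x]]]) (simp add: bil_simps)
    show "Dfield B x h v (u + u') = Dfield B x h v u + Dfield B x h v u'"
      by (rule Dfield_eqI[OF x has_derivative_add[OF Dfield_deriv[OF x] Dfield_deriv[OF x]]]) (simp add: bil_simps)
    show "Dfield B x h (c *\<^sub>R u) v = c *\<^sub>R Dfield B x h u v"
      by (rule Dfield_eqI[OF x has_derivative_scaleR_right[OF Dfield_deriv[OF x]]]) (simp add: bil_simps)
    show "Dfield B x h v (c *\<^sub>R u) = c *\<^sub>R Dfield B x h v u"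
      by (rule Dfield_eqI[OF x has_derivative_scaleR_right[OF Dfield_deriv[OF x]]]) (simp add: bil_simps)
  qed
qed

lemmas Dfield_bil_simps = bilin_field.bil_simps[OF bilin_field_Dfield]

lemma Dfield_expand_dir:
  "x \<in> U \<Longrightarrow> Dfield B x h u v = (\<Sum>i\<in>Basis. (h \<bullet> i) *\<^sub>R Dfield B x i u v)"
proof -
  assume x: "x \<in> U"
  have "Dfield B x (\<Sum>i\<in>Basis. (h \<bullet> i) *\<^sub>R i) u v = (\<Sum>i\<in>Basis. (h \<bullet> i) *\<^sub>R Dfield B x i u v)"
    unfolding linear_sum[OF linear_Dfield[OF x]] Dfield_simps(3)[OF x] ..
  then show ?thesis by (simp add: euclidean_representation)
qed

lemma has_derivative_field:
  assumes t: "t \<in> S" "x t \<in> U" and x: "(x has_derivative x') (at t within S)"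
    and X: "(X has_derivative X') (at t within S)" and Y: "(Y has_derivative Y') (at t within S)"
  shows "((\<lambda>s. B (x s) (X s) (Y s)) has_derivative
    (\<lambda>d. Dfield B (x t) (x' d) (X t) (Y t) + B (x t) (X' d) (Y t) + B (x t) (X t) (Y' d))) (at t within S)"
proof -
  have Bij: "((\<lambda>s. B (x s) i j) has_derivative (\<lambda>d. Dfield B (x t) (x' d) i j)) (at t within S)" for i j
    using has_derivative_compose[OF x Dfield_deriv[OF t(2)]] .
  have tm: "((\<lambda>s. ((X s \<bullet> i) * (Y s \<bullet> j)) *\<^sub>R B (x s) i j) has_derivative
    (\<lambda>d. ((X t \<bullet> i) * (Y t \<bullet> j)) *\<^sub>R Dfield B (x t) (x' d) i j
       + ((X t \<bullet> i) * (Y' d \<bullet> j) + (X' d \<bullet> i) * (Y t \<bullet> j)) *\<^sub>R B (x t) i j)) (at t within S)" for i j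
    by (rule has_derivative_scaleR[OF has_derivative_mult[OF has_derivative_inner_left[OF X] has_derivative_inner_left[OF Y]] Bij])
  have "((\<lambda>s. \<Sum>i\<in>Basis. \<Sum>j\<in>Basis. ((X s \<bullet> i) * (Y s \<bullet> j)) *\<^sub>R B (x s) i j) has_derivative
    (\<lambda>d. \<Sum>i\<in>Basis. \<Sum>j\<in>Basis. ((X t \<bullet> i) * (Y t \<bullet> j)) *\<^sub>R Dfield B (x t) (x' d) i j
       + ((X t \<bullet> i) * (Y' d \<bullet> j) + (X' d \<bullet> i) * (Y t \<bullet> j)) *\<^sub>R B (x t) i j)) (at t within S)"
    by (rule has_derivative_sum, rule has_derivative_sum, rule tm)
  moreover have "(\<Sum>i\<in>Basis. \<Sum>j\<in>Basis. ((X t \<bullet> i) * (Y t \<bullet> j)) *\<^sub>R Dfield B (x t) (x' d) i j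
       + ((X t \<bullet> i) * (Y' d \<bullet> j) + (X' d \<bullet> i) * (Y t \<bullet> j)) *\<^sub>R B (x t) i j)
    = Dfield B (x t) (x' d) (X t) (Y t) + B (x t) (X' d) (Y t) + B (x t) (X t) (Y' d)" for d
    unfolding expand[OF t(2), of "X' d" "Y t"] expand[OF t(2), of "X t" "Y' d"]
      bilin_field.expand[OF bilin_field_Dfield t(2), of "x' d" "X t" "Y t"]
    by (simp add: sum.distrib scaleR_add_left algebra_simps)
  ultimately have D: "((\<lambda>s. \<Sum>i\<in>Basis. \<Sum>j\<in>Basis. ((X s \<bullet> i) * (Y s \<bullet> j)) *\<^sub>R B (x s) i j) has_derivative
    (\<lambda>d. Dfield B (x t) (x' d) (X t) (Y t) + B (x t) (X' d) (Y t) + B (x t) (X t) (Y' d))) (at t within S)"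
    by simp
  have "eventually (\<lambda>s. x s \<in> U) (at t within S)"
    using has_derivative_continuous[OF x] open_U t(2)
    by (simp add: continuous_within tendsto_def)
  then have ev: "eventually (\<lambda>s. (\<Sum>i\<in>Basis. \<Sum>j\<in>Basis. ((X s \<bullet> i) * (Y s \<bullet> j)) *\<^sub>R B (x s) i j) = B (x s) (X s) (Y s)) (at t within S)"
    by (rule eventually_mono) (rule expand[symmetric])
  show ?thesis
    by (rule has_derivative_transform_eventually[OF D ev expand[OF t(2), symmetric] t(1)])
qed

lemma has_vector_derivative_field:
  assumes t: "t \<in> S" "x t \<in> U" and x: "(x has_vector_derivative x') (at t within S)"
    and X: "(X has_vector_derivative X') (at t within S)" and Y: "(Y has_vector_derivative Y') (at t within S)"
  shows "((\<lambda>s. B (x s) (X s) (Y s)) has_vector_derivative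
    (Dfield B (x t) x' (X t) (Y t) + B (x t) X' (Y t) + B (x t) (X t) Y')) (at t within S)"
  using has_derivative_field[OF t x[unfolded has_vector_derivative_def] X[unfolded has_vector_derivative_def] Y[unfolded has_vector_derivative_def]]
  unfolding has_vector_derivative_def
  by (rule has_derivative_eq_rhs) (use t in \<open>auto simp: bil_simps Dfield_simps scaleR_add_right\<close>)

lemma continuous_on_field:
  assumes "continuous_on S x" "continuous_on S X" "continuous_on S Y" "x ` S \<subseteq> U"
  shows "continuous_on S (\<lambda>s. B (x s) (X s) (Y s))"
proof -
  have "continuous_on U (\<lambda>y. B y i j)" for i j by (rule smooth_on_continuous[OF smooth])
  then have "continuous_on S (\<lambda>s. B (x s) i j)" for i j
    using assms(1,4) continuous_on_compose2 by blast
  then have "continuous_on S (\<lambda>s. \<Sum>i\<in>Basis. \<Sum>j\<in>Basis. ((X s \<bullet> i) * (Y s \<bullet> j)) *\<^sub>R B (x s) i j)"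
    using assms by (intro continuous_intros) auto
  then show ?thesis
    by (rule continuous_on_eq) (rule expand[symmetric], use assms(4) in blast)
qed

lemma C_k_on_field:
  assumes S: "fat S" and "C_k_on k S x" "C_k_on k S X" "C_k_on k S Y" "x ` S \<subseteq> U"
  shows "C_k_on k S (\<lambda>s. B (x s) (X s) (Y s))"
proof -
  have "C_k_on k S (\<lambda>s. B (x s) i j)" for i j
    by (rule C_k_on_compose[OF S open_U smooth_onD[OF smooth]]) (use assms in auto)
  then have "C_k_on k S (\<lambda>s. \<Sum>i\<in>Basis. \<Sum>j\<in>Basis. ((X s \<bullet> i) * (Y s \<bullet> j)) *\<^sub>R B (x s) i j)"
    by (intro C_k_on_sum C_k_on_scaleR C_k_on_mult C_k_on_inner_left S assms finite_Basis)
  then show ?thesis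
    by (rule C_k_on_transfer) (rule expand[symmetric], use assms(5) in blast)
qed

lemma continuous_on_Dfield:
  assumes "continuous_on S x" "continuous_on S h" "continuous_on S X" "continuous_on S Y" "x ` S \<subseteq> U"
  shows "continuous_on S (\<lambda>s. Dfield B (x s) (h s) (X s) (Y s))"
proof -
  have "continuous_on S (\<lambda>s. \<Sum>i\<in>Basis. (h s \<bullet> i) *\<^sub>R Dfield B (x s) i (X s) (Y s))"
    by (intro continuous_intros bilin_field.continuous_on_field[OF bilin_field_Dfield] assms)
  then show ?thesis
    by (rule continuous_on_eq) (rule Dfield_expand_dir[symmetric], use assms(5) in blast)
qed

lemma C_k_on_Dfield:
  assumes S: "fat S" and "C_k_on k S x" "C_k_on k S h" "C_k_on k S X" "C_k_on k S Y" "x ` S \<subseteq> U"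
  shows "C_k_on k S (\<lambda>s. Dfield B (x s) (h s) (X s) (Y s))"
proof -
  have "C_k_on k S (\<lambda>s. \<Sum>i\<in>Basis. (h s \<bullet> i) *\<^sub>R Dfield B (x s) i (X s) (Y s))"
    by (intro C_k_on_sum C_k_on_scaleR C_k_on_inner_left bilin_field.C_k_on_field[OF bilin_field_Dfield] S assms finite_Basis)
  then show ?thesis
    by (rule C_k_on_transfer) (rule Dfield_expand_dir[symmetric], use assms(6) in blast)
qed

end

section \<open>A Riemannian metric in a chart\<close>

text \<open>
  The Christoffel symbols in the form of Koszul's formula.
\<close>

definition Chr :: "('e::euclidean_space \<Rightarrow> 'e \<Rightarrow> 'e \<Rightarrow> real) \<Rightarrow> 'e \<Rightarrow> 'e \<Rightarrow> 'e \<Rightarrow> 'e"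
  where "Chr G x u v = (THE z. \<forall>w. G x z w = (Dfield G x u v w + Dfield G x v u w - Dfield G x w u v) / 2)"

text \<open>
  The curvature applied to fields with constant components, for which the Lie bracket vanishes.
\<close>

definition Rm :: "('e::euclidean_space \<Rightarrow> 'e \<Rightarrow> 'e \<Rightarrow> real) \<Rightarrow> 'e \<Rightarrow> 'e \<Rightarrow> 'e \<Rightarrow> 'e \<Rightarrow> 'e"
  where "Rm G x u v w = Dfield (Chr G) x u v w - Dfield (Chr G) x v u w
    + Chr G x u (Chr G x v w) - Chr G x v (Chr G x u w)"

locale riem_chart = bilin_field U G for U :: "'e::euclidean_space set" and G :: "'e \<Rightarrow> 'e \<Rightarrow> 'e \<Rightarrow> real" +
  assumes sym: "x \<in> U \<Longrightarrow> G x u v = G x v u"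
    and pos: "x \<in> U \<Longrightarrow> u \<noteq> 0 \<Longrightarrow> G x u u > 0"
begin

lemma nonneg: "x \<in> U \<Longrightarrow> G x u u \<ge> 0"
  using pos[of x u] by (cases "u = 0") (auto simp: bil_simps)

lemma expand_right: "x \<in> U \<Longrightarrow> G x z w = (\<Sum>i\<in>Basis. (w \<bullet> i) * G x z i)"
proof -
  assume x: "x \<in> U"
  have "linear (G x z)" using bil[OF x] by (simp add: bilinear_def)
  then have "G x z (\<Sum>i\<in>Basis. (w \<bullet> i) *\<^sub>R i) = (\<Sum>i\<in>Basis. (w \<bullet> i) * G x z i)"
    by (simp add: linear_sum linear_scale)
  then show ?thesis by (simp add: euclidean_representation)
qed

lemma nondeg_Basis:
  assumes x: "x \<in> U" and "\<And>i. i \<in> Basis \<Longrightarrow> G x z i = G x z' i" shows "z = z'"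
proof -
  have "G x (z - z') (z - z') = (\<Sum>i\<in>Basis. ((z - z') \<bullet> i) * G x (z - z') i)"
    by (rule expand_right[OF x])
  also have "\<dots> = 0" by (rule sum.neutral) (use assms in \<open>simp add: bil_simps\<close>)
  finally have "G x (z - z') (z - z') = 0" .
  then show ?thesis using pos[OF x, of "z - z'"] by force
qed

lemma nondeg: "x \<in> U \<Longrightarrow> (\<And>w. G x z w = G x z' w) \<Longrightarrow> z = z'"
  using nondeg_Basis by blast

lemma solve_Basis:
  assumes x: "x \<in> U" obtains z where "\<And>i. i \<in> Basis \<Longrightarrow> G x z i = \<beta> i"
proof -
  define L where "L z = (\<Sum>i\<in>Basis. G x z i *\<^sub>R i)" for z
  have "linear L" unfolding L_def
    by (rule linearI) (auto simp: bil_simps x scaleR_add_left sum.distrib scaleR_sum_right)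
  moreover have Li: "L z \<bullet> i = G x z i" if "i \<in> Basis" for z i
    using that unfolding L_def by (simp add: inner_sum_left inner_Basis if_distrib cong: if_cong)
  then have "inj L" using nondeg_Basis[OF x] by (metis injI)
  ultimately have "surj L" by (rule linear_inj_imp_surj)
  then obtain z where "L z = (\<Sum>i\<in>Basis. \<beta> i *\<^sub>R i)" by (metis surjD)
  then have "G x z i = \<beta> i" if "i \<in> Basis" for i
    using Li[OF that, of z] that by (simp add: inner_sum_left inner_Basis if_distrib cong: if_cong)
  then show ?thesis using that by blast
qed

lemma riesz:
  assumes x: "x \<in> U" and l: "linear l" shows "\<exists>!z. \<forall>w. G x z w = l w"
proof -
  obtain z where z: "\<And>i. i \<in> Basis \<Longrightarrow> G x z i = l i" using solve_Basis[OF x] by blast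
  have "G x z w = l w" for w
  proof -
    have "l (\<Sum>i\<in>Basis. (w \<bullet> i) *\<^sub>R i) = (\<Sum>i\<in>Basis. (w \<bullet> i) * l i)"
      using l by (simp add: linear_sum linear_scale)
    then show ?thesis using z expand_right[OF x, of z w] by (simp add: euclidean_representation)
  qed
  then show ?thesis using nondeg[OF x] by metis
qed

text \<open>
  A continuous positive function on the compact set of pairs of a point of \<open>K\<close> and a unit vector has a
  positive minimum.
\<close>

lemma coercive:
  assumes K: "compact K" "K \<subseteq> U"
  obtains c where "c > 0" "\<And>x u. x \<in> K \<Longrightarrow> c * (norm u)\<^sup>2 \<le> G x u u"
proof -
  let ?S = "K \<times> sphere (0::'e) 1"
  have comp: "compact ?S" using K by (intro compact_Times) auto
  have cont: "continuous_on ?S (\<lambda>p. G (fst p) (snd p) (snd p))"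
    by (rule continuous_on_field) (use K in \<open>auto intro!: continuous_intros\<close>)
  show ?thesis
  proof (cases "K = {}")
    case True
    then show ?thesis using that[of 1] by auto
  next
    case False
    obtain e :: 'e where "norm e = 1" using vector_choose_size[of 1] by auto
    then have ne: "?S \<noteq> {}" using False by auto
    obtain p where p: "p \<in> ?S" "\<And>q. q \<in> ?S \<Longrightarrow> G (fst p) (snd p) (snd p) \<le> G (fst q) (snd q) (snd q)"
      using continuous_attains_inf[OF comp ne cont] by blast
    define c where "c = G (fst p) (snd p) (snd p)"
    have "c > 0" unfolding c_def using p(1) K by (intro pos) auto
    moreover have "c * (norm u)\<^sup>2 \<le> G x u u" if x: "x \<in> K" for x u
    proof (cases "u = 0")
      case True then show ?thesis using x K by (auto simp: bil_simps)
    next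
      case False
      have xU: "x \<in> U" using x K by auto
      have "c \<le> G x ((1 / norm u) *\<^sub>R u) ((1 / norm u) *\<^sub>R u)"
        using p(2)[of "(x, (1 / norm u) *\<^sub>R u)"] x False unfolding c_def by simp
      also have "\<dots> = G x u u / (norm u)\<^sup>2" by (simp add: bil_simps(5,6)[OF xU] power2_eq_square)
      finally show ?thesis using False by (simp add: field_simps)
    qed
    ultimately show ?thesis using that by blast
  qed
qed

text \<open>
  Locally uniform invertibility of the Gram matrix: this replaces an estimate for its inverse.
\<close>

lemma norm_le_components:
  assumes "x0 \<in> U"
  obtains c e where "c > 0" "e > 0" "ball x0 e \<subseteq> U"
    "\<And>x d. x \<in> ball x0 e \<Longrightarrow> norm d \<le> c * (\<Sum>i\<in>Basis. \<bar>G x d i\<bar>)"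
proof -
  obtain e where e: "e > 0" "cball x0 e \<subseteq> U" using open_U assms open_contains_cball by blast
  obtain c where c: "c > 0" "\<And>x u. x \<in> cball x0 e \<Longrightarrow> c * (norm u)\<^sup>2 \<le> G x u u"
    using coercive[OF compact_cball e(2)] by blast
  have "norm d \<le> (1 / c) * (\<Sum>i\<in>Basis. \<bar>G x d i\<bar>)" if x: "x \<in> ball x0 e" for x d
  proof (cases "d = 0")
    case False
    have xU: "x \<in> U" using x e by auto
    have "c * (norm d)\<^sup>2 \<le> G x d d" using c(2) x by auto
    also have "\<dots> = (\<Sum>i\<in>Basis. (d \<bullet> i) * G x d i)" by (rule expand_right[OF xU])
    also have "\<dots> \<le> (\<Sum>i\<in>Basis. norm d * \<bar>G x d i\<bar>)"
    proof (rule sum_mono)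
      fix i :: 'e assume "i \<in> Basis"
      have "(d \<bullet> i) * G x d i \<le> \<bar>d \<bullet> i\<bar> * \<bar>G x d i\<bar>" by (metis abs_ge_self abs_mult)
      also have "\<dots> \<le> norm d * \<bar>G x d i\<bar>"
        using Basis_le_norm[OF \<open>i \<in> Basis\<close>, of d] by (intro mult_right_mono) auto
      finally show "(d \<bullet> i) * G x d i \<le> norm d * \<bar>G x d i\<bar>" .
    qed
    also have "\<dots> = norm d * (\<Sum>i\<in>Basis. \<bar>G x d i\<bar>)" by (simp add: sum_distrib_left)
    finally have "norm d * (c * norm d) \<le> norm d * (\<Sum>i\<in>Basis. \<bar>G x d i\<bar>)"
      by (simp add: power2_eq_square algebra_simps)
    then have "c * norm d \<le> (\<Sum>i\<in>Basis. \<bar>G x d i\<bar>)" using False by simp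
    then show ?thesis using c(1) by (simp add: field_simps)
  qed (simp add: sum_nonneg c(1) less_imp_le)
  then show ?thesis using that[of "1/c" e] c(1) e by (meson ball_subset_cball order_trans zero_less_divide_1_iff)
qed

subsection \<open>Smooth dependence of solutions\<close>

lemma solution_continuous:
  assumes r: "\<And>i. i \<in> Basis \<Longrightarrow> continuous_on U (\<lambda>x. r x i)"
    and z: "\<And>x i. x \<in> U \<Longrightarrow> i \<in> Basis \<Longrightarrow> G x (z x) i = r x i"
  shows "continuous_on U z"
  unfolding continuous_on_eq_continuous_at[OF open_U]
proof
  fix x0 assume x0: "x0 \<in> U"
  obtain c e where ce: "c > 0" "e > 0" "ball x0 e \<subseteq> U"
    "\<And>x d. x \<in> ball x0 e \<Longrightarrow> norm d \<le> c * (\<Sum>i\<in>Basis. \<bar>G x d i\<bar>)" using norm_le_components[OF x0] by blast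
  have ev: "eventually (\<lambda>x. norm (z x - z x0) \<le> c * (\<Sum>i\<in>Basis. \<bar>r x i - G x (z x0) i\<bar>)) (at x0)"
    using eventually_at_ball[OF ce(2), of x0 UNIV]
  proof eventually_elim
    case (elim x)
    then have x: "x \<in> ball x0 e" "x \<in> U" using ce(3) by auto
    have "(\<Sum>i\<in>Basis. \<bar>G x (z x - z x0) i\<bar>) = (\<Sum>i\<in>Basis. \<bar>r x i - G x (z x0) i\<bar>)"
      by (rule sum.cong) (auto simp: bil_simps x z)
    then show ?case using ce(4)[OF x(1)] by metis
  qed
  have "((\<lambda>x. c * (\<Sum>i\<in>Basis. \<bar>r x i - G x (z x0) i\<bar>)) \<longlongrightarrow> c * (\<Sum>i\<in>Basis. \<bar>r x0 i - G x0 (z x0) i\<bar>)) (at x0)"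
  proof (intro tendsto_intros)
    fix i :: 'e assume "i \<in> Basis"
    then show "((\<lambda>x. r x i) \<longlongrightarrow> r x0 i) (at x0)"
      using r x0 open_U by (metis continuous_on_def at_within_open)
    show "((\<lambda>x. G x (z x0) i) \<longlongrightarrow> G x0 (z x0) i) (at x0)"
      using smooth_on_continuous[OF smooth] x0 open_U by (metis continuous_on_def at_within_open)
  qed
  then have "((\<lambda>x. c * (\<Sum>i\<in>Basis. \<bar>r x i - G x (z x0) i\<bar>)) \<longlongrightarrow> 0) (at x0)"
    using z x0 by simp
  then have "((\<lambda>x. z x - z x0) \<longlongrightarrow> 0) (at x0)" by (rule Lim_null_comparison[OF ev])
  then show "isCont z x0" unfolding isCont_def by (simp add: LIM_zero_iff)
qed

text \<open>
  The candidate \<open>z'\<close> is found by differentiating the equation for \<open>z\<close>. The error of the linear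
  approximation solves a system with the same matrix, whose right-hand side \<open>\<rho>\<close> vanishes to first order,
  and \<open>norm_le_components\<close> carries this over to the error.
\<close>

lemma solution_has_derivative:
  assumes x0: "x0 \<in> U"
    and r: "\<And>i. i \<in> Basis \<Longrightarrow> ((\<lambda>x. r x i) has_derivative r' i) (at x0)"
    and z: "\<And>x i. x \<in> U \<Longrightarrow> i \<in> Basis \<Longrightarrow> G x (z x) i = r x i"
    and z': "\<And>h i. i \<in> Basis \<Longrightarrow> G x0 (z' h) i = r' i h - Dfield G x0 h (z x0) i"
  shows "(z has_derivative z') (at x0)"
proof -
  have lin: "linear z'"
  proof (rule linearI; rule nondeg_Basis[OF x0])
    fix h h' i :: 'e and c :: real assume i: "i \<in> Basis"
    have l: "linear (r' i)" using r[OF i] has_derivative_linear by blast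
    show "G x0 (z' (h + h')) i = G x0 (z' h + z' h') i"
      using i x0 l by (simp add: bil_simps z' Dfield_simps linear_add)
    show "G x0 (z' (c *\<^sub>R h)) i = G x0 (c *\<^sub>R z' h) i"
      using i x0 l by (simp add: bil_simps z' Dfield_simps linear_scale algebra_simps)
  qed
  then have bl: "bounded_linear z'" by (rule linear_conv_bounded_linear[THEN iffD1])
  define d where "d x = z x - z x0 - z' (x - x0)" for x
  define \<rho> where "\<rho> i x = r x i - G x (z x0 + z' (x - x0)) i" for i x
  have z'0: "z' 0 = 0" using lin by (rule linear_0)
  have dz: "((\<lambda>x. z x0 + z' (x - x0)) has_derivative z') (at x0)"
  proof -
    have "((\<lambda>x. x - x0) has_derivative (\<lambda>h. h)) (at x0)" by (auto intro!: derivative_eq_intros)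
    from bounded_linear.has_derivative[OF bl this] show ?thesis
      by (auto intro!: derivative_eq_intros)
  qed
  have \<rho>0: "\<rho> i x0 = 0" if "i \<in> Basis" for i using that z x0 z'0 by (simp add: \<rho>_def)
  have \<rho>: "(\<rho> i has_derivative (\<lambda>h. 0)) (at x0)" if i: "i \<in> Basis" for i
  proof -
    have "((\<lambda>x. G x (z x0 + z' (x - x0)) i) has_derivative
      (\<lambda>h. Dfield G x0 h (z x0 + z' (x0 - x0)) i + G x0 (z' h) i + G x0 (z x0 + z' (x0 - x0)) 0)) (at x0)"
      by (rule has_derivative_field[OF _ _ has_derivative_ident dz has_derivative_const]) (use x0 in auto)
    from has_derivative_diff[OF r[OF i] this] show ?thesis unfolding \<rho>_def
      by (rule has_derivative_eq_rhs) (use z' i x0 z'0 in \<open>auto simp: bil_simps\<close>)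
  qed
  obtain c e where ce: "c > 0" "e > 0" "ball x0 e \<subseteq> U"
    "\<And>x d. x \<in> ball x0 e \<Longrightarrow> norm d \<le> c * (\<Sum>i\<in>Basis. \<bar>G x d i\<bar>)" using norm_le_components[OF x0] by blast
  have d0: "d x0 = 0" by (simp add: d_def z'0)
  have "((\<lambda>x. c * (\<Sum>i\<in>Basis. norm (\<rho> i x - \<rho> i x0 - 0) / norm (x - x0))) \<longlongrightarrow> c * (\<Sum>i\<in>(Basis::'e set). 0)) (at x0)"
    by (intro tendsto_intros) (use \<rho> in \<open>auto simp: has_derivative_iff_norm\<close>)
  then have lim: "((\<lambda>x. c * (\<Sum>i\<in>Basis. norm (\<rho> i x - \<rho> i x0 - 0) / norm (x - x0))) \<longlongrightarrow> 0) (at x0)" by simp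
  have ev: "eventually (\<lambda>x. norm (norm (d x - d x0 - 0) / norm (x - x0)) \<le> c * (\<Sum>i\<in>Basis. norm (\<rho> i x - \<rho> i x0 - 0) / norm (x - x0))) (at x0)"
    using eventually_at_ball[OF ce(2), of x0 UNIV]
  proof eventually_elim
    case (elim x)
    then have x: "x \<in> ball x0 e" "x \<in> U" using ce(3) by auto
    have "(\<Sum>i\<in>Basis. \<bar>G x (d x) i\<bar>) = (\<Sum>i\<in>Basis. norm (\<rho> i x - \<rho> i x0))"
      by (rule sum.cong) (auto simp: \<rho>0, auto simp: \<rho>_def d_def bil_simps x z algebra_simps)
    then have "norm (d x) \<le> c * (\<Sum>i\<in>Basis. norm (\<rho> i x - \<rho> i x0))" using ce(4)[OF x(1), of "d x"] by simp
    then have "norm (d x) / norm (x - x0) \<le> c * (\<Sum>i\<in>Basis. norm (\<rho> i x - \<rho> i x0)) / norm (x - x0)"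
      by (rule divide_right_mono) auto
    then show ?case by (simp add: d0 sum_divide_distrib[symmetric])
  qed
  have "((\<lambda>x. norm (d x - d x0 - 0) / norm (x - x0)) \<longlongrightarrow> 0) (at x0)"
    by (rule Lim_null_comparison[OF ev lim])
  then have "(d has_derivative (\<lambda>h. 0)) (at x0)" by (simp add: has_derivative_iff_norm)
  from has_derivative_add[OF this dz] show ?thesis by (simp add: d_def)
qed

text \<open>
  Directional derivatives of a solution solve a system of the same kind, whose right-hand side contains
  the solution itself but no derivative of it. So one order of differentiability is gained at a time.
\<close>

lemma solution_C_k:
  assumes r: "\<And>i. i \<in> Basis \<Longrightarrow> C_k_on k U (\<lambda>x. r x i)"
    and z: "\<And>x i. x \<in> U \<Longrightarrow> i \<in> Basis \<Longrightarrow> G x (z x) i = r x i"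
  shows "C_k_on k U z"
  using assms
proof (induction k arbitrary: r z)
  case 0 then show ?case by (metis C_k_on.simps(1) solution_continuous)
next
  case (Suc k)
  have fat: "fat U" by (rule fat_open[OF open_U])
  have zk: "C_k_on k U z" by (rule Suc.IH[OF C_k_on_Suc_imp[OF Suc.prems(1)] Suc.prems(2)])
  define r' where "r' x h i = frechet_derivative (\<lambda>x. r x i) (at x) h" for x h and i :: 'e
  have r'k: "C_k_on k U (\<lambda>x. r' x h i)" if "i \<in> Basis" for h i
  proof -
    have "C_k_on k U (\<lambda>x. frechet_derivative (\<lambda>x. r x i) (at x within U) h)" using Suc.prems(1)[OF that] by simp
    then show ?thesis unfolding r'_def
      by (rule C_k_on_transfer) (simp add: at_within_open[OF _ open_U])
  qed
  have r': "((\<lambda>x. r x i) has_derivative (\<lambda>h. r' x h i)) (at x)" if "i \<in> Basis" "x \<in> U" for x i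
  proof -
    have "(\<lambda>x. r x i) differentiable (at x within U)" by (rule C_k_on_Suc_differentiable[OF Suc.prems(1)[OF that(1)] that(2)])
    then show ?thesis unfolding r'_def at_within_open[OF that(2) open_U] frechet_derivative_works .
  qed
  define z' where "z' x h = (SOME w. \<forall>i\<in>Basis. G x w i = r' x h i - Dfield G x h (z x) i)" for x h
  have z': "G x (z' x h) i = r' x h i - Dfield G x h (z x) i" if x: "x \<in> U" and i: "i \<in> Basis" for x h i
  proof -
    obtain w where "\<And>i. i \<in> Basis \<Longrightarrow> G x w i = r' x h i - Dfield G x h (z x) i"
      using solve_Basis[OF x, of "\<lambda>i. r' x h i - Dfield G x h (z x) i"] by blast
    then have "\<forall>i\<in>Basis. G x (z' x h) i = r' x h i - Dfield G x h (z x) i"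
      unfolding z'_def by (intro someI[where P="\<lambda>w. \<forall>i\<in>Basis. G x w i = r' x h i - Dfield G x h (z x) i"]) blast
    then show ?thesis using i by blast
  qed
  show ?case
  proof (rule C_k_on_SucI[OF fat, of _ z'])
    fix x assume x: "x \<in> U"
    have "(z has_derivative z' x) (at x)"
      by (rule solution_has_derivative[OF x r'[OF _ x] Suc.prems(2) z'[OF x]]) auto
    then show "(z has_derivative z' x) (at x within U)" by (rule has_derivative_at_withinI)
  next
    fix h
    show "C_k_on k U (\<lambda>x. z' x h)"
    proof (rule Suc.IH[of "\<lambda>x i. r' x h i - Dfield G x h (z x) i"])
      fix i :: 'e assume i: "i \<in> Basis"
      show "C_k_on k U (\<lambda>x. r' x h i - Dfield G x h (z x) i)"
        by (intro C_k_on_diff r'k i C_k_on_Dfield fat zk C_k_on_const C_k_on_linear) auto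
    qed (use z' in auto)
  qed
qed

end

section \<open>Levi-Civita connection and curvature in a chart\<close>

context riem_chart
begin

abbreviation "\<Gamma> \<equiv> Chr G"

lemma Dfield_sym: "x \<in> U \<Longrightarrow> Dfield G x h u v = Dfield G x h v u"
  by (rule Dfield_eqI[OF _ Dfield_deriv]) (auto simp: sym)

lemma linear_koszul: "x \<in> U \<Longrightarrow> linear (\<lambda>w. (Dfield G x u v w + Dfield G x v u w - Dfield G x w u v) / 2)"
  by (rule linearI) (auto simp: Dfield_simps Dfield_bil_simps field_simps)

lemma Chr_koszul:
  assumes "x \<in> U"
  shows "G x (\<Gamma> x u v) w = (Dfield G x u v w + Dfield G x v u w - Dfield G x w u v) / 2"
  using theI'[OF riesz[OF assms linear_koszul[OF assms]]] unfolding Chr_def by blast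

lemma Chr_eqI:
  assumes "x \<in> U" "\<And>w. G x z w = (Dfield G x u v w + Dfield G x v u w - Dfield G x w u v) / 2"
  shows "\<Gamma> x u v = z"
  by (rule nondeg[OF assms(1)]) (simp add: Chr_koszul[OF assms(1)] assms(2))

lemma Chr_sym: "x \<in> U \<Longrightarrow> \<Gamma> x u v = \<Gamma> x v u"
  by (rule Chr_eqI) (auto simp: Chr_koszul Dfield_sym[of x _ u v])

lemma bilin_field_Chr: "bilin_field U \<Gamma>"
proof
  show "open U" by (rule open_U)
  show "bilinear (\<Gamma> x)" if x: "x \<in> U" for x
    unfolding bilinear_def
  proof (intro conjI allI linearI)
    fix u v w and c :: real
    show 1: "\<Gamma> x (u + v) w = \<Gamma> x u w + \<Gamma> x v w" for u v w
      by (rule Chr_eqI[OF x]) (simp add: bil_simps x Chr_koszul Dfield_simps Dfield_bil_simps field_simps)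
    show 2: "\<Gamma> x (c *\<^sub>R u) w = c *\<^sub>R \<Gamma> x u w" for u w
      by (rule Chr_eqI[OF x]) (simp add: bil_simps x Chr_koszul Dfield_simps Dfield_bil_simps field_simps)
    show "\<Gamma> x w (u + v) = \<Gamma> x w u + \<Gamma> x w v" "\<Gamma> x w (c *\<^sub>R u) = c *\<^sub>R \<Gamma> x w u"
      using 1 2 Chr_sym[OF x, of w] by auto
  qed
  show "smooth_on U (\<lambda>x. \<Gamma> x u v)" for u v
    unfolding smooth_on_def
  proof
    fix k
    have s: "C_k_on k U (\<lambda>x. Dfield G x h a b)" for h a b
      using bilin_field.smooth[OF bilin_field_Dfield] smooth_onD by blast
    show "C_k_on k U (\<lambda>x. \<Gamma> x u v)"
    proof (rule solution_C_k[where r="\<lambda>x w. (1/2) *\<^sub>R (Dfield G x u v w + Dfield G x v u w - Dfield G x w u v)"])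
      show "C_k_on k U (\<lambda>x. (1/2) *\<^sub>R (Dfield G x u v w + Dfield G x v u w - Dfield G x w u v))" for w
        by (intro C_k_on_linear_comp[OF bounded_linear_scaleR_right] C_k_on_diff C_k_on_add s fat_open open_U)
    qed (simp add: Chr_koszul)
  qed
qed

sublocale Chr: bilin_field U \<Gamma> by (rule bilin_field_Chr)

lemma compat: "x \<in> U \<Longrightarrow> Dfield G x h a b = G x (\<Gamma> x h a) b + G x a (\<Gamma> x h b)"
  using Chr_koszul[of x h a b] Chr_koszul[of x h b a] sym[of x a "\<Gamma> x h b"]
    Dfield_sym[of x h a b] Dfield_sym[of x a h b] Dfield_sym[of x b h a]
  by (simp add: field_simps)

lemma Dfield_Chr_sym: "x \<in> U \<Longrightarrow> Dfield \<Gamma> x h u v = Dfield \<Gamma> x h v u"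
  by (rule Chr.Dfield_eqI[OF _ Chr.Dfield_deriv]) (auto intro: Chr_sym)

lemma Rm_antisym: "Rm G x u v w = - Rm G x v u w"
  by (simp add: Rm_def)

lemma Rm_bianchi: "x \<in> U \<Longrightarrow> Rm G x u v w + Rm G x v w u + Rm G x w u v = 0"
  using Chr_sym[of x u v] Chr_sym[of x v w] Chr_sym[of x w u]
    Dfield_Chr_sym[of x u v w] Dfield_Chr_sym[of x v w u] Dfield_Chr_sym[of x w u v]
  by (simp add: Rm_def)

text \<open>
  The second derivatives of the function \<open>y \<mapsto> G y a a\<close> in the directions \<open>h\<close> and \<open>k\<close> do not depend on
  their order. When they are expressed through the Christoffel symbols by \<open>compat\<close>, their difference is,
  up to sign, twice the left-hand side.
\<close>

lemma Rm_skew_diag: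
  assumes x: "x \<in> U" shows "G x (Rm G x h k a) a = 0"
proof -
  define f2 where "f2 h y k = 2 * (Dfield G y k (\<Gamma> y h a) a + G y (Dfield \<Gamma> y k h a) a)" for h y k
  have "f2 h x k = f2 k x h"
  proof (rule symmetric_second_derivative[OF open_U x, where f="\<lambda>y. G y a a" and f'="\<lambda>y h. Dfield G y h a a"])
    show "((\<lambda>y. G y a a) has_derivative (\<lambda>h. Dfield G y h a a)) (at y)" if "y \<in> U" for y
      by (rule Dfield_deriv[OF that])
    show "((\<lambda>y. Dfield G y u a a) has_derivative f2 u y) (at y)" if y: "y \<in> U" for y u
    proof -
      have "((\<lambda>y. G y (\<Gamma> y u a) a) has_derivative (\<lambda>k. Dfield G y k (\<Gamma> y u a) a + G y (Dfield \<Gamma> y k u a) a + G y (\<Gamma> y u a) 0)) (at y)"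
        by (rule has_derivative_field[OF _ y has_derivative_ident Chr.Dfield_deriv[OF y] has_derivative_const]) simp
      then have "((\<lambda>y. 2 * G y (\<Gamma> y u a) a) has_derivative f2 u y) (at y)"
        unfolding f2_def by (auto intro!: derivative_eq_intros simp: bil_simps y algebra_simps)
      then show ?thesis
        by (rule has_derivative_transform_within_open[OF _ open_U y]) (simp add: compat sym)
    qed
    show "continuous_on U (\<lambda>y. f2 u y v)" for u v
      unfolding f2_def
      by (intro continuous_intros continuous_on_Dfield continuous_on_field Chr.continuous_on_field Chr.continuous_on_Dfield) auto
  qed
  then show ?thesis
    using sym[OF x, of "\<Gamma> x h a" "\<Gamma> x k a"]
    by (simp add: f2_def compat[OF x] Rm_def bil_simps[OF x])
qed

lemma Rm_skew:
  assumes x: "x \<in> U" shows "G x (Rm G x h k a) b = - G x (Rm G x h k b) a"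
proof -
  have l: "Rm G x h k (a + b) = Rm G x h k a + Rm G x h k b"
    unfolding Rm_def by (simp add: Chr.bil_simps[OF x] Chr.Dfield_bil_simps[OF x])
  show ?thesis using Rm_skew_diag[OF x, of h k "a + b"] Rm_skew_diag[OF x, of h k a] Rm_skew_diag[OF x, of h k b]
    by (simp add: l bil_simps[OF x])
qed

text \<open>
  The case of the pair symmetry that occurs in the first variation. It takes a single Bianchi identity:
  the one for \<open>h, v, a\<close>, paired with \<open>v\<close>, where the term with \<open>R(a, h)v\<close> drops out.
\<close>

lemma Rm_self_adjoint:
  assumes x: "x \<in> U" shows "G x (Rm G x h v v) a = G x (Rm G x a v v) h"
proof -
  have "G x (Rm G x h v a + Rm G x v a h + Rm G x a h v) v = 0"
    using Rm_bianchi[OF x] bil_simps[OF x] by simp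
  then have "G x (Rm G x h v a) v + G x (Rm G x v a h) v = 0"
    using Rm_skew_diag[OF x, of a h v] by (simp add: bil_simps[OF x])
  then show ?thesis
    using Rm_skew[OF x, of h v v a] Rm_skew[OF x, of a v v h] Rm_antisym[of x v a h]
    by (simp add: bil_simps[OF x])
qed

lemma continuous_on_Rm:
  assumes "continuous_on S x" "continuous_on S u" "continuous_on S v" "continuous_on S w" "x ` S \<subseteq> U"
  shows "continuous_on S (\<lambda>s. Rm G (x s) (u s) (v s) (w s))"
  unfolding Rm_def by (intro continuous_intros Chr.continuous_on_Dfield Chr.continuous_on_field assms)

lemma C_k_on_Rm:
  assumes "fat S" "C_k_on k S x" "C_k_on k S u" "C_k_on k S v" "C_k_on k S w" "x ` S \<subseteq> U"
  shows "C_k_on k S (\<lambda>s. Rm G (x s) (u s) (v s) (w s))"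
  unfolding Rm_def by (intro C_k_on_add C_k_on_diff Chr.C_k_on_Dfield Chr.C_k_on_field assms)

end

section \<open>The first variation\<close>

locale riem_pot = riem_chart U G for U :: "'e::euclidean_space set" and G :: "'e \<Rightarrow> 'e \<Rightarrow> 'e \<Rightarrow> real" +
  fixes V :: "'e \<Rightarrow> real"
  assumes smooth_V: "smooth_on U V"
begin

abbreviation "dV x h \<equiv> frechet_derivative V (at x) h"

definition grd :: "'e \<Rightarrow> 'e" where "grd x = (THE z. \<forall>w. G x z w = dV x w)"

lemma dV: "x \<in> U \<Longrightarrow> (V has_derivative dV x) (at x)"
  by (rule smooth_on_has_derivative[OF smooth_V open_U])

lemma linear_dV: "x \<in> U \<Longrightarrow> linear (dV x)"
  using dV has_derivative_linear by blast

lemma grd: "x \<in> U \<Longrightarrow> G x (grd x) w = dV x w"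
  using theI'[OF riesz[OF _ linear_dV]] unfolding grd_def by blast

lemma grd_C_k: "C_k_on k U grd"
proof (rule solution_C_k[where r="\<lambda>x w. dV x w"])
  show "C_k_on k U (\<lambda>x. dV x i)" for i
    using smooth_on_frechet_derivative[OF smooth_V open_U] smooth_onD by blast
qed (simp add: grd)

text \<open>
  The derivative at \<open>s = 0\<close> of the integrand of \<open>J\<close> along a variation \<open>x + s h\<close>, where \<open>a\<close> is the
  covariant acceleration of \<open>x\<close>, and \<open>h\<close>, \<open>k\<close>, \<open>j\<close> are the variation and its first two derivatives.
\<close>

definition ell :: "'e \<Rightarrow> 'e \<Rightarrow> 'e \<Rightarrow> 'e \<Rightarrow> 'e \<Rightarrow> 'e \<Rightarrow> real"
  where "ell x v a h k j = G x a (j + Dfield \<Gamma> x h v v + 2 *\<^sub>R \<Gamma> x v k) + Dfield G x h a a / 2 + dV x h"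

text \<open>
  The antiderivative that appears when \<open>ell\<close> is integrated by parts twice.
\<close>

definition boundary_term :: "'e \<Rightarrow> 'e \<Rightarrow> 'e \<Rightarrow> 'e \<Rightarrow> 'e \<Rightarrow> 'e \<Rightarrow> real"
  where "boundary_term x v a b h k = G x (k + \<Gamma> x v h) a - G x h b"

text \<open>
  With \<open>H = h' + \<Gamma>(v, h)\<close> the covariant derivative of \<open>h\<close>, the derivative of \<open>G(H, a) - G(h, Da)\<close> is
  \<open>G(DH, a) - G(h, D\<^sup>2a)\<close> by compatibility with the metric. The variation of the acceleration is
  \<open>DH + R(h, v)v\<close> up to the term \<open>\<Gamma>(h, a)\<close> that accounts for the variation of the metric; self-adjointness
  of \<open>h \<mapsto> R(h, v)v\<close> then collects everything that multiplies \<open>h\<close> in \<open>e\<close>.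
\<close>

lemma first_variation:
  assumes t: "t \<in> S" "x t \<in> U"
    and x: "(x has_vector_derivative v t) (at t within S)"
    and v: "(v has_vector_derivative a t - \<Gamma> (x t) (v t) (v t)) (at t within S)"
    and a: "(a has_vector_derivative b t - \<Gamma> (x t) (v t) (a t)) (at t within S)"
    and b: "(b has_vector_derivative e - Rm G (x t) (a t) (v t) (v t) - grd (x t) - \<Gamma> (x t) (v t) (b t)) (at t within S)"
    and h: "(h has_vector_derivative k t) (at t within S)"
    and k: "(k has_vector_derivative j) (at t within S)"
  shows "((\<lambda>s. boundary_term (x s) (v s) (a s) (b s) (h s) (k s)) has_vector_derivative
    ell (x t) (v t) (a t) (h t) (k t) j - G (x t) e (h t)) (at t within S)"
proof -
  let ?H' = "j + (Dfield \<Gamma> (x t) (v t) (v t) (h t) + \<Gamma> (x t) (a t - \<Gamma> (x t) (v t) (v t)) (h t) + \<Gamma> (x t) (v t) (k t))"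
  have "((\<lambda>s. \<Gamma> (x s) (v s) (h s)) has_vector_derivative
    Dfield \<Gamma> (x t) (v t) (v t) (h t) + \<Gamma> (x t) (a t - \<Gamma> (x t) (v t) (v t)) (h t) + \<Gamma> (x t) (v t) (k t)) (at t within S)"
    by (rule Chr.has_vector_derivative_field[OF t x v h])
  from has_vector_derivative_add[OF k this]
  have H: "((\<lambda>s. k s + \<Gamma> (x s) (v s) (h s)) has_vector_derivative ?H') (at t within S)" .
  from has_vector_derivative_diff[OF has_vector_derivative_field[OF t x H a] has_vector_derivative_field[OF t x h b]]
  have D: "((\<lambda>s. boundary_term (x s) (v s) (a s) (b s) (h s) (k s)) has_vector_derivative
    (Dfield G (x t) (v t) (k t + \<Gamma> (x t) (v t) (h t)) (a t) + G (x t) ?H' (a t)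
      + G (x t) (k t + \<Gamma> (x t) (v t) (h t)) (b t - \<Gamma> (x t) (v t) (a t)))
    - (Dfield G (x t) (v t) (h t) (b t) + G (x t) (k t) (b t)
      + G (x t) (h t) (e - Rm G (x t) (a t) (v t) (v t) - grd (x t) - \<Gamma> (x t) (v t) (b t)))) (at t within S)"
    unfolding boundary_term_def .
  note U = t(2)
  have R: "G (x t) (h t) (Rm G (x t) (a t) (v t) (v t)) = G (x t) (Rm G (x t) (h t) (v t) (v t)) (a t)"
    using Rm_self_adjoint[OF U] sym[OF U] by metis
  have gr: "G (x t) (h t) (grd (x t)) = dV (x t) (h t)" using grd[OF U] sym[OF U] by metis
  have e: "G (x t) (h t) e = G (x t) e (h t)" by (rule sym[OF U])
  have c: "Dfield G (x t) (h t) (a t) (a t) = 2 * G (x t) (\<Gamma> (x t) (h t) (a t)) (a t)"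
    by (simp add: compat[OF U] sym[OF U, of "a t"])
  have A: "G (x t) (a t) z = G (x t) z (a t)" for z by (rule sym[OF U])
  show ?thesis
    by (rule has_vector_derivative_eq_rhs[OF D], unfold ell_def c A compat[OF U, of "v t"])
      (simp add: bil_simps[OF U] Chr.bil_simps[OF U] gr e R,
       simp add: Rm_def bil_simps[OF U] Chr_sym[OF U, of "h t"] Dfield_Chr_sym[OF U, of "v t" "h t"] scaleR_2)
qed

end

section \<open>Uniform Taylor estimates on balls\<close>

lemma smooth_lipschitz_on_cball:
  fixes f :: "'e::euclidean_space \<Rightarrow> 'f::euclidean_space"
  assumes f: "smooth_on U f" and U: "open U" "cball x0 r \<subseteq> U"
  shows "\<exists>C\<ge>0. \<forall>x\<in>cball x0 r. norm (f x) \<le> C \<and> (\<forall>h. norm (frechet_derivative f (at x) h) \<le> C * norm h)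
    \<and> (\<forall>y\<in>cball x0 r. norm (f y - f x) \<le> C * norm (y - x))"
proof -
  let ?K = "cball x0 r" and ?D = "\<lambda>x. frechet_derivative f (at x)"
  have bdd: "\<exists>c. \<forall>x\<in>?K. norm (g x) \<le> c" if "smooth_on U g" for g :: "'e \<Rightarrow> 'f"
  proof -
    have "continuous_on ?K g" using smooth_on_continuous[OF that] U(2) continuous_on_subset by blast
    then have "bounded (g ` ?K)" using compact_continuous_image compact_cball compact_imp_bounded by blast
    then show ?thesis by (auto simp: bounded_iff)
  qed
  obtain c0 where c0: "\<And>x. x \<in> ?K \<Longrightarrow> norm (f x) \<le> c0" using bdd[OF f] by blast
  have "\<forall>i. \<exists>c. \<forall>x\<in>?K. norm (?D x i) \<le> c" using bdd[OF smooth_on_frechet_derivative[OF f U(1)]] by blast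
  then obtain c where c: "\<And>i x. x \<in> ?K \<Longrightarrow> norm (?D x i) \<le> c i" by metis
  define C where "C = \<bar>c0\<bar> + (\<Sum>i\<in>Basis. \<bar>c i\<bar>)"
  have D: "(f has_derivative ?D x) (at x)" if "x \<in> ?K" for x
    using smooth_on_has_derivative[OF f U(1)] that U(2) by blast
  have Db: "norm (?D x h) \<le> C * norm h" if x: "x \<in> ?K" for x h
  proof -
    have l: "linear (?D x)" using D[OF x] has_derivative_linear by blast
    have "?D x h = ?D x (\<Sum>i\<in>Basis. (h \<bullet> i) *\<^sub>R i)" by (simp add: euclidean_representation)
    also have "\<dots> = (\<Sum>i\<in>Basis. (h \<bullet> i) *\<^sub>R ?D x i)" by (simp add: linear_sum[OF l] linear_scale[OF l])
    finally have "norm (?D x h) \<le> (\<Sum>i\<in>Basis. norm ((h \<bullet> i) *\<^sub>R ?D x i))" by (metis norm_sum)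
    also have "\<dots> \<le> (\<Sum>i\<in>Basis. norm h * \<bar>c i\<bar>)"
    proof (rule sum_mono)
      fix i :: 'e assume i: "i \<in> Basis"
      have "\<bar>h \<bullet> i\<bar> * norm (?D x i) \<le> norm h * \<bar>c i\<bar>"
        using c[OF x, of i] Basis_le_norm[OF i, of h] by (intro mult_mono) auto
      then show "norm ((h \<bullet> i) *\<^sub>R ?D x i) \<le> norm h * \<bar>c i\<bar>" by simp
    qed
    also have "\<dots> = (\<Sum>i\<in>Basis. \<bar>c i\<bar>) * norm h" by (simp add: sum_distrib_left[symmetric] mult.commute)
    also have "\<dots> \<le> C * norm h" by (intro mult_right_mono) (auto simp: C_def)
    finally show ?thesis .
  qed
  have "norm (f y - f x) \<le> C * norm (y - x)" if "x \<in> ?K" "y \<in> ?K" for x y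
  proof (rule differentiable_bound[of ?K f ?D C y x])
    show "(f has_derivative ?D z) (at z within ?K)" if "z \<in> ?K" for z
      using D[OF that] by (rule has_derivative_at_withinI)
    show "onorm (?D z) \<le> C" if "z \<in> ?K" for z using Db[OF that] by (intro onorm_le) auto
  qed (use that in auto)
  moreover have "norm (f x) \<le> C" if "x \<in> ?K" for x
  proof -
    have "0 \<le> (\<Sum>i\<in>Basis. \<bar>c i\<bar>)" by (intro sum_nonneg) auto
    then show ?thesis using c0[OF that] abs_ge_self[of c0] unfolding C_def by linarith
  qed
  moreover have "C \<ge> 0" by (auto simp: C_def intro: add_nonneg_nonneg sum_nonneg)
  ultimately show ?thesis using Db by (intro exI[of _ C]) auto
qed

text \<open>
  The mean value inequality is applied to \<open>f\<close> minus its linearization, on the intersection of the ball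
  with the ball around \<open>x\<close> through \<open>y\<close>; there the derivative of \<open>f\<close> differs from the one at \<open>x\<close> by at most
  a multiple of \<open>\<bar>y - x\<bar>\<close>.
\<close>

lemma smooth_taylor_on_cball:
  fixes f :: "'e::euclidean_space \<Rightarrow> 'f::euclidean_space"
  assumes f: "smooth_on U f" and U: "open U" "cball x0 r \<subseteq> U"
  shows "\<exists>C\<ge>0. \<forall>x\<in>cball x0 r. norm (f x) \<le> C \<and> (\<forall>h. norm (frechet_derivative f (at x) h) \<le> C * norm h)
    \<and> (\<forall>y\<in>cball x0 r. norm (f y - f x) \<le> C * norm (y - x)
         \<and> norm (f y - f x - frechet_derivative f (at x) (y - x)) \<le> C * (norm (y - x))\<^sup>2)"
proof -
  let ?K = "cball x0 r" and ?D = "\<lambda>x. frechet_derivative f (at x)"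
  obtain C0 where C0: "C0 \<ge> 0" "\<And>x h. x \<in> ?K \<Longrightarrow> norm (f x) \<le> C0 \<and> norm (?D x h) \<le> C0 * norm h"
      "\<And>x y. x \<in> ?K \<Longrightarrow> y \<in> ?K \<Longrightarrow> norm (f y - f x) \<le> C0 * norm (y - x)"
    using smooth_lipschitz_on_cball[OF f U] by blast
  have "\<forall>i. \<exists>c\<ge>0. \<forall>x\<in>?K. \<forall>y\<in>?K. norm (?D y i - ?D x i) \<le> c * norm (y - x)"
    using smooth_lipschitz_on_cball[OF smooth_on_frechet_derivative[OF f U(1)] U] by blast
  then obtain c where c: "\<And>i. c i \<ge> 0" "\<And>i x y. x \<in> ?K \<Longrightarrow> y \<in> ?K \<Longrightarrow> norm (?D y i - ?D x i) \<le> c i * norm (y - x)"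
    by metis
  define C where "C = (\<Sum>i\<in>Basis. c i)"
  have Cnn: "C \<ge> 0" unfolding C_def by (intro sum_nonneg c)
  have D: "(f has_derivative ?D x) (at x)" if "x \<in> ?K" for x
    using smooth_on_has_derivative[OF f U(1)] that U(2) by blast
  have l: "linear (?D x)" if "x \<in> ?K" for x using D[OF that] has_derivative_linear by blast
  have Db: "norm (?D y h - ?D x h) \<le> C * norm (y - x) * norm h" if x: "x \<in> ?K" "y \<in> ?K" for x y h
  proof -
    have e: "?D x h = (\<Sum>i\<in>Basis. (h \<bullet> i) *\<^sub>R ?D x i)" if "x \<in> ?K" for x
    proof -
      have "?D x h = ?D x (\<Sum>i\<in>Basis. (h \<bullet> i) *\<^sub>R i)" by (simp add: euclidean_representation)
      also have "\<dots> = (\<Sum>i\<in>Basis. (h \<bullet> i) *\<^sub>R ?D x i)" by (simp add: linear_sum[OF l[OF that]] linear_scale[OF l[OF that]])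
      finally show ?thesis .
    qed
    have "norm (?D y h - ?D x h) = norm (\<Sum>i\<in>Basis. (h \<bullet> i) *\<^sub>R (?D y i - ?D x i))"
      by (simp add: e[OF x(1)] e[OF x(2)] sum_subtractf scaleR_diff_right)
    also have "\<dots> \<le> (\<Sum>i\<in>Basis. norm ((h \<bullet> i) *\<^sub>R (?D y i - ?D x i)))" by (rule norm_sum)
    also have "\<dots> \<le> (\<Sum>i\<in>Basis. norm h * (c i * norm (y - x)))"
    proof (rule sum_mono)
      fix i :: 'e assume i: "i \<in> Basis"
      have "\<bar>h \<bullet> i\<bar> * norm (?D y i - ?D x i) \<le> norm h * (c i * norm (y - x))"
        using c(2)[OF x, of i] Basis_le_norm[OF i, of h] by (intro mult_mono) auto
      then show "norm ((h \<bullet> i) *\<^sub>R (?D y i - ?D x i)) \<le> norm h * (c i * norm (y - x))" by simp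
    qed
    also have "\<dots> = C * norm (y - x) * norm h" unfolding C_def by (simp add: sum_distrib_left sum_distrib_right mult_ac)
    finally show ?thesis .
  qed
  have T: "norm (f y - f x - ?D x (y - x)) \<le> C * (norm (y - x))\<^sup>2" if x: "x \<in> ?K" "y \<in> ?K" for x y
  proof -
    let ?S = "?K \<inter> cball x (norm (y - x))"
    have "norm ((f y - ?D x y) - (f x - ?D x x)) \<le> (C * norm (y - x)) * norm (y - x)"
    proof (rule differentiable_bound[of ?S "\<lambda>z. f z - ?D x z" "\<lambda>z h. ?D z h - ?D x h"])
      show "convex ?S" by (intro convex_Int convex_cball)
      show "((\<lambda>z. f z - ?D x z) has_derivative (\<lambda>h. ?D z h - ?D x h)) (at z within ?S)" if "z \<in> ?S" for z
        by (intro has_derivative_diff has_derivative_at_withinI[OF D] linear_imp_has_derivative l x) (use that in auto)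
      show "onorm (\<lambda>h. ?D z h - ?D x h) \<le> C * norm (y - x)" if z: "z \<in> ?S" for z
      proof (rule onorm_le)
        fix h
        have "norm (?D z h - ?D x h) \<le> C * norm (z - x) * norm h" using Db x z by auto
        also have "\<dots> \<le> C * norm (y - x) * norm h"
          using z Cnn by (intro mult_right_mono mult_left_mono) (auto simp: dist_norm norm_minus_commute)
        finally show "norm (?D z h - ?D x h) \<le> C * norm (y - x) * norm h" .
      qed
    qed (use x in \<open>auto simp: dist_norm norm_minus_commute\<close>)
    then show ?thesis by (simp add: linear_diff[OF l[OF x(1)]] power2_eq_square algebra_simps)
  qed
  have mono: "a \<le> C0 * b \<Longrightarrow> a \<le> (C0 + C) * b" "a \<le> C * b \<Longrightarrow> a \<le> (C0 + C) * b" if "b \<ge> 0" for a b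
    using mult_nonneg_nonneg[OF Cnn that] mult_nonneg_nonneg[OF C0(1) that] by (auto simp: algebra_simps)
  show ?thesis
  proof (intro exI[of _ "C0 + C"] conjI ballI allI)
    show "0 \<le> C0 + C" using Cnn C0 by simp
    fix x assume x: "x \<in> ?K"
    show "norm (f x) \<le> C0 + C" using C0(2)[OF x, of 0] Cnn by simp
    show "norm (?D x h) \<le> (C0 + C) * norm h" for h using C0(2)[OF x, of h] by (intro mono) auto
    fix y assume y: "y \<in> ?K"
    show "norm (f y - f x) \<le> (C0 + C) * norm (y - x)" using C0(3)[OF x y] by (intro mono(1)) auto
    show "norm (f y - f x - ?D x (y - x)) \<le> (C0 + C) * (norm (y - x))\<^sup>2" using T[OF x y] by (intro mono(2)) auto
  qed
qed

context bilin_field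
begin

lemma norm_bilinear_le:
  fixes \<beta> :: "'e \<Rightarrow> 'e \<Rightarrow> 'f"
  assumes "\<beta> u v = (\<Sum>i\<in>Basis. \<Sum>j\<in>Basis. ((u \<bullet> i) * (v \<bullet> j)) *\<^sub>R \<beta> i j)"
    and "\<And>i j. norm (\<beta> i j) \<le> c i j * m" and "m \<ge> 0" "\<And>i j. c i j \<ge> 0"
  shows "norm (\<beta> u v) \<le> (\<Sum>i\<in>Basis. \<Sum>j\<in>Basis. c i j) * m * norm u * norm v"
proof -
  have "norm (\<beta> u v) \<le> (\<Sum>i\<in>Basis. norm (\<Sum>j\<in>Basis. ((u \<bullet> i) * (v \<bullet> j)) *\<^sub>R \<beta> i j))"
    by (subst assms(1)) (rule norm_sum)
  also have "\<dots> \<le> (\<Sum>i\<in>Basis. \<Sum>j\<in>Basis. norm (((u \<bullet> i) * (v \<bullet> j)) *\<^sub>R \<beta> i j))"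
    by (intro sum_mono norm_sum)
  also have "\<dots> \<le> (\<Sum>i\<in>Basis. \<Sum>j\<in>Basis. (norm u * norm v) * (c i j * m))"
  proof (intro sum_mono)
    fix i j :: 'e assume "i \<in> Basis" "j \<in> Basis"
    then have "\<bar>(u \<bullet> i) * (v \<bullet> j)\<bar> \<le> norm u * norm v"
      unfolding abs_mult by (intro mult_mono Basis_le_norm) auto
    then show "norm (((u \<bullet> i) * (v \<bullet> j)) *\<^sub>R \<beta> i j) \<le> (norm u * norm v) * (c i j * m)"
      using assms(2)[of i j] by (simp only: norm_scaleR) (intro mult_mono, auto)
  qed
  also have "\<dots> = (\<Sum>i\<in>Basis. \<Sum>j\<in>Basis. c i j) * m * norm u * norm v"
    by (simp add: sum_distrib_left sum_distrib_right mult_ac)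
  finally show ?thesis .
qed

lemma taylor_on_cball:
  assumes K: "cball x0 r \<subseteq> U"
  shows "\<exists>C\<ge>0. \<forall>x\<in>cball x0 r. \<forall>y\<in>cball x0 r. \<forall>u v h.
    norm (B x u v) \<le> C * norm u * norm v \<and>
    norm (Dfield B x h u v) \<le> C * norm h * norm u * norm v \<and>
    norm (B y u v - B x u v) \<le> C * norm (y - x) * norm u * norm v \<and>
    norm (B y u v - B x u v - Dfield B x (y - x) u v) \<le> C * (norm (y - x))\<^sup>2 * norm u * norm v"
proof -
  let ?K = "cball x0 r"
  have "\<forall>i j. \<exists>C\<ge>0. \<forall>x\<in>?K. norm (B x i j) \<le> C \<and> (\<forall>h. norm (Dfield B x h i j) \<le> C * norm h)
    \<and> (\<forall>y\<in>?K. norm (B y i j - B x i j) \<le> C * norm (y - x)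
         \<and> norm (B y i j - B x i j - Dfield B x (y - x) i j) \<le> C * (norm (y - x))\<^sup>2)"
    unfolding Dfield_def using smooth_taylor_on_cball[OF smooth open_U K] by blast
  then obtain c where c: "\<And>i j. c i j \<ge> 0"
    "\<And>i j. \<forall>x\<in>?K. norm (B x i j) \<le> c i j \<and> (\<forall>h. norm (Dfield B x h i j) \<le> c i j * norm h)
    \<and> (\<forall>y\<in>?K. norm (B y i j - B x i j) \<le> c i j * norm (y - x)
         \<and> norm (B y i j - B x i j - Dfield B x (y - x) i j) \<le> c i j * (norm (y - x))\<^sup>2)"
    by metis
  show ?thesis
  proof (intro exI[of _ "\<Sum>i\<in>Basis. \<Sum>j\<in>Basis. c i j"] conjI ballI allI)
    show "0 \<le> (\<Sum>i\<in>Basis. \<Sum>j\<in>Basis. c i j)" by (intro sum_nonneg c)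
    fix x y u v h assume x: "x \<in> ?K" and y: "y \<in> ?K"
    have xU: "x \<in> U" and yU: "y \<in> U" using x y K by auto
    note e = expand[OF xU, of u v] expand[OF yU, of u v]
      bilin_field.expand[OF bilin_field_Dfield xU, of _ u v]
    show "norm (B x u v) \<le> (\<Sum>i\<in>Basis. \<Sum>j\<in>Basis. c i j) * norm u * norm v"
      using norm_bilinear_le[of "B x" u v c 1] e(1) c x by simp
    show "norm (Dfield B x h u v) \<le> (\<Sum>i\<in>Basis. \<Sum>j\<in>Basis. c i j) * norm h * norm u * norm v"
      using c x by (intro norm_bilinear_le e(3)) auto
    show "norm (B y u v - B x u v) \<le> (\<Sum>i\<in>Basis. \<Sum>j\<in>Basis. c i j) * norm (y - x) * norm u * norm v"
    proof (rule norm_bilinear_le[where \<beta>="\<lambda>u v. B y u v - B x u v"])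
      show "B y u v - B x u v = (\<Sum>i\<in>Basis. \<Sum>j\<in>Basis. ((u \<bullet> i) * (v \<bullet> j)) *\<^sub>R (B y i j - B x i j))"
        unfolding e(1,2) by (simp add: sum_subtractf scaleR_diff_right)
    qed (use c x y in auto)
    show "norm (B y u v - B x u v - Dfield B x (y - x) u v) \<le> (\<Sum>i\<in>Basis. \<Sum>j\<in>Basis. c i j) * (norm (y - x))\<^sup>2 * norm u * norm v"
    proof (rule norm_bilinear_le[where \<beta>="\<lambda>u v. B y u v - B x u v - Dfield B x (y - x) u v"])
      show "B y u v - B x u v - Dfield B x (y - x) u v = (\<Sum>i\<in>Basis. \<Sum>j\<in>Basis. ((u \<bullet> i) * (v \<bullet> j)) *\<^sub>R (B y i j - B x i j - Dfield B x (y - x) i j))"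
        unfolding e(1,2) e(3)[of "y - x"] by (simp add: sum_subtractf scaleR_diff_right)
    qed (use c x y in auto)
  qed
qed

end

section \<open>The second-order remainder of the Lagrangian\<close>

context riem_pot
begin

definition Lag :: "'e \<Rightarrow> 'e \<Rightarrow> real" where "Lag x a = G x a a / 2 + V x"

text \<open>
  The accelerations \<open>b\<close> of competitors are not bounded pointwise, only in the mean. The term that is
  quadratic in \<open>b - a\<close> is therefore kept exactly, and apart from it \<open>j\<close> may only enter linearly, with the
  small factor \<open>y - x\<close>. In the application \<open>j\<close> is the second derivative of \<open>y - x\<close>.
\<close>

lemma remainder_estimate:
  assumes K: "cball x0 r \<subseteq> U" and MN: "M \<ge> 0" "N \<ge> 0" "r \<ge> 0"
  obtains C where "C > 0"
    "\<And>x y v u a b j. \<lbrakk>x \<in> cball x0 r; y \<in> cball x0 r; norm v \<le> M; norm a \<le> M; norm (u - v) \<le> N;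
       j = (b - \<Gamma> y u u) - (a - \<Gamma> x v v)\<rbrakk> \<Longrightarrow>
     \<bar>Lag y b - Lag x a - ell x v a (y - x) (u - v) j - G y (b - a) (b - a) / 2\<bar>
        \<le> C * ((norm (y - x))\<^sup>2 + (norm (u - v))\<^sup>2 + norm (y - x) * norm j) \<and>
     norm (b - a - j) \<le> C * (norm (y - x) + norm (u - v)) \<and>
     \<bar>G y (b - a) (b - a)\<bar> \<le> C * (norm (b - a))\<^sup>2"
proof -
  let ?K = "cball x0 r"
  obtain C1 where C1: "C1 \<ge> 0" "\<forall>x\<in>?K. \<forall>y\<in>?K. \<forall>u v h.
    norm (G x u v) \<le> C1 * norm u * norm v \<and>
    norm (Dfield G x h u v) \<le> C1 * norm h * norm u * norm v \<and>
    norm (G y u v - G x u v) \<le> C1 * norm (y - x) * norm u * norm v \<and>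
    norm (G y u v - G x u v - Dfield G x (y - x) u v) \<le> C1 * (norm (y - x))\<^sup>2 * norm u * norm v"
    using taylor_on_cball[OF K] by blast
  obtain C2 where C2: "C2 \<ge> 0" "\<forall>x\<in>?K. \<forall>y\<in>?K. \<forall>u v h.
    norm (\<Gamma> x u v) \<le> C2 * norm u * norm v \<and>
    norm (Dfield \<Gamma> x h u v) \<le> C2 * norm h * norm u * norm v \<and>
    norm (\<Gamma> y u v - \<Gamma> x u v) \<le> C2 * norm (y - x) * norm u * norm v \<and>
    norm (\<Gamma> y u v - \<Gamma> x u v - Dfield \<Gamma> x (y - x) u v) \<le> C2 * (norm (y - x))\<^sup>2 * norm u * norm v"
    using Chr.taylor_on_cball[OF K] by blast
  obtain C3 where C3: "C3 \<ge> 0" "\<forall>x\<in>?K. \<forall>y\<in>?K. norm (V y - V x - dV x (y - x)) \<le> C3 * (norm (y - x))\<^sup>2"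
    using smooth_taylor_on_cball[OF smooth_V open_U K] by blast
  \<comment> \<open>Bounds for the Christoffel terms \<open>P = \<Gamma> y u u - \<Gamma> x v v\<close>: \<open>F\<close> for their linear part \<open>P1\<close>, \<open>E\<close>
    for the remainder \<open>P - P1\<close>, and \<open>H\<close> for \<open>P\<close> itself, given that \<open>y - x\<close> has norm at most \<open>2 r\<close> and
    \<open>u - v\<close> at most \<open>N\<close>.\<close>
  define E where "E = C2 * (M\<^sup>2 + M + 1)"
  define F where "F = C2 * (M\<^sup>2 + 2 * M)"
  define H where "H = F + E * (2 * r + N)"
  define C where "C = 1 + H + C1 + C1 * M\<^sup>2 + C3 + C1 * M + C1 * M * E + 2 * C1 * M * H"
  have nn: "E \<ge> 0" "F \<ge> 0" "H \<ge> 0" using C2(1) MN by (auto simp: E_def F_def H_def)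
  have nn2: "C1 * M \<ge> 0" "C1 * M\<^sup>2 \<ge> 0" "C1 * M * E \<ge> 0" "C1 * M * H \<ge> 0" using nn C1(1) MN by auto
  have Cpos: "C > 0" unfolding C_def using nn nn2 C1(1) C3(1) by linarith
  have key: "\<bar>Lag y b - Lag x a - ell x v a (y - x) (u - v) j - G y (b - a) (b - a) / 2\<bar>
        \<le> C * ((norm (y - x))\<^sup>2 + (norm (u - v))\<^sup>2 + norm (y - x) * norm j) \<and>
     norm (b - a - j) \<le> C * (norm (y - x) + norm (u - v)) \<and>
     \<bar>G y (b - a) (b - a)\<bar> \<le> C * (norm (b - a))\<^sup>2"
    if x: "x \<in> ?K" and y: "y \<in> ?K" and v: "norm v \<le> M" and a: "norm a \<le> M"
      and k: "norm (u - v) \<le> N" and j: "j = (b - \<Gamma> y u u) - (a - \<Gamma> x v v)" for x y v u a b j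
  proof -
    have xU: "x \<in> U" and yU: "y \<in> U" using x y K by auto
    define h where "h = y - x"
    define k where "k = u - v"
    define P where "P = \<Gamma> y u u - \<Gamma> x v v"
    define P1 where "P1 = Dfield \<Gamma> x h v v + 2 *\<^sub>R \<Gamma> x v k"
    have u: "u = v + k" by (simp add: k_def)
    have d: "b - a = j + P" by (simp add: j P_def)
    have nk: "norm k \<le> N" using k by (simp add: k_def)
    have nh: "norm h \<le> 2 * r"
    proof -
      have "dist y x \<le> dist y x0 + dist x0 x" by (rule dist_triangle)
      then show ?thesis using x y by (simp add: h_def dist_norm norm_minus_commute[of y x0])
    qed
    let ?q = "(norm h)\<^sup>2 + (norm k)\<^sup>2"
    have hk: "2 * (norm h * norm k) \<le> ?q" using sum_squares_bound[of "norm h" "norm k"] by simp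
    have hk': "norm h * norm k \<le> ?q" using hk mult_nonneg_nonneg[OF norm_ge_zero norm_ge_zero, of h k] by linarith
    have vv: "norm v * norm v \<le> M\<^sup>2" unfolding power2_eq_square using v MN by (intro mult_mono) auto
    have aa: "norm a * norm a \<le> M\<^sup>2" unfolding power2_eq_square using a MN by (intro mult_mono) auto
    have tri: "norm (p + 2 *\<^sub>R q + s) \<le> norm p + 2 * norm q + norm s" for p q s :: 'e
      using norm_triangle_ineq[of "p + 2 *\<^sub>R q" s] norm_triangle_ineq[of p "2 *\<^sub>R q"] by simp
    have PP1: "norm (P - P1) \<le> E * ?q"
    proof -
      have eq: "P - P1 = (\<Gamma> y v v - \<Gamma> x v v - Dfield \<Gamma> x h v v) + 2 *\<^sub>R (\<Gamma> y v k - \<Gamma> x v k) + \<Gamma> y k k"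
        unfolding P_def P1_def u by (simp add: Chr.bil_simps[OF yU] Chr_sym[OF yU, of k v] scaleR_2 algebra_simps)
      have "norm (P - P1) \<le> norm (\<Gamma> y v v - \<Gamma> x v v - Dfield \<Gamma> x h v v) + 2 * norm (\<Gamma> y v k - \<Gamma> x v k) + norm (\<Gamma> y k k)"
        unfolding eq by (rule tri)
      also have "\<dots> \<le> C2 * (norm h)\<^sup>2 * M\<^sup>2 + 2 * (C2 * norm h * M * norm k) + C2 * (norm k)\<^sup>2"
      proof (intro add_mono)
        have "norm (\<Gamma> y v v - \<Gamma> x v v - Dfield \<Gamma> x h v v) \<le> C2 * (norm h)\<^sup>2 * norm v * norm v"
          using C2(2) x y unfolding h_def by blast
        also have "\<dots> = C2 * (norm h)\<^sup>2 * (norm v * norm v)" by simp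
        also have "\<dots> \<le> C2 * (norm h)\<^sup>2 * M\<^sup>2" using C2(1) vv by (intro mult_left_mono) auto
        finally show "norm (\<Gamma> y v v - \<Gamma> x v v - Dfield \<Gamma> x h v v) \<le> C2 * (norm h)\<^sup>2 * M\<^sup>2" .
        have "norm (\<Gamma> y v k - \<Gamma> x v k) \<le> C2 * norm h * norm v * norm k"
          using C2(2) x y unfolding h_def by blast
        also have "\<dots> \<le> C2 * norm h * M * norm k"
          using C2(1) v by (intro mult_right_mono mult_left_mono) auto
        finally show "2 * norm (\<Gamma> y v k - \<Gamma> x v k) \<le> 2 * (C2 * norm h * M * norm k)" by simp
        have "norm (\<Gamma> y k k) \<le> C2 * norm k * norm k" using C2(2) y by blast
        then show "norm (\<Gamma> y k k) \<le> C2 * (norm k)\<^sup>2" by (simp add: power2_eq_square)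
      qed
      also have "\<dots> = C2 * M\<^sup>2 * (norm h)\<^sup>2 + C2 * M * (2 * (norm h * norm k)) + C2 * (norm k)\<^sup>2" by (simp add: algebra_simps)
      also have "\<dots> \<le> C2 * M\<^sup>2 * ?q + C2 * M * ?q + C2 * ?q"
        using C2(1) MN hk by (intro add_mono mult_left_mono) auto
      also have "\<dots> = E * ?q" by (simp add: E_def algebra_simps)
      finally show ?thesis .
    qed
    have P1: "norm P1 \<le> F * (norm h + norm k)"
    proof -
      have "norm P1 \<le> norm (Dfield \<Gamma> x h v v) + 2 * norm (\<Gamma> x v k)"
        unfolding P1_def by (rule norm_triangle_le) simp
      also have "\<dots> \<le> C2 * norm h * M\<^sup>2 + 2 * (C2 * M * norm k)"
      proof (intro add_mono)
        have "norm (Dfield \<Gamma> x h v v) \<le> C2 * norm h * norm v * norm v" using C2(2) x by blast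
        also have "\<dots> = C2 * norm h * (norm v * norm v)" by simp
        also have "\<dots> \<le> C2 * norm h * M\<^sup>2" using C2(1) vv by (intro mult_left_mono) auto
        finally show "norm (Dfield \<Gamma> x h v v) \<le> C2 * norm h * M\<^sup>2" .
        have "norm (\<Gamma> x v k) \<le> C2 * norm v * norm k" using C2(2) x by blast
        also have "\<dots> \<le> C2 * M * norm k" using C2(1) v by (intro mult_right_mono mult_left_mono) auto
        finally show "2 * norm (\<Gamma> x v k) \<le> 2 * (C2 * M * norm k)" by simp
      qed
      also have "\<dots> = (C2 * M\<^sup>2) * norm h + (2 * C2 * M) * norm k" by (simp add: algebra_simps)
      also have "\<dots> \<le> F * norm h + F * norm k"
        unfolding F_def using C2(1) MN by (intro add_mono mult_right_mono) (auto simp: algebra_simps)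
      finally show ?thesis by (simp add: algebra_simps)
    qed
    have P: "norm P \<le> H * (norm h + norm k)"
    proof -
      have "norm P \<le> norm P1 + norm (P - P1)" by (metis norm_triangle_sub add.commute)
      also have "\<dots> \<le> F * (norm h + norm k) + E * ?q" using P1 PP1 by simp
      also have "?q \<le> (2 * r + N) * (norm h + norm k)"
      proof -
        have "(norm h)\<^sup>2 \<le> (2 * r + N) * norm h" "(norm k)\<^sup>2 \<le> (2 * r + N) * norm k"
          unfolding power2_eq_square using nh nk MN by (intro mult_right_mono; simp)+
        then show ?thesis by (simp add: algebra_simps)
      qed
      then have "F * (norm h + norm k) + E * ?q \<le> F * (norm h + norm k) + E * ((2 * r + N) * (norm h + norm k))"
        using nn by (intro add_left_mono mult_left_mono) auto
      also have "\<dots> = H * (norm h + norm k)" by (simp add: H_def algebra_simps)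
      finally show ?thesis by simp
    qed
    have c2: "norm (b - a - j) \<le> C * (norm (y - x) + norm (u - v))"
    proof -
      have "norm (b - a - j) = norm P" by (simp add: d)
      also have "\<dots> \<le> C * (norm h + norm k)"
        by (rule order_trans[OF P]) (intro mult_right_mono, use nn nn2 C1(1) C3(1) in \<open>auto simp: C_def\<close>)
      finally show ?thesis by (simp add: h_def k_def)
    qed
    have c3: "\<bar>G y (b - a) (b - a)\<bar> \<le> C * (norm (b - a))\<^sup>2"
    proof -
      have "\<bar>G y (b - a) (b - a)\<bar> \<le> C1 * norm (b - a) * norm (b - a)" using C1(2) y by fastforce
      also have "\<dots> = C1 * (norm (b - a))\<^sup>2" by (simp add: power2_eq_square)
      also have "\<dots> \<le> C * (norm (b - a))\<^sup>2"
        by (intro mult_right_mono) (use nn nn2 C1(1) C3(1) in \<open>auto simp: C_def\<close>)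
      finally show ?thesis .
    qed
    have b: "b = a + (j + P)" using d by (simp add: algebra_simps)
    have aux2: "p + s \<le> 2 * (p + q)" if "s \<le> p + q" "0 \<le> p" "0 \<le> q" for p q s :: real
      using that by simp
    have abs5: "\<bar>p / 2 + q + s + t + w\<bar> \<le> \<bar>p\<bar> / 2 + \<bar>q\<bar> + \<bar>s\<bar> + \<bar>t\<bar> + \<bar>w\<bar>" for p q s t w :: real
      by simp
    have eq: "Lag y b - Lag x a - ell x v a (y - x) (u - v) j - G y (b - a) (b - a) / 2
      = (G y a a - G x a a - Dfield G x h a a) / 2 + (V y - V x - dV x h)
        + (G y a j - G x a j) + (G y a P - G x a P) + G x a (P - P1)"
    proof -
      have l: "ell x v a (y - x) (u - v) j = G x a j + G x a P1 + Dfield G x h a a / 2 + dV x h"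
        unfolding ell_def P1_def h_def[symmetric] k_def[symmetric] by (simp add: add.assoc bil_simps[OF xU])
      have g: "G y b b = G y a a + 2 * G y a j + 2 * G y a P + G y (b - a) (b - a)"
        unfolding d unfolding b using sym[OF yU, of a j] sym[OF yU, of a P] by (simp add: bil_simps[OF yU])
      have p: "G x a (P - P1) = G x a P - G x a P1" by (simp add: bil_simps[OF xU])
      show ?thesis unfolding Lag_def l g p by (simp add: field_simps)
    qed
    have "\<bar>Lag y b - Lag x a - ell x v a (y - x) (u - v) j - G y (b - a) (b - a) / 2\<bar>
       \<le> \<bar>G y a a - G x a a - Dfield G x h a a\<bar> / 2 + \<bar>V y - V x - dV x h\<bar>
        + \<bar>G y a j - G x a j\<bar> + \<bar>G y a P - G x a P\<bar> + \<bar>G x a (P - P1)\<bar>" unfolding eq by (rule abs5)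
    also have "\<dots> \<le> C1 * M\<^sup>2 * ?q + C3 * ?q + C1 * M * (norm h * norm j) + 2 * C1 * M * H * ?q + C1 * M * E * ?q"
    proof (intro add_mono)
      have q: "(norm h)\<^sup>2 \<le> ?q" by simp
      have "norm (G y a a - G x a a - Dfield G x h a a) \<le> C1 * (norm h)\<^sup>2 * norm a * norm a"
        using C1(2) x y unfolding h_def by blast
      also have "\<dots> = C1 * (norm h)\<^sup>2 * (norm a * norm a)" by simp
      also have "\<dots> \<le> C1 * (norm h)\<^sup>2 * M\<^sup>2" using C1(1) aa by (intro mult_left_mono) auto
      also have "\<dots> = C1 * M\<^sup>2 * (norm h)\<^sup>2" by simp
      also have "\<dots> \<le> C1 * M\<^sup>2 * ?q" using nn2 q by (intro mult_left_mono) auto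
      finally show "\<bar>G y a a - G x a a - Dfield G x h a a\<bar> / 2 \<le> C1 * M\<^sup>2 * ?q"
        by simp
      have "norm (V y - V x - dV x h) \<le> C3 * (norm h)\<^sup>2" using C3(2) x y unfolding h_def by blast
      also have "\<dots> \<le> C3 * ?q" using C3(1) q by (intro mult_left_mono) auto
      finally show "\<bar>V y - V x - dV x h\<bar> \<le> C3 * ?q" by simp
      have Gd: "\<bar>G y a z - G x a z\<bar> \<le> C1 * M * (norm h * norm z)" for z
      proof -
        have "norm (G y a z - G x a z) \<le> C1 * norm h * norm a * norm z" using C1(2) x y unfolding h_def by blast
        also have "\<dots> \<le> C1 * norm h * M * norm z" using C1(1) a by (intro mult_right_mono mult_left_mono) auto
        finally show ?thesis by (simp add: mult_ac)
      qed
      show "\<bar>G y a j - G x a j\<bar> \<le> C1 * M * (norm h * norm j)" by (rule Gd)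
      have "norm h * norm P \<le> norm h * (H * (norm h + norm k))" using P by (intro mult_left_mono) auto
      also have "\<dots> = H * ((norm h)\<^sup>2 + norm h * norm k)" by (simp add: power2_eq_square algebra_simps)
      also have "\<dots> \<le> H * (2 * ?q)" using nn by (intro mult_left_mono aux2[OF hk']) auto
      finally have "C1 * M * (norm h * norm P) \<le> C1 * M * (H * (2 * ?q))" using nn2 by (intro mult_left_mono) auto
      then show "\<bar>G y a P - G x a P\<bar> \<le> 2 * C1 * M * H * ?q" using Gd[of P] by (simp add: algebra_simps)
      have "norm (G x a (P - P1)) \<le> C1 * norm a * norm (P - P1)" using C1(2) x by blast
      also have "\<dots> \<le> C1 * M * (E * ?q)" using C1(1) MN a PP1 by (intro mult_mono) auto
      finally show "\<bar>G x a (P - P1)\<bar> \<le> C1 * M * E * ?q" by (simp add: mult_ac)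
    qed
    also have "\<dots> = (C1 * M\<^sup>2 + C3 + 2 * C1 * M * H + C1 * M * E) * ?q + C1 * M * (norm h * norm j)"
      by (simp add: algebra_simps)
    also have "\<dots> \<le> C * ?q + C * (norm h * norm j)"
      by (intro add_mono mult_right_mono) (use nn nn2 C1(1) C3(1) in \<open>auto simp: C_def\<close>)
    also have "\<dots> = C * ((norm h)\<^sup>2 + (norm k)\<^sup>2 + norm h * norm j)"
      by (simp only: distrib_left)
    finally have c1: "\<bar>Lag y b - Lag x a - ell x v a (y - x) (u - v) j - G y (b - a) (b - a) / 2\<bar>
        \<le> C * ((norm (y - x))\<^sup>2 + (norm (u - v))\<^sup>2 + norm (y - x) * norm j)"
      unfolding h_def k_def .
    show ?thesis using c1 c2 c3 by (intro conjI)
  qed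
  show ?thesis by (rule that[OF Cpos key])
qed

text \<open>
  Coercivity of the metric makes the quadratic term control the square of \<open>j\<close>, and the mixed term
  \<open>\<bar>y - x\<bar> \<bar>j\<bar>\<close> is absorbed by it.
\<close>

lemma lagrangian_lower_bound:
  assumes K: "cball x0 r \<subseteq> U" and MN: "M \<ge> 0" "N \<ge> 0" "r \<ge> 0"
  obtains c C where "c > 0" "C > 0"
    "\<And>x y v u a b j. \<lbrakk>x \<in> cball x0 r; y \<in> cball x0 r; norm v \<le> M; norm a \<le> M; norm (u - v) \<le> N;
       j = (b - \<Gamma> y u u) - (a - \<Gamma> x v v)\<rbrakk> \<Longrightarrow>
     c * (norm j)\<^sup>2 - C * ((norm (y - x))\<^sup>2 + (norm (u - v))\<^sup>2)
       \<le> Lag y b - Lag x a - ell x v a (y - x) (u - v) j"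
proof -
  obtain C where C: "C > 0"
    "\<And>x y v u a b j. \<lbrakk>x \<in> cball x0 r; y \<in> cball x0 r; norm v \<le> M; norm a \<le> M; norm (u - v) \<le> N;
       j = (b - \<Gamma> y u u) - (a - \<Gamma> x v v)\<rbrakk> \<Longrightarrow>
     \<bar>Lag y b - Lag x a - ell x v a (y - x) (u - v) j - G y (b - a) (b - a) / 2\<bar>
        \<le> C * ((norm (y - x))\<^sup>2 + (norm (u - v))\<^sup>2 + norm (y - x) * norm j) \<and>
     norm (b - a - j) \<le> C * (norm (y - x) + norm (u - v)) \<and>
     \<bar>G y (b - a) (b - a)\<bar> \<le> C * (norm (b - a))\<^sup>2"
    using remainder_estimate[OF K MN] by blast
  obtain l where l: "l > 0" "\<And>x u. x \<in> cball x0 r \<Longrightarrow> l * (norm u)\<^sup>2 \<le> G x u u"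
    using coercive[OF compact_cball K] by blast
  define D where "D = C + l * C\<^sup>2 + 2 * C\<^sup>2 / l"
  have l8: "l / 8 > 0" and Dpos: "D > 0" using l C by (auto simp: D_def intro!: add_pos_pos)
  have key: "l / 8 * (norm j)\<^sup>2 - D * ((norm (y - x))\<^sup>2 + (norm (u - v))\<^sup>2)
       \<le> Lag y b - Lag x a - ell x v a (y - x) (u - v) j"
    if *: "x \<in> cball x0 r" "y \<in> cball x0 r" "norm v \<le> M" "norm a \<le> M" "norm (u - v) \<le> N"
       "j = (b - \<Gamma> y u u) - (a - \<Gamma> x v v)" for x y v u a b j
  proof -
    let ?n = "norm (y - x)" and ?k = "norm (u - v)" and ?j = "norm j"
    have 1: "Lag y b - Lag x a - ell x v a (y - x) (u - v) j \<ge> G y (b - a) (b - a) / 2 - C * (?n\<^sup>2 + ?k\<^sup>2 + ?n * ?j)"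
      and 2: "norm (b - a - j) \<le> C * (?n + ?k)" using C(2)[OF *] by auto
    have 3: "l * (norm (b - a))\<^sup>2 \<le> G y (b - a) (b - a)" using l(2)[OF *(2)] .
    have "?j \<le> norm (b - a) + norm (b - a - j)" by (metis norm_triangle_sub norm_minus_commute)
    then have "?j\<^sup>2 \<le> (norm (b - a) + C * (?n + ?k))\<^sup>2" using 2 by (intro power_mono) auto
    also have "\<dots> \<le> 2 * (norm (b - a))\<^sup>2 + 2 * (C * (?n + ?k))\<^sup>2"
      using sum_squares_bound[of "norm (b - a)" "C * (?n + ?k)"] by (simp add: power2_sum)
    also have "(C * (?n + ?k))\<^sup>2 \<le> C\<^sup>2 * (2 * (?n\<^sup>2 + ?k\<^sup>2))"
      unfolding power_mult_distrib using sum_squares_bound[of ?n ?k]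
      by (intro mult_left_mono) (auto simp: power2_sum)
    finally have 4: "?j\<^sup>2 / 2 - 2 * C\<^sup>2 * (?n\<^sup>2 + ?k\<^sup>2) \<le> (norm (b - a))\<^sup>2" by (simp add: algebra_simps)
    have "l * (?j\<^sup>2 / 2 - 2 * C\<^sup>2 * (?n\<^sup>2 + ?k\<^sup>2)) \<le> G y (b - a) (b - a)"
      using order_trans[OF mult_left_mono[OF 4] 3] l(1) by simp
    then have 5: "l / 4 * ?j\<^sup>2 - l * C\<^sup>2 * (?n\<^sup>2 + ?k\<^sup>2) \<le> G y (b - a) (b - a) / 2" by (simp add: algebra_simps)
    have 6: "C * (?n * ?j) \<le> l / 8 * ?j\<^sup>2 + 2 * C\<^sup>2 / l * (?n\<^sup>2 + ?k\<^sup>2)"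
    proof -
      \<comment> \<open>Young's inequality, with the weight that leaves half of the coefficient \<open>l / 4\<close> of \<open>?j\<^sup>2\<close> in fact 5.\<close>
      have "0 \<le> (l * ?j - 4 * C * ?n)\<^sup>2" by simp
      then have "8 * l * C * (?n * ?j) \<le> l\<^sup>2 * ?j\<^sup>2 + 16 * C\<^sup>2 * ?n\<^sup>2" by (simp add: power2_diff power_mult_distrib algebra_simps)
      also have "\<dots> \<le> l\<^sup>2 * ?j\<^sup>2 + 16 * C\<^sup>2 * (?n\<^sup>2 + ?k\<^sup>2)" by (intro add_left_mono mult_left_mono) auto
      also have "\<dots> = 8 * l * (l / 8 * ?j\<^sup>2 + 2 * C\<^sup>2 / l * (?n\<^sup>2 + ?k\<^sup>2))"
        using l(1) by (simp add: field_simps power2_eq_square)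
      finally have "(8 * l) * (C * (?n * ?j)) \<le> (8 * l) * (l / 8 * ?j\<^sup>2 + 2 * C\<^sup>2 / l * (?n\<^sup>2 + ?k\<^sup>2))" by simp
      then show ?thesis using l(1) by (simp only: mult_le_cancel_left_pos[of "8 * l"])
    qed
    have "D * (?n\<^sup>2 + ?k\<^sup>2) = C * (?n\<^sup>2 + ?k\<^sup>2) + l * C\<^sup>2 * (?n\<^sup>2 + ?k\<^sup>2) + 2 * C\<^sup>2 / l * (?n\<^sup>2 + ?k\<^sup>2)"
      by (simp add: D_def algebra_simps)
    moreover have "C * (?n\<^sup>2 + ?k\<^sup>2 + ?n * ?j) = C * (?n\<^sup>2 + ?k\<^sup>2) + C * (?n * ?j)" by (simp add: algebra_simps)
    ultimately show ?thesis using 1 5 6 by linarith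
  qed
  show ?thesis by (rule that[OF l8 Dpos key])
qed

lemma lagrangian_upper_bound:
  assumes K: "cball x0 r \<subseteq> U" and MN: "M \<ge> 0" "N \<ge> 0" "r \<ge> 0"
  obtains C where "C > 0"
    "\<And>x y v u a b j. \<lbrakk>x \<in> cball x0 r; y \<in> cball x0 r; norm v \<le> M; norm a \<le> M; norm (u - v) \<le> N;
       j = (b - \<Gamma> y u u) - (a - \<Gamma> x v v)\<rbrakk> \<Longrightarrow>
     Lag y b - Lag x a - ell x v a (y - x) (u - v) j
       \<le> C * ((norm (y - x))\<^sup>2 + (norm (u - v))\<^sup>2 + (norm j)\<^sup>2)"
proof -
  obtain C where C: "C > 0"
    "\<And>x y v u a b j. \<lbrakk>x \<in> cball x0 r; y \<in> cball x0 r; norm v \<le> M; norm a \<le> M; norm (u - v) \<le> N;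
       j = (b - \<Gamma> y u u) - (a - \<Gamma> x v v)\<rbrakk> \<Longrightarrow>
     \<bar>Lag y b - Lag x a - ell x v a (y - x) (u - v) j - G y (b - a) (b - a) / 2\<bar>
        \<le> C * ((norm (y - x))\<^sup>2 + (norm (u - v))\<^sup>2 + norm (y - x) * norm j) \<and>
     norm (b - a - j) \<le> C * (norm (y - x) + norm (u - v)) \<and>
     \<bar>G y (b - a) (b - a)\<bar> \<le> C * (norm (b - a))\<^sup>2"
    using remainder_estimate[OF K MN] by blast
  define D where "D = 2 * C + C * (1 + 2 * C\<^sup>2)"
  have Dpos: "D > 0" using C(1) by (auto simp: D_def intro!: add_pos_pos mult_pos_pos)
  have key: "Lag y b - Lag x a - ell x v a (y - x) (u - v) j
       \<le> D * ((norm (y - x))\<^sup>2 + (norm (u - v))\<^sup>2 + (norm j)\<^sup>2)"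
    if *: "x \<in> cball x0 r" "y \<in> cball x0 r" "norm v \<le> M" "norm a \<le> M" "norm (u - v) \<le> N"
       "j = (b - \<Gamma> y u u) - (a - \<Gamma> x v v)" for x y v u a b j
  proof -
    let ?n = "norm (y - x)" and ?k = "norm (u - v)" and ?j = "norm j"
    let ?q = "?n\<^sup>2 + ?k\<^sup>2 + ?j\<^sup>2"
    have 1: "Lag y b - Lag x a - ell x v a (y - x) (u - v) j \<le> G y (b - a) (b - a) / 2 + C * (?n\<^sup>2 + ?k\<^sup>2 + ?n * ?j)"
      and 2: "norm (b - a - j) \<le> C * (?n + ?k)" and 3: "G y (b - a) (b - a) \<le> C * (norm (b - a))\<^sup>2"
      using C(2)[OF *] by auto
    have "norm (b - a) \<le> ?j + norm (b - a - j)" by (metis norm_triangle_sub add.commute)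
    then have "(norm (b - a))\<^sup>2 \<le> (?j + C * (?n + ?k))\<^sup>2" using 2 by (intro power_mono) auto
    also have "\<dots> \<le> 2 * ?j\<^sup>2 + 2 * (C * (?n + ?k))\<^sup>2"
      using sum_squares_bound[of ?j "C * (?n + ?k)"] by (simp add: power2_sum)
    also have "(C * (?n + ?k))\<^sup>2 \<le> C\<^sup>2 * (2 * (?n\<^sup>2 + ?k\<^sup>2))"
      unfolding power_mult_distrib using sum_squares_bound[of ?n ?k]
      by (intro mult_left_mono) (auto simp: power2_sum)
    also have "\<dots> \<le> C\<^sup>2 * (2 * ?q)" by (intro mult_left_mono) auto
    finally have 4: "(norm (b - a))\<^sup>2 \<le> 2 * (1 + 2 * C\<^sup>2) * ?q"
      by (simp add: algebra_simps) (use zero_le_power2[of ?n] zero_le_power2[of ?k] in linarith)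
    have 5: "G y (b - a) (b - a) / 2 \<le> C * (1 + 2 * C\<^sup>2) * ?q"
      using order_trans[OF 3 mult_left_mono[OF 4]] C(1) by (simp add: algebra_simps)
    have aux: "p + q + s \<le> 2 * (p + q + t)" if "s \<le> p + t" "0 \<le> p" "0 \<le> q" "0 \<le> t" for p q s t :: real
      using that by simp
    have "?n * ?j \<le> ?n\<^sup>2 + ?j\<^sup>2"
      using sum_squares_bound[of ?n ?j] mult_nonneg_nonneg[OF norm_ge_zero norm_ge_zero, of "y - x" j] by linarith
    then have "?n\<^sup>2 + ?k\<^sup>2 + ?n * ?j \<le> 2 * ?q"
      by (rule aux) auto
    from mult_left_mono[OF this, of C] have 6: "C * (?n\<^sup>2 + ?k\<^sup>2 + ?n * ?j) \<le> 2 * C * ?q" using C(1) by simp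
    have "D * ?q = 2 * C * ?q + C * (1 + 2 * C\<^sup>2) * ?q" by (simp add: D_def algebra_simps)
    then show ?thesis using 1 5 6 by linarith
  qed
  show ?thesis by (rule that[OF Dpos key])
qed

end

section \<open>Piecewise continuous functions\<close>

text \<open>
  Splitting an interval at its finitely many exceptional points, one at a time.
\<close>

lemma pieces_induct:
  fixes a b :: real
  assumes S: "finite S" and ab: "a < b"
    and base: "\<And>u v. a \<le> u \<Longrightarrow> u < v \<Longrightarrow> v \<le> b \<Longrightarrow> {u<..<v} \<inter> S = {} \<Longrightarrow> P u v"
    and join: "\<And>u s v. a \<le> u \<Longrightarrow> u < s \<Longrightarrow> s < v \<Longrightarrow> v \<le> b \<Longrightarrow> P u s \<Longrightarrow> P s v \<Longrightarrow> P u v"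
  shows "P a b"
proof -
  have "P u v" if "a \<le> u" "u < v" "v \<le> b" for u v
    using that
  proof (induction "card ({u<..<v} \<inter> S)" arbitrary: u v rule: less_induct)
    case less
    show ?case
    proof (cases "{u<..<v} \<inter> S = {}")
      case True then show ?thesis using base less.prems by blast
    next
      case False
      then obtain s where s: "u < s" "s < v" "s \<in> S" by auto
      have fin: "finite ({u<..<v} \<inter> S)" using S by simp
      have "{u<..<s} \<inter> S \<subset> {u<..<v} \<inter> S" "{s<..<v} \<inter> S \<subset> {u<..<v} \<inter> S" using s by auto
      from this[THEN psubset_card_mono[OF fin]] have "P u s" "P s v"
        using less.hyps[of u s] less.hyps[of s v] less.prems s by auto
      then show ?thesis using join less.prems s by blast
    qed
  qed
  then show ?thesis using ab by simp
qed

text \<open>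
  At the exceptional points themselves nothing is required, as the second derivative of an admissible
  curve has no meaningful value there.
\<close>

definition pw_cont :: "real \<Rightarrow> real \<Rightarrow> (real \<Rightarrow> 'a::euclidean_space) \<Rightarrow> bool"
  where "pw_cont a b f \<longleftrightarrow> (\<exists>S. finite S \<and> (\<forall>u v. a \<le> u \<and> u < v \<and> v \<le> b \<and> {u<..<v} \<inter> S = {} \<longrightarrow>
    (\<exists>g. continuous_on {u..v} g \<and> (\<forall>t\<in>{u<..<v}. f t = g t))))"

lemma pw_contI:
  assumes "finite S" "\<And>u v. a \<le> u \<Longrightarrow> u < v \<Longrightarrow> v \<le> b \<Longrightarrow> {u<..<v} \<inter> S = {} \<Longrightarrow>
    \<exists>g. continuous_on {u..v} g \<and> (\<forall>t\<in>{u<..<v}. f t = g t)"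
  shows "pw_cont a b f"
  unfolding pw_cont_def using assms by (intro exI[of _ S]) auto

lemma pw_cont_combine:
  assumes "pw_cont a b f" "continuous_on {a..b} h" "continuous_on UNIV (\<lambda>p. F (fst p) (snd p))"
  shows "pw_cont a b (\<lambda>t. F (f t) (h t))"
proof -
  obtain S where S: "finite S" "\<And>u v. a \<le> u \<Longrightarrow> u < v \<Longrightarrow> v \<le> b \<Longrightarrow> {u<..<v} \<inter> S = {} \<Longrightarrow>
    \<exists>g. continuous_on {u..v} g \<and> (\<forall>t\<in>{u<..<v}. f t = g t)"
    using assms(1) unfolding pw_cont_def by blast
  show ?thesis
  proof (rule pw_contI[OF S(1)])
    fix u v assume uv: "a \<le> u" "u < v" "v \<le> b" "{u<..<v} \<inter> S = {}"
    obtain g where g: "continuous_on {u..v} g" "\<forall>t\<in>{u<..<v}. f t = g t" using S(2)[OF uv] by blast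
    have h: "continuous_on {u..v} h" using assms(2) uv continuous_on_subset by (metis atLeastatMost_subset_iff)
    have "continuous_on {u..v} (\<lambda>t. (\<lambda>p. F (fst p) (snd p)) (g t, h t))"
      by (rule continuous_on_compose2[OF assms(3)]) (auto intro!: continuous_intros g h)
    then show "\<exists>g. continuous_on {u..v} g \<and> (\<forall>t\<in>{u<..<v}. F (f t) (h t) = g t)"
      using g(2) by (intro exI[of _ "\<lambda>t. F (g t) (h t)"]) auto
  qed
qed

lemma pw_cont_compose:
  assumes "pw_cont a b f" "continuous_on UNIV F"
  shows "pw_cont a b (\<lambda>t. F (f t))"
proof -
  have "continuous_on UNIV (\<lambda>p :: 'a \<times> real. F (fst p))"
    by (rule continuous_on_compose2[OF assms(2)]) (auto intro: continuous_intros)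
  then show ?thesis
    by (rule pw_cont_combine[OF assms(1) continuous_on_const, of "\<lambda>p _. F p" "0::real"])
qed

lemma pw_cont_integrable:
  assumes "pw_cont a b f" "a < b" shows "f integrable_on {a..b}"
proof -
  obtain S where S: "finite S" "\<And>u v. a \<le> u \<Longrightarrow> u < v \<Longrightarrow> v \<le> b \<Longrightarrow> {u<..<v} \<inter> S = {} \<Longrightarrow>
    \<exists>g. continuous_on {u..v} g \<and> (\<forall>t\<in>{u<..<v}. f t = g t)"
    using assms(1) unfolding pw_cont_def by blast
  show ?thesis
  proof (rule pieces_induct[OF S(1) assms(2), of "\<lambda>u v. f integrable_on {u..v}"])
    fix u v assume uv: "a \<le> u" "u < v" "v \<le> b" "{u<..<v} \<inter> S = {}"
    obtain g where g: "continuous_on {u..v} g" "\<forall>t\<in>{u<..<v}. f t = g t" using S(2)[OF uv] by blast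
    show "f integrable_on {u..v}"
      by (rule integrable_spike_finite[of "{u, v}" _ _ g])
        (use g in \<open>auto intro: integrable_continuous_real\<close>)
  next
    fix u s v assume "u < s" "s < v" "f integrable_on {u..s}" "f integrable_on {s..v}"
    then show "f integrable_on {u..v}"
      by (intro Henstock_Kurzweil_Integration.integrable_combine[of u s v]) auto
  qed
qed

lemma const_has_integral: "a \<le> b \<Longrightarrow> ((\<lambda>t. c) has_integral (b - a) * c) {a..b}" for a b c :: real
  using has_integral_const_real[of c a b] by simp

lemma square_integral_le:
  fixes f :: "real \<Rightarrow> real"
  assumes ab: "a < b" and f: "f integrable_on {a..b}" and f2: "(\<lambda>t. (f t)\<^sup>2) integrable_on {a..b}"
  shows "(integral {a..b} f)\<^sup>2 \<le> (b - a) * integral {a..b} (\<lambda>t. (f t)\<^sup>2)"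
proof -
  define I where "I = integral {a..b} f"
  define m where "m = I / (b - a)"
  have "((\<lambda>t. (f t)\<^sup>2 - 2 * m * f t + m\<^sup>2) has_integral (integral {a..b} (\<lambda>t. (f t)\<^sup>2) - 2 * m * I + (b - a) * m\<^sup>2)) {a..b}"
    unfolding I_def
    by (intro has_integral_add has_integral_diff has_integral_mult_right integrable_integral f f2 const_has_integral less_imp_le ab)
  moreover have "0 \<le> (f t)\<^sup>2 - 2 * m * f t + m\<^sup>2" for t
    using zero_le_power2[of "f t - m"] by (simp add: power2_diff algebra_simps)
  ultimately have "0 \<le> integral {a..b} (\<lambda>t. (f t)\<^sup>2) - 2 * m * I + (b - a) * m\<^sup>2"
    by (rule has_integral_nonneg)
  moreover have "2 * m * I - (b - a) * m\<^sup>2 = I\<^sup>2 / (b - a)"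
  proof -
    have mI: "(b - a) * m = I" using ab by (simp add: m_def)
    have "(b - a) * m\<^sup>2 = ((b - a) * m) * m" by (simp add: power2_eq_square)
    then have "2 * m * I - (b - a) * m\<^sup>2 = I * m" unfolding mI by simp
    then show ?thesis by (simp add: m_def power2_eq_square)
  qed
  ultimately have "I\<^sup>2 / (b - a) \<le> integral {a..b} (\<lambda>t. (f t)\<^sup>2)" by linarith
  then show ?thesis using ab by (simp add: I_def field_simps)
qed

lemma vderiv_continuous_on:
  "(\<And>t. t \<in> I \<Longrightarrow> (f has_vector_derivative f' t) (at t within I)) \<Longrightarrow> continuous_on I f"
  unfolding continuous_on_eq_continuous_within using has_vector_derivative_continuous by blast

lemma has_vector_derivative_at_interior: "t \<in> {p<..<q} \<Longrightarrow> (f has_vector_derivative D) (at t within {p..q}) \<Longrightarrow> (f has_vector_derivative D) (at t)"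
  for f :: "real \<Rightarrow> 'b::real_normed_vector"
  by (metis at_within_Icc_at greaterThanLessThan_iff)

text \<open>
  \<open>f\<close> is an integral of the continuous function \<open>f'\<close>, hence differentiable also at the exceptional points.
  This is how break points are recognized as harmless.
\<close>

lemma has_vector_derivative_extend:
  fixes f f' :: "real \<Rightarrow> 'a::euclidean_space"
  assumes S: "finite S" and f: "continuous_on {a..b} f" and f': "continuous_on {a..b} f'"
    and d: "\<And>t. t \<in> {a<..<b} - S \<Longrightarrow> (f has_vector_derivative f' t) (at t)" and t: "t \<in> {a..b}"
  shows "(f has_vector_derivative f' t) (at t within {a..b})"
proof -
  have e: "f s = f a + integral {a..s} f'" if s: "s \<in> {a..b}" for s
  proof -
    have "(f' has_integral (f s - f a)) {a..s}"
      by (rule fundamental_theorem_of_calculus_interior_strong[OF S])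
        (use s d f in \<open>auto intro: continuous_on_subset\<close>)
    then show ?thesis by (simp add: integral_unique)
  qed
  have "((\<lambda>s. f a + integral {a..s} f') has_vector_derivative f' t) (at t within {a..b})"
    using integral_has_vector_derivative[OF f' t] by (auto intro!: derivative_eq_intros)
  then show ?thesis
    by (rule has_vector_derivative_transform[OF t e, rotated]) auto
qed

section \<open>Local minimality in a chart\<close>

context riem_pot
begin

text \<open>
  A curve \<open>x\<close> with its velocity \<open>v\<close>, covariant acceleration \<open>a\<close> and covariant jerk \<open>b\<close>; \<open>e\<close> is then the
  left-hand side of the equation of modified cubic polynomials. Writing the fourth-order equation as a
  first-order system makes it possible to speak of solutions before their smoothness is known.
\<close>

definition motion :: "real set \<Rightarrow> (real \<Rightarrow> 'e) \<Rightarrow> (real \<Rightarrow> 'e) \<Rightarrow> (real \<Rightarrow> 'e) \<Rightarrow> (real \<Rightarrow> 'e) \<Rightarrow> (real \<Rightarrow> 'e) \<Rightarrow> bool"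
  where "motion I x v a b e \<longleftrightarrow> (\<forall>t\<in>I. x t \<in> U \<and>
    (x has_vector_derivative v t) (at t within I) \<and>
    (v has_vector_derivative a t - \<Gamma> (x t) (v t) (v t)) (at t within I) \<and>
    (a has_vector_derivative b t - \<Gamma> (x t) (v t) (a t)) (at t within I) \<and>
    (b has_vector_derivative e t - Rm G (x t) (a t) (v t) (v t) - grd (x t) - \<Gamma> (x t) (v t) (b t)) (at t within I))"

lemma motionD:
  assumes "motion I x v a b e" "t \<in> I"
  shows "x t \<in> U" "(x has_vector_derivative v t) (at t within I)"
    "(v has_vector_derivative a t - \<Gamma> (x t) (v t) (v t)) (at t within I)"
    "(a has_vector_derivative b t - \<Gamma> (x t) (v t) (a t)) (at t within I)"
    "(b has_vector_derivative e t - Rm G (x t) (a t) (v t) (v t) - grd (x t) - \<Gamma> (x t) (v t) (b t)) (at t within I)"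
  using assms unfolding motion_def by auto

lemma motion_subset: "motion I x v a b e \<Longrightarrow> I' \<subseteq> I \<Longrightarrow> motion I' x v a b e"
  unfolding motion_def by (meson has_vector_derivative_within_subset subsetD)

lemma motion_continuous:
  assumes "motion I x v a b e"
  shows "continuous_on I x" "continuous_on I v" "continuous_on I a" "continuous_on I b"
  using motionD(2-5)[OF assms, THEN vderiv_continuous_on] by blast+

lemma first_variation_integral:
  assumes pq: "p \<le> q" and m: "motion {p..q} x v a b e" and S: "finite S"
    and h: "continuous_on {p..q} h" "continuous_on {p..q} k"
    and d: "\<And>t. t \<in> {p<..<q} - S \<Longrightarrow> (h has_vector_derivative k t) (at t)"
      "\<And>t. t \<in> {p<..<q} - S \<Longrightarrow> (k has_vector_derivative j t) (at t)"
  shows "((\<lambda>t. ell (x t) (v t) (a t) (h t) (k t) (j t) - G (x t) (e t) (h t)) has_integral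
    (boundary_term (x q) (v q) (a q) (b q) (h q) (k q) - boundary_term (x p) (v p) (a p) (b p) (h p) (k p))) {p..q}"
proof (rule fundamental_theorem_of_calculus_interior_strong[OF S pq])
  note c = motion_continuous[OF m]
  have im: "x ` {p..q} \<subseteq> U" using motionD(1)[OF m] by auto
  show "continuous_on {p..q} (\<lambda>t. boundary_term (x t) (v t) (a t) (b t) (h t) (k t))"
    unfolding boundary_term_def by (intro continuous_intros continuous_on_field Chr.continuous_on_field c h im)
  fix t assume t: "t \<in> {p<..<q} - S"
  then have t': "t \<in> {p..q}" "t \<in> {p<..<q}" by auto
  note D = motionD[OF m t'(1)]
  show "((\<lambda>t. boundary_term (x t) (v t) (a t) (b t) (h t) (k t)) has_vector_derivative ell (x t) (v t) (a t) (h t) (k t) (j t) - G (x t) (e t) (h t)) (at t)"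
    by (rule first_variation[where S=UNIV, simplified, OF D(1) D(2-5)[THEN has_vector_derivative_at_interior[OF t'(2)]] d(1)[OF t] d(2)[OF t]])
qed

text \<open>
  Both functions start at zero, so they are bounded by integrals of \<open>\<bar>j\<bar>\<close>, and the Cauchy-Schwarz
  inequality yields the powers of \<open>b - a\<close>.
\<close>

lemma poincare:
  fixes h k j :: "real \<Rightarrow> 'e"
  assumes ab: "a < b" and S: "finite S" and j: "pw_cont a b j"
    and h: "\<And>t. t \<in> {a..b} \<Longrightarrow> (h has_vector_derivative k t) (at t within {a..b})"
    and k: "continuous_on {a..b} k" and d: "\<And>t. t \<in> {a<..<b} - S \<Longrightarrow> (k has_vector_derivative j t) (at t)"
    and z: "h a = 0" "k a = 0"
  defines "I \<equiv> integral {a..b} (\<lambda>t. (norm (j t))\<^sup>2)"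
  assumes t: "t \<in> {a..b}"
  shows "(norm (k t))\<^sup>2 \<le> (b - a) * I" "(norm (h t))\<^sup>2 \<le> (b - a) ^ 3 * I"
proof -
  define I1 where "I1 = integral {a..b} (\<lambda>t. norm (j t))"
  have nj: "pw_cont a b (\<lambda>t. norm (j t))" "pw_cont a b (\<lambda>t. (norm (j t))\<^sup>2)"
    by (intro pw_cont_compose[OF j] continuous_intros)+
  note int = nj[THEN pw_cont_integrable[OF _ ab]]
  have I1: "I1\<^sup>2 \<le> (b - a) * I" unfolding I1_def I_def by (rule square_integral_le[OF ab int])
  have I1nn: "I1 \<ge> 0" unfolding I1_def by (rule integral_nonneg[OF int(1)]) simp
  have kb: "norm (k t) \<le> I1" if t: "t \<in> {a..b}" for t
  proof -
    have "(j has_integral (k t - k a)) {a..t}"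
      by (rule fundamental_theorem_of_calculus_interior_strong[OF S])
        (use t d k in \<open>auto intro: continuous_on_subset\<close>)
    then have "k t = integral {a..t} j" and ji: "j integrable_on {a..t}" using z by (auto simp: integral_unique)
    then have "norm (k t) \<le> integral {a..t} (\<lambda>t. norm (j t))"
      using integral_norm_bound_integral[OF ji integrable_on_subinterval[OF int(1)]] t by auto
    also have "\<dots> \<le> I1" unfolding I1_def
      by (rule integral_subset_le[OF _ integrable_on_subinterval[OF int(1)] int(1)]) (use t in auto)
    finally show ?thesis .
  qed
  have "(norm (k t))\<^sup>2 \<le> I1\<^sup>2" using kb[OF t] by (intro power_mono) auto
  then show "(norm (k t))\<^sup>2 \<le> (b - a) * I" using I1 by linarith
  have "norm (h t - h a) \<le> I1 * norm (t - a)"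
  proof (rule differentiable_bound[of "{a..b}" h "\<lambda>t d. d *\<^sub>R k t"])
    show "(h has_derivative (\<lambda>d. d *\<^sub>R k t)) (at t within {a..b})" if "t \<in> {a..b}" for t
      using h[OF that] by (simp add: has_vector_derivative_def)
    show "onorm (\<lambda>d. d *\<^sub>R k t) \<le> I1" if "t \<in> {a..b}" for t
    proof (rule onorm_le)
      show "norm (d *\<^sub>R k t) \<le> I1 * norm d" for d
        using mult_right_mono[OF kb[OF that], of "norm d"] by (simp add: mult.commute)
    qed
  qed (use t ab in auto)
  then have "norm (h t) \<le> I1 * (b - a)"
    using z t mult_left_mono[OF _ I1nn, of "t - a" "b - a"] by simp
  then have "(norm (h t))\<^sup>2 \<le> (I1 * (b - a))\<^sup>2" by (intro power_mono) auto
  also have "\<dots> = I1\<^sup>2 * (b - a)\<^sup>2" by (simp add: power_mult_distrib)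
  also have "\<dots> \<le> ((b - a) * I) * (b - a)\<^sup>2" using I1 by (intro mult_right_mono) auto
  finally show "(norm (h t))\<^sup>2 \<le> (b - a) ^ 3 * I" by (simp add: power2_eq_square power3_eq_cube algebra_simps)
qed

text \<open>
  The linear part of the difference of the actions vanishes by \<open>first_variation_integral\<close>, since \<open>x\<close>
  solves the equation and \<open>y - x\<close> and \<open>u - v\<close> vanish at both ends. What is left is bounded below by
  \<open>lagrangian_lower_bound\<close>, whose negative part is dominated by the positive one on short intervals.
  The length \<open>\<rho>\<close> depends only on the ball and the bounds \<open>M\<close> and \<open>N\<close>, so that an interval can be chosen
  before any competitor is known.
\<close>

theorem local_minimality_in_ball:
  assumes K: "cball x0 r \<subseteq> U" and MN: "M \<ge> 0" "N \<ge> 0" "r \<ge> 0"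
  obtains \<rho> where "\<rho> > 0"
    "\<And>p q x v a b y u w S. \<lbrakk>p < q; q - p \<le> \<rho>; motion {p..q} x v a b (\<lambda>_. 0);
      \<And>t. t \<in> {p..q} \<Longrightarrow> x t \<in> cball x0 r \<and> y t \<in> cball x0 r \<and> norm (v t) \<le> M \<and> norm (a t) \<le> M \<and> norm (u t - v t) \<le> N;
      \<And>t. t \<in> {p..q} \<Longrightarrow> (y has_vector_derivative u t) (at t within {p..q});
      continuous_on {p..q} u; finite S; \<And>t. t \<in> {p<..<q} - S \<Longrightarrow> (u has_vector_derivative w t) (at t);
      pw_cont p q w; y p = x p; y q = x q; u p = v p; u q = v q;
      (\<lambda>t. Lag (x t) (a t)) integrable_on {p..q};
      (\<lambda>t. Lag (y t) (w t + \<Gamma> (y t) (u t) (u t))) integrable_on {p..q}\<rbrakk> \<Longrightarrow>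
     integral {p..q} (\<lambda>t. Lag (x t) (a t)) \<le> integral {p..q} (\<lambda>t. Lag (y t) (w t + \<Gamma> (y t) (u t) (u t))) \<and>
     (integral {p..q} (\<lambda>t. Lag (y t) (w t + \<Gamma> (y t) (u t) (u t))) \<le> integral {p..q} (\<lambda>t. Lag (x t) (a t))
       \<longrightarrow> (\<forall>t\<in>{p..q}. y t = x t))"
proof -
  obtain c C where cC: "c > 0" "C > 0"
    "\<And>x y v u a b j. \<lbrakk>x \<in> cball x0 r; y \<in> cball x0 r; norm v \<le> M; norm a \<le> M; norm (u - v) \<le> N;
       j = (b - \<Gamma> y u u) - (a - \<Gamma> x v v)\<rbrakk> \<Longrightarrow>
     c * (norm j)\<^sup>2 - C * ((norm (y - x))\<^sup>2 + (norm (u - v))\<^sup>2)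
       \<le> Lag y b - Lag x a - ell x v a (y - x) (u - v) j"
    using lagrangian_lower_bound[OF K MN] by blast
  \<comment> \<open>With \<open>d = q - p\<close>, the integral of the negative part is at most \<open>2 C d\<^sup>2\<close> times the integral of the square of
    the second derivative; this choice makes it at most half of the positive part.\<close>
  define \<rho> where "\<rho> = min 1 (c / (4 * C))"
  have \<rho>: "\<rho> > 0" using cC by (simp add: \<rho>_def)
  have key: "integral {p..q} (\<lambda>t. Lag (x t) (a t)) \<le> integral {p..q} (\<lambda>t. Lag (y t) (w t + \<Gamma> (y t) (u t) (u t))) \<and>
     (integral {p..q} (\<lambda>t. Lag (y t) (w t + \<Gamma> (y t) (u t) (u t))) \<le> integral {p..q} (\<lambda>t. Lag (x t) (a t))
       \<longrightarrow> (\<forall>t\<in>{p..q}. y t = x t))"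
    if pq: "p < q" "q - p \<le> \<rho>" and m: "motion {p..q} x v a b (\<lambda>_. 0)"
      and B: "\<And>t. t \<in> {p..q} \<Longrightarrow> x t \<in> cball x0 r \<and> y t \<in> cball x0 r \<and> norm (v t) \<le> M \<and> norm (a t) \<le> M \<and> norm (u t - v t) \<le> N"
      and y: "\<And>t. t \<in> {p..q} \<Longrightarrow> (y has_vector_derivative u t) (at t within {p..q})"
      and u: "continuous_on {p..q} u" and S: "finite S" and w: "\<And>t. t \<in> {p<..<q} - S \<Longrightarrow> (u has_vector_derivative w t) (at t)"
      and pw: "pw_cont p q w" and bc: "y p = x p" "y q = x q" "u p = v p" "u q = v q"
      and ix: "(\<lambda>t. Lag (x t) (a t)) integrable_on {p..q}"
      and iy: "(\<lambda>t. Lag (y t) (w t + \<Gamma> (y t) (u t) (u t))) integrable_on {p..q}"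
    for p q x v a b y u w S
  proof -
    note c = motion_continuous[OF m]
    have im: "x ` {p..q} \<subseteq> U" using motionD(1)[OF m] by auto
    define h where "h t = y t - x t" for t
    define k where "k t = u t - v t" for t
    define j where "j t = w t - (a t - \<Gamma> (x t) (v t) (v t))" for t
    define I where "I = integral {p..q} (\<lambda>t. (norm (j t))\<^sup>2)"
    have pj: "pw_cont p q j" unfolding j_def
      by (intro pw_cont_combine[OF pw, where F="\<lambda>x y. x - y"] continuous_intros Chr.continuous_on_field c im)
    have hk: "(h has_vector_derivative k t) (at t within {p..q})" if "t \<in> {p..q}" for t
      unfolding h_def k_def by (intro has_vector_derivative_diff y motionD(2)[OF m] that)
    have hc: "continuous_on {p..q} h" by (rule vderiv_continuous_on[OF hk])
    have kc: "continuous_on {p..q} k" unfolding k_def by (intro continuous_intros u c)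
    have kj: "(k has_vector_derivative j t) (at t)" if "t \<in> {p<..<q} - S" for t
      unfolding k_def j_def
      by (intro has_vector_derivative_diff w that has_vector_derivative_at_interior[OF _ motionD(3)[OF m]]) (use that in auto)
    have hk': "(h has_vector_derivative k t) (at t)" if "t \<in> {p<..<q} - S" for t
      using that by (intro has_vector_derivative_at_interior[OF _ hk]) auto
    have z: "h p = 0" "k p = 0" "h q = 0" "k q = 0" using bc by (auto simp: h_def k_def)
    have Up: "x p \<in> U" "x q \<in> U" using im pq by auto
    have "((\<lambda>t. ell (x t) (v t) (a t) (h t) (k t) (j t) - G (x t) 0 (h t)) has_integral
      (boundary_term (x q) (v q) (a q) (b q) (h q) (k q) - boundary_term (x p) (v p) (a p) (b p) (h p) (k p))) {p..q}"
      by (rule first_variation_integral[OF _ m S hc kc hk' kj]) (use pq in auto)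
    then have "((\<lambda>t. ell (x t) (v t) (a t) (h t) (k t) (j t) - G (x t) 0 (h t)) has_integral 0) {p..q}"
      by (simp add: z boundary_term_def bil_simps[OF Up(1)] bil_simps[OF Up(2)] Chr.bil_simps[OF Up(1)] Chr.bil_simps[OF Up(2)])
    then have ell: "((\<lambda>t. ell (x t) (v t) (a t) (h t) (k t) (j t)) has_integral 0) {p..q}"
    proof (rule has_integral_eq[rotated])
      fix t assume "t \<in> {p..q}"
      then have "x t \<in> U" using im by blast
      then show "ell (x t) (v t) (a t) (h t) (k t) (j t) - G (x t) 0 (h t) = ell (x t) (v t) (a t) (h t) (k t) (j t)"
        by (simp add: bil_simps)
    qed
    have P: "(norm (k t))\<^sup>2 \<le> (q - p) * I" "(norm (h t))\<^sup>2 \<le> (q - p) ^ 3 * I" if "t \<in> {p..q}" for t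
      unfolding I_def by (rule poincare[where j=j and k=k and h=h, OF pq(1) S pj _ kc _ z(1) z(2) that]; use hk kj in blast)+
    have intj: "(\<lambda>t. (norm (j t))\<^sup>2) integrable_on {p..q}"
      by (intro pw_cont_integrable[OF _ pq(1)] pw_cont_compose[OF pj] continuous_intros)
    have Inn: "I \<ge> 0" unfolding I_def by (rule integral_nonneg[OF intj]) simp
    define W where "W = 2 * C * ((q - p) * I)"
    have low: "c * (norm (j t))\<^sup>2 - W \<le> Lag (y t) (w t + \<Gamma> (y t) (u t) (u t)) - Lag (x t) (a t) - ell (x t) (v t) (a t) (h t) (k t) (j t)"
      if t: "t \<in> {p..q}" for t
    proof -
      have "c * (norm (j t))\<^sup>2 - C * ((norm (y t - x t))\<^sup>2 + (norm (u t - v t))\<^sup>2)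
        \<le> Lag (y t) (w t + \<Gamma> (y t) (u t) (u t)) - Lag (x t) (a t) - ell (x t) (v t) (a t) (y t - x t) (u t - v t) (j t)"
        using B[OF t] by (intro cC(3)) (auto simp: j_def)
      moreover have "(norm (h t))\<^sup>2 + (norm (k t))\<^sup>2 \<le> 2 * ((q - p) * I)"
      proof -
        have "(q - p) ^ 3 \<le> (q - p)" using pq power_decreasing[of 1 3 "q - p"] by (simp add: \<rho>_def)
        then have "(q - p) ^ 3 * I \<le> (q - p) * I" using Inn by (rule mult_right_mono)
        then show ?thesis using P[OF t] by linarith
      qed
      then have "C * ((norm (h t))\<^sup>2 + (norm (k t))\<^sup>2) \<le> C * (2 * ((q - p) * I))" using cC(2) by (intro mult_left_mono) auto
      ultimately show ?thesis unfolding W_def h_def k_def by (simp add: algebra_simps)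
    qed
    have H1: "((\<lambda>t. c * (norm (j t))\<^sup>2 - W) has_integral (c * I - (q - p) * W)) {p..q}"
      using pq unfolding I_def
      by (intro has_integral_diff has_integral_mult_right integrable_integral intj const_has_integral) auto
    have H2: "((\<lambda>t. Lag (y t) (w t + \<Gamma> (y t) (u t) (u t)) - Lag (x t) (a t) - ell (x t) (v t) (a t) (h t) (k t) (j t)) has_integral
      (integral {p..q} (\<lambda>t. Lag (y t) (w t + \<Gamma> (y t) (u t) (u t))) - integral {p..q} (\<lambda>t. Lag (x t) (a t)) - 0)) {p..q}"
      by (intro has_integral_diff integrable_integral ix iy ell)
    have D: "c * I - (q - p) * W \<le> integral {p..q} (\<lambda>t. Lag (y t) (w t + \<Gamma> (y t) (u t) (u t))) - integral {p..q} (\<lambda>t. Lag (x t) (a t))"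
      using has_integral_le[OF H1 H2 low] by simp
    have "(q - p) * W = (2 * C * ((q - p) * (q - p))) * I" by (simp add: W_def algebra_simps)
    also have "\<dots> \<le> (c / 2) * I"
    proof (rule mult_right_mono[OF _ Inn])
      have "(q - p) * (q - p) \<le> 1 * (c / (4 * C))"
        using pq cC by (intro mult_mono) (auto simp: \<rho>_def)
      then have "2 * C * ((q - p) * (q - p)) \<le> 2 * C * (c / (4 * C))" using cC by (intro mult_left_mono) auto
      then show "2 * C * ((q - p) * (q - p)) \<le> c / 2" using cC by (simp add: field_simps)
    qed
    finally have D2: "c / 2 * I \<le> integral {p..q} (\<lambda>t. Lag (y t) (w t + \<Gamma> (y t) (u t) (u t))) - integral {p..q} (\<lambda>t. Lag (x t) (a t))"
      using D by (simp add: field_simps)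
    have cI: "0 \<le> c / 2 * I" using cC(1) Inn by simp
    have "\<forall>t\<in>{p..q}. y t = x t" if "integral {p..q} (\<lambda>t. Lag (y t) (w t + \<Gamma> (y t) (u t) (u t))) \<le> integral {p..q} (\<lambda>t. Lag (x t) (a t))"
    proof
      fix t assume t: "t \<in> {p..q}"
      have "c / 2 * I = 0" using that D2 cI by linarith
      then have "I = 0" using cC(1) by simp
      then have "h t = 0" using P(2)[OF t] by simp
      then show "y t = x t" by (simp add: h_def)
    qed
    then show ?thesis using D2 cI by linarith
  qed
  show ?thesis by (rule that[OF \<rho>]) (rule key)
qed

section \<open>A bound on the speed\<close>

text \<open>
  The function \<open>sqrt (1 + \<bar>u\<bar>\<^sup>2)\<close> is used instead of the speed because it is differentiable where the
  velocity vanishes. Its derivative is at most the norm of the acceleration, hence at most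
  \<open>1/2\<close> plus half of its square, which \<open>Lag\<close> dominates when the potential is nonnegative.
\<close>

lemma speed_bound:
  assumes pq: "p \<le> q" and V: "\<And>x. x \<in> U \<Longrightarrow> V x \<ge> 0" and S: "finite S"
    and y: "\<And>t. t \<in> {p..q} \<Longrightarrow> y t \<in> U \<and> (y has_vector_derivative u t) (at t within {p..q})"
    and u: "continuous_on {p..q} u"
    and w: "\<And>t. t \<in> {p<..<q} - S \<Longrightarrow> (u has_vector_derivative w t) (at t)"
    and i: "(\<lambda>t. Lag (y t) (w t + \<Gamma> (y t) (u t) (u t))) integrable_on {p..q}"
  shows "sqrt (1 + G (y q) (u q) (u q)) \<le> sqrt (1 + G (y p) (u p) (u p)) + (q - p) / 2
    + integral {p..q} (\<lambda>t. Lag (y t) (w t + \<Gamma> (y t) (u t) (u t)))"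
proof -
  define acc where "acc t = w t + \<Gamma> (y t) (u t) (u t)" for t
  define f where "f t = G (y t) (u t) (u t)" for t
  have im: "y ` {p..q} \<subseteq> U" using y by auto
  have yc: "continuous_on {p..q} y" by (rule vderiv_continuous_on) (use y in blast)
  have fc: "continuous_on {p..q} f" unfolding f_def by (intro continuous_on_field yc u im)
  have "((\<lambda>t. G (y t) (acc t) (u t) / sqrt (1 + f t)) has_integral (sqrt (1 + f q) - sqrt (1 + f p))) {p..q}"
  proof (rule fundamental_theorem_of_calculus_interior_strong[OF S pq])
    show "continuous_on {p..q} (\<lambda>t. sqrt (1 + f t))" by (intro continuous_intros fc)
    fix t assume t: "t \<in> {p<..<q} - S"
    then have t': "t \<in> {p<..<q}" "t \<in> {p..q}" by auto
    have yU: "y t \<in> U" using y t' by blast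
    have "(f has_vector_derivative (Dfield G (y t) (u t) (u t) (u t) + G (y t) (w t) (u t) + G (y t) (u t) (w t))) (at t)"
      unfolding f_def
      by (rule has_vector_derivative_field[where S=UNIV and x=y, simplified, OF yU _ w[OF t] w[OF t]])
        (rule has_vector_derivative_at_interior[OF t'(1)], use y t' in blast)
    moreover have "Dfield G (y t) (u t) (u t) (u t) + G (y t) (w t) (u t) + G (y t) (u t) (w t) = 2 * G (y t) (acc t) (u t)"
      by (simp add: compat[OF yU] acc_def bil_simps[OF yU] sym[OF yU, of "u t" "w t"] sym[OF yU, of "u t" "\<Gamma> (y t) (u t) (u t)"])
    ultimately have f': "(f has_real_derivative 2 * G (y t) (acc t) (u t)) (at t)"
      by (simp add: has_real_derivative_iff_has_vector_derivative)
    have pos: "1 + f t > 0" unfolding f_def using nonneg[OF yU, of "u t"] by linarith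
    have "((\<lambda>t. sqrt (1 + f t)) has_real_derivative (2 * G (y t) (acc t) (u t)) * (inverse (sqrt (1 + f t)) / 2)) (at t)"
      using pos by (auto intro!: derivative_eq_intros f')
    then show "((\<lambda>t. sqrt (1 + f t)) has_vector_derivative G (y t) (acc t) (u t) / sqrt (1 + f t)) (at t)"
      by (simp add: has_real_derivative_iff_has_vector_derivative field_simps)
  qed
  moreover have "((\<lambda>t. 1 / 2 + Lag (y t) (acc t)) has_integral ((q - p) / 2 + integral {p..q} (\<lambda>t. Lag (y t) (acc t)))) {p..q}"
    using const_has_integral[OF pq, of "1/2"] i unfolding acc_def
    by (intro has_integral_add integrable_integral) auto
  moreover have "G (y t) (acc t) (u t) / sqrt (1 + f t) \<le> 1 / 2 + Lag (y t) (acc t)" if t: "t \<in> {p..q}" for t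
  proof -
    have yU: "y t \<in> U" using y t by blast
    have fn: "f t \<ge> 0" unfolding f_def by (rule nonneg[OF yU])
    define s where "s = sqrt (1 + f t)"
    have s: "s > 0" "s * s = 1 + f t" using fn by (auto simp: s_def)
    have "0 \<le> G (y t) (s *\<^sub>R acc t - u t) (s *\<^sub>R acc t - u t)" by (rule nonneg[OF yU])
    also have "\<dots> = (s * s) * G (y t) (acc t) (acc t) - 2 * s * G (y t) (acc t) (u t) + f t"
      by (simp add: bil_simps[OF yU] sym[OF yU, of "u t" "acc t"] f_def right_diff_distrib)
    finally have "2 * s * G (y t) (acc t) (u t) \<le> (s * s) * G (y t) (acc t) (acc t) + s * s" using s(2) by linarith
    also have "\<dots> = s * (s * (G (y t) (acc t) (acc t) + 1))" by (simp add: algebra_simps)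
    finally have "s * (2 * G (y t) (acc t) (u t)) \<le> s * (s * (G (y t) (acc t) (acc t) + 1))" by (simp add: mult_ac)
    then have "2 * G (y t) (acc t) (u t) \<le> s * (G (y t) (acc t) (acc t) + 1)" using s(1) by simp
    then have "G (y t) (acc t) (u t) / s \<le> G (y t) (acc t) (acc t) / 2 + 1 / 2" using s(1) by (simp add: field_simps)
    then show ?thesis using V[OF yU] unfolding Lag_def s_def by linarith
  qed
  ultimately have "sqrt (1 + f q) - sqrt (1 + f p) \<le> (q - p) / 2 + integral {p..q} (\<lambda>t. Lag (y t) (acc t))"
    by (rule has_integral_le)
  then show ?thesis unfolding acc_def f_def by linarith
qed

section \<open>Regularity\<close>

text \<open>
  Bootstrapping: the right-hand sides of the system are smooth functions of \<open>x\<close>, \<open>v\<close>, \<open>a\<close>, \<open>b\<close>, so each of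
  these is one order smoother than all of them are known to be.
\<close>

lemma motion_C_k:
  assumes I: "fat I" and m: "motion I x v a b (\<lambda>_. 0)"
  shows "C_k_on k I x \<and> C_k_on k I v \<and> C_k_on k I a \<and> C_k_on k I b"
proof (induction k)
  case 0 show ?case using motion_continuous[OF m] by simp
next
  case (Suc k)
  then have c: "C_k_on k I x" "C_k_on k I v" "C_k_on k I a" "C_k_on k I b" by auto
  have im: "x ` I \<subseteq> U" using motionD(1)[OF m] by auto
  have g: "C_k_on k I (\<lambda>t. grd (x t))" by (rule C_k_on_compose[OF I open_U grd_C_k c(1) im])
  note D = motionD[OF m]
  show ?case
  proof (intro conjI)
    show "C_k_on (Suc k) I x" by (rule C_k_on_Suc_vectorI[OF I D(2) c(2)])
    show "C_k_on (Suc k) I v"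
      by (rule C_k_on_Suc_vectorI[OF I D(3)], assumption) (intro C_k_on_diff Chr.C_k_on_field I c im)
    show "C_k_on (Suc k) I a"
      by (rule C_k_on_Suc_vectorI[OF I D(4)], assumption) (intro C_k_on_diff Chr.C_k_on_field I c im)
    show "C_k_on (Suc k) I b"
      by (rule C_k_on_Suc_vectorI[OF I D(5)], assumption) (intro C_k_on_diff Chr.C_k_on_field C_k_on_Rm C_k_on_const I c im g)
  qed
qed

text \<open>
  If acceleration and jerk do not jump at \<open>\<sigma>\<close>, the right-hand sides of the system are continuous
  there, and \<open>has_vector_derivative_extend\<close> makes the system hold at \<open>\<sigma>\<close> too.
\<close>

lemma motion_glue:
  assumes pq: "p < \<sigma>" "\<sigma> < q" and x: "continuous_on {p..q} x" "continuous_on {p..q} v" "x ` {p..q} \<subseteq> U"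
    and m1: "motion {p..\<sigma>} x v a1 b1 (\<lambda>_. 0)" and m2: "motion {\<sigma>..q} x v a2 b2 (\<lambda>_. 0)"
    and eq: "a1 \<sigma> = a2 \<sigma>" "b1 \<sigma> = b2 \<sigma>"
  defines "a \<equiv> \<lambda>t. if t \<le> \<sigma> then a1 t else a2 t" and "b \<equiv> \<lambda>t. if t \<le> \<sigma> then b1 t else b2 t"
  shows "motion {p..q} x v a b (\<lambda>_. 0)"
proof -
  have U: "{p..q} = {p..\<sigma>} \<union> {\<sigma>..q}" using pq by auto
  have ac: "continuous_on {p..q} a" unfolding U a_def
    by (rule continuous_on_cases) (use motion_continuous[OF m1] motion_continuous[OF m2] eq in auto)
  have bc: "continuous_on {p..q} b" unfolding U b_def
    by (rule continuous_on_cases) (use motion_continuous[OF m1] motion_continuous[OF m2] eq in auto)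
  have gc: "continuous_on {p..q} (\<lambda>t. grd (x t))"
    using C_k_on_continuous[OF grd_C_k[of 0]] by (rule continuous_on_compose2) (use x in auto)
  have D: "(x has_vector_derivative v t) (at t)"
      "(v has_vector_derivative a t - \<Gamma> (x t) (v t) (v t)) (at t)"
      "(a has_vector_derivative b t - \<Gamma> (x t) (v t) (a t)) (at t)"
      "(b has_vector_derivative 0 - Rm G (x t) (a t) (v t) (v t) - grd (x t) - \<Gamma> (x t) (v t) (b t)) (at t)"
    if t: "t \<in> {p<..<q} - {\<sigma>}" for t
  proof -
    consider "t \<in> {p<..<\<sigma>}" | "t \<in> {\<sigma><..<q}" using t by fastforce
    then have "(x has_vector_derivative v t) (at t) \<and>
      (v has_vector_derivative a t - \<Gamma> (x t) (v t) (v t)) (at t) \<and>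
      (a has_vector_derivative b t - \<Gamma> (x t) (v t) (a t)) (at t) \<and>
      (b has_vector_derivative 0 - Rm G (x t) (a t) (v t) (v t) - grd (x t) - \<Gamma> (x t) (v t) (b t)) (at t)"
    proof cases
      case 1
      then have t1: "t \<in> {p..\<sigma>}" by auto
      note M = motionD(2-5)[OF m1 t1, THEN has_vector_derivative_at_interior[OF 1]]
      have e: "a t = a1 t" "b t = b1 t" using 1 by (auto simp: a_def b_def)
      have "(a has_vector_derivative b1 t - \<Gamma> (x t) (v t) (a1 t)) (at t)"
        by (rule has_vector_derivative_transform_within_open[OF M(3) _ 1]) (auto simp: a_def)
      moreover have "(b has_vector_derivative 0 - Rm G (x t) (a1 t) (v t) (v t) - grd (x t) - \<Gamma> (x t) (v t) (b1 t)) (at t)"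
        by (rule has_vector_derivative_transform_within_open[OF M(4) _ 1]) (auto simp: b_def)
      ultimately show ?thesis using M(1,2) unfolding e by blast
    next
      case 2
      then have t1: "t \<in> {\<sigma>..q}" by auto
      note M = motionD(2-5)[OF m2 t1, THEN has_vector_derivative_at_interior[OF 2]]
      have e: "a t = a2 t" "b t = b2 t" using 2 by (auto simp: a_def b_def)
      have "(a has_vector_derivative b2 t - \<Gamma> (x t) (v t) (a2 t)) (at t)"
        by (rule has_vector_derivative_transform_within_open[OF M(3) _ 2]) (auto simp: a_def)
      moreover have "(b has_vector_derivative 0 - Rm G (x t) (a2 t) (v t) (v t) - grd (x t) - \<Gamma> (x t) (v t) (b2 t)) (at t)"
        by (rule has_vector_derivative_transform_within_open[OF M(4) _ 2]) (auto simp: b_def)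
      ultimately show ?thesis using M(1,2) unfolding e by blast
    qed
    then show "(x has_vector_derivative v t) (at t)"
      "(v has_vector_derivative a t - \<Gamma> (x t) (v t) (v t)) (at t)"
      "(a has_vector_derivative b t - \<Gamma> (x t) (v t) (a t)) (at t)"
      "(b has_vector_derivative 0 - Rm G (x t) (a t) (v t) (v t) - grd (x t) - \<Gamma> (x t) (v t) (b t)) (at t)" by auto
  qed
  have fin: "finite {\<sigma>}" by simp
  show ?thesis unfolding motion_def
  proof (intro ballI conjI)
    fix t assume t: "t \<in> {p..q}"
    show "x t \<in> U" using x t by auto
    show "(x has_vector_derivative v t) (at t within {p..q})"
      by (rule has_vector_derivative_extend[OF fin _ _ D(1) t]) (rule x)+
    show "(v has_vector_derivative a t - \<Gamma> (x t) (v t) (v t)) (at t within {p..q})"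
      by (rule has_vector_derivative_extend[OF fin _ _ D(2) t])
        (intro continuous_intros Chr.continuous_on_field x ac)+
    show "(a has_vector_derivative b t - \<Gamma> (x t) (v t) (a t)) (at t within {p..q})"
      by (rule has_vector_derivative_extend[OF fin _ _ D(3) t])
        (intro continuous_intros Chr.continuous_on_field x ac bc)+
    show "(b has_vector_derivative 0 - Rm G (x t) (a t) (v t) (v t) - grd (x t) - \<Gamma> (x t) (v t) (b t)) (at t within {p..q})"
      by (rule has_vector_derivative_extend[OF fin _ _ D(4) t])
        (intro continuous_intros Chr.continuous_on_field continuous_on_Rm x ac bc gc)+
  qed
qed

end

section \<open>Test variations\<close>

text \<open>
  Admissible curves are only piecewise smooth, so variations that are \<open>C\<^sup>1\<close> and smooth off the ends of their
  support keep them admissible.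
\<close>

definition testfun :: "real \<Rightarrow> real \<Rightarrow> (real \<Rightarrow> 'e::euclidean_space) \<Rightarrow> (real \<Rightarrow> 'e) \<Rightarrow> (real \<Rightarrow> 'e) \<Rightarrow> bool"
  where "testfun p q h k j \<longleftrightarrow>
    (\<forall>t. (h has_vector_derivative k t) (at t)) \<and> continuous_on UNIV k \<and>
    (\<forall>t. t \<notin> {p, q} \<longrightarrow> (k has_vector_derivative j t) (at t)) \<and>
    (\<forall>t. t \<notin> {p<..<q} \<longrightarrow> h t = 0 \<and> k t = 0 \<and> j t = 0) \<and>
    (\<exists>B. \<forall>t. norm (h t) \<le> B \<and> norm (k t) \<le> B \<and> norm (j t) \<le> B) \<and>
    (\<forall>u v n. u < v \<and> {u<..<v} \<inter> {p, q} = {} \<longrightarrow> C_k_on n {u..v} h)"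

lemma cutoff_continuous:
  fixes P :: "real \<Rightarrow> 'e::euclidean_space"
  assumes "p < q" "continuous_on UNIV P" "P p = 0" "P q = 0"
  shows "continuous_on UNIV (\<lambda>t. if t \<in> {p..q} then P t else 0)"
proof -
  have "UNIV = {p..q} \<union> ({..p} \<union> {q..})" by auto
  moreover have "continuous_on ({p..q} \<union> ({..p} \<union> {q..})) (\<lambda>t. if t \<in> {p..q} then P t else 0)"
    by (rule continuous_on_cases) (use assms in \<open>auto intro: continuous_on_subset\<close>)
  ultimately show ?thesis by simp
qed

lemma cutoff_derivative:
  fixes P :: "real \<Rightarrow> 'e::euclidean_space"
  assumes d: "\<And>t. (P has_vector_derivative P' t) (at t)" and t: "t \<notin> {p, q}"
  shows "((\<lambda>t. if t \<in> {p..q} then P t else 0) has_vector_derivative (if t \<in> {p<..<q} then P' t else 0)) (at t)"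
proof (cases "t \<in> {p<..<q}")
  case True
  have "((\<lambda>t. if t \<in> {p..q} then P t else 0) has_vector_derivative P' t) (at t)"
    by (rule has_vector_derivative_transform_within_open[OF d, of "{p<..<q}"]) (use True in auto)
  then show ?thesis using True by simp
next
  case False
  then have "t \<in> {..<p} \<union> {q<..}" using t by auto
  then have "((\<lambda>t. if t \<in> {p..q} then P t else 0) has_vector_derivative 0) (at t)"
    by (intro has_vector_derivative_transform_within_open[OF has_vector_derivative_const, of "{..<p} \<union> {q<..}" t 0]) auto
  then show ?thesis by (simp only: False if_False)
qed

text \<open>
  A polynomial with double zeros at \<open>p\<close> and \<open>q\<close>, cut off outside \<open>{p..q}\<close>. The two vectors allow for
  prescribing its value or its derivative at \<open>\<sigma>\<close>: with \<open>w = 0\<close> it vanishes at \<open>\<sigma>\<close> with derivative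
  \<open>\<phi> \<sigma> *\<^sub>R w'\<close>.
\<close>

lemma testfun_exists:
  fixes w w' :: "'e::euclidean_space"
  assumes pq: "p < q"
  defines "\<phi> \<equiv> \<lambda>t. ((t - p) * (q - t))\<^sup>2" and "\<psi> \<equiv> \<lambda>t. 2 * ((t - p) * (q - t)) * (p + q - 2 * t)"
  obtains h k j where "testfun p q h k j"
    "\<And>t. t \<in> {p..q} \<Longrightarrow> h t = \<phi> t *\<^sub>R (w + (t - \<sigma>) *\<^sub>R w')"
    "\<And>t. t \<in> {p..q} \<Longrightarrow> k t = \<psi> t *\<^sub>R (w + (t - \<sigma>) *\<^sub>R w') + \<phi> t *\<^sub>R w'"
proof -
  define P where "P t = \<phi> t *\<^sub>R (w + (t - \<sigma>) *\<^sub>R w')" for t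
  define P1 where "P1 t = \<psi> t *\<^sub>R (w + (t - \<sigma>) *\<^sub>R w') + \<phi> t *\<^sub>R w'" for t
  define P2 where "P2 t = (2 * (p + q - 2 * t)\<^sup>2 - 4 * ((t - p) * (q - t))) *\<^sub>R (w + (t - \<sigma>) *\<^sub>R w') + (2 * \<psi> t) *\<^sub>R w'" for t
  have \<phi>: "(\<phi> has_real_derivative \<psi> t) (at t)" for t
    unfolding \<phi>_def \<psi>_def by (auto intro!: derivative_eq_intros simp: algebra_simps power2_eq_square)
  have \<psi>: "(\<psi> has_real_derivative (2 * (p + q - 2 * t)\<^sup>2 - 4 * ((t - p) * (q - t)))) (at t)" for t
    unfolding \<psi>_def by (auto intro!: derivative_eq_intros simp: algebra_simps power2_eq_square)
  have l: "((\<lambda>t. w + (t - \<sigma>) *\<^sub>R w') has_vector_derivative w') (at t)" for t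
    by (auto intro!: derivative_eq_intros simp: has_vector_derivative_def)
  have P: "(P has_vector_derivative P1 t) (at t)" for t
    unfolding P_def P1_def
    by (rule has_vector_derivative_eq_rhs[OF has_vector_derivative_scaleR[OF \<phi> l]]) simp
  have P1: "(P1 has_vector_derivative P2 t) (at t)" for t
    unfolding P1_def P2_def
    by (rule has_vector_derivative_eq_rhs[OF has_vector_derivative_add[OF has_vector_derivative_scaleR[OF \<psi> l]
          has_vector_derivative_scaleR[OF \<phi> has_vector_derivative_const]]])
      (simp add: scaleR_add_left[symmetric])
  have c: "continuous_on UNIV P" "continuous_on UNIV P1" "continuous_on UNIV P2"
    unfolding P_def P1_def P2_def \<phi>_def \<psi>_def by (intro continuous_intros)+
  have z: "P p = 0" "P q = 0" "P1 p = 0" "P1 q = 0" by (auto simp: P_def P1_def \<phi>_def \<psi>_def)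
  define h where "h t = (if t \<in> {p..q} then P t else 0)" for t
  define k where "k t = (if t \<in> {p..q} then P1 t else 0)" for t
  define j where "j t = (if t \<in> {p<..<q} then P2 t else 0)" for t
  have hc: "continuous_on UNIV h" and kc: "continuous_on UNIV k"
    unfolding h_def k_def by (intro cutoff_continuous pq c z)+
  have k': "k t = (if t \<in> {p<..<q} then P1 t else 0)" for t using z by (auto simp: k_def)
  have hk0: "(h has_vector_derivative k t) (at t)" if "t \<notin> {p, q}" for t
    unfolding k' unfolding h_def by (rule cutoff_derivative[OF P that])
  have hk: "(h has_vector_derivative k t) (at t)" for t
  proof -
    have "(h has_vector_derivative k t) (at t within {t - 1..t + 1})"
      by (rule has_vector_derivative_extend[of "{p, q}"])
        (use hk0 hc kc in \<open>auto intro: continuous_on_subset\<close>)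
    then show ?thesis by (simp add: at_within_Icc_at)
  qed
  have kj: "(k has_vector_derivative j t) (at t)" if "t \<notin> {p, q}" for t
    unfolding k_def j_def by (rule cutoff_derivative[OF P1 that])
  have "\<exists>B. \<forall>t\<in>{p..q}. norm (f t) \<le> B" if "continuous_on UNIV f" for f :: "real \<Rightarrow> 'e"
  proof -
    have "compact (f ` {p..q})" using that by (intro compact_continuous_image) (auto intro: continuous_on_subset)
    then have "bounded (f ` {p..q})" by (rule compact_imp_bounded)
    then show ?thesis unfolding bounded_iff by blast
  qed
  from this[OF c(1)] this[OF c(2)] this[OF c(3)] obtain B B1 B2 where B: "\<forall>t\<in>{p..q}. norm (P t) \<le> B" "\<forall>t\<in>{p..q}. norm (P1 t) \<le> B1" "\<forall>t\<in>{p..q}. norm (P2 t) \<le> B2"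
    by blast
  have bdd: "norm (h t) \<le> max 0 (max B (max B1 B2)) \<and> norm (k t) \<le> max 0 (max B (max B1 B2)) \<and> norm (j t) \<le> max 0 (max B (max B1 B2))" for t
    using B by (auto simp: h_def k_def j_def le_max_iff_disj)
  have Ck: "C_k_on n {u..v} h" if uv: "u < v" "{u<..<v} \<inter> {p, q} = {}" for u v n
  proof -
    have f: "fat {u..v}" by (rule fat_Icc[OF uv(1)])
    have id: "C_k_on n {u..v} (\<lambda>t. t)" by (rule C_k_on_linear[OF bounded_linear_ident f])
    consider "{u..v} \<subseteq> {p..q}" | "v \<le> p" | "q \<le> u" using uv by fastforce
    then show ?thesis
    proof cases
      case 1
      have "C_k_on n {u..v} P" unfolding P_def \<phi>_def power2_eq_square
        by (intro C_k_on_scaleR C_k_on_mult C_k_on_add C_k_on_diff C_k_on_const f id)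
      then show ?thesis by (rule C_k_on_transfer) (use 1 in \<open>auto simp: h_def\<close>)
    next
      case 2
      have "0 = h y" if "y \<in> {u..v}" for y using that 2 z by (cases "y = p") (auto simp: h_def)
      then show ?thesis by (rule C_k_on_transfer[OF C_k_on_const[OF f]])
    next
      case 3
      have "0 = h y" if "y \<in> {u..v}" for y using that 3 z by (cases "y = q") (auto simp: h_def)
      then show ?thesis by (rule C_k_on_transfer[OF C_k_on_const[OF f]])
    qed
  qed
  have "h t = 0 \<and> k t = 0 \<and> j t = 0" if "t \<notin> {p<..<q}" for t
    using that z by (auto simp: h_def k_def j_def)
  then have "testfun p q h k j" unfolding testfun_def using hk kc kj bdd Ck by blast
  then show ?thesis by (rule that) (auto simp: h_def k_def P_def P1_def)
qed

lemma linear_coefficient_zero: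
  fixes L C e0 :: real
  assumes e0: "e0 > 0" and le: "\<And>e. \<bar>e\<bar> \<le> e0 \<Longrightarrow> 0 \<le> e * L + C * e\<^sup>2"
  shows "L = 0"
proof (rule ccontr)
  assume L: "L \<noteq> 0"
  define D where "D = \<bar>C\<bar> + 1"
  have D: "D > 0" "C \<le> D" by (auto simp: D_def)
  define s where "s = min e0 (\<bar>L\<bar> / (2 * D))"
  have s: "s > 0" "s \<le> e0" "s \<le> \<bar>L\<bar> / (2 * D)" using e0 L D by (auto simp: s_def)
  have "0 \<le> (- sgn L * s) * L + C * (- sgn L * s)\<^sup>2" by (rule le) (use s L in \<open>auto simp: abs_mult sgn_if\<close>)
  also have "\<dots> = - s * \<bar>L\<bar> + C * s\<^sup>2" using L by (auto simp: sgn_if power2_eq_square)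
  also have "\<dots> \<le> - s * \<bar>L\<bar> + D * s\<^sup>2" using D by (intro add_left_mono mult_right_mono) auto
  also have "\<dots> = s * (D * s - \<bar>L\<bar>)" by (simp add: power2_eq_square algebra_simps)
  finally have "0 \<le> D * s - \<bar>L\<bar>" using s by (simp add: zero_le_mult_iff)
  moreover have "D * s \<le> \<bar>L\<bar> / 2" using s(3) D by (simp add: field_simps)
  ultimately show False using L by simp
qed

section \<open>The Euler-Lagrange equation in a chart\<close>

context riem_pot
begin

definition stationary :: "real \<Rightarrow> real \<Rightarrow> (real \<Rightarrow> 'e) \<Rightarrow> (real \<Rightarrow> 'e) \<Rightarrow> (real \<Rightarrow> 'e) \<Rightarrow> bool"
  where "stationary p q x v a \<longleftrightarrow> (\<forall>h k j I. testfun p q h k j \<and>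
    ((\<lambda>t. ell (x t) (v t) (a t) (h t) (k t) (j t)) has_integral I) {p..q} \<longrightarrow> I = 0)"

definition varied_acc :: "'e \<Rightarrow> 'e \<Rightarrow> 'e \<Rightarrow> 'e \<Rightarrow> 'e \<Rightarrow> 'e \<Rightarrow> 'e"
  where "varied_acc x v a h k j = a - \<Gamma> x v v + j + \<Gamma> (x + h) (v + k) (v + k)"

lemma ell_scale:
  assumes "x \<in> U" shows "ell x v a (c *\<^sub>R h) (c *\<^sub>R k) (c *\<^sub>R j) = c * ell x v a h k j"
  by (simp add: ell_def bil_simps[OF assms] Chr.bil_simps[OF assms] Dfield_simps[OF assms] Chr.Dfield_simps[OF assms]
      linear_scale[OF linear_dV[OF assms]] algebra_simps)

text \<open>
  Minimality bounds the linear term of \<open>\<epsilon> \<mapsto> J(x + \<epsilon> h)\<close> from both sides, as \<open>\<epsilon>\<close> may have either sign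
  and the remainder is of order \<open>\<epsilon>\<^sup>2\<close>.
\<close>

lemma stationary_of_minimal:
  assumes K: "cball x0 r \<subseteq> U" "r > 0"
    and x: "\<And>t. t \<in> {p..q} \<Longrightarrow> x t \<in> cball x0 (r / 2)" and M: "\<And>t. t \<in> {p..q} \<Longrightarrow> norm (v t) \<le> M \<and> norm (a t) \<le> M"
    and ix: "(\<lambda>t. Lag (x t) (a t)) integrable_on {p..q}" and pq: "p < q"
    and min: "\<And>h k j \<epsilon>. testfun p q h k j \<Longrightarrow> (\<And>t. t \<in> {p..q} \<Longrightarrow> x t + \<epsilon> *\<^sub>R h t \<in> cball x0 r) \<Longrightarrow>
      (\<lambda>t. Lag (x t + \<epsilon> *\<^sub>R h t) (varied_acc (x t) (v t) (a t) (\<epsilon> *\<^sub>R h t) (\<epsilon> *\<^sub>R k t) (\<epsilon> *\<^sub>R j t))) integrable_on {p..q} \<and>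
      integral {p..q} (\<lambda>t. Lag (x t) (a t)) \<le>
      integral {p..q} (\<lambda>t. Lag (x t + \<epsilon> *\<^sub>R h t) (varied_acc (x t) (v t) (a t) (\<epsilon> *\<^sub>R h t) (\<epsilon> *\<^sub>R k t) (\<epsilon> *\<^sub>R j t)))"
  shows "stationary p q x v a"
  unfolding stationary_def
proof (intro allI impI, elim conjE)
  fix h k j I assume tf: "testfun p q h k j"
    and I: "((\<lambda>t. ell (x t) (v t) (a t) (h t) (k t) (j t)) has_integral I) {p..q}"
  obtain B0 where B0: "\<And>t. norm (h t) \<le> B0 \<and> norm (k t) \<le> B0 \<and> norm (j t) \<le> B0"
    using tf unfolding testfun_def by blast
  define B where "B = B0 + 1"
  have B: "B > 0" "norm (h t) \<le> B" "norm (k t) \<le> B" "norm (j t) \<le> B" for t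
    using B0[of t] norm_ge_zero[of "h t"] unfolding B_def by linarith+
  have "p \<in> {p..q}" using pq by simp
  from M[OF this] have Mnn: "M \<ge> 0" using norm_ge_zero order_trans by blast
  obtain C where C: "C > 0"
    "\<And>x y v u a b j. \<lbrakk>x \<in> cball x0 r; y \<in> cball x0 r; norm v \<le> M; norm a \<le> M; norm (u - v) \<le> B;
       j = (b - \<Gamma> y u u) - (a - \<Gamma> x v v)\<rbrakk> \<Longrightarrow>
     Lag y b - Lag x a - ell x v a (y - x) (u - v) j
       \<le> C * ((norm (y - x))\<^sup>2 + (norm (u - v))\<^sup>2 + (norm j)\<^sup>2)"
    using lagrangian_upper_bound[OF K(1) Mnn less_imp_le[OF B(1)] less_imp_le[OF K(2)]] by blast
  \<comment> \<open>Small enough for the varied curve to stay in the ball of radius \<open>r\<close>.\<close>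
  define e0 where "e0 = min 1 (r / (2 * B))"
  have e0: "e0 > 0" using B(1) K(2) by (simp add: e0_def)
  show "I = 0"
  proof (rule linear_coefficient_zero[OF e0])
    fix \<epsilon> :: real assume \<epsilon>: "\<bar>\<epsilon>\<bar> \<le> e0"
    have eB: "\<bar>\<epsilon>\<bar> * B \<le> r / 2"
    proof -
      have "\<bar>\<epsilon>\<bar> * B \<le> (r / (2 * B)) * B" using \<epsilon> B(1) unfolding e0_def by (intro mult_right_mono) auto
      then show ?thesis using B(1) by simp
    qed
    have xK: "x t \<in> cball x0 r" if "t \<in> {p..q}" for t using x[OF that] K(2) by auto
    have yK: "x t + \<epsilon> *\<^sub>R h t \<in> cball x0 r" if t: "t \<in> {p..q}" for t
    proof -
      have "dist x0 (x t + \<epsilon> *\<^sub>R h t) \<le> dist x0 (x t) + dist (x t) (x t + \<epsilon> *\<^sub>R h t)" by (rule dist_triangle)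
      also have "dist (x t) (x t + \<epsilon> *\<^sub>R h t) = \<bar>\<epsilon>\<bar> * norm (h t)" by (simp add: dist_norm)
      also have "\<dots> \<le> \<bar>\<epsilon>\<bar> * B" using B by (intro mult_left_mono) auto
      finally show ?thesis using eB x[OF t] by simp
    qed
    let ?y = "\<lambda>t. x t + \<epsilon> *\<^sub>R h t"
    let ?b = "\<lambda>t. varied_acc (x t) (v t) (a t) (\<epsilon> *\<^sub>R h t) (\<epsilon> *\<^sub>R k t) (\<epsilon> *\<^sub>R j t)"
    have iy: "(\<lambda>t. Lag (?y t) (?b t)) integrable_on {p..q}"
      and le: "integral {p..q} (\<lambda>t. Lag (x t) (a t)) \<le> integral {p..q} (\<lambda>t. Lag (?y t) (?b t))"
      using min[OF tf yK] by auto
    have H1: "((\<lambda>t. Lag (?y t) (?b t) - Lag (x t) (a t) - \<epsilon> * ell (x t) (v t) (a t) (h t) (k t) (j t)) has_integral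
      (integral {p..q} (\<lambda>t. Lag (?y t) (?b t)) - integral {p..q} (\<lambda>t. Lag (x t) (a t)) - \<epsilon> * I)) {p..q}"
      by (intro has_integral_diff has_integral_mult_right integrable_integral ix iy I)
    have H2: "((\<lambda>t. C * (3 * B\<^sup>2) * \<epsilon>\<^sup>2) has_integral ((q - p) * (C * (3 * B\<^sup>2) * \<epsilon>\<^sup>2))) {p..q}"
      by (rule const_has_integral) (use pq in simp)
    have "integral {p..q} (\<lambda>t. Lag (?y t) (?b t)) - integral {p..q} (\<lambda>t. Lag (x t) (a t)) - \<epsilon> * I \<le> (q - p) * (C * (3 * B\<^sup>2) * \<epsilon>\<^sup>2)"
    proof (rule has_integral_le[OF H1 H2])
      fix t assume t: "t \<in> {p..q}"
      have xU: "x t \<in> U" using xK[OF t] K(1) by blast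
      have nk: "norm (\<epsilon> *\<^sub>R k t) \<le> B"
      proof -
        have "\<bar>\<epsilon>\<bar> * norm (k t) \<le> 1 * B" using \<epsilon> B unfolding e0_def by (intro mult_mono) auto
        then show ?thesis by simp
      qed
      have "Lag (?y t) (?b t) - Lag (x t) (a t) - ell (x t) (v t) (a t) (?y t - x t) ((v t + \<epsilon> *\<^sub>R k t) - v t) (\<epsilon> *\<^sub>R j t)
         \<le> C * ((norm (?y t - x t))\<^sup>2 + (norm ((v t + \<epsilon> *\<^sub>R k t) - v t))\<^sup>2 + (norm (\<epsilon> *\<^sub>R j t))\<^sup>2)"
        by (rule C(2)) (use xK yK t M nk in \<open>auto simp: varied_acc_def algebra_simps\<close>)
      then have "Lag (?y t) (?b t) - Lag (x t) (a t) - \<epsilon> * ell (x t) (v t) (a t) (h t) (k t) (j t)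
         \<le> C * (\<epsilon>\<^sup>2 * ((norm (h t))\<^sup>2 + (norm (k t))\<^sup>2 + (norm (j t))\<^sup>2))"
        by (simp add: ell_scale[OF xU] power_mult_distrib algebra_simps)
      also have "\<dots> \<le> C * (\<epsilon>\<^sup>2 * (B\<^sup>2 + B\<^sup>2 + B\<^sup>2))"
        using B C(1) by (intro mult_left_mono add_mono power_mono) auto
      also have "\<dots> = C * (3 * B\<^sup>2) * \<epsilon>\<^sup>2" by simp
      finally show "Lag (?y t) (?b t) - Lag (x t) (a t) - \<epsilon> * ell (x t) (v t) (a t) (h t) (k t) (j t) \<le> C * (3 * B\<^sup>2) * \<epsilon>\<^sup>2" .
    qed
    moreover have "(q - p) * (C * (3 * B\<^sup>2) * \<epsilon>\<^sup>2) = ((q - p) * (C * (3 * B\<^sup>2))) * \<epsilon>\<^sup>2" by simp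
    moreover have "- (\<epsilon> * I) \<le> integral {p..q} (\<lambda>t. Lag (?y t) (?b t)) - integral {p..q} (\<lambda>t. Lag (x t) (a t)) - \<epsilon> * I"
      using le by simp
    ultimately show "0 \<le> \<epsilon> * I + ((q - p) * (C * (3 * B\<^sup>2))) * \<epsilon>\<^sup>2" by linarith
  qed
qed

text \<open>
  If \<open>e\<close> did not vanish at an interior time \<open>t1\<close>, it would have a positive inner product with the constant
  vector \<open>e t1\<close> nearby, and a bump in this direction would have a nonzero first variation.
\<close>

lemma euler_lagrange_interior:
  assumes m: "motion {p..q} x v a b e" and ec: "continuous_on {p..q} e" and pq: "p < q"
    and stat: "\<And>p' q'. p < p' \<Longrightarrow> p' < q' \<Longrightarrow> q' < q \<Longrightarrow> stationary p' q' x v a"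
    and t: "t \<in> {p..q}"
  shows "e t = 0"
proof -
  have im: "x ` {p..q} \<subseteq> U" using motionD(1)[OF m] by auto
  have int: "e t1 = 0" if t1: "t1 \<in> {p<..<q}" for t1
  proof (rule ccontr)
    assume ne: "e t1 \<noteq> 0"
    define s where "s t = G (x t) (e t) (e t1)" for t
    have sc: "continuous_on {p..q} s" unfolding s_def
      by (intro continuous_on_field motion_continuous[OF m] ec continuous_on_const im)
    have "s t1 > 0" unfolding s_def by (rule pos) (use t1 im ne in auto)
    moreover have "continuous_on {p<..<q} s" using sc by (rule continuous_on_subset) auto
    then have "isCont s t1" using t1 by (simp add: continuous_on_eq_continuous_at)
    ultimately have "eventually (\<lambda>t. s t > 0) (nhds t1)"
      unfolding isCont_def tendsto_at_iff_tendsto_nhds by (rule order_tendstoD(1)[rotated])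
    then obtain d0 where d0: "d0 > 0" "\<And>t. dist t t1 < d0 \<Longrightarrow> s t > 0" unfolding eventually_nhds_metric by blast
    define d where "d = min (d0 / 2) (min ((t1 - p) / 2) ((q - t1) / 2))"
    have d: "d > 0" "d < d0" "p < t1 - d" "t1 + d < q" using d0 t1 by (auto simp: d_def min_def field_simps)
    define p' where "p' = t1 - d" define q' where "q' = t1 + d"
    have pq': "p < p'" "p' < q'" "q' < q" "{p'..q'} \<subseteq> {p..q}" using d by (auto simp: p'_def q'_def)
    obtain h k j where tf: "testfun p' q' h k j" and
      h: "\<And>t. t \<in> {p'..q'} \<Longrightarrow> h t = ((t - p') * (q' - t))\<^sup>2 *\<^sub>R (e t1 + (t - 0) *\<^sub>R 0)"
      using testfun_exists[OF pq'(2), of "e t1" 0 0] by metis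
    note T = tf[unfolded testfun_def]
    have m': "motion {p'..q'} x v a b e" using motion_subset[OF m pq'(4)] .
    have im': "x ` {p'..q'} \<subseteq> U" using im pq' by blast
    have F: "((\<lambda>t. ell (x t) (v t) (a t) (h t) (k t) (j t) - G (x t) (e t) (h t)) has_integral
      (boundary_term (x q') (v q') (a q') (b q') (h q') (k q') - boundary_term (x p') (v p') (a p') (b p') (h p') (k p'))) {p'..q'}"
    proof (rule first_variation_integral[OF _ m', of "{p', q'}"])
      show "continuous_on {p'..q'} h" by (rule vderiv_continuous_on) (use T has_vector_derivative_at_within in blast)
      show "continuous_on {p'..q'} k" using T continuous_on_subset by blast
    qed (use T pq' in auto)
    have z: "h p' = 0" "k p' = 0" "h q' = 0" "k q' = 0" using T by auto
    have Up: "x p' \<in> U" "x q' \<in> U" using im' pq' by auto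
    have F0: "((\<lambda>t. ell (x t) (v t) (a t) (h t) (k t) (j t) - G (x t) (e t) (h t)) has_integral 0) {p'..q'}"
      using F by (simp add: z boundary_term_def bil_simps[OF Up(1)] bil_simps[OF Up(2)] Chr.bil_simps[OF Up(1)] Chr.bil_simps[OF Up(2)])
    have ce: "continuous_on {p'..q'} (\<lambda>t. G (x t) (e t) (h t))"
      by (intro continuous_on_field motion_continuous[OF m'] continuous_on_subset[OF ec pq'(4)] im' vderiv_continuous_on)
        (use T has_vector_derivative_at_within in blast)
    have ig: "((\<lambda>t. G (x t) (e t) (h t)) has_integral integral {p'..q'} (\<lambda>t. G (x t) (e t) (h t))) {p'..q'}"
      using integrable_continuous_real[OF ce] by (rule integrable_integral)
    have "((\<lambda>t. ell (x t) (v t) (a t) (h t) (k t) (j t)) has_integral (0 + integral {p'..q'} (\<lambda>t. G (x t) (e t) (h t)))) {p'..q'}"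
      using has_integral_add[OF F0 ig] by simp
    then have i0: "integral {p'..q'} (\<lambda>t. G (x t) (e t) (h t)) = 0"
      using stat[OF pq'(1-3)] tf unfolding stationary_def by fastforce
    have eq: "G (x t) (e t) (h t) = ((t - p') * (q' - t))\<^sup>2 * s t" if t: "t \<in> {p'..q'}" for t
    proof -
      have "x t \<in> U" using im' t by blast
      then show ?thesis using h[OF t] by (simp add: s_def bil_simps)
    qed
    have "\<forall>t\<in>{p'..q'}. G (x t) (e t) (h t) = 0"
    proof (subst integral_eq_0_iff[OF ce pq'(2), symmetric])
      fix t assume t: "t \<in> {p'..q'}"
      have "dist t t1 < d0" using t d by (auto simp: p'_def q'_def dist_real_def)
      then show "0 \<le> G (x t) (e t) (h t)" unfolding eq[OF t] using d0(2)[of t] by simp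
    qed (rule i0)
    then have "((t1 - p') * (q' - t1))\<^sup>2 * s t1 = 0" using eq[of t1] d by (simp add: p'_def q'_def)
    then show False using \<open>s t1 > 0\<close> d by (simp add: p'_def q'_def)
  qed
  have "e ` closure {p<..<q} \<subseteq> {0}"
    by (rule image_closure_subset) (use ec int pq in auto)
  then show ?thesis using t pq by (auto simp: image_subset_iff)
qed

text \<open>
  With \<open>e = 0\<close> on both sides, only the boundary terms at \<open>\<sigma>\<close> are left in the first variation. They pair the
  jump of \<open>a\<close> with the derivative and the jump of \<open>b\<close> with the value of the test variation, and these can
  be chosen independently.
\<close>

lemma corner_conditions:
  assumes pq: "p < \<sigma>" "\<sigma> < q"
    and m1: "motion {p..\<sigma>} x v a1 b1 (\<lambda>_. 0)" and m2: "motion {\<sigma>..q} x v a2 b2 (\<lambda>_. 0)"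
    and stat: "stationary p q x v (\<lambda>t. if t \<le> \<sigma> then a1 t else a2 t)"
  shows "a1 \<sigma> = a2 \<sigma>" "b1 \<sigma> = b2 \<sigma>"
proof -
  have U: "x p \<in> U" "x \<sigma> \<in> U" "x q \<in> U"
    using motionD(1)[OF m1, of p] motionD(1)[OF m1, of \<sigma>] motionD(1)[OF m2, of q] pq by auto
  have key: "boundary_term (x \<sigma>) (v \<sigma>) (a1 \<sigma>) (b1 \<sigma>) (h \<sigma>) (k \<sigma>) = boundary_term (x \<sigma>) (v \<sigma>) (a2 \<sigma>) (b2 \<sigma>) (h \<sigma>) (k \<sigma>)"
    if tf: "testfun p q h k j" for h k j
  proof -
    note T = tf[unfolded testfun_def]
    have hc: "continuous_on UNIV h" by (rule vderiv_continuous_on) (use T in auto)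
    have kc: "continuous_on UNIV k" using T by blast
    have z: "h p = 0" "k p = 0" "h q = 0" "k q = 0" using T by auto
    have F1: "((\<lambda>t. ell (x t) (v t) (a1 t) (h t) (k t) (j t) - G (x t) 0 (h t)) has_integral
      (boundary_term (x \<sigma>) (v \<sigma>) (a1 \<sigma>) (b1 \<sigma>) (h \<sigma>) (k \<sigma>) - boundary_term (x p) (v p) (a1 p) (b1 p) (h p) (k p))) {p..\<sigma>}"
      by (rule first_variation_integral[OF _ m1, of "{p, q}"]) (use T pq hc kc in \<open>auto intro: continuous_on_subset\<close>)
    have F2: "((\<lambda>t. ell (x t) (v t) (a2 t) (h t) (k t) (j t) - G (x t) 0 (h t)) has_integral
      (boundary_term (x q) (v q) (a2 q) (b2 q) (h q) (k q) - boundary_term (x \<sigma>) (v \<sigma>) (a2 \<sigma>) (b2 \<sigma>) (h \<sigma>) (k \<sigma>))) {\<sigma>..q}"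
      by (rule first_variation_integral[OF _ m2, of "{p, q}"]) (use T pq hc kc in \<open>auto intro: continuous_on_subset\<close>)
    let ?f = "\<lambda>t. ell (x t) (v t) (if t \<le> \<sigma> then a1 t else a2 t) (h t) (k t) (j t)"
    have G1: "(?f has_integral boundary_term (x \<sigma>) (v \<sigma>) (a1 \<sigma>) (b1 \<sigma>) (h \<sigma>) (k \<sigma>)) {p..\<sigma>}"
    proof (rule has_integral_eq[rotated])
      show "((\<lambda>t. ell (x t) (v t) (a1 t) (h t) (k t) (j t) - G (x t) 0 (h t)) has_integral boundary_term (x \<sigma>) (v \<sigma>) (a1 \<sigma>) (b1 \<sigma>) (h \<sigma>) (k \<sigma>)) {p..\<sigma>}"
        using F1 by (simp add: z boundary_term_def[of "x p"] bil_simps[OF U(1)] Chr.bil_simps[OF U(1)])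
      show "ell (x t) (v t) (a1 t) (h t) (k t) (j t) - G (x t) 0 (h t) = ?f t" if "t \<in> {p..\<sigma>}" for t
        using that motionD(1)[OF m1 that] by (simp add: bil_simps)
    qed
    have G2: "(?f has_integral - boundary_term (x \<sigma>) (v \<sigma>) (a2 \<sigma>) (b2 \<sigma>) (h \<sigma>) (k \<sigma>)) {\<sigma>..q}"
    proof (rule has_integral_spike_finite[of "{\<sigma>}"])
      show "((\<lambda>t. ell (x t) (v t) (a2 t) (h t) (k t) (j t) - G (x t) 0 (h t)) has_integral - boundary_term (x \<sigma>) (v \<sigma>) (a2 \<sigma>) (b2 \<sigma>) (h \<sigma>) (k \<sigma>)) {\<sigma>..q}"
        using F2 by (simp add: z boundary_term_def[of "x q"] bil_simps[OF U(3)] Chr.bil_simps[OF U(3)])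
      show "?f t = ell (x t) (v t) (a2 t) (h t) (k t) (j t) - G (x t) 0 (h t)" if "t \<in> {\<sigma>..q} - {\<sigma>}" for t
        using that motionD(1)[OF m2, of t] by (simp add: bil_simps)
    qed simp
    have "(?f has_integral (boundary_term (x \<sigma>) (v \<sigma>) (a1 \<sigma>) (b1 \<sigma>) (h \<sigma>) (k \<sigma>) + - boundary_term (x \<sigma>) (v \<sigma>) (a2 \<sigma>) (b2 \<sigma>) (h \<sigma>) (k \<sigma>))) {p..q}"
      by (rule has_integral_combine[OF _ _ G1 G2]) (use pq in auto)
    then have "boundary_term (x \<sigma>) (v \<sigma>) (a1 \<sigma>) (b1 \<sigma>) (h \<sigma>) (k \<sigma>) + - boundary_term (x \<sigma>) (v \<sigma>) (a2 \<sigma>) (b2 \<sigma>) (h \<sigma>) (k \<sigma>) = 0"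
      using stat tf unfolding stationary_def by blast
    then show ?thesis by simp
  qed
  have pq': "p < q" "\<sigma> \<in> {p..q}" using pq by auto
  define c where "c = ((\<sigma> - p) * (q - \<sigma>))\<^sup>2"
  have c: "c > 0" using pq by (simp add: c_def)
  show a: "a1 \<sigma> = a2 \<sigma>"
  proof (rule nondeg[OF U(2)])
    fix w :: 'e
    obtain h k j where tf: "testfun p q h k j" and
      h: "\<And>t. t \<in> {p..q} \<Longrightarrow> h t = ((t - p) * (q - t))\<^sup>2 *\<^sub>R (0 + (t - \<sigma>) *\<^sub>R w)" and
      k: "\<And>t. t \<in> {p..q} \<Longrightarrow> k t = (2 * ((t - p) * (q - t)) * (p + q - 2 * t)) *\<^sub>R (0 + (t - \<sigma>) *\<^sub>R w) + ((t - p) * (q - t))\<^sup>2 *\<^sub>R w"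
      using testfun_exists[OF pq'(1), of 0 \<sigma> w] by metis
    have "h \<sigma> = 0" "k \<sigma> = c *\<^sub>R w" using h[OF pq'(2)] k[OF pq'(2)] by (auto simp: c_def)
    then show "G (x \<sigma>) (a1 \<sigma>) w = G (x \<sigma>) (a2 \<sigma>) w"
      using key[OF tf] c by (simp add: boundary_term_def bil_simps[OF U(2)] Chr.bil_simps[OF U(2)] sym[OF U(2), of w])
  qed
  show "b1 \<sigma> = b2 \<sigma>"
  proof (rule nondeg[OF U(2)])
    fix w :: 'e
    obtain h k j where tf: "testfun p q h k j" and
      h: "\<And>t. t \<in> {p..q} \<Longrightarrow> h t = ((t - p) * (q - t))\<^sup>2 *\<^sub>R (w + (t - \<sigma>) *\<^sub>R 0)"
      using testfun_exists[OF pq'(1), of w \<sigma> 0] by metis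
    have "h \<sigma> = c *\<^sub>R w" using h[OF pq'(2)] by (auto simp: c_def)
    then show "G (x \<sigma>) (b1 \<sigma>) w = G (x \<sigma>) (b2 \<sigma>) w"
      using key[OF tf] c by (simp add: boundary_term_def a bil_simps[OF U(2)] Chr.bil_simps[OF U(2)] sym[OF U(2), of w])
  qed
qed

end

section \<open>Charts and tangent vectors\<close>

locale manifold =
  fixes A :: "('q::{t2_space,second_countable_topology}, 'e::euclidean_space) chart set"
  assumes atlas: "smooth_atlas A"
begin

lemma chart_open: "c \<in> A \<Longrightarrow> open (dom_chart c)" "c \<in> A \<Longrightarrow> open (ran_chart c)"
  using atlas unfolding smooth_atlas_def by auto

lemma chart_homeo: "c \<in> A \<Longrightarrow> homeomorphism (dom_chart c) (ran_chart c) (coord c) (inv_coord c)"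
  using atlas unfolding smooth_atlas_def by auto

lemma chart_cover: "\<exists>c\<in>A. p \<in> dom_chart c"
  using atlas unfolding smooth_atlas_def by blast

lemma coord_in: "c \<in> A \<Longrightarrow> p \<in> dom_chart c \<Longrightarrow> coord c p \<in> ran_chart c"
  by (simp add: ran_chart_def)

lemma inv_coord_in: "c \<in> A \<Longrightarrow> x \<in> ran_chart c \<Longrightarrow> inv_coord c x \<in> dom_chart c"
  using chart_homeo[of c] unfolding homeomorphism_def by blast

lemma coord_inv: "c \<in> A \<Longrightarrow> x \<in> ran_chart c \<Longrightarrow> coord c (inv_coord c x) = x"
  using chart_homeo[of c] unfolding homeomorphism_def by blast

lemma inv_coord_coord: "c \<in> A \<Longrightarrow> p \<in> dom_chart c \<Longrightarrow> inv_coord c (coord c p) = p"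
  using chart_homeo[of c] unfolding homeomorphism_def by blast

lemma continuous_on_coord: "c \<in> A \<Longrightarrow> continuous_on (dom_chart c) (coord c)"
  using chart_homeo[of c] unfolding homeomorphism_def by blast

lemma continuous_on_inv_coord: "c \<in> A \<Longrightarrow> continuous_on (ran_chart c) (inv_coord c)"
  using chart_homeo[of c] unfolding homeomorphism_def by blast

abbreviation trans_dom :: "('q, 'e) chart \<Rightarrow> ('q, 'e) chart \<Rightarrow> 'e set"
  where "trans_dom c c' \<equiv> coord c ` (dom_chart c \<inter> dom_chart c')"

abbreviation trans :: "('q, 'e) chart \<Rightarrow> ('q, 'e) chart \<Rightarrow> 'e \<Rightarrow> 'e"
  where "trans c c' \<equiv> coord c' \<circ> inv_coord c"

abbreviation Dtrans :: "('q, 'e) chart \<Rightarrow> ('q, 'e) chart \<Rightarrow> 'e \<Rightarrow> 'e \<Rightarrow> 'e"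
  where "Dtrans c c' x \<equiv> frechet_derivative (trans c c') (at x)"

lemma open_trans_dom: assumes "c \<in> A" "c' \<in> A" shows "open (trans_dom c c')"
proof -
  have "openin (top_of_set (dom_chart c)) (dom_chart c \<inter> dom_chart c')"
    using chart_open[OF assms(2)] by (simp add: openin_open_Int)
  then have "openin (top_of_set (ran_chart c)) (trans_dom c c')"
    using homeomorphism_imp_open_map[OF chart_homeo[OF assms(1)]] by blast
  then show ?thesis using chart_open(2)[OF assms(1)] openin_open_trans by blast
qed

lemma smooth_trans: "c \<in> A \<Longrightarrow> c' \<in> A \<Longrightarrow> smooth_on (trans_dom c c') (trans c c')"
  using atlas unfolding smooth_atlas_def by blast

lemma trans_dom_iff: "c \<in> A \<Longrightarrow> x \<in> trans_dom c c' \<longleftrightarrow> x \<in> ran_chart c \<and> inv_coord c x \<in> dom_chart c'"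
proof
  assume c: "c \<in> A" and "x \<in> trans_dom c c'"
  then show "x \<in> ran_chart c \<and> inv_coord c x \<in> dom_chart c'" by (auto simp: inv_coord_coord coord_in)
next
  assume c: "c \<in> A" and "x \<in> ran_chart c \<and> inv_coord c x \<in> dom_chart c'"
  then show "x \<in> trans_dom c c'" using coord_inv[OF c] inv_coord_in[OF c] by (metis IntI image_eqI)
qed

lemma trans_in_ran: "c \<in> A \<Longrightarrow> c' \<in> A \<Longrightarrow> x \<in> trans_dom c c' \<Longrightarrow> trans c c' x \<in> ran_chart c'"
  by (simp add: trans_dom_iff coord_in)

lemma trans_derivative:
  assumes "c \<in> A" "c' \<in> A" "x \<in> trans_dom c c'"
  shows "(trans c c' has_derivative Dtrans c c' x) (at x)"
  by (rule smooth_on_has_derivative[OF smooth_trans open_trans_dom]) (use assms in auto)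

lemma charts_atD: "c \<in> charts_at A p \<Longrightarrow> c \<in> A" "c \<in> charts_at A p \<Longrightarrow> p \<in> dom_chart c"
  by (auto simp: charts_at_def)

lemma transition_has_derivative:
  assumes "c \<in> charts_at A p" "c' \<in> charts_at A p"
  shows "(trans c c' has_derivative transition_deriv c c' p) (at (coord c p))"
  unfolding transition_deriv_def
  by (rule trans_derivative) (use charts_atD assms in auto)

lemma linear_transition:
  "c \<in> charts_at A p \<Longrightarrow> c' \<in> charts_at A p \<Longrightarrow> linear (transition_deriv c c' p)"
  using transition_has_derivative has_derivative_linear by blast

lemma transition_compose:
  assumes c: "c \<in> charts_at A p" "c' \<in> charts_at A p" "c'' \<in> charts_at A p"
  shows "transition_deriv c c'' p u = transition_deriv c' c'' p (transition_deriv c c' p u)"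
proof -
  note cA = c[THEN charts_atD(1)] and cd = c[THEN charts_atD(2)]
  have e: "trans c c' (coord c p) = coord c' p" using inv_coord_coord[OF cA(1) cd(1)] by simp
  have "(trans c' c'' has_derivative transition_deriv c' c'' p) (at (trans c c' (coord c p)))"
    unfolding e by (rule transition_has_derivative[OF c(2,3)])
  from has_derivative_compose[OF transition_has_derivative[OF c(1,2)] this]
  have "((\<lambda>x. trans c' c'' (trans c c' x)) has_derivative (\<lambda>u. transition_deriv c' c'' p (transition_deriv c c' p u))) (at (coord c p))" .
  then have "(trans c c'' has_derivative (\<lambda>u. transition_deriv c' c'' p (transition_deriv c c' p u))) (at (coord c p))"
    by (rule has_derivative_transform_within_open[OF _ open_trans_dom[OF cA(1,2)]])
      (use cA cd in \<open>auto simp: inv_coord_coord\<close>)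
  from has_derivative_unique[OF this transition_has_derivative[OF c(1,3)]] show ?thesis by metis
qed

lemma transition_id:
  assumes c: "c \<in> charts_at A p" shows "transition_deriv c c p u = u"
proof -
  note cA = c[THEN charts_atD(1)] and cd = c[THEN charts_atD(2)]
  have "(trans c c has_derivative (\<lambda>u. u)) (at (coord c p))"
    by (rule has_derivative_transform_within_open[OF has_derivative_ident chart_open(2)[OF cA]])
      (use cA cd in \<open>auto simp: coord_inv coord_in\<close>)
  from has_derivative_unique[OF this transition_has_derivative[OF c c]] show ?thesis by metis
qed

lemma tvec_of_in: "c \<in> charts_at A p \<Longrightarrow> tvec_of A c p u \<in> tangent_space A p"
  unfolding tangent_space_def tvec_of_def by (auto simp: transition_compose[symmetric])

lemma tvec_of_self: "c \<in> charts_at A p \<Longrightarrow> tvec_of A c p u c = u"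
  by (simp add: tvec_of_def transition_id)

lemma tvec_of_component:
  assumes "v \<in> tangent_space A p" "c \<in> charts_at A p" shows "tvec_of A c p (v c) = v"
proof
  fix c' show "tvec_of A c p (v c) c' = v c'"
  proof (cases "c' \<in> charts_at A p")
    case True
    then have "v c' = transition_deriv c c' p (v c)" using assms unfolding tangent_space_def by blast
    then show ?thesis unfolding tvec_of_def if_P[OF True] by (rule sym)
  next
    case False
    then have "v c' = 0" using assms unfolding tangent_space_def by blast
    then show ?thesis using False by (simp add: tvec_of_def)
  qed
qed

end

section \<open>The metric in charts\<close>

locale riem_manifold = manifold A
  for A :: "('q::{t2_space,second_countable_topology}, 'e::euclidean_space) chart set" +
  fixes g :: "('q, 'e) metric" and V :: "'q \<Rightarrow> real"
  assumes metric: "riemannian_metric A g" and pot: "smooth_scalar A V"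
begin

abbreviation "Gc \<equiv> metric_in_chart A g"

lemma metricD:
  assumes "u \<in> tangent_space A p" "v \<in> tangent_space A p" "w \<in> tangent_space A p"
  shows "g p u v = g p v u" "g p (\<lambda>c. u c + r *\<^sub>R v c) w = g p u w + r * g p v w"
    "u \<noteq> (\<lambda>c. 0) \<Longrightarrow> g p u u > 0"
  using metric assms unfolding riemannian_metric_def by blast+

lemma metric_chart:
  assumes "v \<in> tangent_space A p" "w \<in> tangent_space A p" "c \<in> charts_at A p"
  shows "g p v w = Gc c (coord c p) (v c) (w c)"
proof -
  have "inv_coord c (coord c p) = p" using assms(3) charts_atD inv_coord_coord by blast
  then show ?thesis by (simp add: metric_in_chart_def tvec_of_component assms)
qed

text \<open>
  The metric in a chart is bilinear because coordinate vectors are carried linearly to tangent vectors.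
\<close>

lemma riem_pot_chart:
  assumes c: "c \<in> A" shows "riem_pot (ran_chart c) (Gc c) (V \<circ> inv_coord c)"
proof -
  let ?T = "\<lambda>x u. tvec_of A c (inv_coord c x) u"
  have ca: "c \<in> charts_at A (inv_coord c x)" if "x \<in> ran_chart c" for x
    using c that inv_coord_in by (simp add: charts_at_def)
  have T: "?T x u \<in> tangent_space A (inv_coord c x)" if "x \<in> ran_chart c" for x u
    by (rule tvec_of_in[OF ca[OF that]])
  have lin: "?T x (u + r *\<^sub>R v) = (\<lambda>c'. ?T x u c' + r *\<^sub>R ?T x v c')" if x: "x \<in> ran_chart c" for x u v r
  proof
    fix c' show "?T x (u + r *\<^sub>R v) c' = ?T x u c' + r *\<^sub>R ?T x v c'"
    proof (cases "c' \<in> charts_at A (inv_coord c x)")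
      case True
      then show ?thesis using linear_transition[OF ca[OF x] True]
        by (simp add: tvec_of_def linear_add linear_scale)
    qed (simp add: tvec_of_def)
  qed
  have sym: "Gc c x u v = Gc c x v u" if "x \<in> ran_chart c" for x u v
    unfolding metric_in_chart_def using metricD(1) T[OF that] by blast
  have add: "Gc c x (u + r *\<^sub>R v) w = Gc c x u w + r * Gc c x v w" if x: "x \<in> ran_chart c" for x u v w r
    unfolding metric_in_chart_def lin[OF x] using metricD(2) T[OF x] by blast
  have bil: "bilinear (Gc c x)" if x: "x \<in> ran_chart c" for x
  proof -
    have z: "Gc c x 0 w = 0" for w using add[OF x, of 0 1 0 w] by simp
    have 1: "Gc c x (u + v) w = Gc c x u w + Gc c x v w" for u v w using add[OF x, of u 1 v w] by simp
    have 2: "Gc c x (r *\<^sub>R v) w = r *\<^sub>R Gc c x v w" for r v w using add[OF x, of 0 r v w] z by simp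
    show ?thesis unfolding bilinear_def
      using 1 2 sym[OF x] by (auto intro!: linearI)
  qed
  show ?thesis
  proof
    show "open (ran_chart c)" by (rule chart_open(2)[OF c])
    show "bilinear (Gc c x)" if "x \<in> ran_chart c" for x by (rule bil[OF that])
    show "smooth_on (ran_chart c) (\<lambda>x. Gc c x u v)" for u v
      using metric c unfolding riemannian_metric_def by blast
    show "Gc c x u v = Gc c x v u" if "x \<in> ran_chart c" for x u v by (rule sym[OF that])
    show "Gc c x u u > 0" if "x \<in> ran_chart c" "u \<noteq> 0" for x u
    proof -
      have "?T x u \<noteq> (\<lambda>c. 0)" using tvec_of_self[OF ca[OF that(1)], of u] that(2) by auto
      then show ?thesis unfolding metric_in_chart_def using metricD(3) T[OF that(1)] by blast
    qed
    show "smooth_on (ran_chart c) (V \<circ> inv_coord c)" using pot c unfolding smooth_scalar_def by blast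
  qed
qed

lemma christoffel_Chr: "christoffel A g c = Chr (Gc c)"
  by (intro ext) (simp add: christoffel_def Chr_def Dfield_def)

lemma curvature_Rm:
  assumes c: "c \<in> charts_at A p"
  shows "curvature A g p u v w c = Rm (Gc c) (coord c p) (u c) (v c) (w c)"
proof -
  interpret R: riem_pot "ran_chart c" "Gc c" "V \<circ> inv_coord c" by (rule riem_pot_chart[OF charts_atD(1)[OF c]])
  have x: "coord c p \<in> ran_chart c" using charts_atD[OF c] coord_in by blast
  show ?thesis using c
    by (simp add: curvature_def curvature_field_def nabla_def lie_bracket_def christoffel_Chr Rm_def Dfield_def
        frechet_derivative_const R.Chr.bil_simps[OF x])
qed

text \<open>
  By the chain rule the differential of \<open>V\<close>, applied to a tangent vector, has the same value in all charts;
  so the tangent vector that represents it in one chart has the property defining the gradient.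
\<close>

lemma grad_chart:
  assumes c: "c \<in> charts_at A p"
  shows "grad A g V p c = riem_pot.grd (Gc c) (V \<circ> inv_coord c) (coord c p)"
proof -
  interpret R: riem_pot "ran_chart c" "Gc c" "V \<circ> inv_coord c" by (rule riem_pot_chart[OF charts_atD(1)[OF c]])
  have x: "coord c p \<in> ran_chart c" using charts_atD[OF c] coord_in by blast
  have dV: "frechet_derivative (V \<circ> inv_coord c') (at (coord c' p)) (w c') = frechet_derivative (V \<circ> inv_coord c) (at (coord c p)) (w c)"
    if w: "w \<in> tangent_space A p" and c': "c' \<in> charts_at A p" for w c'
  proof -
    interpret R': riem_pot "ran_chart c'" "Gc c'" "V \<circ> inv_coord c'" by (rule riem_pot_chart[OF charts_atD(1)[OF c']])
    have x': "coord c' p \<in> ran_chart c'" using charts_atD[OF c'] coord_in by blast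
    have e: "trans c c' (coord c p) = coord c' p" using inv_coord_coord[OF charts_atD[OF c]] by simp
    have "(V \<circ> inv_coord c' has_derivative frechet_derivative (V \<circ> inv_coord c') (at (coord c' p))) (at (trans c c' (coord c p)))"
      unfolding e by (rule R'.dV[OF x'])
    from has_derivative_compose[OF transition_has_derivative[OF c c'] this]
    have "((\<lambda>y. (V \<circ> inv_coord c') (trans c c' y)) has_derivative
      (\<lambda>u. frechet_derivative (V \<circ> inv_coord c') (at (coord c' p)) (transition_deriv c c' p u))) (at (coord c p))" .
    then have "(V \<circ> inv_coord c has_derivative
      (\<lambda>u. frechet_derivative (V \<circ> inv_coord c') (at (coord c' p)) (transition_deriv c c' p u))) (at (coord c p))"
      by (rule has_derivative_transform_within_open[OF _ open_trans_dom[of c c']])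
        (use charts_atD[OF c] charts_atD[OF c'] in \<open>auto simp: inv_coord_coord\<close>)
    from has_derivative_unique[OF this R.dV[OF x]]
    have "frechet_derivative (V \<circ> inv_coord c) (at (coord c p)) (w c) =
      frechet_derivative (V \<circ> inv_coord c') (at (coord c' p)) (transition_deriv c c' p (w c))" by metis
    moreover have "w c' = transition_deriv c c' p (w c)" using w c c' unfolding tangent_space_def by blast
    ultimately show ?thesis by simp
  qed
  let ?P = "\<lambda>z. z \<in> tangent_space A p \<and> (\<forall>w\<in>tangent_space A p. \<forall>c\<in>charts_at A p.
       g p z w = frechet_derivative (V \<circ> inv_coord c) (at (coord c p)) (w c))"
  have "?P (tvec_of A c p (R.grd (coord c p)))"
    by (auto simp: tvec_of_in[OF c] dV metric_chart[OF tvec_of_in[OF c] _ c] tvec_of_self[OF c] R.grd[OF x])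
  moreover have "z = tvec_of A c p (R.grd (coord c p))" if z: "?P z" for z
  proof -
    have "z c = R.grd (coord c p)"
    proof (rule R.nondeg[OF x])
      fix w
      have "g p z (tvec_of A c p w) = Gc c (coord c p) (z c) w"
        using metric_chart[OF _ tvec_of_in[OF c] c, of z w] z tvec_of_self[OF c] by simp
      moreover have "g p z (tvec_of A c p w) = frechet_derivative (V \<circ> inv_coord c) (at (coord c p)) w"
        using z tvec_of_in[OF c] c tvec_of_self[OF c] by metis
      ultimately show "Gc c (coord c p) (z c) w = Gc c (coord c p) (R.grd (coord c p)) w"
        by (simp add: R.grd[OF x])
    qed
    then show ?thesis using tvec_of_component[of z p c] z c by simp
  qed
  ultimately have "grad A g V p = tvec_of A c p (R.grd (coord c p))"
    unfolding grad_def by (rule the_equality)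
  then show ?thesis by (simp add: tvec_of_self[OF c])
qed

subsection \<open>Change of coordinates of the Christoffel symbols\<close>

definition D2trans :: "('q, 'e) chart \<Rightarrow> ('q, 'e) chart \<Rightarrow> 'e \<Rightarrow> 'e \<Rightarrow> 'e \<Rightarrow> 'e"
  where "D2trans c c' x h u = frechet_derivative (\<lambda>y. Dtrans c c' y u) (at x) h"

lemma Dtrans_derivative:
  assumes "c \<in> A" "c' \<in> A" "x \<in> trans_dom c c'"
  shows "((\<lambda>y. Dtrans c c' y u) has_derivative (\<lambda>h. D2trans c c' x h u)) (at x)"
  unfolding D2trans_def
  by (rule smooth_on_has_derivative[OF smooth_on_frechet_derivative[OF smooth_trans open_trans_dom] open_trans_dom])
    (use assms in auto)

lemma D2trans_sym:
  assumes c: "c \<in> A" "c' \<in> A" and x: "x \<in> trans_dom c c'"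
  shows "D2trans c c' x h u = D2trans c c' x u h"
proof (rule euclidean_eqI)
  fix i :: 'e assume "i \<in> Basis"
  have "D2trans c c' x u h \<bullet> i = D2trans c c' x h u \<bullet> i"
  proof (rule symmetric_second_derivative[OF open_trans_dom[OF c] x, where ?f2.0="\<lambda>u y v. D2trans c c' y v u \<bullet> i" and f="\<lambda>y. trans c c' y \<bullet> i" and f'="\<lambda>y h. Dtrans c c' y h \<bullet> i"])
    fix y assume y: "y \<in> trans_dom c c'"
    show "((\<lambda>y. trans c c' y \<bullet> i) has_derivative (\<lambda>h. Dtrans c c' y h \<bullet> i)) (at y)"
      by (rule has_derivative_inner_left[OF trans_derivative[OF c y]])
    show "((\<lambda>y. Dtrans c c' y u \<bullet> i) has_derivative (\<lambda>v. D2trans c c' y v u \<bullet> i)) (at y)" for u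
      by (rule has_derivative_inner_left[OF Dtrans_derivative[OF c y]])
  next
    fix u v
    have "smooth_on (trans_dom c c') (\<lambda>y. D2trans c c' y v u)"
      unfolding D2trans_def by (intro smooth_on_frechet_derivative smooth_trans open_trans_dom c)
    from smooth_on_continuous[OF this] show "continuous_on (trans_dom c c') (\<lambda>y. D2trans c c' y v u \<bullet> i)"
      by (intro continuous_intros)
  qed
  then show "D2trans c c' x h u \<bullet> i = D2trans c c' x u h \<bullet> i" by simp
qed

lemma metric_change:
  assumes c: "c \<in> A" "c' \<in> A" and x: "x \<in> trans_dom c c'"
  shows "Gc c x u v = Gc c' (trans c c' x) (Dtrans c c' x u) (Dtrans c c' x v)"
proof -
  define p where "p = inv_coord c x"
  have xr: "x \<in> ran_chart c" "p \<in> dom_chart c'" using x trans_dom_iff[OF c(1)] by (auto simp: p_def)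
  then have ca: "c \<in> charts_at A p" "c' \<in> charts_at A p" using c inv_coord_in by (auto simp: charts_at_def p_def)
  have xp: "coord c p = x" using coord_inv[OF c(1) xr(1)] by (simp add: p_def)
  have "Gc c x u v = g p (tvec_of A c p u) (tvec_of A c p v)" by (simp add: metric_in_chart_def p_def)
  also have "\<dots> = Gc c' (coord c' p) (tvec_of A c p u c') (tvec_of A c p v c')"
    by (rule metric_chart) (use tvec_of_in ca in auto)
  also have "\<dots> = Gc c' (trans c c' x) (Dtrans c c' x u) (Dtrans c c' x v)"
    unfolding tvec_of_def if_P[OF ca(2)] transition_deriv_def xp by (simp add: p_def)
  finally show ?thesis .
qed

lemma Dtrans_linear: "c \<in> A \<Longrightarrow> c' \<in> A \<Longrightarrow> x \<in> trans_dom c c' \<Longrightarrow> linear (Dtrans c c' x)"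
  using trans_derivative has_derivative_linear by blast

text \<open>
  The change of coordinates in the opposite direction provides the preimage.
\<close>

lemma Dtrans_surj:
  assumes c: "c \<in> A" "c' \<in> A" and x: "x \<in> trans_dom c c'"
  obtains w where "Dtrans c c' x w = w'"
proof -
  define p where "p = inv_coord c x"
  have xr: "x \<in> ran_chart c" "p \<in> dom_chart c'" using x trans_dom_iff[OF c(1)] by (auto simp: p_def)
  then have ca: "c \<in> charts_at A p" "c' \<in> charts_at A p" using c inv_coord_in by (auto simp: charts_at_def p_def)
  have xp: "coord c p = x" using coord_inv[OF c(1) xr(1)] by (simp add: p_def)
  have "transition_deriv c c' p (transition_deriv c' c p w') = w'"
    using transition_compose[OF ca(2,1,2), of w'] transition_id[OF ca(2)] by simp
  then show ?thesis using that unfolding transition_deriv_def[of c c'] xp by blast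
qed

text \<open>
  Differentiating \<open>metric_change\<close> gives the derivatives of the metric in \<open>c\<close> in terms of those in \<open>c'\<close> and
  of second derivatives of the change of coordinates. In Koszul's formula the latter cancel, by their
  symmetry, except for one term.
\<close>

lemma christoffel_change:
  assumes c: "c \<in> A" "c' \<in> A" and x: "x \<in> trans_dom c c'"
  shows "Dtrans c c' x (Chr (Gc c) x u v) = Chr (Gc c') (trans c c' x) (Dtrans c c' x u) (Dtrans c c' x v) + D2trans c c' x u v"
proof -
  interpret R: riem_pot "ran_chart c" "Gc c" "V \<circ> inv_coord c" by (rule riem_pot_chart[OF c(1)])
  interpret R': riem_pot "ran_chart c'" "Gc c'" "V \<circ> inv_coord c'" by (rule riem_pot_chart[OF c(2)])
  have xr: "x \<in> ran_chart c" using x trans_dom_iff[OF c(1)] by blast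
  let ?y = "trans c c' x" and ?D = "Dtrans c c' x" and ?D2 = "D2trans c c' x"
  have yr: "?y \<in> ran_chart c'" by (rule trans_in_ran[OF c x])
  have dG: "Dfield (Gc c) x h a b = Dfield (Gc c') ?y (?D h) (?D a) (?D b) + Gc c' ?y (?D2 h a) (?D b) + Gc c' ?y (?D a) (?D2 h b)"
    for h a b
  proof -
    have "((\<lambda>y. Gc c' (trans c c' y) (Dtrans c c' y a) (Dtrans c c' y b)) has_derivative
      (\<lambda>h. Dfield (Gc c') ?y (?D h) (?D a) (?D b) + Gc c' ?y (?D2 h a) (?D b) + Gc c' ?y (?D a) (?D2 h b))) (at x)"
      by (rule R'.has_derivative_field[OF UNIV_I yr trans_derivative[OF c x] Dtrans_derivative[OF c x] Dtrans_derivative[OF c x]])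
    then have "((\<lambda>y. Gc c y a b) has_derivative
      (\<lambda>h. Dfield (Gc c') ?y (?D h) (?D a) (?D b) + Gc c' ?y (?D2 h a) (?D b) + Gc c' ?y (?D a) (?D2 h b))) (at x)"
      by (rule has_derivative_transform_within_open[OF _ open_trans_dom[OF c] x]) (simp add: metric_change[OF c])
    from has_derivative_unique[OF this R.Dfield_deriv[OF xr]] show ?thesis by metis
  qed
  show ?thesis
  proof (rule R'.nondeg[OF yr])
    fix w'
    obtain w where w: "Dtrans c c' x w = w'" using Dtrans_surj[OF c x] by blast
    have s: "?D2 v u = ?D2 u v" "?D2 w u = ?D2 u w" "?D2 w v = ?D2 v w" using D2trans_sym[OF c x] by auto
    have "Gc c' ?y (?D (Chr (Gc c) x u v)) w' = Gc c x (Chr (Gc c) x u v) w"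
      unfolding w[symmetric] by (rule metric_change[OF c x, symmetric])
    also have "\<dots> = (Dfield (Gc c) x u v w + Dfield (Gc c) x v u w - Dfield (Gc c) x w u v) / 2"
      by (rule R.Chr_koszul[OF xr])
    also have "\<dots> = (Dfield (Gc c') ?y (?D u) (?D v) w' + Dfield (Gc c') ?y (?D v) (?D u) w' - Dfield (Gc c') ?y w' (?D u) (?D v)) / 2
        + Gc c' ?y (?D2 u v) w'"
      unfolding dG s w
      using R'.sym[OF yr, of "?D v" "?D2 u w"] R'.sym[OF yr, of "?D u" "?D2 v w"] by (simp add: field_simps)
    also have "\<dots> = Gc c' ?y (Chr (Gc c') ?y (?D u) (?D v) + ?D2 u v) w'"
      unfolding R'.Chr_koszul[OF yr, symmetric] by (simp only: R'.bil_simps(1)[OF yr])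
    finally show "Gc c' ?y (?D (Chr (Gc c) x u v)) w' = Gc c' ?y (Chr (Gc c') ?y (?D u) (?D v) + ?D2 u v) w'" .
  qed
qed

end

section \<open>Curves in charts\<close>

lemma vector_derivative_local_cong:
  fixes f f' :: "real \<Rightarrow> 'b::real_normed_vector"
  assumes W: "open W" "t \<in> W" "t \<in> I" and I: "I \<inter> W = I' \<inter> W" and f: "\<And>s. s \<in> I \<inter> W \<Longrightarrow> f s = f' s"
  shows "vector_derivative f (at t within I) = vector_derivative f' (at t within I')"
proof -
  have t: "t \<in> I \<inter> W" using W by blast
  have "(f has_vector_derivative D) (at t within I \<inter> W) \<longleftrightarrow> (f' has_vector_derivative D) (at t within I \<inter> W)" for D
    using has_vector_derivative_transform[OF t] f by metis
  then have "vector_derivative f (at t within I \<inter> W) = vector_derivative f' (at t within I' \<inter> W)"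
    unfolding vector_derivative_def I by simp
  then show ?thesis unfolding at_within_Int_nhd[OF W(1,2)] .
qed

lemma curve_dom_open:
  assumes "continuous_on I \<gamma>" "open (dom_chart c)"
  obtains W where "open W" "{t \<in> I. \<gamma> t \<in> dom_chart c} = I \<inter> W"
proof -
  obtain W where "open W" "W \<inter> I = \<gamma> -` dom_chart c \<inter> I"
    using assms continuous_on_open_invariant by metis
  then show ?thesis using that[of W] by blast
qed

context riem_manifold
begin

abbreviation cdom :: "('q, 'e) chart \<Rightarrow> real set \<Rightarrow> (real \<Rightarrow> 'q) \<Rightarrow> real set"
  where "cdom c I \<gamma> \<equiv> {t \<in> I. \<gamma> t \<in> dom_chart c}"

lemma C_k_curve_continuous: "C_k_curve A k I \<gamma> \<Longrightarrow> continuous_on I \<gamma>"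
  by (simp add: C_k_curve_def)

lemma smooth_curve_continuous: "smooth_curve A I \<gamma> \<Longrightarrow> continuous_on I \<gamma>"
  by (simp add: smooth_curve_def C_k_curve_def)

lemma cdom_fat:
  assumes "continuous_on I \<gamma>" "c \<in> A" "fat I" shows "fat (cdom c I \<gamma>)"
  using curve_dom_open[OF assms(1) chart_open(1)[OF assms(2)]] fat_open_Int[OF assms(3)] by metis

lemma at_within_cdom:
  assumes "continuous_on I \<gamma>" "c \<in> A" "t \<in> cdom c I \<gamma>"
  shows "at t within cdom c I \<gamma> = at t within I"
proof -
  obtain W where W: "open W" "cdom c I \<gamma> = I \<inter> W" using curve_dom_open[OF assms(1) chart_open(1)[OF assms(2)]] by blast
  show ?thesis unfolding W(2) by (rule at_within_Int_nhd[OF W(1)]) (use assms(3) W(2) in blast)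
qed

lemma C_k_curve_coord: "C_k_curve A k I \<gamma> \<Longrightarrow> c \<in> A \<Longrightarrow> C_k_on k (cdom c I \<gamma>) (coord c \<circ> \<gamma>)"
  by (simp add: C_k_curve_def)

lemma C_k_curve_subset:
  assumes g: "C_k_curve A k I \<gamma>" and I': "I' \<subseteq> I" "fat I'"
  shows "C_k_curve A k I' \<gamma>"
proof -
  have c: "continuous_on I' \<gamma>" using g I' continuous_on_subset unfolding C_k_curve_def by blast
  have "C_k_on k (cdom c I' \<gamma>) (coord c \<circ> \<gamma>)" if "c \<in> A" for c
    by (rule C_k_on_subset[OF C_k_curve_coord[OF g that] _ cdom_fat[OF c that I'(2)]]) (use I' in auto)
  then show ?thesis using c by (simp add: C_k_curve_def)
qed

lemma smooth_curve_subset: "smooth_curve A I \<gamma> \<Longrightarrow> I' \<subseteq> I \<Longrightarrow> fat I' \<Longrightarrow> smooth_curve A I' \<gamma>"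
  unfolding smooth_curve_def using C_k_curve_subset by blast

lemma velocity_in_chart:
  assumes g: "C_k_curve A (Suc k) I \<gamma>" and I: "fat I" and c: "c \<in> A"
  shows "\<And>t. t \<in> cdom c I \<gamma> \<Longrightarrow> ((coord c \<circ> \<gamma>) has_vector_derivative velocity A I \<gamma> t c) (at t within cdom c I \<gamma>)"
    and "C_k_on k (cdom c I \<gamma>) (\<lambda>t. velocity A I \<gamma> t c)"
proof -
  note cont = C_k_curve_continuous[OF g]
  note D = C_k_on_Suc_vectorD[OF cdom_fat[OF cont c I] C_k_curve_coord[OF g c]]
  have v: "velocity A I \<gamma> t c = vector_derivative (coord c \<circ> \<gamma>) (at t within cdom c I \<gamma>)" if t: "t \<in> cdom c I \<gamma>" for t
    unfolding at_within_cdom[OF cont c t] using t c by (simp add: velocity_def charts_at_def)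
  show "((coord c \<circ> \<gamma>) has_vector_derivative velocity A I \<gamma> t c) (at t within cdom c I \<gamma>)" if t: "t \<in> cdom c I \<gamma>" for t
    unfolding v[OF t] by (rule D(1)[OF t])
  show "C_k_on k (cdom c I \<gamma>) (\<lambda>t. velocity A I \<gamma> t c)"
    by (rule C_k_on_transfer[OF D(2)]) (use v in simp)
qed

lemma coord_cdom_in: "c \<in> A \<Longrightarrow> (coord c \<circ> \<gamma>) ` cdom c I \<gamma> \<subseteq> ran_chart c"
  by (rule image_subsetI) (simp add: coord_in)

text \<open>
  In each chart the covariant derivative only involves the components in that chart. So it can be iterated
  there, and \<open>cov_deriv\<close> of any family of components makes sense, whether or not it is a tangent vector.
\<close>

lemma cov_deriv_in_chart:
  assumes g: "C_k_curve A (Suc k) I \<gamma>" and I: "fat I" and c: "c \<in> A"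
    and X: "C_k_on (Suc k) (cdom c I \<gamma>) (\<lambda>t. X t c)"
  shows "\<And>t. t \<in> cdom c I \<gamma> \<Longrightarrow> ((\<lambda>t. X t c) has_vector_derivative
      cov_deriv A g I \<gamma> X t c - Chr (Gc c) (coord c (\<gamma> t)) (velocity A I \<gamma> t c) (X t c)) (at t within cdom c I \<gamma>)"
    and "C_k_on k (cdom c I \<gamma>) (\<lambda>t. cov_deriv A g I \<gamma> X t c)"
proof -
  interpret R: riem_pot "ran_chart c" "Gc c" "V \<circ> inv_coord c" by (rule riem_pot_chart[OF c])
  note cont = C_k_curve_continuous[OF g]
  note f = cdom_fat[OF cont c I]
  note D = C_k_on_Suc_vectorD[OF f X]
  have e: "cov_deriv A g I \<gamma> X t c = vector_derivative (\<lambda>t. X t c) (at t within cdom c I \<gamma>)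
     + Chr (Gc c) (coord c (\<gamma> t)) (velocity A I \<gamma> t c) (X t c)" if t: "t \<in> cdom c I \<gamma>" for t
    unfolding at_within_cdom[OF cont c t] using t c by (simp add: cov_deriv_def charts_at_def christoffel_Chr)
  show "((\<lambda>t. X t c) has_vector_derivative
      cov_deriv A g I \<gamma> X t c - Chr (Gc c) (coord c (\<gamma> t)) (velocity A I \<gamma> t c) (X t c)) (at t within cdom c I \<gamma>)"
    if t: "t \<in> cdom c I \<gamma>" for t
    using D(1)[OF t] by (simp add: e[OF t])
  have "C_k_on k (cdom c I \<gamma>) (\<lambda>t. vector_derivative (\<lambda>t. X t c) (at t within cdom c I \<gamma>)
     + Chr (Gc c) ((coord c \<circ> \<gamma>) t) (velocity A I \<gamma> t c) (X t c))"
    by (intro C_k_on_add f D(2) R.Chr.C_k_on_field C_k_on_Suc_imp[OF C_k_curve_coord[OF g c]]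
        velocity_in_chart(2)[OF g I c] C_k_on_Suc_imp[OF X] coord_cdom_in c)
  then show "C_k_on k (cdom c I \<gamma>) (\<lambda>t. cov_deriv A g I \<gamma> X t c)"
    by (rule C_k_on_transfer) (use e in simp)
qed

abbreviation vel :: "real set \<Rightarrow> (real \<Rightarrow> 'q) \<Rightarrow> real \<Rightarrow> ('q, 'e) tvec"
  where "vel I \<gamma> \<equiv> velocity A I \<gamma>"
abbreviation acc :: "real set \<Rightarrow> (real \<Rightarrow> 'q) \<Rightarrow> real \<Rightarrow> ('q, 'e) tvec"
  where "acc I \<gamma> \<equiv> cov_deriv A g I \<gamma> (velocity A I \<gamma>)"
abbreviation jerk :: "real set \<Rightarrow> (real \<Rightarrow> 'q) \<Rightarrow> real \<Rightarrow> ('q, 'e) tvec"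
  where "jerk I \<gamma> \<equiv> cov_deriv A g I \<gamma> (acc I \<gamma>)"

text \<open>
  The left-hand side of the equation of modified cubic polynomials, on an interval that may vary.
\<close>

definition mcp_lhs :: "real set \<Rightarrow> (real \<Rightarrow> 'q) \<Rightarrow> ('q, 'e) chart \<Rightarrow> real \<Rightarrow> 'e"
  where "mcp_lhs I \<gamma> c t = cov_deriv A g I \<gamma> (jerk I \<gamma>) t c
    + curvature A g (\<gamma> t) (acc I \<gamma> t) (vel I \<gamma> t) (vel I \<gamma> t) c + grad A g V (\<gamma> t) c"

lemma modified_cubic_polynomial_iff:
  "modified_cubic_polynomial A g V a b \<gamma> \<longleftrightarrow> smooth_curve A {a..b} \<gamma> \<and>
    (\<forall>t\<in>{a..b}. \<forall>c\<in>charts_at A (\<gamma> t). mcp_lhs {a..b} \<gamma> c t = 0)"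
  by (simp add: modified_cubic_polynomial_def mcp_lhs_def Let_def)

lemma smooth_curve_motion:
  assumes g: "smooth_curve A I \<gamma>" and I: "fat I" and c: "c \<in> A"
  shows "riem_pot.motion (ran_chart c) (Gc c) (V \<circ> inv_coord c) (cdom c I \<gamma>) (coord c \<circ> \<gamma>) (\<lambda>t. vel I \<gamma> t c)
      (\<lambda>t. acc I \<gamma> t c) (\<lambda>t. jerk I \<gamma> t c) (mcp_lhs I \<gamma> c)"
    and "continuous_on (cdom c I \<gamma>) (mcp_lhs I \<gamma> c)"
    and "C_k_on k (cdom c I \<gamma>) (\<lambda>t. vel I \<gamma> t c)" "C_k_on k (cdom c I \<gamma>) (\<lambda>t. acc I \<gamma> t c)"
proof -
  interpret R: riem_pot "ran_chart c" "Gc c" "V \<circ> inv_coord c" by (rule riem_pot_chart[OF c])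
  have gk: "C_k_curve A k I \<gamma>" for k using g by (simp add: smooth_curve_def)
  note cont = smooth_curve_continuous[OF g]
  note f = cdom_fat[OF cont c I]
  have x: "C_k_on k (cdom c I \<gamma>) (coord c \<circ> \<gamma>)" for k by (rule C_k_curve_coord[OF gk c])
  have v: "C_k_on k (cdom c I \<gamma>) (\<lambda>t. vel I \<gamma> t c)" for k by (rule velocity_in_chart(2)[OF gk I c])
  have a: "C_k_on k (cdom c I \<gamma>) (\<lambda>t. acc I \<gamma> t c)" for k by (rule cov_deriv_in_chart(2)[where X="vel I \<gamma>", OF gk I c v])
  have j: "C_k_on k (cdom c I \<gamma>) (\<lambda>t. jerk I \<gamma> t c)" for k by (rule cov_deriv_in_chart(2)[where X="acc I \<gamma>", OF gk I c a])
  have s: "C_k_on k (cdom c I \<gamma>) (\<lambda>t. cov_deriv A g I \<gamma> (jerk I \<gamma>) t c)" for k by (rule cov_deriv_in_chart(2)[where X="jerk I \<gamma>", OF gk I c j])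
  have e: "mcp_lhs I \<gamma> c t = cov_deriv A g I \<gamma> (jerk I \<gamma>) t c
      + Rm (Gc c) (coord c (\<gamma> t)) (acc I \<gamma> t c) (vel I \<gamma> t c) (vel I \<gamma> t c) + R.grd (coord c (\<gamma> t))"
    if "t \<in> cdom c I \<gamma>" for t
  proof -
    have "c \<in> charts_at A (\<gamma> t)" using that c by (simp add: charts_at_def)
    then show ?thesis by (simp add: mcp_lhs_def curvature_Rm grad_chart)
  qed
  show "C_k_on k (cdom c I \<gamma>) (\<lambda>t. vel I \<gamma> t c)" "C_k_on k (cdom c I \<gamma>) (\<lambda>t. acc I \<gamma> t c)" by (rule v a)+
  show "R.motion (cdom c I \<gamma>) (coord c \<circ> \<gamma>) (\<lambda>t. vel I \<gamma> t c) (\<lambda>t. acc I \<gamma> t c) (\<lambda>t. jerk I \<gamma> t c) (mcp_lhs I \<gamma> c)"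
    unfolding R.motion_def
  proof (intro ballI conjI)
    fix t assume t: "t \<in> cdom c I \<gamma>"
    show "(coord c \<circ> \<gamma>) t \<in> ran_chart c" using t c coord_in by auto
    show "((coord c \<circ> \<gamma>) has_vector_derivative vel I \<gamma> t c) (at t within cdom c I \<gamma>)"
      by (rule velocity_in_chart(1)[OF gk I c t])
    show "((\<lambda>t. vel I \<gamma> t c) has_vector_derivative acc I \<gamma> t c - R.\<Gamma> ((coord c \<circ> \<gamma>) t) (vel I \<gamma> t c) (vel I \<gamma> t c)) (at t within cdom c I \<gamma>)"
      using cov_deriv_in_chart(1)[where X="vel I \<gamma>", OF gk I c v t] by simp
    show "((\<lambda>t. acc I \<gamma> t c) has_vector_derivative jerk I \<gamma> t c - R.\<Gamma> ((coord c \<circ> \<gamma>) t) (vel I \<gamma> t c) (acc I \<gamma> t c)) (at t within cdom c I \<gamma>)"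
      using cov_deriv_in_chart(1)[where X="acc I \<gamma>", OF gk I c a t] by simp
    show "((\<lambda>t. jerk I \<gamma> t c) has_vector_derivative mcp_lhs I \<gamma> c t - Rm (Gc c) ((coord c \<circ> \<gamma>) t) (acc I \<gamma> t c) (vel I \<gamma> t c) (vel I \<gamma> t c)
       - R.grd ((coord c \<circ> \<gamma>) t) - R.\<Gamma> ((coord c \<circ> \<gamma>) t) (vel I \<gamma> t c) (jerk I \<gamma> t c)) (at t within cdom c I \<gamma>)"
      using cov_deriv_in_chart(1)[where X="jerk I \<gamma>", OF gk I c j t] by (simp add: e[OF t])
  qed
  have "continuous_on (cdom c I \<gamma>) (\<lambda>t. cov_deriv A g I \<gamma> (jerk I \<gamma>) t c
      + Rm (Gc c) ((coord c \<circ> \<gamma>) t) (acc I \<gamma> t c) (vel I \<gamma> t c) (vel I \<gamma> t c) + R.grd ((coord c \<circ> \<gamma>) t))"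
    by (intro continuous_intros R.continuous_on_Rm C_k_on_continuous[OF s] C_k_on_continuous[OF x] C_k_on_continuous[OF a]
        C_k_on_continuous[OF v] coord_cdom_in c continuous_on_compose2[OF C_k_on_continuous[OF R.grd_C_k] C_k_on_continuous[OF x]])
  then show "continuous_on (cdom c I \<gamma>) (mcp_lhs I \<gamma> c)"
    by (rule continuous_on_eq) (use e in simp)
qed

subsection \<open>Locality\<close>

lemma velocity_local:
  assumes W: "open W" "t \<in> W" "t \<in> I" and I: "I \<inter> W = I' \<inter> W" and \<gamma>: "\<And>s. s \<in> I \<inter> W \<Longrightarrow> \<gamma> s = \<gamma>' s"
  shows "velocity A I \<gamma> t = velocity A I' \<gamma>' t"
proof
  fix c :: "('q, 'e) chart"
  have "\<gamma> t = \<gamma>' t" using W \<gamma> by blast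
  moreover have "vector_derivative (coord c \<circ> \<gamma>) (at t within I) = vector_derivative (coord c \<circ> \<gamma>') (at t within I')"
    by (rule vector_derivative_local_cong[OF W I]) (simp add: \<gamma>)
  ultimately show "velocity A I \<gamma> t c = velocity A I' \<gamma>' t c" by (simp add: velocity_def)
qed

lemma cov_deriv_local:
  assumes W: "open W" "t \<in> W" "t \<in> I" and I: "I \<inter> W = I' \<inter> W" and \<gamma>: "\<And>s. s \<in> I \<inter> W \<Longrightarrow> \<gamma> s = \<gamma>' s"
    and X: "\<And>s. s \<in> I \<inter> W \<Longrightarrow> X s = X' s"
  shows "cov_deriv A g I \<gamma> X t = cov_deriv A g I' \<gamma>' X' t"
proof
  fix c :: "('q, 'e) chart"
  have "\<gamma> t = \<gamma>' t" "X t = X' t" using W \<gamma> X by blast+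
  moreover have "vector_derivative (\<lambda>s. X s c) (at t within I) = vector_derivative (\<lambda>s. X' s c) (at t within I')"
    by (rule vector_derivative_local_cong[OF W I]) (simp add: X)
  moreover have "velocity A I \<gamma> t = velocity A I' \<gamma>' t" by (rule velocity_local[OF W I \<gamma>])
  ultimately show "cov_deriv A g I \<gamma> X t c = cov_deriv A g I' \<gamma>' X' t c" by (simp add: cov_deriv_def)
qed

text \<open>
  Time derivatives are taken within intervals, and the intervals change: from \<open>{0..T}\<close> to the interval of
  a minimization problem, and further to the pieces on which a curve is smooth. At interior times this makes
  no difference.
\<close>

lemma acc_local:
  assumes W: "open W" "t \<in> W" "t \<in> I" and I: "I \<inter> W = I' \<inter> W" and \<gamma>: "\<And>s. s \<in> I \<inter> W \<Longrightarrow> \<gamma> s = \<gamma>' s"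
  shows "acc I \<gamma> t = acc I' \<gamma>' t"
  by (rule cov_deriv_local[OF W I \<gamma>]) (use velocity_local[OF W(1) _ _ I \<gamma>] in auto)

lemma mcp_lhs_local:
  assumes W: "open W" "t \<in> W" "t \<in> I" and I: "I \<inter> W = I' \<inter> W"
  shows "mcp_lhs I \<gamma> c t = mcp_lhs I' \<gamma> c t"
proof -
  have v: "vel I \<gamma> s = vel I' \<gamma> s" if "s \<in> I \<inter> W" for s by (rule velocity_local[OF W(1) _ _ I]) (use that in auto)
  have a: "acc I \<gamma> s = acc I' \<gamma> s" if "s \<in> I \<inter> W" for s by (rule acc_local[OF W(1) _ _ I]) (use that in auto)
  have j: "jerk I \<gamma> s = jerk I' \<gamma> s" if "s \<in> I \<inter> W" for s by (rule cov_deriv_local[OF W(1) _ _ I _ a]) (use that in auto)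
  have "cov_deriv A g I \<gamma> (jerk I \<gamma>) t = cov_deriv A g I' \<gamma> (jerk I' \<gamma>) t"
    by (rule cov_deriv_local[OF W I _ j]) auto
  then show ?thesis using v[of t] a[of t] W by (simp add: mcp_lhs_def)
qed

subsection \<open>The acceleration is a tangent vector\<close>

lemma velocity_change:
  assumes g: "C_k_curve A 1 I \<gamma>" and I: "fat I" and t: "t \<in> I" and c: "c \<in> charts_at A (\<gamma> t)" "c' \<in> charts_at A (\<gamma> t)"
  shows "vel I \<gamma> t c' = Dtrans c c' (coord c (\<gamma> t)) (vel I \<gamma> t c)"
proof -
  note cA = c[THEN charts_atD(1)] and cd = c[THEN charts_atD(2)]
  have g1: "C_k_curve A (Suc 0) I \<gamma>" using g by simp
  note cont = C_k_curve_continuous[OF g]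
  have tc: "t \<in> cdom c I \<gamma>" "t \<in> cdom c' I \<gamma>" using t cd by auto
  have x: "(coord c \<circ> \<gamma> has_vector_derivative vel I \<gamma> t c) (at t within I)"
    using velocity_in_chart(1)[OF g1 I cA(1) tc(1)] unfolding at_within_cdom[OF cont cA(1) tc(1)] .
  have x': "(coord c' \<circ> \<gamma> has_vector_derivative vel I \<gamma> t c') (at t within I)"
    using velocity_in_chart(1)[OF g1 I cA(2) tc(2)] unfolding at_within_cdom[OF cont cA(2) tc(2)] .
  have xd: "coord c (\<gamma> t) \<in> trans_dom c c'" using cd by blast
  have "(trans c c' has_derivative Dtrans c c' (coord c (\<gamma> t))) (at ((coord c \<circ> \<gamma>) t))"
    using trans_derivative[OF cA xd] by simp
  from has_derivative_compose[OF x[unfolded has_vector_derivative_def] this]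
  have "((\<lambda>s. trans c c' ((coord c \<circ> \<gamma>) s)) has_vector_derivative Dtrans c c' (coord c (\<gamma> t)) (vel I \<gamma> t c)) (at t within I)"
    unfolding has_vector_derivative_def by (simp add: linear_scale[OF Dtrans_linear[OF cA xd]])
  then have D: "((\<lambda>s. trans c c' ((coord c \<circ> \<gamma>) s)) has_vector_derivative Dtrans c c' (coord c (\<gamma> t)) (vel I \<gamma> t c)) (at t within cdom c I \<gamma>)"
    unfolding at_within_cdom[OF cont cA(1) tc(1)] .
  have "(coord c' \<circ> \<gamma> has_vector_derivative Dtrans c c' (coord c (\<gamma> t)) (vel I \<gamma> t c)) (at t within cdom c I \<gamma>)"
    by (rule has_vector_derivative_transform[OF tc(1) _ D]) (use cA(1) in \<open>simp add: inv_coord_coord\<close>)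
  then have D': "(coord c' \<circ> \<gamma> has_vector_derivative Dtrans c c' (coord c (\<gamma> t)) (vel I \<gamma> t c)) (at t within I)"
    unfolding at_within_cdom[OF cont cA(1) tc(1)] .
  show ?thesis by (rule vector_derivative_unique_within[OF fat_not_bot[OF I t] x' D'])
qed

text \<open>
  The second derivative of the change of coordinates, which appears when the velocity is differentiated,
  is compensated by \<open>christoffel_change\<close>. Only for tangent vectors can the metric be evaluated in a chart.
\<close>

lemma acc_tangent:
  assumes g: "smooth_curve A I \<gamma>" and I: "fat I" and t: "t \<in> I"
  shows "acc I \<gamma> t \<in> tangent_space A (\<gamma> t)"
  unfolding tangent_space_def
proof (intro CollectI conjI allI impI ballI)
  show "acc I \<gamma> t c = 0" if "c \<notin> charts_at A (\<gamma> t)" for c using that by (simp add: cov_deriv_def)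
  fix c c' assume c: "c \<in> charts_at A (\<gamma> t)" "c' \<in> charts_at A (\<gamma> t)"
  note cA = c[THEN charts_atD(1)] and cd = c[THEN charts_atD(2)]
  interpret R: riem_pot "ran_chart c" "Gc c" "V \<circ> inv_coord c" by (rule riem_pot_chart[OF cA(1)])
  have gk: "C_k_curve A k I \<gamma>" for k using g by (simp add: smooth_curve_def)
  note cont = smooth_curve_continuous[OF g]
  have tc: "t \<in> cdom c I \<gamma>" "t \<in> cdom c' I \<gamma>" using t cd by auto
  let ?x = "coord c (\<gamma> t)" and ?v = "vel I \<gamma> t c"
  have xd: "?x \<in> trans_dom c c'" using cd by blast
  have lin: "linear (Dtrans c c' y)" if "y \<in> trans_dom c c'" for y by (rule Dtrans_linear[OF cA that])
  define a where "a = acc I \<gamma> t c - R.\<Gamma> ?x ?v ?v"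
  have x: "(coord c \<circ> \<gamma> has_vector_derivative ?v) (at t within I)"
    using velocity_in_chart(1)[OF gk I cA(1) tc(1)] unfolding at_within_cdom[OF cont cA(1) tc(1)] .
  have v: "((\<lambda>t. vel I \<gamma> t c) has_vector_derivative a) (at t within I)"
    using cov_deriv_in_chart(1)[where X="vel I \<gamma>", OF gk I cA(1) velocity_in_chart(2)[OF gk I cA(1)] tc(1)]
    unfolding at_within_cdom[OF cont cA(1) tc(1)] a_def .
  have v': "((\<lambda>t. vel I \<gamma> t c') has_vector_derivative acc I \<gamma> t c' - Chr (Gc c') (coord c' (\<gamma> t)) (vel I \<gamma> t c') (vel I \<gamma> t c')) (at t within I)"
    using cov_deriv_in_chart(1)[where X="vel I \<gamma>", OF gk I cA(2) velocity_in_chart(2)[OF gk I cA(2)] tc(2)]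
    unfolding at_within_cdom[OF cont cA(2) tc(2)] .
  have v'eq: "vel I \<gamma> s c' = Dtrans c c' (coord c (\<gamma> s)) (vel I \<gamma> s c)" if "s \<in> I" "\<gamma> s \<in> dom_chart c" "\<gamma> s \<in> dom_chart c'" for s
    by (rule velocity_change[OF gk I]) (use that cA in \<open>auto simp: charts_at_def\<close>)
  have expand: "Dtrans c c' y u = (\<Sum>i\<in>Basis. (u \<bullet> i) *\<^sub>R Dtrans c c' y i)" if "y \<in> trans_dom c c'" for y u
  proof -
    have "Dtrans c c' y u = Dtrans c c' y (\<Sum>i\<in>Basis. (u \<bullet> i) *\<^sub>R i)" by (simp add: euclidean_representation)
    also have "\<dots> = (\<Sum>i\<in>Basis. (u \<bullet> i) *\<^sub>R Dtrans c c' y i)" by (simp add: linear_sum[OF lin[OF that]] linear_scale[OF lin[OF that]])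
    finally show ?thesis .
  qed
  have Di: "((\<lambda>s. Dtrans c c' ((coord c \<circ> \<gamma>) s) i) has_vector_derivative D2trans c c' ?x ?v i) (at t within I)" for i
  proof -
    have "((\<lambda>y. Dtrans c c' y i) has_derivative (\<lambda>h. D2trans c c' ?x h i)) (at ((coord c \<circ> \<gamma>) t))"
      using Dtrans_derivative[OF cA xd] by simp
    from has_derivative_compose[OF x[unfolded has_vector_derivative_def] this]
    show ?thesis unfolding has_vector_derivative_def
      by (simp add: linear_scale[OF has_derivative_linear[OF Dtrans_derivative[OF cA xd]]])
  qed
  have "((\<lambda>s. \<Sum>i\<in>Basis. (vel I \<gamma> s c \<bullet> i) *\<^sub>R Dtrans c c' ((coord c \<circ> \<gamma>) s) i) has_vector_derivative
      (\<Sum>i\<in>Basis. (?v \<bullet> i) *\<^sub>R D2trans c c' ?x ?v i + (a \<bullet> i) *\<^sub>R Dtrans c c' ((coord c \<circ> \<gamma>) t) i)) (at t within I)"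
  proof (rule has_vector_derivative_sum)
    fix i :: 'e
    have "((\<lambda>s. vel I \<gamma> s c \<bullet> i) has_real_derivative a \<bullet> i) (at t within I)"
      using has_derivative_inner_left[OF v[unfolded has_vector_derivative_def]]
      by (simp add: has_field_derivative_def mult_commute_abs)
    from has_vector_derivative_scaleR[OF this Di]
    show "((\<lambda>s. (vel I \<gamma> s c \<bullet> i) *\<^sub>R Dtrans c c' ((coord c \<circ> \<gamma>) s) i) has_vector_derivative
      (?v \<bullet> i) *\<^sub>R D2trans c c' ?x ?v i + (a \<bullet> i) *\<^sub>R Dtrans c c' ((coord c \<circ> \<gamma>) t) i) (at t within I)" .
  qed
  moreover have "(\<Sum>i\<in>Basis. (?v \<bullet> i) *\<^sub>R D2trans c c' ?x ?v i + (a \<bullet> i) *\<^sub>R Dtrans c c' ((coord c \<circ> \<gamma>) t) i)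
     = D2trans c c' ?x ?v ?v + Dtrans c c' ?x a"
  proof -
    have l: "linear (\<lambda>h. D2trans c c' ?x h ?v)" using Dtrans_derivative[OF cA xd] has_derivative_linear by blast
    have "D2trans c c' ?x ?v ?v = D2trans c c' ?x (\<Sum>i\<in>Basis. (?v \<bullet> i) *\<^sub>R i) ?v" by (simp add: euclidean_representation)
    also have "\<dots> = (\<Sum>i\<in>Basis. (?v \<bullet> i) *\<^sub>R D2trans c c' ?x i ?v)" by (simp add: linear_sum[OF l] linear_scale[OF l])
    also have "\<dots> = (\<Sum>i\<in>Basis. (?v \<bullet> i) *\<^sub>R D2trans c c' ?x ?v i)" using D2trans_sym[OF cA xd] by simp
    finally show ?thesis using expand[OF xd, of a] by (simp add: sum.distrib)
  qed
  ultimately have D1: "((\<lambda>s. \<Sum>i\<in>Basis. (vel I \<gamma> s c \<bullet> i) *\<^sub>R Dtrans c c' ((coord c \<circ> \<gamma>) s) i) has_vector_derivative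
      D2trans c c' ?x ?v ?v + Dtrans c c' ?x a) (at t within I)" by simp
  obtain W where W: "open W" "cdom c I \<gamma> = I \<inter> W" using curve_dom_open[OF cont chart_open(1)[OF cA(1)]] by blast
  obtain W' where W': "open W'" "cdom c' I \<gamma> = I \<inter> W'" using curve_dom_open[OF cont chart_open(1)[OF cA(2)]] by blast
  have tW: "t \<in> I \<inter> (W \<inter> W')" using tc W W' by auto
  have atW: "at t within (I \<inter> (W \<inter> W')) = at t within I"
    by (rule at_within_Int_nhd) (use W W' tW in auto)
  have "((\<lambda>s. vel I \<gamma> s c') has_vector_derivative D2trans c c' ?x ?v ?v + Dtrans c c' ?x a) (at t within I \<inter> (W \<inter> W'))"
  proof (rule has_vector_derivative_transform[OF tW _ D1[folded atW]])
    fix s assume s: "s \<in> I \<inter> (W \<inter> W')"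
    then have "s \<in> cdom c I \<gamma>" "s \<in> cdom c' I \<gamma>" unfolding W W' by auto
    then have ss: "s \<in> I" "\<gamma> s \<in> dom_chart c" "\<gamma> s \<in> dom_chart c'" by auto
    then have "coord c (\<gamma> s) \<in> trans_dom c c'" by blast
    from expand[OF this, of "vel I \<gamma> s c"] v'eq[OF ss]
    show "vel I \<gamma> s c' = (\<Sum>i\<in>Basis. (vel I \<gamma> s c \<bullet> i) *\<^sub>R Dtrans c c' ((coord c \<circ> \<gamma>) s) i)" by simp
  qed
  then have D2: "((\<lambda>s. vel I \<gamma> s c') has_vector_derivative D2trans c c' ?x ?v ?v + Dtrans c c' ?x a) (at t within I)"
    unfolding atW .
  have e: "trans c c' ?x = coord c' (\<gamma> t)" using inv_coord_coord[OF cA(1) cd(1)] by simp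
  have "acc I \<gamma> t c' = D2trans c c' ?x ?v ?v + Dtrans c c' ?x a + Chr (Gc c') (coord c' (\<gamma> t)) (vel I \<gamma> t c') (vel I \<gamma> t c')"
    using vector_derivative_unique_within[OF fat_not_bot[OF I t] v' D2] by (simp add: algebra_simps)
  also have "\<dots> = Dtrans c c' ?x a + (Chr (Gc c') (trans c c' ?x) (Dtrans c c' ?x ?v) (Dtrans c c' ?x ?v) + D2trans c c' ?x ?v ?v)"
    unfolding e v'eq[OF t cd] by simp
  also have "\<dots> = Dtrans c c' ?x a + Dtrans c c' ?x (R.\<Gamma> ?x ?v ?v)"
    using christoffel_change[OF cA xd, of ?v ?v] by simp
  also have "\<dots> = Dtrans c c' ?x (acc I \<gamma> t c)" unfolding a_def by (simp add: linear_diff[OF lin[OF xd]])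
  finally show "acc I \<gamma> t c' = transition_deriv c c' (\<gamma> t) (acc I \<gamma> t c)" by (simp add: transition_deriv_def)
qed

end

section \<open>Admissible curves and their action\<close>

context riem_manifold
begin

text \<open>
  A description of piecewise smooth curves by a set of break points, without an order: it is stable under
  adding break points and under passing to a subinterval.
\<close>

definition pieces :: "real set \<Rightarrow> real \<Rightarrow> real \<Rightarrow> (real \<Rightarrow> 'q) \<Rightarrow> bool"
  where "pieces S a b \<gamma> \<longleftrightarrow> finite S \<and>
    (\<forall>u v. a \<le> u \<and> u < v \<and> v \<le> b \<and> {u<..<v} \<inter> S = {} \<longrightarrow> smooth_curve A {u..v} \<gamma>)"

lemma piecesD: "pieces S a b \<gamma> \<Longrightarrow> a \<le> u \<Longrightarrow> u < v \<Longrightarrow> v \<le> b \<Longrightarrow> {u<..<v} \<inter> S = {} \<Longrightarrow> smooth_curve A {u..v} \<gamma>"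
  unfolding pieces_def by blast

lemma pieces_finite: "pieces S a b \<gamma> \<Longrightarrow> finite S"
  unfolding pieces_def by blast

lemma piecewise_smooth_pieces:
  assumes "piecewise_smooth_curve A a b \<gamma>" shows "\<exists>S. pieces S a b \<gamma>"
proof -
  obtain n :: nat and s where s: "s 0 = a" "s n = b" "\<And>i. i < n \<Longrightarrow> s i < s (Suc i) \<and> smooth_curve A {s i..s (Suc i)} \<gamma>"
    using assms unfolding piecewise_smooth_curve_def by blast
  have "smooth_curve A {u..v} \<gamma>" if uv: "a \<le> u" "u < v" "v \<le> b" "{u<..<v} \<inter> s ` {..n} = {}" for u v
  proof -
    define N where "N = {i. i \<le> n \<and> s i \<le> u}"
    have N: "finite N" "0 \<in> N" using s(1) uv by (auto simp: N_def)
    define i where "i = Max N"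
    have i: "i \<in> N" using Max_in[OF N(1)] N(2) unfolding i_def by blast
    have "i \<noteq> n" using i s(2) uv by (auto simp: N_def)
    then have ilt: "i < n" using i by (auto simp: N_def)
    have "Suc i \<notin> N" using Max_ge[OF N(1), of "Suc i"] unfolding i_def by auto
    then have "u < s (Suc i)" using ilt by (auto simp: N_def)
    moreover have "s (Suc i) \<in> s ` {..n}" using ilt by simp
    ultimately have "v \<le> s (Suc i)" using uv(4) by (meson disjoint_iff greaterThanLessThan_iff not_le)
    then have "{u..v} \<subseteq> {s i..s (Suc i)}" using i by (auto simp: N_def)
    then show ?thesis using smooth_curve_subset s(3)[OF ilt] fat_Icc[OF uv(2)] by blast
  qed
  then have "pieces (s ` {..n}) a b \<gamma>" unfolding pieces_def by blast
  then show ?thesis by blast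
qed

lemma pieces_piecewise_smooth:
  assumes ab: "a < b" and S: "pieces S a b \<gamma>" shows "piecewise_smooth_curve A a b \<gamma>"
proof (rule pieces_induct[OF pieces_finite[OF S] ab, of "\<lambda>u v. piecewise_smooth_curve A u v \<gamma>"])
  fix u v assume uv: "a \<le> u" "u < v" "v \<le> b" "{u<..<v} \<inter> S = {}"
  show "piecewise_smooth_curve A u v \<gamma>" unfolding piecewise_smooth_curve_def
    by (rule exI[of _ 1], rule exI[of _ "\<lambda>i. if i = 0 then u else v"]) (use piecesD[OF S uv] uv in auto)
next
  fix u m v assume "piecewise_smooth_curve A u m \<gamma>" "piecewise_smooth_curve A m v \<gamma>"
  then obtain n1 s1 n2 s2 where s: "s1 0 = u" "s1 n1 = m" "s2 0 = m" "s2 n2 = v"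
    and s1: "\<And>i. i < n1 \<Longrightarrow> s1 i < s1 (Suc i) \<and> smooth_curve A {s1 i..s1 (Suc i)} \<gamma>"
    and s2: "\<And>i. i < n2 \<Longrightarrow> s2 i < s2 (Suc i) \<and> smooth_curve A {s2 i..s2 (Suc i)} \<gamma>"
    unfolding piecewise_smooth_curve_def by blast
  define s where "s i = (if i \<le> n1 then s1 i else s2 (i - n1))" for i
  have sge: "s i = s2 (i - n1)" if "n1 \<le> i" for i using that s by (auto simp: s_def)
  have "s i < s (Suc i) \<and> smooth_curve A {s i..s (Suc i)} \<gamma>" if "i < n1 + n2" for i
  proof (cases "i < n1")
    case True then show ?thesis using s1[OF True] by (simp add: s_def)
  next
    case False
    then have "s i = s2 (i - n1)" "s (Suc i) = s2 (Suc (i - n1))" using sge[of i] sge[of "Suc i"] by (auto simp: Suc_diff_le)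
    then show ?thesis using s2[of "i - n1"] False that by auto
  qed
  moreover have "s 0 = u" "s (n1 + n2) = v" using s sge[of "n1 + n2"] by (auto simp: s_def)
  ultimately show "piecewise_smooth_curve A u v \<gamma>" unfolding piecewise_smooth_curve_def by blast
qed

definition J_integrand :: "real set \<Rightarrow> (real \<Rightarrow> 'q) \<Rightarrow> real \<Rightarrow> real"
  where "J_integrand I \<gamma> t = g (\<gamma> t) (acc I \<gamma> t) (acc I \<gamma> t) / 2 + V (\<gamma> t)"

lemma J_functional_integral: "J_functional A g V a b \<gamma> = integral {a..b} (J_integrand {a..b} \<gamma>)"
  by (simp add: J_functional_def J_integrand_def[abs_def] Let_def)

abbreviation Lagc :: "('q, 'e) chart \<Rightarrow> 'e \<Rightarrow> 'e \<Rightarrow> real"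
  where "Lagc c \<equiv> riem_pot.Lag (Gc c) (V \<circ> inv_coord c)"

lemma J_integrand_chart:
  assumes g: "smooth_curve A I \<gamma>" "fat I" and c: "c \<in> A" and t: "t \<in> cdom c I \<gamma>"
  shows "J_integrand I \<gamma> t = Lagc c (coord c (\<gamma> t)) (acc I \<gamma> t c)"
proof -
  interpret R: riem_pot "ran_chart c" "Gc c" "V \<circ> inv_coord c" by (rule riem_pot_chart[OF c])
  have a: "acc I \<gamma> t \<in> tangent_space A (\<gamma> t)" by (rule acc_tangent[OF g]) (use t in auto)
  have ca: "c \<in> charts_at A (\<gamma> t)" using c t by (auto simp: charts_at_def)
  show ?thesis unfolding J_integrand_def R.Lag_def metric_chart[OF a a ca]
    using inv_coord_coord[OF charts_atD[OF ca]] by simp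
qed

lemma J_integrand_continuous:
  assumes g: "smooth_curve A I \<gamma>" "fat I" shows "continuous_on I (J_integrand I \<gamma>)"
  unfolding continuous_on_eq_continuous_within
proof
  fix t assume t: "t \<in> I"
  obtain c where c: "c \<in> A" "\<gamma> t \<in> dom_chart c" using chart_cover by blast
  interpret R: riem_pot "ran_chart c" "Gc c" "V \<circ> inv_coord c" by (rule riem_pot_chart[OF c(1)])
  note m = smooth_curve_motion[OF g c(1)]
  have tc: "t \<in> cdom c I \<gamma>" using t c by simp
  have x: "continuous_on (cdom c I \<gamma>) (coord c \<circ> \<gamma>)" by (rule R.motion_continuous(1)[OF m(1)])
  have gc: "continuous_on (cdom c I \<gamma>) (\<lambda>t. Gc c ((coord c \<circ> \<gamma>) t) (acc I \<gamma> t c) (acc I \<gamma> t c))"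
    by (intro R.continuous_on_field x C_k_on_continuous[OF m(4)] coord_cdom_in c)
  have vc: "continuous_on (cdom c I \<gamma>) (\<lambda>t. (V \<circ> inv_coord c) ((coord c \<circ> \<gamma>) t))"
    by (rule continuous_on_compose2[OF smooth_on_continuous[OF R.smooth_V] x coord_cdom_in[OF c(1)]])
  have "continuous_on (cdom c I \<gamma>) (\<lambda>t. Lagc c ((coord c \<circ> \<gamma>) t) (acc I \<gamma> t c))"
    unfolding R.Lag_def by (rule continuous_on_add[OF continuous_on_divide[OF gc continuous_on_const] vc]) simp
  then have "continuous_on (cdom c I \<gamma>) (J_integrand I \<gamma>)"
    by (rule continuous_on_eq) (simp add: J_integrand_chart[OF g c(1)])
  then have "continuous (at t within cdom c I \<gamma>) (J_integrand I \<gamma>)" using tc by (simp add: continuous_on_eq_continuous_within)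
  then show "continuous (at t within I) (J_integrand I \<gamma>)"
    unfolding at_within_cdom[OF smooth_curve_continuous[OF g(1)] c(1) tc] .
qed

lemma J_integrand_nonneg:
  assumes g: "smooth_curve A I \<gamma>" "fat I" and V: "\<And>p. V p \<ge> 0" and t: "t \<in> I" shows "J_integrand I \<gamma> t \<ge> 0"
proof -
  obtain c where c: "c \<in> A" "\<gamma> t \<in> dom_chart c" using chart_cover by blast
  interpret R: riem_pot "ran_chart c" "Gc c" "V \<circ> inv_coord c" by (rule riem_pot_chart[OF c(1)])
  have "coord c (\<gamma> t) \<in> ran_chart c" using c coord_in by blast
  from R.nonneg[OF this, of "acc I \<gamma> t c"] show ?thesis
    using J_integrand_chart[OF g c(1)] t c V by (simp add: R.Lag_def)
qed

lemma J_integrand_local: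
  assumes W: "open W" "t \<in> W" "t \<in> I" and I: "I \<inter> W = I' \<inter> W" and \<gamma>: "\<And>s. s \<in> I \<inter> W \<Longrightarrow> \<gamma> s = \<gamma>' s"
  shows "J_integrand I \<gamma> t = J_integrand I' \<gamma>' t"
  using acc_local[OF W I \<gamma>] \<gamma>[of t] W by (simp add: J_integrand_def)

lemma J_integrand_piece: "a \<le> u \<Longrightarrow> v \<le> b \<Longrightarrow> t \<in> {u<..<v} \<Longrightarrow> J_integrand {a..b} \<gamma> t = J_integrand {u..v} \<gamma> t"
  by (rule J_integrand_local[of "{u<..<v}"]) auto

lemma J_integrand_integrable:
  assumes ab: "a < b" and S: "pieces S a b \<gamma>" shows "J_integrand {a..b} \<gamma> integrable_on {a..b}"
proof (rule pieces_induct[OF pieces_finite[OF S] ab, of "\<lambda>u v. J_integrand {a..b} \<gamma> integrable_on {u..v}"])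
  fix u v assume uv: "a \<le> u" "u < v" "v \<le> b" "{u<..<v} \<inter> S = {}"
  show "J_integrand {a..b} \<gamma> integrable_on {u..v}"
  proof (rule integrable_spike_finite[of "{u, v}"])
    show "J_integrand {u..v} \<gamma> integrable_on {u..v}"
      by (rule integrable_continuous_real[OF J_integrand_continuous[OF piecesD[OF S uv] fat_Icc[OF uv(2)]]])
    show "J_integrand {a..b} \<gamma> t = J_integrand {u..v} \<gamma> t" if "t \<in> {u..v} - {u, v}" for t
      by (rule J_integrand_piece) (use uv that in auto)
  qed simp
next
  fix u s v assume "u < s" "s < v" "J_integrand {a..b} \<gamma> integrable_on {u..s}" "J_integrand {a..b} \<gamma> integrable_on {s..v}"
  then show "J_integrand {a..b} \<gamma> integrable_on {u..v}"
    by (intro Henstock_Kurzweil_Integration.integrable_combine[of u s v]) auto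
qed

lemma pieces_near:
  assumes S: "pieces S a b \<gamma>" and t: "t \<in> {p<..<q} - S" and pq: "a \<le> p" "q \<le> b"
  obtains u v where "p \<le> u" "u < t" "t < v" "v \<le> q" "{u<..<v} \<inter> S = {}" "smooth_curve A {u..v} \<gamma>"
proof -
  have "open ({p<..<q} - S)" using pieces_finite[OF S] by (intro open_Diff finite_imp_closed) auto
  then obtain d where d: "d > 0" "ball t d \<subseteq> {p<..<q} - S" using t openE by blast
  have sub: "{t - d<..<t + d} \<subseteq> {p<..<q} - S" using d by (auto simp: ball_def dist_real_def subset_iff)
  define u v where "u = t - d / 2" and "v = t + d / 2"
  have uv: "{u..v} \<subseteq> {p<..<q} - S" using sub d(1) by (auto simp: u_def v_def subset_iff)
  have lt: "u < t" "t < v" using d(1) by (auto simp: u_def v_def)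
  then have "u \<in> {u..v}" "v \<in> {u..v}" by auto
  then have "u \<in> {p<..<q}" "v \<in> {p<..<q}" using uv by blast+
  then have pu: "p \<le> u" "v \<le> q" by auto
  have "{u<..<v} \<subseteq> {u..v}" by auto
  then have uvS: "{u<..<v} \<inter> S = {}" using uv by blast
  show ?thesis by (rule that[OF pu(1) lt pu(2) uvS piecesD[OF S _ _ _ uvS]]) (use pu pq lt in auto)
qed

text \<open>
  The integrand is nonnegative off the break points, where its value is arbitrary.
\<close>

lemma J_integrand_integral_mono:
  assumes ab: "a < b" and S: "pieces S a b \<gamma>" and V: "\<And>p. V p \<ge> 0" and pq: "a \<le> p" "q \<le> b"
  shows "integral {p..q} (J_integrand {a..b} \<gamma>) \<le> integral {a..b} (J_integrand {a..b} \<gamma>)"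
proof -
  let ?S = "S \<union> {a, b}"
  define f where "f t = (if t \<in> ?S then 0 else J_integrand {a..b} \<gamma> t)" for t
  have fin: "finite ?S" using pieces_finite[OF S] by simp
  have e: "integral T f = integral T (J_integrand {a..b} \<gamma>)" for T
    by (rule integral_spike[of ?S]) (use fin in \<open>auto simp: f_def intro: negligible_finite\<close>)
  have "J_integrand {a..b} \<gamma> integrable_on {a..b}" by (rule J_integrand_integrable[OF ab S])
  then have fi: "f integrable_on {a..b}" by (rule integrable_spike_finite[OF fin, rotated]) (auto simp: f_def)
  have fn: "f t \<ge> 0" if t: "t \<in> {a..b}" for t
  proof (cases "t \<in> ?S")
    case False
    then have t': "t \<in> {a<..<b} - S" using t by auto
    obtain u v where uv: "a \<le> u" "u < t" "t < v" "v \<le> b" "smooth_curve A {u..v} \<gamma>"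
      using pieces_near[OF S t'] by blast
    have "J_integrand {a..b} \<gamma> t = J_integrand {u..v} \<gamma> t" by (rule J_integrand_piece) (use uv in auto)
    moreover have "J_integrand {u..v} \<gamma> t \<ge> 0" by (rule J_integrand_nonneg[OF uv(5) _ V]) (use uv in \<open>auto intro: fat_Icc\<close>)
    ultimately show ?thesis using False by (simp add: f_def)
  qed (simp add: f_def)
  have "integral {p..q} f \<le> integral {a..b} f"
    by (rule integral_subset_le[OF _ integrable_on_subinterval[OF fi] fi]) (use fn pq in auto)
  then show ?thesis by (simp add: e)
qed

text \<open>
  All that the analysis in a chart has to know about an admissible curve. The function \<open>w\<close> is the second
  derivative of the coordinates, written in terms of the acceleration so that it is defined everywhere.
\<close>

lemma piecewise_curve_in_chart:
  assumes g: "C_k_curve A 1 {a..b} \<gamma>" and S: "pieces S a b \<gamma>" and c: "c \<in> A"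
    and pq: "a \<le> p" "p < q" "q \<le> b" and dom: "\<gamma> ` {p..q} \<subseteq> dom_chart c"
  defines "y \<equiv> coord c \<circ> \<gamma>" and "u \<equiv> \<lambda>t. vel {a..b} \<gamma> t c"
    and "w \<equiv> \<lambda>t. acc {a..b} \<gamma> t c - Chr (Gc c) (coord c (\<gamma> t)) (vel {a..b} \<gamma> t c) (vel {a..b} \<gamma> t c)"
  shows "\<And>t. t \<in> {p..q} \<Longrightarrow> (y has_vector_derivative u t) (at t within {p..q})"
    and "continuous_on {p..q} u"
    and "\<And>t. t \<in> {p<..<q} - S \<Longrightarrow> (u has_vector_derivative w t) (at t)"
    and "pw_cont p q w"
    and "\<And>t. t \<in> {p<..<q} - S \<Longrightarrow> J_integrand {a..b} \<gamma> t = Lagc c (y t) (acc {a..b} \<gamma> t c)"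
proof -
  interpret R: riem_pot "ran_chart c" "Gc c" "V \<circ> inv_coord c" by (rule riem_pot_chart[OF c])
  have I: "fat {a..b}" by (rule fat_Icc) (use pq in simp)
  have g1: "C_k_curve A (Suc 0) {a..b} \<gamma>" using g by simp
  have sub: "{p..q} \<subseteq> cdom c {a..b} \<gamma>" using dom pq by auto
  show "(y has_vector_derivative u t) (at t within {p..q})" if "t \<in> {p..q}" for t
    unfolding y_def u_def
    by (rule has_vector_derivative_within_subset[OF velocity_in_chart(1)[OF g1 I c] sub]) (use that sub in blast)
  show "continuous_on {p..q} u"
    unfolding u_def using C_k_on_continuous[OF velocity_in_chart(2)[OF g1 I c]] sub by (rule continuous_on_subset)
  have piece: "((\<lambda>s. vel I' \<gamma> s c) has_vector_derivative acc I' \<gamma> t c - Chr (Gc c) (coord c (\<gamma> t)) (vel I' \<gamma> t c) (vel I' \<gamma> t c)) (at t within I')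
      \<and> J_integrand I' \<gamma> t = Lagc c (y t) (acc I' \<gamma> t c)"
    if I': "I' = {u'..v'}" "p \<le> u'" "u' < v'" "v' \<le> q" "smooth_curve A I' \<gamma>" and t: "t \<in> I'" for I' u' v' t
  proof -
    have f: "fat I'" unfolding I' by (rule fat_Icc[OF I'(3)])
    have "I' \<subseteq> {p..q}" using I' by auto
    then have cd: "cdom c I' \<gamma> = I'" using dom by blast
    show ?thesis
      using R.motionD(3)[OF smooth_curve_motion(1)[OF I'(5) f c], of t] J_integrand_chart[OF I'(5) f c, of t] t
      unfolding cd y_def by simp
  qed
  have eqs: "vel {a..b} \<gamma> s = vel {u'..v'} \<gamma> s \<and> acc {a..b} \<gamma> s = acc {u'..v'} \<gamma> s"
    if "p \<le> u'" "v' \<le> q" "s \<in> {u'<..<v'}" for u' v' s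
    using velocity_local[of "{u'<..<v'}" s "{a..b}" "{u'..v'}" \<gamma> \<gamma>] acc_local[of "{u'<..<v'}" s "{a..b}" "{u'..v'}" \<gamma> \<gamma>] that pq
    by fastforce
  show "(u has_vector_derivative w t) (at t)" if t: "t \<in> {p<..<q} - S" for t
  proof -
    obtain u' v' where uv: "p \<le> u'" "u' < t" "t < v'" "v' \<le> q" "{u'<..<v'} \<inter> S = {}" "smooth_curve A {u'..v'} \<gamma>"
      using pieces_near[OF S t pq(1,3)] by blast
    have ti: "t \<in> {u'<..<v'}" using uv by simp
    have "((\<lambda>s. vel {u'..v'} \<gamma> s c) has_vector_derivative w t) (at t within {u'..v'})"
      using piece[OF refl uv(1) _ uv(4,6), of t] uv eqs[OF uv(1,4) ti] by (simp add: w_def)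
    then have "((\<lambda>s. vel {u'..v'} \<gamma> s c) has_vector_derivative w t) (at t)"
      by (rule has_vector_derivative_at_interior[OF ti])
    then show ?thesis
      by (rule has_vector_derivative_transform_within_open[OF _ _ ti]) (use eqs[OF uv(1,4)] in \<open>auto simp: u_def\<close>)
  qed
  show "J_integrand {a..b} \<gamma> t = Lagc c (y t) (acc {a..b} \<gamma> t c)" if t: "t \<in> {p<..<q} - S" for t
  proof -
    obtain u' v' where uv: "p \<le> u'" "u' < t" "t < v'" "v' \<le> q" "{u'<..<v'} \<inter> S = {}" "smooth_curve A {u'..v'} \<gamma>"
      using pieces_near[OF S t pq(1,3)] by blast
    have ti: "t \<in> {u'<..<v'}" using uv by simp
    have "J_integrand {a..b} \<gamma> t = J_integrand {u'..v'} \<gamma> t" by (rule J_integrand_piece) (use uv pq in auto)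
    then show ?thesis using piece[OF refl uv(1) _ uv(4,6), of t] uv eqs[OF uv(1,4) ti] by simp
  qed
  show "pw_cont p q w"
  proof (rule pw_contI[OF pieces_finite[OF S]])
    fix u' v' assume uv: "p \<le> u'" "u' < v'" "v' \<le> q" "{u'<..<v'} \<inter> S = {}"
    let ?I = "{u'..v'}"
    have sm: "smooth_curve A ?I \<gamma>" by (rule piecesD[OF S]) (use uv pq in auto)
    have f: "fat ?I" by (rule fat_Icc[OF uv(2)])
    have cd: "cdom c ?I \<gamma> = ?I" using dom uv by auto
    note m = smooth_curve_motion[OF sm f c, unfolded cd]
    have im: "(coord c \<circ> \<gamma>) ` ?I \<subseteq> ran_chart c" using coord_cdom_in[OF c, of \<gamma> ?I] unfolding cd .
    have "continuous_on ?I (\<lambda>t. acc ?I \<gamma> t c - Chr (Gc c) ((coord c \<circ> \<gamma>) t) (vel ?I \<gamma> t c) (vel ?I \<gamma> t c))"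
      by (intro continuous_intros R.Chr.continuous_on_field R.motion_continuous[OF m(1)] im)
    then show "\<exists>f. continuous_on ?I f \<and> (\<forall>t\<in>{u'<..<v'}. w t = f t)"
      using eqs[OF uv(1,3)] by (intro exI conjI) (auto simp: w_def)
  qed
qed

lemma J_integrand_chart_integral:
  assumes g: "C_k_curve A 1 {a..b} \<gamma>" and S: "pieces S a b \<gamma>" and c: "c \<in> A"
    and pq: "a \<le> p" "p < q" "q \<le> b" and dom: "\<gamma> ` {p..q} \<subseteq> dom_chart c"
    and f: "\<And>t. t \<in> {p<..<q} - S' \<Longrightarrow> f t = Lagc c (coord c (\<gamma> t)) (acc {a..b} \<gamma> t c)" and S': "finite S'"
  shows "f integrable_on {p..q}" "integral {p..q} f = integral {p..q} (J_integrand {a..b} \<gamma>)"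
proof -
  note P = piecewise_curve_in_chart(5)[OF g S c pq dom]
  let ?S = "S \<union> S' \<union> {p, q}"
  have fin: "finite ?S" using pieces_finite[OF S] S' by simp
  have eq: "f t = J_integrand {a..b} \<gamma> t" if "t \<in> {p..q} - ?S" for t
    using P[of t] f[of t] that by (auto simp: less_le)
  have "J_integrand {a..b} \<gamma> integrable_on {p..q}"
    by (rule integrable_on_subinterval[OF J_integrand_integrable[OF _ S]]) (use pq in auto)
  then show "f integrable_on {p..q}" by (rule integrable_spike_finite[OF fin eq, rotated]) auto
  show "integral {p..q} f = integral {p..q} (J_integrand {a..b} \<gamma>)"
    by (rule integral_spike[OF negligible_finite[OF fin]]) (use eq in auto)
qed

subsection \<open>Varying a curve inside a chart\<close>

definition modified :: "('q, 'e) chart \<Rightarrow> real \<Rightarrow> real \<Rightarrow> (real \<Rightarrow> 'e) \<Rightarrow> (real \<Rightarrow> 'q) \<Rightarrow> real \<Rightarrow> 'q"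
  where "modified c p q h \<gamma> t = (if t \<in> {p..q} then inv_coord c (coord c (\<gamma> t) + h t) else \<gamma> t)"

text \<open>
  Near times in \<open>{p..q}\<close> the modified curve is given by the formula in the chart \<open>c\<close> (which also holds where
  \<open>h\<close> vanishes), and near all other times it is \<open>\<gamma>\<close>. Other charts are reached from \<open>c\<close> by a change of
  coordinates.
\<close>

lemma modified_C_k:
  assumes I: "fat I" and g: "C_k_curve A k I \<gamma>" and c: "c \<in> A"
    and dom: "\<gamma> ` (I \<inter> {p..q}) \<subseteq> dom_chart c"
    and h: "\<And>t. t \<in> I \<Longrightarrow> t \<notin> {p<..<q} \<Longrightarrow> h t = 0" "C_k_on k I h"
    and ran: "\<And>t. t \<in> I \<inter> {p..q} \<Longrightarrow> coord c (\<gamma> t) + h t \<in> ran_chart c"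
  shows "C_k_curve A k I (modified c p q h \<gamma>)"
proof -
  let ?\<gamma> = "modified c p q h \<gamma>" and ?y = "\<lambda>t. (coord c \<circ> \<gamma>) t + h t"
  note cont = C_k_curve_continuous[OF g]
  obtain W where W: "open W" "cdom c I \<gamma> = I \<inter> W" using curve_dom_open[OF cont chart_open(1)[OF c]] by blast
  have IW: "I \<inter> {p..q} \<subseteq> W" using dom W by auto
  have yran: "?y t \<in> ran_chart c" and \<gamma>y: "?\<gamma> t = inv_coord c (?y t)" if t: "t \<in> I \<inter> W" for t
  proof -
    have d: "\<gamma> t \<in> dom_chart c" using t W by auto
    have "?y t \<in> ran_chart c \<and> ?\<gamma> t = inv_coord c (?y t)"
    proof (cases "t \<in> {p..q}")
      case True then show ?thesis using ran t by (simp add: modified_def)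
    next
      case False
      then have "h t = 0" using h(1) t by auto
      then show ?thesis using False d c by (auto simp: modified_def coord_in inv_coord_coord)
    qed
    then show "?y t \<in> ran_chart c" "?\<gamma> t = inv_coord c (?y t)" by auto
  qed
  have out: "?\<gamma> t = \<gamma> t" if "t \<notin> {p..q}" for t using that by (auto simp: modified_def)
  have fW: "fat (I \<inter> W)" by (rule fat_open_Int[OF I W(1)])
  have xk: "C_k_on k (I \<inter> W) (coord c \<circ> \<gamma>)" using C_k_curve_coord[OF g c] unfolding W(2) .
  have yk: "C_k_on k (I \<inter> W) ?y"
    by (rule C_k_on_add[OF fW xk C_k_on_subset[OF h(2) _ fW]]) auto
  have cont': "continuous_on I ?\<gamma>"
    unfolding continuous_on_eq_continuous_within
  proof
    fix t assume t: "t \<in> I"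
    show "continuous (at t within I) ?\<gamma>"
    proof (cases "t \<in> {p..q}")
      case True
      then have tW: "t \<in> W" using IW t by auto
      have "continuous_on (I \<inter> W) (\<lambda>t. inv_coord c (?y t))"
        by (rule continuous_on_compose2[OF continuous_on_inv_coord[OF c] C_k_on_continuous[OF yk]]) (use yran in auto)
      then have "continuous_on (I \<inter> W) ?\<gamma>" by (rule continuous_on_eq) (use \<gamma>y in simp)
      then have "continuous (at t within I \<inter> W) ?\<gamma>" using t tW by (simp add: continuous_on_eq_continuous_within)
      then show ?thesis unfolding at_within_Int_nhd[OF W(1) tW] .
    next
      case False
      let ?W = "- {p..q}"
      have oW: "open ?W" "t \<in> ?W" using False by auto
      have "continuous_on (I \<inter> ?W) \<gamma>" by (rule continuous_on_subset[OF cont]) auto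
      then have "continuous_on (I \<inter> ?W) ?\<gamma>" by (rule continuous_on_eq) (simp add: out)
      then have "continuous (at t within I \<inter> ?W) ?\<gamma>" using t oW by (simp add: continuous_on_eq_continuous_within)
      then show ?thesis unfolding at_within_Int_nhd[OF oW] .
    qed
  qed
  have "C_k_on k (cdom c' I ?\<gamma>) (coord c' \<circ> ?\<gamma>)" if c': "c' \<in> A" for c'
  proof (rule C_k_on_local[OF cdom_fat[OF cont' c' I]])
    note fc = cdom_fat[OF cont' c' I]
    fix t assume t: "t \<in> cdom c' I ?\<gamma>"
    show "\<exists>W. open W \<and> t \<in> W \<and> C_k_on k (cdom c' I ?\<gamma> \<inter> W) (coord c' \<circ> ?\<gamma>)"
    proof (cases "t \<in> {p..q}")
      case True
      have f': "fat (cdom c' I ?\<gamma> \<inter> W)" by (rule fat_open_Int[OF fc W(1)])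
      have im: "?y ` (cdom c' I ?\<gamma> \<inter> W) \<subseteq> trans_dom c c'"
      proof
        fix z assume "z \<in> ?y ` (cdom c' I ?\<gamma> \<inter> W)"
        then obtain s where s: "s \<in> I \<inter> W" "?\<gamma> s \<in> dom_chart c'" "z = ?y s" by auto
        then show "z \<in> trans_dom c c'" using yran[OF s(1)] \<gamma>y[OF s(1)] unfolding trans_dom_iff[OF c] by simp
      qed
      have "C_k_on k (cdom c' I ?\<gamma> \<inter> W) (\<lambda>t. trans c c' (?y t))"
        by (rule C_k_on_compose[OF f' open_trans_dom[OF c c'] smooth_onD[OF smooth_trans[OF c c']] C_k_on_subset[OF yk _ f'] im]) auto
      then have "C_k_on k (cdom c' I ?\<gamma> \<inter> W) (coord c' \<circ> ?\<gamma>)" by (rule C_k_on_transfer) (use \<gamma>y in auto)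
      then show ?thesis using W(1) IW True t by blast
    next
      case False
      let ?W = "- {p..q}"
      have oW: "open ?W" "t \<in> ?W" using False by auto
      have f': "fat (cdom c' I ?\<gamma> \<inter> ?W)" by (rule fat_open_Int[OF fc oW(1)])
      have "C_k_on k (cdom c' I ?\<gamma> \<inter> ?W) (coord c' \<circ> \<gamma>)"
        by (rule C_k_on_subset[OF C_k_curve_coord[OF g c'] _ f']) (use out in auto)
      then have "C_k_on k (cdom c' I ?\<gamma> \<inter> ?W) (coord c' \<circ> ?\<gamma>)" by (rule C_k_on_transfer) (use out in auto)
      then show ?thesis using oW by blast
    qed
  qed
  then show ?thesis using cont' by (simp add: C_k_curve_def)
qed

end

section \<open>Neighbourhoods in charts\<close>

context riem_manifold
begin

lemma coord_ball_open:
  assumes c: "c \<in> A" shows "open {p \<in> dom_chart c. coord c p \<in> ball x0 \<rho>}"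
proof -
  have "openin (top_of_set (dom_chart c)) (dom_chart c \<inter> coord c -` ball x0 \<rho>)"
    by (rule continuous_openin_preimage_gen[OF continuous_on_coord[OF c] open_ball])
  then have "open (dom_chart c \<inter> coord c -` ball x0 \<rho>)" using chart_open(1)[OF c] openin_open_trans by blast
  moreover have "{p \<in> dom_chart c. coord c p \<in> ball x0 \<rho>} = dom_chart c \<inter> coord c -` ball x0 \<rho>" by auto
  ultimately show ?thesis by simp
qed

lemma near_in_chart:
  fixes q :: "real \<Rightarrow> 'q"
  assumes q: "continuous_on I q" and c: "c \<in> A" and t0: "t0 \<in> I" "q t0 \<in> dom_chart c" and \<rho>: "\<rho> > 0"
  obtains \<delta> where "\<delta> > 0" "\<And>t. t \<in> I \<Longrightarrow> \<bar>t - t0\<bar> \<le> \<delta> \<Longrightarrow> q t \<in> dom_chart c \<and> coord c (q t) \<in> cball (coord c (q t0)) \<rho>"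
proof -
  define N where "N = {p \<in> dom_chart c. coord c p \<in> ball (coord c (q t0)) \<rho>}"
  have N: "open N" unfolding N_def by (rule coord_ball_open[OF c])
  obtain W where W: "open W" "W \<inter> I = q -` N \<inter> I"
    using q N unfolding continuous_on_open_invariant by blast
  have "q t0 \<in> N" using t0 \<rho> by (simp add: N_def)
  then have "t0 \<in> W" using W t0 by blast
  then obtain d where d: "d > 0" "ball t0 d \<subseteq> W" using W(1) openE by blast
  show ?thesis
  proof (rule that[of "d / 2"])
    fix t assume t: "t \<in> I" "\<bar>t - t0\<bar> \<le> d / 2"
    then have "\<bar>t - t0\<bar> < d" using d(1) by linarith
    then have "t \<in> ball t0 d" by (simp add: dist_real_def abs_minus_commute)
    then have "q t \<in> N" using d W t by blast
    then show "q t \<in> dom_chart c \<and> coord c (q t) \<in> cball (coord c (q t0)) \<rho>" by (simp add: N_def)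
  qed (use d in simp)
qed

lemma admissibleD:
  assumes "\<gamma> \<in> admissible A a b \<xi> \<eta>"
  shows "C_k_curve A 1 {a..b} \<gamma>" "\<exists>S. pieces S a b \<gamma>" "(\<gamma> a, vel {a..b} \<gamma> a) = \<xi>" "(\<gamma> b, vel {a..b} \<gamma> b) = \<eta>"
  using assms piecewise_smooth_pieces unfolding admissible_def by blast+

section \<open>Minimizers are stationary\<close>

lemma testfun_scale:
  fixes h :: "real \<Rightarrow> 'e"
  assumes tf: "testfun p q h k j" shows "testfun p q (\<lambda>t. \<epsilon> *\<^sub>R h t) (\<lambda>t. \<epsilon> *\<^sub>R k t) (\<lambda>t. \<epsilon> *\<^sub>R j t)"
proof -
  note T = tf[unfolded testfun_def]
  obtain B where B: "\<And>t. norm (h t) \<le> B \<and> norm (k t) \<le> B \<and> norm (j t) \<le> B" using T by blast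
  have sc: "((\<lambda>t. \<epsilon> *\<^sub>R f t) has_vector_derivative \<epsilon> *\<^sub>R f') F" if "(f has_vector_derivative f') F" for f :: "real \<Rightarrow> 'e" and f' F
    using bounded_linear.has_vector_derivative[OF bounded_linear_scaleR_right that] .
  show ?thesis unfolding testfun_def
  proof (intro conjI allI impI exI[of _ "\<bar>\<epsilon>\<bar> * B"])
    show "continuous_on UNIV (\<lambda>t. \<epsilon> *\<^sub>R k t)" using T by (intro continuous_intros) auto
    show "norm (\<epsilon> *\<^sub>R h t) \<le> \<bar>\<epsilon>\<bar> * B" "norm (\<epsilon> *\<^sub>R k t) \<le> \<bar>\<epsilon>\<bar> * B" "norm (\<epsilon> *\<^sub>R j t) \<le> \<bar>\<epsilon>\<bar> * B" for t
      using B[of t] by (auto intro: mult_left_mono)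
    show "C_k_on n {u..v} (\<lambda>t. \<epsilon> *\<^sub>R h t)" if "u < v \<and> {u<..<v} \<inter> {p, q} = {}" for u v n
      using T that by (intro C_k_on_linear_comp[OF bounded_linear_scaleR_right] fat_Icc) auto
  qed (use T in \<open>auto intro: sc\<close>)
qed

context
  fixes a b \<xi> \<eta> \<gamma> S c p q and h k j :: "real \<Rightarrow> 'e"
  assumes adm: "\<gamma> \<in> admissible A a b \<xi> \<eta>" and S: "pieces S a b \<gamma>" and c: "c \<in> A"
    and pq: "a < p" "p < q" "q < b" and dom: "\<gamma> ` {p..q} \<subseteq> dom_chart c"
    and tf: "testfun p q h k j" and ran: "\<And>t. t \<in> {p..q} \<Longrightarrow> coord c (\<gamma> t) + h t \<in> ran_chart c"
begin

lemma modified_out: "t \<notin> {p..q} \<Longrightarrow> modified c p q h \<gamma> t = \<gamma> t"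
  by (auto simp: modified_def)

lemma modified_pieces: "pieces (S \<union> {p, q}) a b (modified c p q h \<gamma>)"
  unfolding pieces_def
proof (intro conjI allI impI)
  show "finite (S \<union> {p, q})" using pieces_finite[OF S] by simp
  fix u v assume "a \<le> u \<and> u < v \<and> v \<le> b \<and> {u<..<v} \<inter> (S \<union> {p, q}) = {}"
  then have uv: "a \<le> u" "u < v" "v \<le> b" "{u<..<v} \<inter> (S \<union> {p, q}) = {}" by auto
  have sm: "smooth_curve A {u..v} \<gamma>" by (rule piecesD[OF S]) (use uv in auto)
  show "smooth_curve A {u..v} (modified c p q h \<gamma>)"
    unfolding smooth_curve_def
  proof
    fix n show "C_k_curve A n {u..v} (modified c p q h \<gamma>)"
    proof (rule modified_C_k[OF fat_Icc[OF uv(2)] _ c])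
      show "C_k_curve A n {u..v} \<gamma>" using sm by (simp add: smooth_curve_def)
      show "C_k_on n {u..v} h" using tf uv unfolding testfun_def by blast
      show "\<gamma> ` ({u..v} \<inter> {p..q}) \<subseteq> dom_chart c" using dom by blast
      show "h t = 0" if "t \<notin> {p<..<q}" for t using tf that unfolding testfun_def by blast
      show "coord c (\<gamma> t) + h t \<in> ran_chart c" if "t \<in> {u..v} \<inter> {p..q}" for t using ran that by blast
    qed
  qed
qed

lemma modified_C1: "C_k_curve A 1 {a..b} (modified c p q h \<gamma>)"
proof (rule modified_C_k[OF fat_Icc admissibleD(1)[OF adm] c])
  show "a < b" using pq by simp
  then have f: "fat {a..b}" by (rule fat_Icc)
  have "C_k_on (Suc 0) {a..b} h"
    by (rule C_k_on_Suc_vectorI[OF f, of _ k])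
      (use tf in \<open>auto simp: testfun_def intro: has_vector_derivative_at_within continuous_on_subset\<close>)
  then show "C_k_on 1 {a..b} h" by simp
  show "\<gamma> ` ({a..b} \<inter> {p..q}) \<subseteq> dom_chart c" using dom by blast
  show "h t = 0" if "t \<notin> {p<..<q}" for t using tf that unfolding testfun_def by blast
  show "coord c (\<gamma> t) + h t \<in> ran_chart c" if "t \<in> {a..b} \<inter> {p..q}" for t using ran that by blast
qed

lemma modified_admissible: "modified c p q h \<gamma> \<in> admissible A a b \<xi> \<eta>"
proof -
  have out: "vel {a..b} (modified c p q h \<gamma>) t = vel {a..b} \<gamma> t" if "t \<in> {a..b} - {p..q}" for t
    by (rule velocity_local[of "- {p..q}"]) (use that modified_out in auto)
  have "piecewise_smooth_curve A a b (modified c p q h \<gamma>)"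
    by (rule pieces_piecewise_smooth[OF _ modified_pieces]) (use pq in simp)
  then show ?thesis using modified_C1 admissibleD(3,4)[OF adm] out[of a] out[of b] pq modified_out[of a] modified_out[of b]
    unfolding admissible_def by simp
qed

text \<open>
  Outside \<open>{p..q}\<close> the two curves have the same integrand, so that their actions can be compared on
  \<open>{p..q}\<close>, inside the chart.
\<close>

lemma modified_action:
  assumes min: "minimizer A g V a b \<xi> \<eta> \<gamma>"
  shows "integral {p..q} (J_integrand {a..b} \<gamma>) \<le> integral {p..q} (J_integrand {a..b} (modified c p q h \<gamma>))"
proof -
  let ?m = "modified c p q h \<gamma>"
  have ab: "a < b" using pq by simp
  note i1 = J_integrand_integrable[OF ab S] and i2 = J_integrand_integrable[OF ab modified_pieces]
  have split: "integral {a..b} f = integral {a..p} f + integral {p..q} f + integral {q..b} f"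
    if "f integrable_on {a..b}" for f :: "real \<Rightarrow> real"
  proof -
    have "f integrable_on {p..b}" by (rule integrable_on_subinterval[OF that]) (use pq in auto)
    then show ?thesis
      using Henstock_Kurzweil_Integration.integral_combine[of a p b f] Henstock_Kurzweil_Integration.integral_combine[of p q b f] that pq by simp
  qed
  have out: "J_integrand {a..b} \<gamma> t = J_integrand {a..b} ?m t" if "t \<in> {a..b} - {p..q}" for t
    by (rule J_integrand_local[of "- {p..q}"]) (use that modified_out in auto)
  have e1: "integral {a..p} (J_integrand {a..b} ?m) = integral {a..p} (J_integrand {a..b} \<gamma>)"
    by (rule integral_spike[of "{p}"]) (use out pq in auto)
  have e2: "integral {q..b} (J_integrand {a..b} ?m) = integral {q..b} (J_integrand {a..b} \<gamma>)"
    by (rule integral_spike[of "{q}"]) (use out pq in auto)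
  have "integral {a..b} (J_integrand {a..b} \<gamma>) \<le> integral {a..b} (J_integrand {a..b} ?m)"
    using min modified_admissible unfolding minimizer_def J_functional_integral by blast
  then show ?thesis unfolding split[OF i1] split[OF i2] e1 e2 by simp
qed

lemma modified_dom: "modified c p q h \<gamma> ` {p..q} \<subseteq> dom_chart c"
  using ran inv_coord_in[OF c] by (auto simp: modified_def)

lemma modified_coord: "t \<in> {p..q} \<Longrightarrow> coord c (modified c p q h \<gamma> t) = coord c (\<gamma> t) + h t"
  using ran coord_inv[OF c] by (simp add: modified_def)

lemma modified_acc:
  assumes t: "t \<in> {p<..<q} - S"
  shows "acc {a..b} (modified c p q h \<gamma>) t c = riem_pot.varied_acc (Gc c) (coord c (\<gamma> t)) (vel {a..b} \<gamma> t c) (acc {a..b} \<gamma> t c) (h t) (k t) (j t)"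
proof -
  interpret R: riem_pot "ran_chart c" "Gc c" "V \<circ> inv_coord c" by (rule riem_pot_chart[OF c])
  let ?m = "modified c p q h \<gamma>"
  have pq': "a \<le> p" "p < q" "q \<le> b" using pq by auto
  note P = piecewise_curve_in_chart[OF admissibleD(1)[OF adm] S c pq' dom]
  note Q = piecewise_curve_in_chart[OF modified_C1 modified_pieces c pq' modified_dom]
  have hk: "(h has_vector_derivative k t) (at t)" for t using tf unfolding testfun_def by blast
  have kj: "(k has_vector_derivative j t) (at t)" if "t \<notin> {p, q}" for t using tf that unfolding testfun_def by blast
  have u: "vel {a..b} ?m s c = vel {a..b} \<gamma> s c + k s" if s: "s \<in> {p..q}" for s
  proof -
    have "((\<lambda>t. (coord c \<circ> \<gamma>) t + h t) has_vector_derivative vel {a..b} \<gamma> s c + k s) (at s within {p..q})"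
      by (intro has_vector_derivative_add P(1)[OF s] has_vector_derivative_at_within[OF hk])
    then have "(coord c \<circ> ?m has_vector_derivative vel {a..b} \<gamma> s c + k s) (at s within {p..q})"
      by (rule has_vector_derivative_transform[OF s, rotated]) (simp add: modified_coord)
    from vector_derivative_unique_within[OF fat_not_bot[OF fat_Icc[OF pq(2)] s] Q(1)[OF s] this] show ?thesis .
  qed
  have t': "t \<in> {p<..<q} - (S \<union> {p, q})" "t \<in> {p<..<q}" "t \<in> {p..q}" "t \<notin> {p, q}" using t by auto
  let ?w = "\<lambda>\<gamma>. acc {a..b} \<gamma> t c - Chr (Gc c) (coord c (\<gamma> t)) (vel {a..b} \<gamma> t c) (vel {a..b} \<gamma> t c)"
  from has_vector_derivative_add[OF P(3)[OF t] kj[OF t'(4)]]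
  have "((\<lambda>s. vel {a..b} ?m s c) has_vector_derivative ?w \<gamma> + j t) (at t)"
    by (rule has_vector_derivative_transform_within_open[OF _ _ t'(2)]) (use u in auto)
  from vector_derivative_unique_at[OF Q(3)[OF t'(1)] this]
  have "?w ?m = ?w \<gamma> + j t" .
  then show ?thesis unfolding R.varied_acc_def modified_coord[OF t'(3)] u[OF t'(3)] by (simp add: algebra_simps)
qed

end

text \<open>
  The function \<open>\<alpha>\<close> stands for the acceleration, which it may replace at finitely many times by better
  values: at a break point the acceleration itself is arbitrary and need not obey any bound.
\<close>

lemma minimizer_stationary:
  assumes min: "minimizer A g V a b \<xi> \<eta> \<gamma>" and S: "pieces S a b \<gamma>" and c: "c \<in> A"
    and pq: "a < p" "p < q" "q < b" and dom: "\<gamma> ` {p..q} \<subseteq> dom_chart c"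
    and r: "cball x0 r \<subseteq> ran_chart c" "r > 0" and x: "\<And>t. t \<in> {p..q} \<Longrightarrow> coord c (\<gamma> t) \<in> cball x0 (r / 2)"
    and al: "\<And>t. t \<in> {p<..<q} - S' \<Longrightarrow> \<alpha> t = acc {a..b} \<gamma> t c" and S': "finite S'"
    and v: "\<And>t. t \<in> {p..q} \<Longrightarrow> v t = vel {a..b} \<gamma> t c"
    and M: "\<And>t. t \<in> {p..q} \<Longrightarrow> norm (v t) \<le> M \<and> norm (\<alpha> t) \<le> M"
  shows "riem_pot.stationary (Gc c) (V \<circ> inv_coord c) p q (coord c \<circ> \<gamma>) v \<alpha>"
proof -
  interpret R: riem_pot "ran_chart c" "Gc c" "V \<circ> inv_coord c" by (rule riem_pot_chart[OF c])
  have adm: "\<gamma> \<in> admissible A a b \<xi> \<eta>" using min by (simp add: minimizer_def)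
  have pq': "a \<le> p" "p < q" "q \<le> b" using pq by auto
  have fx: "R.Lag ((coord c \<circ> \<gamma>) t) (\<alpha> t) = Lagc c (coord c (\<gamma> t)) (acc {a..b} \<gamma> t c)" if "t \<in> {p<..<q} - S'" for t
    using al[OF that] by simp
  note X = J_integrand_chart_integral[OF admissibleD(1)[OF adm] S c pq' dom fx S']
  show ?thesis
  proof (rule R.stationary_of_minimal[OF r _ M X(1) pq(2)])
    show "(coord c \<circ> \<gamma>) t \<in> cball x0 (r / 2)" if "t \<in> {p..q}" for t using x[OF that] by simp
    fix h k j \<epsilon> assume tf0: "testfun p q h k j" and K: "\<And>t. t \<in> {p..q} \<Longrightarrow> (coord c \<circ> \<gamma>) t + \<epsilon> *\<^sub>R h t \<in> cball x0 r"
    let ?h = "\<lambda>t. \<epsilon> *\<^sub>R h t" and ?k = "\<lambda>t. \<epsilon> *\<^sub>R k t" and ?j = "\<lambda>t. \<epsilon> *\<^sub>R j t"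
    have tf: "testfun p q ?h ?k ?j" by (rule testfun_scale[OF tf0])
    have ran: "coord c (\<gamma> t) + ?h t \<in> ran_chart c" if "t \<in> {p..q}" for t using K[OF that] r(1) by auto
    note C = adm S c pq dom tf ran
    let ?m = "modified c p q ?h \<gamma>"
    let ?f = "\<lambda>t. R.Lag ((coord c \<circ> \<gamma>) t + ?h t) (R.varied_acc ((coord c \<circ> \<gamma>) t) (v t) (\<alpha> t) (?h t) (?k t) (?j t))"
    have fin: "finite (S \<union> S')" using pieces_finite[OF S] S' by simp
    have fm: "?f t = Lagc c (coord c (?m t)) (acc {a..b} ?m t c)" if t: "t \<in> {p<..<q} - (S \<union> S')" for t
    proof -
      have t': "t \<in> {p<..<q} - S" "t \<in> {p..q}" "t \<in> {p<..<q} - S'" using t by auto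
      have 1: "acc {a..b} ?m t c = R.varied_acc (coord c (\<gamma> t)) (v t) (\<alpha> t) (?h t) (?k t) (?j t)"
        using modified_acc[OF C t'(1)] unfolding al[OF t'(3)] v[OF t'(2)] .
      have 2: "coord c (?m t) = coord c (\<gamma> t) + ?h t" by (rule modified_coord[OF C t'(2)])
      show ?thesis unfolding 1 2 by simp
    qed
    note Y = J_integrand_chart_integral[OF modified_C1[OF C] modified_pieces[OF C] c pq' modified_dom[OF C] fm fin]
    have "integral {p..q} (J_integrand {a..b} \<gamma>) \<le> integral {p..q} (J_integrand {a..b} ?m)" by (rule modified_action[OF C min])
    then show "?f integrable_on {p..q} \<and> integral {p..q} (\<lambda>t. R.Lag ((coord c \<circ> \<gamma>) t) (\<alpha> t)) \<le> integral {p..q} ?f"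
      using Y X(2) by simp
  qed
qed

lemma compact_norm_bound:
  fixes f :: "real \<Rightarrow> 'e" assumes "continuous_on {p..q} f" obtains M where "\<And>t. t \<in> {p..q} \<Longrightarrow> norm (f t) \<le> M"
proof -
  have "compact (f ` {p..q})" by (rule compact_continuous_image[OF assms]) simp
  then have "bounded (f ` {p..q})" by (rule compact_imp_bounded)
  then show ?thesis using that unfolding bounded_iff by blast
qed

text \<open>
  On either side of \<open>t0\<close> the curve is smooth, as \<open>t0\<close> is the only possible break point nearby, and satisfies
  the equation there by \<open>euler_lagrange_interior\<close>; the two sides fit together by \<open>corner_conditions\<close>.
\<close>

lemma minimizer_smooth_near:
  assumes min: "minimizer A g V a b \<xi> \<eta> \<gamma>" and t0: "t0 \<in> {a<..<b}" and c: "c \<in> A" "\<gamma> t0 \<in> dom_chart c"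
  obtains p q where "a < p" "p < t0" "t0 < q" "q < b" "\<And>k. C_k_on k {p..q} (coord c \<circ> \<gamma>)"
proof -
  interpret R: riem_pot "ran_chart c" "Gc c" "V \<circ> inv_coord c" by (rule riem_pot_chart[OF c(1)])
  have adm: "\<gamma> \<in> admissible A a b \<xi> \<eta>" using min by (simp add: minimizer_def)
  obtain S where S: "pieces S a b \<gamma>" using admissibleD(2)[OF adm] by blast
  note g = admissibleD(1)[OF adm]
  let ?o = "coord c (\<gamma> t0)" and ?x = "coord c \<circ> \<gamma>"
  have "?o \<in> ran_chart c" using c coord_in by blast
  then obtain r where r: "r > 0" "cball ?o r \<subseteq> ran_chart c" using chart_open(2)[OF c(1)] open_contains_cball by blast
  obtain \<delta> where \<delta>: "\<delta> > 0" "\<And>t. t \<in> {a..b} \<Longrightarrow> \<bar>t - t0\<bar> \<le> \<delta> \<Longrightarrow> \<gamma> t \<in> dom_chart c \<and> coord c (\<gamma> t) \<in> cball ?o (r / 2)"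
    by (rule near_in_chart[OF C_k_curve_continuous[OF g] c(1), of t0 "r / 2"]) (use t0 c r in auto)
  have "finite (S - {t0})" using pieces_finite[OF S] by simp
  then have "open (- (S - {t0}))" using finite_imp_closed by blast
  then have "open ({a<..<b} - (S - {t0}))" by (simp add: Diff_eq open_Int)
  then obtain d where d: "d > 0" "ball t0 d \<subseteq> {a<..<b} - (S - {t0})" using t0 openE by blast
  define e where "e = min \<delta> (d / 2)"
  have e: "e > 0" "e \<le> \<delta>" "e < d" using \<delta>(1) d(1) by (auto simp: e_def)
  define p where "p = t0 - e" define q where "q = t0 + e"
  have sub: "{p..q} \<subseteq> {a<..<b} - (S - {t0})" using d(2) e by (auto simp: p_def q_def ball_def dist_real_def subset_iff)
  have lt: "p < t0" "t0 < q" using e by (auto simp: p_def q_def)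
  then have "p \<in> {p..q}" "q \<in> {p..q}" by auto
  then have pq: "a < p" "q < b" using sub by auto
  have pq': "a \<le> p" "p < q" "q \<le> b" using pq lt by auto
  have near: "\<gamma> t \<in> dom_chart c \<and> coord c (\<gamma> t) \<in> cball ?o (r / 2)" if "t \<in> {p..q}" for t
    by (rule \<delta>(2)) (use that pq e in \<open>auto simp: p_def q_def abs_le_iff\<close>)
  have dom: "\<gamma> ` {p..q} \<subseteq> dom_chart c" using near by auto
  note P = piecewise_curve_in_chart[OF g S c(1) pq' dom]
  let ?v = "\<lambda>t. vel {a..b} \<gamma> t c"
  have sm: "R.motion {u..w} ?x ?v (\<lambda>t. acc {u..w} \<gamma> t c) (\<lambda>t. jerk {u..w} \<gamma> t c) (mcp_lhs {u..w} \<gamma> c)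
      \<and> continuous_on {u..w} (mcp_lhs {u..w} \<gamma> c) \<and> continuous_on {u..w} (\<lambda>t. acc {u..w} \<gamma> t c)"
    if uw: "p \<le> u" "u < w" "w \<le> q" "t0 \<notin> {u<..<w}" for u w
  proof -
    have "z = t0" if z: "z \<in> {u<..<w}" "z \<in> S" for z
    proof -
      have "z \<in> {p..q}" using z uw by auto
      then show ?thesis using sub z by blast
    qed
    then have "{u<..<w} \<inter> S = {}" using uw(4) by blast
    then have s: "smooth_curve A {u..w} \<gamma>" using piecesD[OF S, of u w] uw pq by auto
    have f: "fat {u..w}" by (rule fat_Icc[OF uw(2)])
    have cd: "cdom c {u..w} \<gamma> = {u..w}" using dom uw by auto
    note m = smooth_curve_motion[OF s f c(1), unfolded cd]
    have v: "vel {u..w} \<gamma> t c = ?v t" if t: "t \<in> {u..w}" for t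
    proof -
      have "(?x has_vector_derivative ?v t) (at t within {u..w})"
        by (rule has_vector_derivative_within_subset[OF P(1)]) (use uw t in auto)
      from vector_derivative_unique_within[OF fat_not_bot[OF f t] R.motionD(2)[OF m(1) t] this] show ?thesis .
    qed
    have "R.motion {u..w} ?x ?v (\<lambda>t. acc {u..w} \<gamma> t c) (\<lambda>t. jerk {u..w} \<gamma> t c) (mcp_lhs {u..w} \<gamma> c)"
      unfolding R.motion_def
    proof (intro ballI conjI)
      fix t assume t: "t \<in> {u..w}"
      note D = R.motionD[OF m(1) t, unfolded v[OF t]]
      show "?x t \<in> ran_chart c" "(?x has_vector_derivative ?v t) (at t within {u..w})"
        "((\<lambda>t. acc {u..w} \<gamma> t c) has_vector_derivative jerk {u..w} \<gamma> t c - R.\<Gamma> (?x t) (?v t) (acc {u..w} \<gamma> t c)) (at t within {u..w})"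
        "((\<lambda>t. jerk {u..w} \<gamma> t c) has_vector_derivative mcp_lhs {u..w} \<gamma> c t - Rm (Gc c) (?x t) (acc {u..w} \<gamma> t c) (?v t) (?v t) - R.grd (?x t)
           - R.\<Gamma> (?x t) (?v t) (jerk {u..w} \<gamma> t c)) (at t within {u..w})"
        using D by blast+
      show "(?v has_vector_derivative acc {u..w} \<gamma> t c - R.\<Gamma> (?x t) (?v t) (?v t)) (at t within {u..w})"
        by (rule has_vector_derivative_transform[OF t _ D(3)]) (simp add: v)
    qed
    then show ?thesis using m(2) C_k_on_continuous[OF m(4)] by blast
  qed
  let ?a1 = "\<lambda>t. acc {p..t0} \<gamma> t c" and ?a2 = "\<lambda>t. acc {t0..q} \<gamma> t c"
  have ml: "R.motion {p..t0} ?x ?v ?a1 (\<lambda>t. jerk {p..t0} \<gamma> t c) (mcp_lhs {p..t0} \<gamma> c)"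
      "continuous_on {p..t0} (mcp_lhs {p..t0} \<gamma> c)" "continuous_on {p..t0} ?a1"
    using sm[of p t0] lt by auto
  have mr: "R.motion {t0..q} ?x ?v ?a2 (\<lambda>t. jerk {t0..q} \<gamma> t c) (mcp_lhs {t0..q} \<gamma> c)"
      "continuous_on {t0..q} (mcp_lhs {t0..q} \<gamma> c)" "continuous_on {t0..q} ?a2"
    using sm[of t0 q] lt by auto
  define \<alpha> where "\<alpha> t = (if t \<le> t0 then ?a1 t else ?a2 t)" for t
  obtain M0 where M0: "\<And>t. t \<in> {p..q} \<Longrightarrow> norm (?v t) \<le> M0" using compact_norm_bound[OF P(2)] by blast
  obtain M1 where M1: "\<And>t. t \<in> {p..t0} \<Longrightarrow> norm (?a1 t) \<le> M1" using compact_norm_bound[OF ml(3)] by blast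
  obtain M2 where M2: "\<And>t. t \<in> {t0..q} \<Longrightarrow> norm (?a2 t) \<le> M2" using compact_norm_bound[OF mr(3)] by blast
  define M where "M = max M0 (max M1 M2)"
  have Mv: "norm (?v t) \<le> M" if "t \<in> {p..q}" for t using M0[OF that] by (simp add: M_def)
  have Ma1: "norm (?a1 t) \<le> M" if "t \<in> {p..t0}" for t using M1[OF that] by (simp add: M_def)
  have Ma2: "norm (?a2 t) \<le> M" if "t \<in> {t0..q}" for t using M2[OF that] by (simp add: M_def)
  have a1: "?a1 t = acc {a..b} \<gamma> t c" if "t \<in> {p<..<t0}" for t
    using acc_local[of "{p<..<t0}" t "{p..t0}" "{a..b}" \<gamma> \<gamma>] that pq lt by fastforce
  have a2: "?a2 t = acc {a..b} \<gamma> t c" if "t \<in> {t0<..<q}" for t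
    using acc_local[of "{t0<..<q}" t "{t0..q}" "{a..b}" \<gamma> \<gamma>] that pq lt by fastforce
  have st: "R.stationary p' q' ?x ?v \<beta>"
    if "a < p'" "p' < q'" "q' < b" "{p'..q'} \<subseteq> {p..q}" "\<And>t. t \<in> {p'<..<q'} - {t0} \<Longrightarrow> \<beta> t = acc {a..b} \<gamma> t c"
       "\<And>t. t \<in> {p'..q'} \<Longrightarrow> norm (\<beta> t) \<le> M" for p' q' \<beta>
    by (rule minimizer_stationary[OF min S c(1) that(1,2,3) _ r(2,1) _ that(5)])
      (use that(4,6) near Mv in \<open>auto simp: subset_iff\<close>)
  have e1: "mcp_lhs {p..t0} \<gamma> c t = 0" if "t \<in> {p..t0}" for t
  proof (rule R.euler_lagrange_interior[OF ml(1,2) lt(1) _ that])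
    show "R.stationary p' q' ?x ?v ?a1" if "p < p'" "p' < q'" "q' < t0" for p' q'
    proof (rule st)
      show "?a1 t = acc {a..b} \<gamma> t c" if t: "t \<in> {p'<..<q'} - {t0}" for t
        by (rule a1) (use t \<open>p < p'\<close> \<open>q' < t0\<close> in auto)
      show "norm (?a1 t) \<le> M" if t: "t \<in> {p'..q'}" for t
        by (rule Ma1) (use t \<open>p < p'\<close> \<open>q' < t0\<close> in auto)
    qed (use that pq lt in auto)
  qed
  have e2: "mcp_lhs {t0..q} \<gamma> c t = 0" if "t \<in> {t0..q}" for t
  proof (rule R.euler_lagrange_interior[OF mr(1,2) lt(2) _ that])
    show "R.stationary p' q' ?x ?v ?a2" if "t0 < p'" "p' < q'" "q' < q" for p' q'
    proof (rule st)
      show "?a2 t = acc {a..b} \<gamma> t c" if t: "t \<in> {p'<..<q'} - {t0}" for t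
        by (rule a2) (use t \<open>t0 < p'\<close> \<open>q' < q\<close> in auto)
      show "norm (?a2 t) \<le> M" if t: "t \<in> {p'..q'}" for t
        by (rule Ma2) (use t \<open>t0 < p'\<close> \<open>q' < q\<close> in auto)
    qed (use that pq lt in auto)
  qed
  have ml0: "R.motion {p..t0} ?x ?v ?a1 (\<lambda>t. jerk {p..t0} \<gamma> t c) (\<lambda>_. 0)"
    using ml(1) unfolding R.motion_def by (simp add: e1)
  have mr0: "R.motion {t0..q} ?x ?v ?a2 (\<lambda>t. jerk {t0..q} \<gamma> t c) (\<lambda>_. 0)"
    using mr(1) unfolding R.motion_def by (simp add: e2)
  have "R.stationary p q ?x ?v \<alpha>"
  proof (rule st)
    show "\<alpha> t = acc {a..b} \<gamma> t c" if "t \<in> {p<..<q} - {t0}" for t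
      using that a1[of t] a2[of t] by (auto simp: \<alpha>_def)
    show "norm (\<alpha> t) \<le> M" if "t \<in> {p..q}" for t
      using that Ma1[of t] Ma2[of t] by (auto simp: \<alpha>_def)
  qed (use pq pq' in auto)
  then have st0: "R.stationary p q ?x ?v (\<lambda>t. if t \<le> t0 then ?a1 t else ?a2 t)" unfolding \<alpha>_def .
  note corner = R.corner_conditions[OF lt ml0 mr0 st0]
  have xc: "continuous_on {p..q} ?x" by (rule vderiv_continuous_on[OF P(1)])
  have im: "?x ` {p..q} \<subseteq> ran_chart c" using near coord_in[OF c(1)] by auto
  have "R.motion {p..q} ?x ?v (\<lambda>t. if t \<le> t0 then ?a1 t else ?a2 t) (\<lambda>t. if t \<le> t0 then jerk {p..t0} \<gamma> t c else jerk {t0..q} \<gamma> t c) (\<lambda>_. 0)"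
    by (rule R.motion_glue[OF lt xc P(2) im ml0 mr0 corner])
  then have "C_k_on k {p..q} ?x" for k using R.motion_C_k[OF fat_Icc[OF pq'(2)]] by blast
  then show ?thesis using that[OF pq(1) lt pq(2)] by blast
qed

lemma smooth_minimizer_equation:
  assumes min: "minimizer A g V a b \<xi> \<eta> \<gamma>" and sm: "smooth_curve A {a..b} \<gamma>" and ab: "a < b"
    and t0: "t0 \<in> {a..b}" and c: "c \<in> A" "\<gamma> t0 \<in> dom_chart c"
  shows "mcp_lhs {a..b} \<gamma> c t0 = 0"
proof -
  interpret R: riem_pot "ran_chart c" "Gc c" "V \<circ> inv_coord c" by (rule riem_pot_chart[OF c(1)])
  let ?o = "coord c (\<gamma> t0)" and ?x = "coord c \<circ> \<gamma>"
  have f: "fat {a..b}" by (rule fat_Icc[OF ab])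
  have S: "pieces {} a b \<gamma>" unfolding pieces_def using smooth_curve_subset[OF sm] fat_Icc by auto
  have "?o \<in> ran_chart c" using c coord_in by blast
  then obtain r where r: "r > 0" "cball ?o r \<subseteq> ran_chart c" using chart_open(2)[OF c(1)] open_contains_cball by blast
  obtain \<delta> where \<delta>: "\<delta> > 0" "\<And>t. t \<in> {a..b} \<Longrightarrow> \<bar>t - t0\<bar> \<le> \<delta> \<Longrightarrow> \<gamma> t \<in> dom_chart c \<and> coord c (\<gamma> t) \<in> cball ?o (r / 2)"
    by (rule near_in_chart[OF smooth_curve_continuous[OF sm] c(1), of t0 "r / 2"]) (use t0 c r in auto)
  define p where "p = max a (t0 - \<delta>)" define q where "q = min b (t0 + \<delta>)"
  have pq: "a \<le> p" "p < q" "q \<le> b" "t0 \<in> {p..q}" using t0 ab \<delta>(1) by (auto simp: p_def q_def)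
  have near: "\<gamma> t \<in> dom_chart c \<and> coord c (\<gamma> t) \<in> cball ?o (r / 2)" if "t \<in> {p..q}" for t
    by (rule \<delta>(2)) (use that in \<open>auto simp: p_def q_def abs_le_iff\<close>)
  have sub: "{p..q} \<subseteq> cdom c {a..b} \<gamma>" using near pq by auto
  note m = smooth_curve_motion[OF sm f c(1)]
  have mot: "R.motion {p..q} ?x (\<lambda>t. vel {a..b} \<gamma> t c) (\<lambda>t. acc {a..b} \<gamma> t c) (\<lambda>t. jerk {a..b} \<gamma> t c) (mcp_lhs {a..b} \<gamma> c)"
    by (rule R.motion_subset[OF m(1) sub])
  obtain M0 where M0: "\<And>t. t \<in> {p..q} \<Longrightarrow> norm (vel {a..b} \<gamma> t c) \<le> M0"
    using compact_norm_bound[OF R.motion_continuous(2)[OF mot]] by blast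
  obtain M1 where M1: "\<And>t. t \<in> {p..q} \<Longrightarrow> norm (acc {a..b} \<gamma> t c) \<le> M1"
    using compact_norm_bound[OF R.motion_continuous(3)[OF mot]] by blast
  show ?thesis
  proof (rule R.euler_lagrange_interior[OF mot continuous_on_subset[OF m(2) sub] pq(2) _ pq(4)])
    fix p' q' assume pq': "p < p'" "p' < q'" "q' < q"
    have ab': "a < p'" "q' < b" using pq' pq by auto
    show "R.stationary p' q' ?x (\<lambda>t. vel {a..b} \<gamma> t c) (\<lambda>t. acc {a..b} \<gamma> t c)"
    proof (rule minimizer_stationary[OF min S c(1) ab'(1) pq'(2) ab'(2) _ r(2,1), of "{}" _ _ "max M0 M1"])
      show "norm (vel {a..b} \<gamma> t c) \<le> max M0 M1 \<and> norm (acc {a..b} \<gamma> t c) \<le> max M0 M1" if "t \<in> {p'..q'}" for t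
        using M0[of t] M1[of t] that pq' by (auto simp: le_max_iff_disj)
    qed (use near pq' in auto)
  qed
qed

lemma interval_aroundD:
  assumes "interval_around T \<tau> a b"
  obtains W where "a < b" "{a..b} \<subseteq> {0..T}" "open W" "\<tau> \<in> W" "{0..T} \<inter> W \<subseteq> {a..b}" "\<tau> \<in> {a..b}"
proof -
  obtain U where U: "openin (top_of_set {0..T}) U" "\<tau> \<in> U" "U \<subseteq> {a..b}"
    using assms unfolding interval_around_def interior_of_def by blast
  obtain W where W: "open W" "U = {0..T} \<inter> W" using U(1) by (auto simp: openin_open)
  have "\<tau> \<in> {a..b}" "\<tau> \<in> W" "{0..T} \<inter> W \<subseteq> {a..b}" using U W by blast+
  moreover have "a < b" "{a..b} \<subseteq> {0..T}" using assms by (auto simp: interval_around_def)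
  ultimately show ?thesis using that W(1) by blast
qed

lemma interval_aroundI:
  assumes "a < b" "{a..b} \<subseteq> {0..T}" "open W" "\<tau> \<in> W" "\<tau> \<in> {0..T}" "{0..T} \<inter> W \<subseteq> {a..b}"
  shows "interval_around T \<tau> a b"
proof -
  have "openin (top_of_set {0..T}) ({0..T} \<inter> W)" using assms(3) by (rule openin_open_Int)
  then show ?thesis unfolding interval_around_def interior_of_def using assms by blast
qed

text \<open>
  Smoothness comes first: it makes the equation a statement about a continuous function. At the ends of
  \<open>{0..T}\<close> no break point has to be removed, since admissible curves are smooth on closed pieces.
\<close>

theorem local_minimizer_imp_cubic:
  assumes T: "T > 0" and adm: "q \<in> admissible A 0 T \<xi>\<^sub>0 \<eta>\<^sub>0" and loc: "Q_local_minimizer A g V T q"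
  shows "modified_cubic_polynomial A g V 0 T q"
proof -
  obtain S where S: "pieces S 0 T q" using admissibleD(2)[OF adm] by blast
  have cont: "continuous_on {0..T} q" by (rule C_k_curve_continuous[OF admissibleD(1)[OF adm]])
  have f: "fat {0..T}" by (rule fat_Icc[OF T])
  have near: "\<exists>W p r. open W \<and> t0 \<in> W \<and> {0..T} \<inter> W \<subseteq> {p..r} \<and> C_k_on k {p..r} (coord c \<circ> q)"
    if c: "c \<in> A" and t0: "t0 \<in> cdom c {0..T} q" for c t0 k
  proof (cases "t0 \<in> {0<..<T}")
    case True
    obtain a b where ab: "interval_around T t0 a b"
      and min: "minimizer A g V a b (q a, velocity A {0..T} q a) (q b, velocity A {0..T} q b) q"
      using loc t0 unfolding Q_local_minimizer_def by blast
    obtain W where W: "a < b" "{a..b} \<subseteq> {0..T}" "open W" "t0 \<in> W" "{0..T} \<inter> W \<subseteq> {a..b}" "t0 \<in> {a..b}"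
      using interval_aroundD[OF ab] by blast
    have "open ({0<..<T} \<inter> W)" "t0 \<in> {0<..<T} \<inter> W" using W True by auto
    then obtain d where d: "d > 0" "ball t0 d \<subseteq> {0<..<T} \<inter> W" using openE by blast
    have "t0 - d / 2 \<in> ball t0 d" "t0 + d / 2 \<in> ball t0 d" using d(1) by (auto simp: dist_real_def)
    then have "t0 - d / 2 \<in> {0<..<T} \<inter> W" "t0 + d / 2 \<in> {0<..<T} \<inter> W" using d(2) by blast+
    moreover have "{0<..<T} \<subseteq> {0..T}" by auto
    ultimately have "t0 - d / 2 \<in> {a..b}" "t0 + d / 2 \<in> {a..b}" using W(5) by blast+
    then have "t0 \<in> {a<..<b}" using d(1) by auto
    then obtain p r where "p < t0" "t0 < r" "\<And>k. C_k_on k {p..r} (coord c \<circ> q)"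
      using minimizer_smooth_near[OF min _ c] t0 by blast
    then show ?thesis by (intro exI[of _ "{p<..<r}"] exI[of _ p] exI[of _ r]) auto
  next
    case False
    then have t0': "t0 = 0 \<or> t0 = T" using t0 by auto
    obtain W where W: "open W" "cdom c {0..T} q = {0..T} \<inter> W" using curve_dom_open[OF cont chart_open(1)[OF c]] by blast
    have "finite (S - {t0})" using pieces_finite[OF S] by simp
    then have oS: "open (- (S - {t0}))" using finite_imp_closed by blast
    have "t0 \<in> W \<inter> - (S - {t0})" using W t0 by blast
    then obtain d where d: "d > 0" "ball t0 d \<subseteq> W \<inter> - (S - {t0})" using openE[OF open_Int[OF W(1) oS]] by blast
    define p where "p = max 0 (t0 - d / 2)" define r where "r = min T (t0 + d / 2)"
    have pr: "0 \<le> p" "p < r" "r \<le> T" using t0 T d(1) by (auto simp: p_def r_def)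
    have sub: "{p..r} \<subseteq> W \<inter> - (S - {t0})"
    proof
      fix t assume "t \<in> {p..r}"
      then have "t \<in> ball t0 d" using d(1) by (auto simp: p_def r_def dist_real_def)
      then show "t \<in> W \<inter> - (S - {t0})" using d(2) by blast
    qed
    have "t0 \<notin> {p<..<r}" using t0' by (auto simp: p_def r_def)
    moreover have "{p<..<r} \<subseteq> {p..r}" by auto
    ultimately have "{p<..<r} \<inter> S = {}" using sub by blast
    then have "smooth_curve A {p..r} q" using piecesD[OF S] pr by blast
    then have "C_k_on k (cdom c {p..r} q) (coord c \<circ> q)" by (simp add: smooth_curve_def C_k_curve_def c)
    moreover have "cdom c {p..r} q = {p..r}" using sub W(2) pr by auto
    ultimately have "C_k_on k {p..r} (coord c \<circ> q)" by simp
    then show ?thesis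
      by (intro exI[of _ "{t0 - d / 2<..<t0 + d / 2}"] exI[of _ p] exI[of _ r])
        (use d(1) in \<open>auto simp: p_def r_def\<close>)
  qed
  have "C_k_on k (cdom c {0..T} q) (coord c \<circ> q)" if c: "c \<in> A" for c k
  proof (rule C_k_on_local[OF cdom_fat[OF cont c f]])
    fix t0 assume t0: "t0 \<in> cdom c {0..T} q"
    obtain W p r where W: "open W" "t0 \<in> W" "{0..T} \<inter> W \<subseteq> {p..r}" "C_k_on k {p..r} (coord c \<circ> q)"
      using near[OF c t0] by blast
    have "C_k_on k (cdom c {0..T} q \<inter> W) (coord c \<circ> q)"
      by (rule C_k_on_subset[OF W(4) _ fat_open_Int[OF cdom_fat[OF cont c f] W(1)]]) (use W(3) in auto)
    then show "\<exists>W. open W \<and> t0 \<in> W \<and> C_k_on k (cdom c {0..T} q \<inter> W) (coord c \<circ> q)" using W by blast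
  qed
  then have sm: "smooth_curve A {0..T} q" using cont by (simp add: smooth_curve_def C_k_curve_def)
  have "mcp_lhs {0..T} q c t0 = 0" if t0: "t0 \<in> {0..T}" and c: "c \<in> charts_at A (q t0)" for t0 c
  proof -
    obtain a b where ab: "interval_around T t0 a b"
      and min: "minimizer A g V a b (q a, velocity A {0..T} q a) (q b, velocity A {0..T} q b) q"
      using loc t0 unfolding Q_local_minimizer_def by blast
    obtain W where W: "a < b" "{a..b} \<subseteq> {0..T}" "open W" "t0 \<in> W" "{0..T} \<inter> W \<subseteq> {a..b}" "t0 \<in> {a..b}"
      using interval_aroundD[OF ab] by blast
    have "mcp_lhs {a..b} q c t0 = 0"
      by (rule smooth_minimizer_equation[OF min smooth_curve_subset[OF sm W(2) fat_Icc[OF W(1)]] W(1) W(6) charts_atD[OF c]])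
    moreover have "mcp_lhs {0..T} q c t0 = mcp_lhs {a..b} q c t0"
      by (rule mcp_lhs_local[OF W(3,4) t0]) (use W in auto)
    ultimately show ?thesis by simp
  qed
  then show ?thesis using sm by (simp add: modified_cubic_polynomial_iff)
qed

end

context riem_manifold
begin

section \<open>Short competitors stay in the chart\<close>

lemma velocity_restrict:
  assumes g: "C_k_curve A 1 I \<gamma>" and I: "fat I" "fat I'" "I' \<subseteq> I" and t: "t \<in> I'"
  shows "vel I' \<gamma> t = vel I \<gamma> t"
proof
  fix c :: "('q, 'e) chart"
  show "vel I' \<gamma> t c = vel I \<gamma> t c"
  proof (cases "c \<in> charts_at A (\<gamma> t)")
    case True
    note c = charts_atD[OF True]
    have g1: "C_k_curve A (Suc 0) I \<gamma>" using g by simp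
    have tc: "t \<in> cdom c I \<gamma>" using t I c by auto
    have "(coord c \<circ> \<gamma> has_vector_derivative vel I \<gamma> t c) (at t within I)"
      using velocity_in_chart(1)[OF g1 I(1) c(1) tc] unfolding at_within_cdom[OF C_k_curve_continuous[OF g] c(1) tc] .
    then have "(coord c \<circ> \<gamma> has_vector_derivative vel I \<gamma> t c) (at t within I')"
      by (rule has_vector_derivative_within_subset[OF _ I(3)])
    from fat_vector_derivative[OF I(2) t this] show ?thesis using True by (simp add: velocity_def)
  qed (simp add: velocity_def)
qed

text \<open>
  The bound depends on the competitor only through its initial velocity, which is prescribed, and its
  action.
\<close>

lemma speed_in_chart:
  assumes g: "C_k_curve A 1 {a..b} \<gamma>" and S: "pieces S a b \<gamma>" and ab: "a < b" and V: "\<And>p. V p \<ge> 0" and c: "c \<in> A"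
    and K: "cball x0 r \<subseteq> ran_chart c"
    and co: "l > 0" "\<And>x u. x \<in> cball x0 r \<Longrightarrow> l * (norm u)\<^sup>2 \<le> Gc c x u u"
    and S0: "sqrt (1 + Gc c (coord c (\<gamma> a)) (vel {a..b} \<gamma> a c) (vel {a..b} \<gamma> a c)) \<le> S0"
    and J0: "integral {a..b} (J_integrand {a..b} \<gamma>) \<le> J0" "0 \<le> J0" and len: "b - a \<le> 1"
    and s: "s \<in> {a..b}" and dom: "\<And>t. t \<in> {a..s} \<Longrightarrow> \<gamma> t \<in> dom_chart c \<and> coord c (\<gamma> t) \<in> cball x0 r"
  shows "norm (vel {a..b} \<gamma> s c) \<le> (S0 + 1 + J0) / sqrt l"
proof -
  interpret R: riem_pot "ran_chart c" "Gc c" "V \<circ> inv_coord c" by (rule riem_pot_chart[OF c])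
  let ?u = "\<lambda>t. vel {a..b} \<gamma> t c" and ?y = "coord c \<circ> \<gamma>"
  have "sqrt (1 + Gc c (?y s) (?u s) (?u s)) \<le> S0 + 1 + J0"
  proof (cases "s = a")
    case True then show ?thesis using S0 J0 by simp
  next
    case False
    then have as: "a \<le> a" "a < s" "s \<le> b" using s by auto
    have d: "\<gamma> ` {a..s} \<subseteq> dom_chart c" using dom by auto
    note P = piecewise_curve_in_chart[OF g S c as d]
    define w where "w t = acc {a..b} \<gamma> t c - Chr (Gc c) (coord c (\<gamma> t)) (vel {a..b} \<gamma> t c) (vel {a..b} \<gamma> t c)" for t
    have f: "Lagc c (?y t) (w t + R.\<Gamma> (?y t) (?u t) (?u t)) = Lagc c (coord c (\<gamma> t)) (acc {a..b} \<gamma> t c)" for t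
      by (simp add: w_def)
    note X = J_integrand_chart_integral[where f="\<lambda>t. Lagc c (?y t) (w t + R.\<Gamma> (?y t) (?u t) (?u t))", OF g S c as d f finite.emptyI]
    have "sqrt (1 + Gc c (?y s) (?u s) (?u s)) \<le> sqrt (1 + Gc c (?y a) (?u a) (?u a)) + (s - a) / 2
      + integral {a..s} (\<lambda>t. Lagc c (?y t) (w t + R.\<Gamma> (?y t) (?u t) (?u t)))"
    proof (rule R.speed_bound[OF _ _ pieces_finite[OF S] _ P(2)])
      show "?y t \<in> ran_chart c \<and> (?y has_vector_derivative ?u t) (at t within {a..s})" if "t \<in> {a..s}" for t
        using P(1)[OF that] dom[OF that] coord_in[OF c] by simp
      show "(?u has_vector_derivative w t) (at t)" if "t \<in> {a<..<s} - S" for t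
        unfolding w_def by (rule P(3)[OF that])
    qed (use X V as in auto)
    also have "integral {a..s} (\<lambda>t. Lagc c (?y t) (w t + R.\<Gamma> (?y t) (?u t) (?u t))) = integral {a..s} (J_integrand {a..b} \<gamma>)"
      using X(2) by simp
    also have "\<dots> \<le> integral {a..b} (J_integrand {a..b} \<gamma>)" by (rule J_integrand_integral_mono[OF ab S V]) (use s in auto)
    finally have F: "sqrt (1 + Gc c (?y s) (?u s) (?u s)) \<le> sqrt (1 + Gc c (?y a) (?u a) (?u a)) + (s - a) / 2 + integral {a..b} (J_integrand {a..b} \<gamma>)"
      by simp
    have "(s - a) / 2 \<le> 1" using len s by simp
    then show ?thesis using F S0 J0 unfolding o_apply by linarith
  qed
  then have "(sqrt (1 + Gc c (?y s) (?u s) (?u s)))\<^sup>2 \<le> (S0 + 1 + J0)\<^sup>2"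
    by (rule power_mono) (use dom[of s] s R.nonneg[of "coord c (\<gamma> s)" "?u s"] K in auto)
  moreover have G0: "Gc c (?y s) (?u s) (?u s) \<ge> 0" using dom[of s] s R.nonneg[of "coord c (\<gamma> s)" "?u s"] K by auto
  ultimately have "Gc c (?y s) (?u s) (?u s) \<le> (S0 + 1 + J0)\<^sup>2" by simp
  moreover have "l * (norm (?u s))\<^sup>2 \<le> Gc c (?y s) (?u s) (?u s)" using co(2) dom[of s] s by simp
  ultimately have "(sqrt l * norm (?u s))\<^sup>2 \<le> (S0 + 1 + J0)\<^sup>2" using co(1) by (simp add: power_mult_distrib)
  moreover have "0 \<le> S0 + 1 + J0"
  proof -
    have "a \<in> {a..s}" using s by simp
    from dom[OF this] have "Gc c (coord c (\<gamma> a)) (?u a) (?u a) \<ge> 0" using K R.nonneg by blast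
    then have "0 \<le> S0" using S0 by (meson order_trans real_sqrt_ge_zero add_nonneg_nonneg zero_le_one)
    then show ?thesis using J0 by simp
  qed
  ultimately have "sqrt l * norm (?u s) \<le> S0 + 1 + J0" by (rule power2_le_imp_le)
  then show ?thesis using co(1) by (simp add: field_simps)
qed

text \<open>
  Up to the first time at which the curve leaves the ball of radius \<open>r\<close>, the speed bound keeps it in the
  concentric ball of radius \<open>r / 2\<close>. The latter is compact in the manifold, hence closed, so the curve is
  still in it at the exit time, which is absurd.
\<close>

lemma confinement:
  assumes g: "C_k_curve A 1 {a..b} \<gamma>" and S: "pieces S a b \<gamma>" and ab: "a < b" and V: "\<And>p. V p \<ge> 0" and c: "c \<in> A"
    and K: "cball x0 r \<subseteq> ran_chart c" "r > 0"
    and co: "l > 0" "\<And>x u. x \<in> cball x0 r \<Longrightarrow> l * (norm u)\<^sup>2 \<le> Gc c x u u"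
    and S0: "sqrt (1 + Gc c (coord c (\<gamma> a)) (vel {a..b} \<gamma> a c) (vel {a..b} \<gamma> a c)) \<le> S0"
    and J0: "integral {a..b} (J_integrand {a..b} \<gamma>) \<le> J0" "0 \<le> J0" and len: "b - a \<le> 1"
    and short: "(S0 + 1 + J0) / sqrt l * (b - a) \<le> r / 4"
    and start: "\<gamma> a \<in> dom_chart c" "coord c (\<gamma> a) \<in> cball x0 (r / 4)"
    and t: "t \<in> {a..b}"
  shows "\<gamma> t \<in> dom_chart c" "coord c (\<gamma> t) \<in> cball x0 r" "norm (vel {a..b} \<gamma> t c) \<le> (S0 + 1 + J0) / sqrt l"
proof -
  define N0 where "N0 = (S0 + 1 + J0) / sqrt l"
  note cont = C_k_curve_continuous[OF g]
  have speed: "norm (vel {a..b} \<gamma> s c) \<le> N0"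
    if "s \<in> {a..b}" "\<And>t. t \<in> {a..s} \<Longrightarrow> \<gamma> t \<in> dom_chart c \<and> coord c (\<gamma> t) \<in> cball x0 r" for s
    unfolding N0_def by (rule speed_in_chart[OF g S ab V c K(1) co S0 J0 len that])
  have "a \<in> {a..b}" using ab by simp
  moreover have "\<gamma> t \<in> dom_chart c \<and> coord c (\<gamma> t) \<in> cball x0 r" if "t \<in> {a..a}" for t
    using start K(2) that by auto
  ultimately have "norm (vel {a..b} \<gamma> a c) \<le> N0" by (rule speed)
  then have N0: "N0 \<ge> 0" using norm_ge_zero order_trans by blast
  have half: "coord c (\<gamma> s) \<in> cball x0 (r / 2)"
    if s: "s \<in> {a<..b}" and d: "\<And>t. t \<in> {a..s} \<Longrightarrow> \<gamma> t \<in> dom_chart c \<and> coord c (\<gamma> t) \<in> cball x0 r" for s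
  proof -
    have as: "a \<le> a" "a < s" "s \<le> b" using s by auto
    have dd: "\<gamma> ` {a..s} \<subseteq> dom_chart c" using d by auto
    note P = piecewise_curve_in_chart(1)[OF g S c as dd]
    have "norm ((coord c \<circ> \<gamma>) s - (coord c \<circ> \<gamma>) a) \<le> N0 * norm (s - a)"
    proof (rule differentiable_bound[of "{a..s}" _ "\<lambda>t d. d *\<^sub>R vel {a..b} \<gamma> t c"])
      show "(coord c \<circ> \<gamma> has_derivative (\<lambda>d. d *\<^sub>R vel {a..b} \<gamma> t c)) (at t within {a..s})" if "t \<in> {a..s}" for t
        using P[OF that] by (simp add: has_vector_derivative_def)
      show "onorm (\<lambda>d. d *\<^sub>R vel {a..b} \<gamma> t c) \<le> N0" if t: "t \<in> {a..s}" for t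
      proof (rule onorm_le)
        have vb: "norm (vel {a..b} \<gamma> t c) \<le> N0" by (rule speed) (use t s d in auto)
        show "norm (e *\<^sub>R vel {a..b} \<gamma> t c) \<le> N0 * norm e" for e
          using mult_right_mono[OF vb, of "norm e"] by (simp add: mult.commute)
      qed
    qed (use as in auto)
    also have "\<dots> \<le> N0 * (b - a)" using N0 as by (intro mult_left_mono) auto
    also have "\<dots> \<le> r / 4" using short by (simp add: N0_def)
    finally have "dist (coord c (\<gamma> a)) (coord c (\<gamma> s)) \<le> r / 4" by (simp add: dist_norm norm_minus_commute)
    moreover have "dist x0 (coord c (\<gamma> a)) \<le> r / 4" using start by simp
    ultimately show ?thesis using dist_triangle[of x0 "coord c (\<gamma> s)" "coord c (\<gamma> a)"] by simp
  qed
  define N where "N = {p \<in> dom_chart c. coord c p \<in> ball x0 r}"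
  have N: "open N" unfolding N_def by (rule coord_ball_open[OF c])
  have all: "\<gamma> t \<in> N" if "t \<in> {a..b}" for t
  proof (rule ccontr)
    assume bad: "\<gamma> t \<notin> N"
    define B where "B = {a..b} \<inter> \<gamma> -` (- N)"
    have "closed B" unfolding B_def using N by (intro continuous_closed_preimage cont) auto
    moreover have ne: "B \<noteq> {}" using bad that by (auto simp: B_def)
    moreover have bb: "bdd_below B" by (rule bdd_belowI[of _ a]) (auto simp: B_def)
    ultimately have t1: "Inf B \<in> B" using closed_contains_Inf by blast
    define t1 where "t1 = Inf B"
    have before: "\<gamma> s \<in> N" if "s \<in> {a..b}" "s < t1" for s
    proof (rule ccontr)
      assume "\<gamma> s \<notin> N"
      then have "s \<in> B" using that by (simp add: B_def)
      from cInf_lower[OF this bb] show False using that by (simp add: t1_def)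
    qed
    have "\<gamma> a \<in> N" using start K(2) by (auto simp: N_def)
    then have "a \<notin> B" by (simp add: B_def)
    then have at1: "a < t1" "t1 \<le> b" using t1 by (auto simp: t1_def B_def less_le)
    define C where "C = inv_coord c ` cball x0 (r / 2)"
    have rr: "cball x0 (r / 2) \<subseteq> ran_chart c" using K by auto
    have "compact C" unfolding C_def
      by (rule compact_continuous_image[OF continuous_on_subset[OF continuous_on_inv_coord[OF c] rr] compact_cball])
    then have "closed C" by (rule compact_imp_closed)
    moreover have "\<gamma> ` {a<..<t1} \<subseteq> C"
    proof
      fix z assume "z \<in> \<gamma> ` {a<..<t1}"
      then obtain s where s: "z = \<gamma> s" "s \<in> {a<..<t1}" by blast
      have d: "\<gamma> t \<in> dom_chart c \<and> coord c (\<gamma> t) \<in> cball x0 r" if "t \<in> {a..s}" for t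
        using before[of t] that s at1 by (auto simp: N_def)
      have "coord c (\<gamma> s) \<in> cball x0 (r / 2)" by (rule half[OF _ d]) (use s at1 in auto)
      moreover have "inv_coord c (coord c (\<gamma> s)) = \<gamma> s" using d[of s] s inv_coord_coord[OF c] by simp
      ultimately show "z \<in> C" unfolding C_def s(1) by (metis imageI)
    qed
    ultimately have "\<gamma> ` closure {a<..<t1} \<subseteq> C"
      by (intro image_closure_subset) (use cont at1 in \<open>auto intro: continuous_on_subset\<close>)
    then have "\<gamma> t1 \<in> C" using at1 by (auto simp: image_subset_iff)
    moreover have "C \<subseteq> N" unfolding C_def N_def using rr K(2) inv_coord_in[OF c] coord_inv[OF c] by auto
    ultimately show False using t1 by (auto simp: t1_def B_def)
  qed
  show "\<gamma> t \<in> dom_chart c" "coord c (\<gamma> t) \<in> cball x0 r" using all[OF t] by (auto simp: N_def)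
  show "norm (vel {a..b} \<gamma> t c) \<le> (S0 + 1 + J0) / sqrt l"
    unfolding N0_def[symmetric]
  proof (rule speed[OF t])
    fix s assume "s \<in> {a..t}"
    then have "\<gamma> s \<in> N" using all t by auto
    then show "\<gamma> s \<in> dom_chart c \<and> coord c (\<gamma> s) \<in> cball x0 r" by (auto simp: N_def)
  qed
qed

section \<open>Modified cubic polynomials minimize locally\<close>

text \<open>
  The chart, the ball and all constants are determined by \<open>q\<close> near \<open>\<tau>\<close>; the interval is chosen last. Any
  competitor whose action is not larger than that of \<open>q\<close> is confined to the ball, and then coincides
  with \<open>q\<close> by \<open>local_minimality_in_ball\<close>.
\<close>

theorem cubic_imp_unique_local_minimizer:
  assumes T: "T > 0" and V: "\<And>p. V p \<ge> 0" and cub: "modified_cubic_polynomial A g V 0 T q" and \<tau>: "\<tau> \<in> {0..T}"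
  shows "\<exists>a b. interval_around T \<tau> a b \<and>
    unique_minimizer A g V a b (q a, velocity A {0..T} q a) (q b, velocity A {0..T} q b) q"
proof -
  have sm: "smooth_curve A {0..T} q" and eq: "\<And>t c. t \<in> {0..T} \<Longrightarrow> c \<in> charts_at A (q t) \<Longrightarrow> mcp_lhs {0..T} q c t = 0"
    using cub unfolding modified_cubic_polynomial_iff by blast+
  have f: "fat {0..T}" by (rule fat_Icc[OF T])
  note cont = smooth_curve_continuous[OF sm]
  obtain c where c: "c \<in> A" "q \<tau> \<in> dom_chart c" using chart_cover by blast
  interpret R: riem_pot "ran_chart c" "Gc c" "V \<circ> inv_coord c" by (rule riem_pot_chart[OF c(1)])
  define ctr where "ctr = coord c (q \<tau>)"
  let ?x = "coord c \<circ> q" and ?v = "\<lambda>t. vel {0..T} q t c" and ?a = "\<lambda>t. acc {0..T} q t c" and ?b = "\<lambda>t. jerk {0..T} q t c"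
  have "ctr \<in> ran_chart c" using c coord_in by (simp add: ctr_def)
  then obtain r where r: "r > 0" "cball ctr r \<subseteq> ran_chart c" using chart_open(2)[OF c(1)] open_contains_cball by blast
  obtain \<delta> where \<delta>: "\<delta> > 0" "\<And>t. t \<in> {0..T} \<Longrightarrow> \<bar>t - \<tau>\<bar> \<le> \<delta> \<Longrightarrow> q t \<in> dom_chart c \<and> coord c (q t) \<in> cball ctr (r / 4)"
    unfolding ctr_def by (rule near_in_chart[OF cont c(1), of \<tau> "r / 4"]) (use \<tau> c r in auto)
  define p where "p = max 0 (\<tau> - \<delta>)" define s where "s = min T (\<tau> + \<delta>)"
  have near: "q t \<in> dom_chart c \<and> coord c (q t) \<in> cball ctr (r / 4)" if "t \<in> {p..s}" for t
    by (rule \<delta>(2)) (use that in \<open>auto simp: p_def s_def abs_le_iff\<close>)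
  have ps: "{p..s} \<subseteq> {0..T}" by (auto simp: p_def s_def)
  have sub: "{p..s} \<subseteq> cdom c {0..T} q" using near ps by auto
  note m = smooth_curve_motion[OF sm f c(1)]
  have "R.motion (cdom c {0..T} q) ?x ?v ?a ?b (\<lambda>_. 0)"
  proof -
    have "mcp_lhs {0..T} q c t = 0" if "t \<in> cdom c {0..T} q" for t
      by (rule eq) (use that c in \<open>auto simp: charts_at_def\<close>)
    then show ?thesis using m(1) unfolding R.motion_def by simp
  qed
  then have mot: "R.motion {p..s} ?x ?v ?a ?b (\<lambda>_. 0)" by (rule R.motion_subset[OF _ sub])
  note mc = R.motion_continuous[OF mot]
  have im: "?x ` {p..s} \<subseteq> ran_chart c" using R.motionD(1)[OF mot] by auto
  obtain M1 where M1: "\<And>t. t \<in> {p..s} \<Longrightarrow> norm (?v t) \<le> M1" using compact_norm_bound[OF mc(2)] by blast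
  obtain M2 where M2: "\<And>t. t \<in> {p..s} \<Longrightarrow> norm (?a t) \<le> M2" using compact_norm_bound[OF mc(3)] by blast
  define M where "M = max 0 (max M1 M2)"
  have M: "M \<ge> 0" "\<And>t. t \<in> {p..s} \<Longrightarrow> norm (?v t) \<le> M \<and> norm (?a t) \<le> M"
    using M1 M2 by (auto simp: M_def le_max_iff_disj)
  have bdd: "\<exists>B\<ge>0. \<forall>t\<in>{u..w}. f t \<le> B" if "continuous_on {u..w} f" for f :: "real \<Rightarrow> real" and u w
  proof -
    have "compact (f ` {u..w})" by (rule compact_continuous_image[OF that]) simp
    then have "bounded (f ` {u..w})" by (rule compact_imp_bounded)
    then obtain B where "\<forall>t\<in>{u..w}. \<bar>f t\<bar> \<le> B" unfolding bounded_iff by auto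
    then show ?thesis by (intro exI[of _ "max 0 B"]) (auto simp: le_max_iff_disj)
  qed
  have "continuous_on {p..s} (\<lambda>t. sqrt (1 + Gc c (?x t) (?v t) (?v t)))"
    by (intro continuous_intros R.continuous_on_field mc im)
  then obtain S0 where S0: "S0 \<ge> 0" "\<forall>t\<in>{p..s}. sqrt (1 + Gc c (?x t) (?v t) (?v t)) \<le> S0" using bdd by blast
  obtain J0 where J0: "J0 \<ge> 0" "\<forall>t\<in>{0..T}. J_integrand {0..T} q t \<le> J0" using bdd[OF J_integrand_continuous[OF sm f]] by blast
  obtain l where l: "l > 0" "\<And>x u. x \<in> cball ctr r \<Longrightarrow> l * (norm u)\<^sup>2 \<le> Gc c x u u"
    using R.coercive[OF compact_cball r(2)] by blast
  define N0 where "N0 = (S0 + 1 + J0) / sqrt l"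
  have N0: "N0 \<ge> 0" using S0 J0 l by (simp add: N0_def)
  have MN: "N0 + M \<ge> 0" "r \<ge> 0" using N0 M r by auto
  obtain \<rho> where \<rho>: "\<rho> > 0" and unique:
    "\<And>p q x v a b y u w S. \<lbrakk>p < q; q - p \<le> \<rho>; R.motion {p..q} x v a b (\<lambda>_. 0);
      \<And>t. t \<in> {p..q} \<Longrightarrow> x t \<in> cball ctr r \<and> y t \<in> cball ctr r \<and> norm (v t) \<le> M \<and> norm (a t) \<le> M \<and> norm (u t - v t) \<le> N0 + M;
      \<And>t. t \<in> {p..q} \<Longrightarrow> (y has_vector_derivative u t) (at t within {p..q});
      continuous_on {p..q} u; finite S; \<And>t. t \<in> {p<..<q} - S \<Longrightarrow> (u has_vector_derivative w t) (at t);
      pw_cont p q w; y p = x p; y q = x q; u p = v p; u q = v q;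
      (\<lambda>t. R.Lag (x t) (a t)) integrable_on {p..q};
      (\<lambda>t. R.Lag (y t) (w t + R.\<Gamma> (y t) (u t) (u t))) integrable_on {p..q}\<rbrakk> \<Longrightarrow>
     integral {p..q} (\<lambda>t. R.Lag (x t) (a t)) \<le> integral {p..q} (\<lambda>t. R.Lag (y t) (w t + R.\<Gamma> (y t) (u t) (u t))) \<and>
     (integral {p..q} (\<lambda>t. R.Lag (y t) (w t + R.\<Gamma> (y t) (u t) (u t))) \<le> integral {p..q} (\<lambda>t. R.Lag (x t) (a t))
       \<longrightarrow> (\<forall>t\<in>{p..q}. y t = x t))"
    using R.local_minimality_in_ball[OF r(2) M(1) MN] by blast
  \<comment> \<open>The interval has length at most \<open>2 e\<close>. The bounds keep \<open>q\<close> in the ball of radius \<open>r / 4\<close>, make the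
    interval short enough for \<open>unique\<close>, no longer than 1, and too short for moving by more than \<open>r / 4\<close>
    at speed \<open>N0\<close>.\<close>
  define e where "e = min \<delta> (min (\<rho> / 2) (min (1 / 2) (r / (8 * (N0 + 1)))))"
  have e: "e > 0" "e \<le> \<delta>" "2 * e \<le> \<rho>" "2 * e \<le> 1" "e \<le> r / (8 * (N0 + 1))"
    using \<delta> \<rho> r N0 by (auto simp: e_def)
  define a where "a = max 0 (\<tau> - e)" define b where "b = min T (\<tau> + e)"
  have ab: "a < b" "b - a \<le> 2 * e" "{a..b} \<subseteq> {p..s}" "\<tau> \<in> {a..b}" "{a..b} \<subseteq> {0..T}"
    using \<tau> T e by (auto simp: a_def b_def p_def s_def)
  have len: "b - a \<le> \<rho>" "b - a \<le> 1" using ab e by auto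
  have short: "N0 * (b - a) \<le> r / 4"
  proof -
    have "N0 * (b - a) \<le> (N0 + 1) * (2 * (r / (8 * (N0 + 1))))" using N0 ab e by (intro mult_mono) auto
    also have "\<dots> = r / 4" using N0 by (simp add: field_simps)
    finally show ?thesis .
  qed
  have fab: "fat {a..b}" by (rule fat_Icc[OF ab(1)])
  have sab: "smooth_curve A {a..b} q" by (rule smooth_curve_subset[OF sm ab(5) fab])
  have qC1: "C_k_curve A 1 {a..b} q" "C_k_curve A 1 {0..T} q" using sab sm by (auto simp: smooth_curve_def)
  have vq: "vel {a..b} q t = vel {0..T} q t" if "t \<in> {a..b}" for t
    by (rule velocity_restrict[OF qC1(2) f fab ab(5) that])
  have Sq: "pieces {} a b q" unfolding pieces_def using smooth_curve_subset[OF sab] fat_Icc by auto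
  let ?\<xi> = "(q a, velocity A {0..T} q a)" and ?\<eta> = "(q b, velocity A {0..T} q b)"
  have ain: "a \<in> {a..b}" "b \<in> {a..b}" using ab by auto
  have qadm: "q \<in> admissible A a b ?\<xi> ?\<eta>"
    unfolding admissible_def using qC1 pieces_piecewise_smooth[OF ab(1) Sq] vq ain by simp
  have aq: "acc {a..b} q t c = ?a t" if "t \<in> {a<..<b}" for t
    using acc_local[of "{a<..<b}" t "{a..b}" "{0..T}" q q] that ab(5) by fastforce
  have qdom: "q ` {a..b} \<subseteq> dom_chart c" using near ab(3) by auto
  have "R.Lag (?x t) (?a t) = Lagc c (coord c (q t)) (acc {a..b} q t c)" if "t \<in> {a<..<b} - {}" for t
    using aq that by simp
  note Lq = J_integrand_chart_integral[where f="\<lambda>t. R.Lag (?x t) (?a t)", OF qC1(1) Sq c(1) order_refl ab(1) order_refl qdom this finite.emptyI]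
  have Jq: "integral {a..b} (J_integrand {a..b} q) \<le> J0"
  proof -
    have e1: "integral {a..b} (J_integrand {a..b} q) = integral {a..b} (J_integrand {0..T} q)"
    proof (rule integral_spike[of "{a, b}"])
      show "J_integrand {0..T} q t = J_integrand {a..b} q t" if "t \<in> {a..b} - {a, b}" for t
        by (rule J_integrand_piece) (use that ab(5) in auto)
    qed simp
    have "J_integrand {0..T} q integrable_on {a..b}"
      by (rule integrable_continuous_real[OF continuous_on_subset[OF J_integrand_continuous[OF sm f] ab(5)]])
    then have "integral {a..b} (J_integrand {0..T} q) \<le> (b - a) * J0"
      by (intro has_integral_le[OF integrable_integral const_has_integral]) (use J0 ab in auto)
    also have "\<dots> \<le> 1 * J0" using len J0 by (intro mult_right_mono) auto
    finally show ?thesis using e1 by simp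
  qed
  have key: "J_functional A g V a b q \<le> J_functional A g V a b \<gamma> \<and> (\<forall>t\<in>{a..b}. \<gamma> t = q t)"
    if \<gamma>: "\<gamma> \<in> admissible A a b ?\<xi> ?\<eta>" and le: "J_functional A g V a b \<gamma> \<le> J_functional A g V a b q" for \<gamma>
  proof -
    note D = admissibleD[OF \<gamma>]
    obtain S where S: "pieces S a b \<gamma>" using D(2) by blast
    have ends: "\<gamma> a = q a" "vel {a..b} \<gamma> a = vel {0..T} q a" "\<gamma> b = q b" "vel {a..b} \<gamma> b = vel {0..T} q b" using D by auto
    have aps: "a \<in> {p..s}" using ain ab(3) by blast
    have J\<gamma>: "integral {a..b} (J_integrand {a..b} \<gamma>) \<le> J0" using le Jq unfolding J_functional_integral by simp
    have s0: "sqrt (1 + Gc c (coord c (\<gamma> a)) (vel {a..b} \<gamma> a c) (vel {a..b} \<gamma> a c)) \<le> S0"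
      using S0(2) aps by (simp add: ends)
    have st: "\<gamma> a \<in> dom_chart c" "coord c (\<gamma> a) \<in> cball ctr (r / 4)" using near[OF aps] by (auto simp: ends)
    have C: "\<gamma> t \<in> dom_chart c" "coord c (\<gamma> t) \<in> cball ctr r" "norm (vel {a..b} \<gamma> t c) \<le> (S0 + 1 + J0) / sqrt l"
      if "t \<in> {a..b}" for t
      by (rule confinement[OF D(1) S ab(1) V c(1) r(2,1) l(1) _ s0 J\<gamma> J0(1) len(2) short[unfolded N0_def] st that], rule l(2), assumption)+
    have dom: "\<gamma> ` {a..b} \<subseteq> dom_chart c" using C(1) by auto
    note P = piecewise_curve_in_chart[OF D(1) S c(1) order_refl ab(1) order_refl dom]
    let ?y = "coord c \<circ> \<gamma>" and ?u = "\<lambda>t. vel {a..b} \<gamma> t c"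
    define w where "w t = acc {a..b} \<gamma> t c - Chr (Gc c) (coord c (\<gamma> t)) (vel {a..b} \<gamma> t c) (vel {a..b} \<gamma> t c)" for t
    have fy: "R.Lag (?y t) (w t + R.\<Gamma> (?y t) (?u t) (?u t)) = Lagc c (coord c (\<gamma> t)) (acc {a..b} \<gamma> t c)" for t
      by (simp add: w_def)
    note Ly = J_integrand_chart_integral[where f="\<lambda>t. R.Lag (?y t) (w t + R.\<Gamma> (?y t) (?u t) (?u t))", OF D(1) S c(1) order_refl ab(1) order_refl dom fy finite.emptyI]
    have res: "integral {a..b} (\<lambda>t. R.Lag (?x t) (?a t)) \<le> integral {a..b} (\<lambda>t. R.Lag (?y t) (w t + R.\<Gamma> (?y t) (?u t) (?u t))) \<and>
     (integral {a..b} (\<lambda>t. R.Lag (?y t) (w t + R.\<Gamma> (?y t) (?u t) (?u t))) \<le> integral {a..b} (\<lambda>t. R.Lag (?x t) (?a t))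
       \<longrightarrow> (\<forall>t\<in>{a..b}. ?y t = ?x t))"
    proof (rule unique[OF ab(1) len(1) R.motion_subset[OF mot ab(3)] _ P(1) P(2) pieces_finite[OF S] _ _ _ _ _ _ Lq(1) Ly(1)])
      fix t assume t: "t \<in> {a..b}"
      have tp: "t \<in> {p..s}" using t ab(3) by blast
      have "norm (?u t - ?v t) \<le> norm (?u t) + norm (?v t)" by (rule norm_triangle_ineq4)
      also have "\<dots> \<le> N0 + M" using C(3)[OF t] M(2)[OF tp] unfolding N0_def by (intro add_mono) auto
      finally have "norm (?u t - ?v t) \<le> N0 + M" .
      moreover have "?x t \<in> cball ctr r" using near[OF tp] r(1) by simp
      moreover have "?y t \<in> cball ctr r" using C(2)[OF t] by simp
      ultimately show "?x t \<in> cball ctr r \<and> ?y t \<in> cball ctr r \<and> norm (?v t) \<le> M \<and> norm (?a t) \<le> M \<and> norm (?u t - ?v t) \<le> N0 + M"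
        using M(2)[OF tp] by blast
    next
      show "(?u has_vector_derivative w t) (at t)" if "t \<in> {a<..<b} - S" for t
        unfolding w_def by (rule P(3)[OF that])
      show "pw_cont a b w" unfolding w_def[abs_def] by (rule P(4))
    qed (auto simp: ends)
    have Jeq_q: "J_functional A g V a b q = integral {a..b} (\<lambda>t. R.Lag (?x t) (?a t))"
      unfolding J_functional_integral by (rule Lq(2)[symmetric])
    have Jeq_\<gamma>: "J_functional A g V a b \<gamma> = integral {a..b} (\<lambda>t. R.Lag (?y t) (w t + R.\<Gamma> (?y t) (?u t) (?u t)))"
      unfolding J_functional_integral by (rule Ly(2)[symmetric])
    note Jeq = Jeq_q Jeq_\<gamma>
    have "\<gamma> t = q t" if t: "t \<in> {a..b}" for t
    proof -
      have "?y t = ?x t" using mp[OF conjunct2[OF res] le[unfolded Jeq]] t by (rule bspec)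
      then have "coord c (\<gamma> t) = coord c (q t)" by (simp only: o_apply)
      moreover have "\<gamma> t \<in> dom_chart c" "q t \<in> dom_chart c" using dom qdom t by auto
      ultimately show ?thesis using inv_coord_coord[OF c(1)] by metis
    qed
    then show ?thesis using conjunct1[OF res] unfolding Jeq by (intro conjI ballI)
  qed
  have min: "minimizer A g V a b ?\<xi> ?\<eta> q"
    unfolding minimizer_def using qadm key by (meson linear)
  have "unique_minimizer A g V a b ?\<xi> ?\<eta> q"
    unfolding unique_minimizer_def
  proof (intro conjI allI impI min)
    fix \<gamma> assume "minimizer A g V a b ?\<xi> ?\<eta> \<gamma>"
    then have "\<gamma> \<in> admissible A a b ?\<xi> ?\<eta>" "J_functional A g V a b \<gamma> \<le> J_functional A g V a b q"
      using qadm unfolding minimizer_def by blast+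
    from key[OF this] show "\<forall>t\<in>{a..b}. \<gamma> t = q t" by blast
  qed
  moreover have "interval_around T \<tau> a b"
    by (rule interval_aroundI[OF ab(1,5), of "{\<tau> - e<..<\<tau> + e}"]) (use e \<tau> in \<open>auto simp: a_def b_def\<close>)
  ultimately show ?thesis by blast
qed

end

theorem proposition6:
  fixes A :: "('q::{t2_space,second_countable_topology}, 'e::euclidean_space) chart set"
    and g :: "('q, 'e) metric"
    and V :: "'q \<Rightarrow> real"
    and T :: real
    and \<xi>\<^sub>0 \<eta>\<^sub>0 :: "'q \<times> ('q, 'e) tvec"
    and q :: "real \<Rightarrow> 'q"
  assumes "complete_connected_riemannian_manifold A g"
    and "smooth_scalar A V" and "\<And>p. V p \<ge> 0"
    and "T > 0"
    and "\<xi>\<^sub>0 \<in> tangent_bundle A" and "\<eta>\<^sub>0 \<in> tangent_bundle A"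
    and "q \<in> admissible A 0 T \<xi>\<^sub>0 \<eta>\<^sub>0"
  shows "(modified_cubic_polynomial A g V 0 T q \<longleftrightarrow> Q_local_minimizer A g V T q) \<and>
    (modified_cubic_polynomial A g V 0 T q \<longrightarrow>
      (\<forall>\<tau>\<in>{0..T}. \<exists>a b. interval_around T \<tau> a b \<and>
         unique_minimizer A g V a b
           (q a, velocity A {0..T} q a) (q b, velocity A {0..T} q b) q))"
proof -
  interpret riem_manifold A g V
    using assms(1,2) by unfold_locales (auto simp: complete_connected_riemannian_manifold_def)
  have unique: "\<forall>\<tau>\<in>{0..T}. \<exists>a b. interval_around T \<tau> a b \<and>
      unique_minimizer A g V a b (q a, velocity A {0..T} q a) (q b, velocity A {0..T} q b) q"
    if "modified_cubic_polynomial A g V 0 T q"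
    using cubic_imp_unique_local_minimizer[OF assms(4,3) that] by blast
  have "Q_local_minimizer A g V T q" if "modified_cubic_polynomial A g V 0 T q"
    unfolding Q_local_minimizer_def using unique[OF that] unfolding unique_minimizer_def by blast
  moreover have "modified_cubic_polynomial A g V 0 T q" if "Q_local_minimizer A g V T q"
    by (rule local_minimizer_imp_cubic[OF assms(4,7) that])
  ultimately show ?thesis using unique by blast
qed

end
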